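(* Let $\{H_\omega\}_{\omega\in\Omega}$ be the family of selfadjoint operators in $L_2(a,b)$ generated (as described in the context) by $$-\frac{d^2}{dx^2}+v(x)+\sum_{n\in I}\omega(n)f_n(x).$$ For a given interval $[c,d]\subset(a,b)$, $c<d$, assume there is $n_0\in I$ such that $f_{n_0}(x)>0$ for almost all $x\in(c,d)$ and $f_{n_0}(x)=0$ if $x\notin(c,d)$. Suppose that the probability distribution $p_{n_0}$ of the random variable $\omega(n_0)$ is continuous, i.e. $p_{n_0}(\{r\})=0$ for every $r\in\mathbb{R}$. Let $\{J_\omega\}_{\omega\in\Omega}$ be any measurable family of selfadjoint operators in a separable Hilbert space such that $\sigma_p(J_\omega)$ is independent of $\omega(n_0)$ (i.e. $\sigma_p(J_\omega)=\sigma_p(J_{\omega'})$ whenever $\omega(n)=\omega'(n)$ for all $n\in I\setminus\{n_0\}$). Then $$\mathbb{P}\bigl(\{\omega\in\Omega:\sigma_p(J_\omega)\cap\sigma_p(H_\omega)\neq\emptyset\}\bigr)=0.$$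
   Context: Let $-\infty\le a<b\le\infty$. Probability space: fix $n_1<n_2$ in $\mathbb{Z}\cup\{\pm\infty\}$ and let $I=\{n\in\mathbb{Z}:n_1<n<n_2\}$. Let $\{p_n\}_{n\in I}$ be arbitrary Borel probability measures on $\mathbb{R}$, and let $\Omega=(\mathbb{R}^I,\mathcal{F},\mathbb{P})$, where $\mathbb{R}^I$ is the space of real sequences $\omega=\{\omega(n)\}_{n\in I}$, $\mathcal{F}$ is the product $\sigma$-algebra generated by the cylinder sets $\{\omega:\omega(i_1)\in A_1,\dots,\omega(i_k)\in A_k\}$ with $i_1,\dots,i_k\in I$ and $A_1,\dots,A_k\subset\mathbb{R}$ Borel, and $\mathbb{P}=\times_{n\in I}p_n$ is the product measure. The operators $H_\omega$: let $v$ and $f_n$ ($n\in I$) be real valued, measurable, locally $L_1$ functions on $(a,b)$, and put $q_\omega(x)=v(x)+\sum_{n\in I}\omega(n)f_n(x)$; it is assumed that for every $\omega$ this is a well defined real valued locally integrable function on $(a,b)$. Let $\tau_\omega u=-u''+q_\omega u$. It is assumed that, at each of the endpoints $a$ and $b$, $\tau_\omega$ is either regular or in the limit point case. Let $D_{\tau_\omega}$ be the set of $u\in L_2(a,b)$ with $u,u'$ absolutely continuous in $(a,b)$ (locally) and $\tau_\omega u\in L_2(a,b)$. For fixed real angles $\alpha,\beta$ not depending on $\omega$, $H_\omega u=\tau_\omega u$ with domain the set of $u\in D_{\tau_\omega}$ satisfying $u(a)\cos\alpha+u'(a)\sin\alpha=0$ if $\tau_\omega$ is regular at $a$, and $u(b)\cos\beta+u'(b)\sin\beta=0$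 if $\tau_\omega$ is regular at $b$ (no condition at a limit point endpoint). It is assumed that $H_\omega$ is selfadjoint for all $\omega\in\Omega$. For an operator $H$, $\sigma_p(H)=\{r\in\mathbb{R}:H\varphi=r\varphi\text{ for some }\varphi\not\equiv0\}$ denotes its set of eigenvalues. A family $\{A_\omega\}_{\omega\in\Omega}$ of selfadjoint operators is called measurable if for all vectors $\varphi,\psi$ and every bounded Borel function $f:\mathbb{C}\to\mathbb{C}$ the map $\omega\mapsto\langle f(A_\omega)\varphi,\psi\rangle$ is measurable. *)

theory Defs
  imports "HOL-Probability.Probability" "HOL-Library.Extended"
begin

no_notation Pinf (\<open>\<infinity>\<close>) and Minf (\<open>-\<infinity>\<close>)

section \<open>Complex Hilbert spaces\<close>

text \<open>The inner product is linear in the first and conjugate linear in the second argument.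
  Positivity and definiteness of the inner product follow from the last axiom.\<close>

class complex_inner = real_normed_vector +
  fixes scaleC :: "complex \<Rightarrow> 'a \<Rightarrow> 'a" (infixr \<open>*\<^sub>C\<close> 75)
    and cinner :: "'a \<Rightarrow> 'a \<Rightarrow> complex"
  assumes scaleR_scaleC: "scaleR r x = complex_of_real r *\<^sub>C x"
    and scaleC_add_right: "c *\<^sub>C (x + y) = c *\<^sub>C x + c *\<^sub>C y"
    and scaleC_add_left: "(c + d) *\<^sub>C x = c *\<^sub>C x + d *\<^sub>C x"
    and scaleC_scaleC: "c *\<^sub>C d *\<^sub>C x = (c * d) *\<^sub>C x"
    and scaleC_one: "1 *\<^sub>C x = x"
    and cinner_commute: "cinner x y = cnj (cinner y x)"
    and cinner_add_left: "cinner (x + y) z = cinner x z + cinner y z"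
    and cinner_scaleC_left: "cinner (c *\<^sub>C x) y = c * cinner x y"
    and norm_eq_sqrt_cinner: "norm x = sqrt (Re (cinner x x))"

class complex_hilbert_space = complex_inner + complete_space

instantiation complex :: complex_hilbert_space
begin

definition "scaleC_complex c x = c * (x::complex)"
definition "cinner_complex x y = x * cnj (y::complex)"

instance
  by standard
    (auto simp: scaleC_complex_def cinner_complex_def algebra_simps scaleR_conv_of_real
      cmod_def power2_eq_square)

end

text \<open>The space of square integrable functions is handled on the level of functions rather than
  classes of functions. To treat it and the types of class complex_hilbert_space uniformly, the
  notions below refer to a space with a positive semidefinite inner product, in which vectors
  whose difference has inner square 0 are identified.\<close>

record 'v hspace =
  vectors :: "'v set"
  vminus :: "'v \<Rightarrow> 'v \<Rightarrow> 'v"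
  vscale :: "complex \<Rightarrow> 'v \<Rightarrow> 'v"
  vinner :: "'v \<Rightarrow> 'v \<Rightarrow> complex"

definition type_hspace :: "'h::complex_hilbert_space hspace" where
  "type_hspace = \<lparr>vectors = UNIV, vminus = (-), vscale = scaleC, vinner = cinner\<rparr>"

definition square_integrable :: "real measure \<Rightarrow> (real \<Rightarrow> complex) \<Rightarrow> bool" where
  "square_integrable M u \<longleftrightarrow>
     u \<in> borel_measurable M \<and> integrable M (\<lambda>x. (cmod (u x))\<^sup>2)"

abbreviation interval_measure_on :: "ereal \<Rightarrow> ereal \<Rightarrow> real measure" where
  "interval_measure_on a b \<equiv> lebesgue_on (einterval a b)"

definition L2_hspace :: "ereal \<Rightarrow> ereal \<Rightarrow> (real \<Rightarrow> complex) hspace" where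
  "L2_hspace a b =
     \<lparr>vectors = Collect (square_integrable (interval_measure_on a b)),
      vminus = (\<lambda>u w x. u x - w x),
      vscale = (\<lambda>c u x. c * u x),
      vinner = (\<lambda>u w. \<integral>x. u x * cnj (w x) \<partial>interval_measure_on a b)\<rparr>"

text \<open>Operators (in general unbounded and not everywhere defined) are represented by their
  graphs.\<close>

type_synonym 'v operator = "('v \<times> 'v) set"

definition densely_defined :: "('v, 'z) hspace_scheme \<Rightarrow> 'v operator \<Rightarrow> bool" where
  "densely_defined K A \<longleftrightarrow>
     (\<forall>u\<in>vectors K. \<forall>e>0. \<exists>\<phi>\<in>Domain A. sqrt (Re (vinner K (vminus K u \<phi>) (vminus K u \<phi>))) < e)"

definition adjoint_operator :: "('v, 'z) hspace_scheme \<Rightarrow> 'v operator \<Rightarrow> 'v operator" where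
  "adjoint_operator K A =
     {(u, w). u \<in> vectors K \<and> w \<in> vectors K \<and> (\<forall>(\<phi>, \<xi>)\<in>A. vinner K \<xi> u = vinner K \<phi> w)}"

text \<open>An adjoint is always a linear subspace, and the adjoint of a densely defined operator is
  single valued (up to vectors of inner square 0), so linearity and single-valuedness need not be required separately.\<close>

definition selfadjoint :: "('v, 'z) hspace_scheme \<Rightarrow> 'v operator \<Rightarrow> bool" where
  "selfadjoint K A \<longleftrightarrow>
     A \<subseteq> vectors K \<times> vectors K \<and> densely_defined K A \<and> adjoint_operator K A = A"

definition point_spectrum :: "('v, 'z) hspace_scheme \<Rightarrow> 'v operator \<Rightarrow> real set" where
  "point_spectrum K A =
     {r. \<exists>\<phi>. (\<phi>, vscale K (complex_of_real r) \<phi>) \<in> A \<and> vinner K \<phi> \<phi> \<noteq> 0}"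


section \<open>Borel functional calculus and measurable families\<close>

definition projection_valued_measure :: "(real set \<Rightarrow> 'h \<Rightarrow> 'h::complex_hilbert_space) \<Rightarrow> bool" where
  "projection_valued_measure E \<longleftrightarrow>
     (\<forall>B\<in>sets borel. (\<forall>\<phi> \<psi>. cinner (E B \<phi>) \<psi> = cinner \<phi> (E B \<psi>)) \<and> (\<forall>\<phi>. E B (E B \<phi>) = E B \<phi>)) \<and>
     (\<forall>\<phi>. E UNIV \<phi> = \<phi>) \<and>
     (\<forall>B::nat \<Rightarrow> real set. range B \<subseteq> sets borel \<longrightarrow> disjoint_family B \<longrightarrow>
        (\<forall>\<phi>. (\<lambda>i. E (B i) \<phi>) sums E (\<Union>i. B i) \<phi>))"

text \<open>The measure mapping B to the inner product of E B \<open>\<phi>\<close> and \<open>\<phi>\<close>.\<close>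

definition scalar_spectral_measure ::
    "(real set \<Rightarrow> 'h \<Rightarrow> 'h::complex_hilbert_space) \<Rightarrow> 'h \<Rightarrow> real measure" where
  "scalar_spectral_measure E \<phi> =
     measure_of UNIV (sets borel) (\<lambda>B. ennreal (Re (cinner (E B \<phi>) \<phi>)))"

text \<open>E is the spectral resolution of the selfadjoint operator A, that is, A is the integral of
  the identity function with respect to E. By polarization it is enough to consider
  quadratic forms.\<close>

definition is_spectral_measure ::
    "'h::complex_hilbert_space operator \<Rightarrow> (real set \<Rightarrow> 'h \<Rightarrow> 'h) \<Rightarrow> bool" where
  "is_spectral_measure A E \<longleftrightarrow>
     projection_valued_measure E \<and>
     Domain A = {\<phi>. integrable (scalar_spectral_measure E \<phi>) (\<lambda>r. r\<^sup>2)} \<and>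
     (\<forall>(\<phi>, \<xi>)\<in>A. cinner \<xi> \<phi> = (\<integral>r. complex_of_real r \<partial>scalar_spectral_measure E \<phi>))"

text \<open>The choice is immaterial: by the spectral theorem every selfadjoint operator has a spectral
  measure, and its values on Borel sets are uniquely determined.\<close>

definition spectral_measure ::
    "'h::complex_hilbert_space operator \<Rightarrow> real set \<Rightarrow> 'h \<Rightarrow> 'h" where
  "spectral_measure A = (SOME E. is_spectral_measure A E)"

text \<open>For a bounded Borel function f and a selfadjoint operator A, this is the operator f(A), the
  integral of f with respect to the spectral measure of A. A bounded linear operator on a
  complex Hilbert space is determined by its quadratic form.\<close>

definition borel_calculus ::
    "(complex \<Rightarrow> complex) \<Rightarrow> 'h::complex_hilbert_space operator \<Rightarrow> 'h \<Rightarrow> 'h" where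
  "borel_calculus f A =
     (THE T. bounded_linear T \<and> (\<forall>c \<phi>. T (c *\<^sub>C \<phi>) = c *\<^sub>C T \<phi>) \<and>
        (\<forall>\<phi>. cinner (T \<phi>) \<phi> =
           (\<integral>r. f (complex_of_real r) \<partial>scalar_spectral_measure (spectral_measure A) \<phi>)))"

definition measurable_family ::
    "'w measure \<Rightarrow> ('w \<Rightarrow> 'h::complex_hilbert_space operator) \<Rightarrow> bool" where
  "measurable_family M A \<longleftrightarrow>
     (\<forall>\<omega>\<in>space M. selfadjoint type_hspace (A \<omega>)) \<and>
     (\<forall>\<phi> \<psi>. \<forall>f\<in>borel_measurable borel. bounded (range f) \<longrightarrow>
        (\<lambda>\<omega>. cinner (borel_calculus f (A \<omega>) \<phi>) \<psi>) \<in> borel_measurable M)"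


section \<open>Sturm-Liouville operators\<close>

text \<open>This includes Lebesgue measurability on (a, b).\<close>

definition locally_integrable :: "ereal \<Rightarrow> ereal \<Rightarrow> (real \<Rightarrow> real) \<Rightarrow> bool" where
  "locally_integrable a b g \<longleftrightarrow>
     (\<forall>K. compact K \<longrightarrow> K \<subseteq> einterval a b \<longrightarrow> g absolutely_integrable_on K)"

definition absolutely_continuous_on :: "real \<Rightarrow> real \<Rightarrow> (real \<Rightarrow> complex) \<Rightarrow> bool" where
  "absolutely_continuous_on s t g \<longleftrightarrow>
     (\<forall>e>0. \<exists>d>0. \<forall>D::(real \<times> real) set.
        finite D \<longrightarrow> (\<forall>(x, y)\<in>D. s \<le> x \<and> x \<le> y \<and> y \<le> t) \<longrightarrow>
        disjoint_family_on (\<lambda>(x, y). {x<..<y}) D \<longrightarrow> (\<Sum>(x, y)\<in>D. y - x) < d \<longrightarrow>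
        (\<Sum>(x, y)\<in>D. cmod (g y - g x)) < e)"

definition locally_absolutely_continuous :: "ereal \<Rightarrow> ereal \<Rightarrow> (real \<Rightarrow> complex) \<Rightarrow> bool" where
  "locally_absolutely_continuous a b g \<longleftrightarrow>
     (\<forall>s t. a < ereal s \<longrightarrow> s \<le> t \<longrightarrow> ereal t < b \<longrightarrow> absolutely_continuous_on s t g)"

abbreviation vderiv :: "(real \<Rightarrow> complex) \<Rightarrow> real \<Rightarrow> complex" where
  "vderiv u \<equiv> (\<lambda>x. vector_derivative u (at x))"

text \<open>u and u' are locally absolutely continuous in (a, b) and -u'' + q u = w almost
  everywhere.\<close>

definition sl_expression ::
    "ereal \<Rightarrow> ereal \<Rightarrow> (real \<Rightarrow> real) \<Rightarrow> (real \<Rightarrow> complex) \<Rightarrow> (real \<Rightarrow> complex) \<Rightarrow> bool" where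
  "sl_expression a b q u w \<longleftrightarrow>
     (\<forall>x\<in>einterval a b. u differentiable (at x)) \<and>
     locally_absolutely_continuous a b u \<and> locally_absolutely_continuous a b (vderiv u) \<and>
     (AE x in interval_measure_on a b. \<exists>u''. (vderiv u has_vector_derivative u'') (at x) \<and>
        - u'' + complex_of_real (q x) * u x = w x)"

definition regular_at_left :: "ereal \<Rightarrow> ereal \<Rightarrow> (real \<Rightarrow> real) \<Rightarrow> bool" where
  "regular_at_left a b q \<longleftrightarrow>
     a \<noteq> -\<infinity> \<and> (\<exists>c\<in>einterval a b. q absolutely_integrable_on einterval a (ereal c))"

definition regular_at_right :: "ereal \<Rightarrow> ereal \<Rightarrow> (real \<Rightarrow> real) \<Rightarrow> bool" where
  "regular_at_right a b q \<longleftrightarrow>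
     b \<noteq> \<infinity> \<and> (\<exists>c\<in>einterval a b. q absolutely_integrable_on einterval (ereal c) b)"

text \<open>Limit point case: for every complex z the equation -u'' + q u = z u has a solution which is
  not square integrable near the endpoint. By Weyl's alternative it is equivalent to require this
  for one z.\<close>

definition limit_point_at_left :: "ereal \<Rightarrow> ereal \<Rightarrow> (real \<Rightarrow> real) \<Rightarrow> bool" where
  "limit_point_at_left a b q \<longleftrightarrow>
     (\<forall>z. \<exists>u. sl_expression a b q u (\<lambda>x. z * u x) \<and>
        \<not> (\<exists>c\<in>einterval a b. square_integrable (interval_measure_on a (ereal c)) u))"

definition limit_point_at_right :: "ereal \<Rightarrow> ereal \<Rightarrow> (real \<Rightarrow> real) \<Rightarrow> bool" where
  "limit_point_at_right a b q \<longleftrightarrow>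
     (\<forall>z. \<exists>u. sl_expression a b q u (\<lambda>x. z * u x) \<and>
        \<not> (\<exists>c\<in>einterval a b. square_integrable (interval_measure_on (ereal c) b) u))"

text \<open>The values of u and u' at a regular endpoint are limits; they exist for all u in the
  maximal domain.\<close>

definition boundary_condition ::
    "real \<Rightarrow> real filter \<Rightarrow> (real \<Rightarrow> complex) \<Rightarrow> bool" where
  "boundary_condition \<alpha> F u \<longleftrightarrow>
     (\<exists>l l'. (u \<longlongrightarrow> l) F \<and> (vderiv u \<longlongrightarrow> l') F \<and>
        l * complex_of_real (cos \<alpha>) + l' * complex_of_real (sin \<alpha>) = 0)"

text \<open>The elements of the graph are representatives of classes of functions: the first component
  only has to agree almost everywhere with a function \<open>u\<^sub>0\<close> having the regularity and the boundary
  values required by the domain.\<close>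

definition sl_operator ::
    "ereal \<Rightarrow> ereal \<Rightarrow> real \<Rightarrow> real \<Rightarrow> (real \<Rightarrow> real) \<Rightarrow> (real \<Rightarrow> complex) operator" where
  "sl_operator a b \<alpha> \<beta> q =
     {(u, w). u \<in> vectors (L2_hspace a b) \<and> w \<in> vectors (L2_hspace a b) \<and>
        (\<exists>u\<^sub>0. (AE x in interval_measure_on a b. u x = u\<^sub>0 x) \<and> sl_expression a b q u\<^sub>0 w \<and>
           (regular_at_left a b q \<longrightarrow> boundary_condition \<alpha> (at_right (real_of_ereal a)) u\<^sub>0) \<and>
           (regular_at_right a b q \<longrightarrow> boundary_condition \<beta> (at_left (real_of_ereal b)) u\<^sub>0))}"

definition random_potential ::
    "int set \<Rightarrow> (real \<Rightarrow> real) \<Rightarrow> (int \<Rightarrow> real \<Rightarrow> real) \<Rightarrow> (int \<Rightarrow> real) \<Rightarrow> real \<Rightarrow> real" where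
  "random_potential I v f \<omega> x = v x + (\<Sum>\<^sub>\<infinity>n\<in>I. \<omega> n * f n x)"

end

theory Submission
  imports Defs
begin

text \<open>Fix all coordinates except \<open>\<omega>(n\<^sub>0)\<close>. Then \<open>\<sigma>\<^sub>p(J\<^sub>\<omega>)\<close> is a fixed set, and it is countable since the Hilbert space is
  separable. For a fixed \<open>r\<close> in it, at most countably many values \<open>s = \<omega>(n\<^sub>0)\<close> turn \<open>r\<close> into an eigenvalue of \<open>H\<^sub>\<omega>\<close>:
  the Wronskian of eigenfunctions for different \<open>s\<close> vanishes at both ends of \<open>[c, d]\<close>, so that the eigenfunctions
  are orthogonal in \<open>L\<^sub>2([c, d])\<close> with weight \<open>f\<close> of index \<open>n\<^sub>0\<close>, and none of them vanishes identically there. As the distribution of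
  \<open>\<omega>(n\<^sub>0)\<close> has no atoms, Fubini's theorem gives the claim, once the event is known to be measurable. For this,
  the eigenvalues of \<open>J\<^sub>\<omega>\<close> are obtained from its spectral measure, and those of \<open>H\<^sub>\<omega>\<close> are
  described by a fundamental system depending measurably on \<open>\<omega>\<close> and \<open>r\<close>.\<close>

section \<open>Complex inner product spaces\<close>

text \<open>Measurability shapes most of the development. The conclusion asks for membership in
  \<open>null_sets P\<close>, without completion, and the event is a projection along the eigenvalue
  \<open>r\<close>; projections of measurable sets need not be measurable. On the side of
  \<open>J\<close> the information consists of inner products of \<open>borel_calculus\<close>,
  defined through a chosen \<open>spectral_measure\<close>. Its properties become available once
  existence is proved, hence a full spectral theorem, obtained from the Cayley transform and the
  trigonometric moment problem. Eigenvalues then are atoms of countably many measurable kernels, and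
  integration over a kernel replaces the projection. On the side of \<open>H\<close> an
  eigenfunction is a pair of coefficients in a fundamental system, normalized to the unit circle;
  compactness of the circle turns the existential quantifier into countable ones. Picard iteration
  is carried out explicitly so that this system is jointly measurable. Potentials are merely
  integrable, so second derivatives exist almost everywhere only, and the fundamental theorem of
  calculus is proved with gauges.\<close>

lemma cinner_self: "cinner x x = of_real ((norm x)\<^sup>2)" for x :: "'a::complex_inner"
proof -
  have im: "Im (cinner x x) = 0"
    using arg_cong[OF cinner_commute[of x x], of Im] by simp
  have "norm x \<ge> 0" by simp
  \<comment> \<open>\<open>sqrt\<close> is an odd function on the reals, so a nonnegative value
    forces a nonnegative argument; positivity is hidden in the norm axiom in this way.\<close>
  then have "Re (cinner x x) \<ge> 0"
    unfolding norm_eq_sqrt_cinner by simp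
  then have "Re (cinner x x) = (norm x)\<^sup>2"
    by (simp add: norm_eq_sqrt_cinner)
  with im show ?thesis by (simp add: complex_eq_iff)
qed

lemma cinner_add_right: "cinner z (x + y) = cinner z x + cinner z y" for x :: "'a::complex_inner"
  by (metis cinner_add_left cinner_commute complex_cnj_add)

lemma cinner_scaleC_right: "cinner x (c *\<^sub>C y) = cnj c * cinner x y" for x :: "'a::complex_inner"
  by (metis cinner_commute cinner_scaleC_left complex_cnj_mult)

lemma scaleC_minus1: "(-1) *\<^sub>C x = - x" for x :: "'a::complex_inner"
  by (metis of_real_1 of_real_minus scaleR_minus1_left scaleR_scaleC)

lemma cinner_minus_right: "cinner z (- y) = - cinner z y" for y :: "'a::complex_inner"
  using cinner_scaleC_right[of z "-1" y] by (simp add: scaleC_minus1)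

lemma norm_sq_add: "(norm (x + y))\<^sup>2 = (norm x)\<^sup>2 + (norm y)\<^sup>2 + 2 * Re (cinner x y)"
  for x :: "'a::complex_inner"
proof -
  have "cinner (x + y) (x + y) = cinner x x + cinner y y + (cinner x y + cnj (cinner x y))"
    by (simp add: cinner_add_left cinner_add_right flip: cinner_commute)
  then have "complex_of_real ((norm (x + y))\<^sup>2) = of_real ((norm x)\<^sup>2 + (norm y)\<^sup>2 + 2 * Re (cinner x y))"
    unfolding cinner_self complex_add_cnj by simp
  then show ?thesis using of_real_eq_iff by blast
qed

lemma norm_sq_diff: "(norm (x - y))\<^sup>2 = (norm x)\<^sup>2 + (norm y)\<^sup>2 - 2 * Re (cinner x y)"
  for x :: "'a::complex_inner"
  using norm_sq_add[of x "- y"] by (simp add: cinner_minus_right)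

lemma norm_scaleC: "norm (c *\<^sub>C x) = cmod c * norm x" for x :: "'a::complex_inner"
proof -
  have "complex_of_real ((norm (c *\<^sub>C x))\<^sup>2) = c * cnj c * of_real ((norm x)\<^sup>2)"
    by (simp only: cinner_self[symmetric] cinner_scaleC_left cinner_scaleC_right ac_simps)
  also have "\<dots> = of_real ((cmod c * norm x)\<^sup>2)"
    by (simp only: complex_norm_square[symmetric] power_mult_distrib of_real_mult)
  finally have "(norm (c *\<^sub>C x))\<^sup>2 = (cmod c * norm x)\<^sup>2"
    using of_real_eq_iff by blast
  then show ?thesis by simp
qed

lemma cinner_Cauchy_Schwarz: "cmod (cinner x y) \<le> norm x * norm y" for x :: "'a::complex_inner"
proof (cases "y = 0")
  case True
  then show ?thesis using cinner_scaleC_right[of x 0 y] scaleR_scaleC[of 0 y] by simp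
next
  case False
  define n where "n = complex_of_real ((norm y)\<^sup>2)"
  \<comment> \<open>\<open>c *\<^sub>C y\<close> is the orthogonal projection of \<open>x\<close> to
    the line of \<open>y\<close>; the inequality says that the squared distance of \<open>x\<close>
    to it is nonnegative.\<close>
  define c where "c = cinner x y / n"
  have "cmod n = (norm y)\<^sup>2" by (simp add: n_def norm_power)
  have ny: "norm y > 0" using False by simp
  have "0 \<le> (norm (x - c *\<^sub>C y))\<^sup>2" by simp
  also have "\<dots> = (norm x)\<^sup>2 + (cmod c * norm y)\<^sup>2 - 2 * Re (cnj c * cinner x y)"
    by (simp add: norm_sq_diff norm_scaleC cinner_scaleC_right)
  also have "cnj c * cinner x y = of_real ((cmod (cinner x y))\<^sup>2 / (norm y)\<^sup>2)"
    by (simp add: c_def n_def mult.commute complex_norm_square del: of_real_power)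
  also have "(cmod c * norm y)\<^sup>2 = (cmod (cinner x y))\<^sup>2 / (norm y)\<^sup>2"
    using ny by (simp add: c_def norm_divide \<open>cmod n = _\<close> power2_eq_square)
  finally have "(cmod (cinner x y))\<^sup>2 / (norm y)\<^sup>2 \<le> (norm x)\<^sup>2" by simp
  then have "(cmod (cinner x y))\<^sup>2 \<le> (norm x * norm y)\<^sup>2"
    using ny by (simp add: field_simps)
  then show ?thesis by (rule power2_le_imp_le) simp
qed

lemma bounded_bilinear_cinner: "bounded_bilinear (cinner :: 'a::complex_inner \<Rightarrow> _)"
proof
  show "\<exists>K. \<forall>a b::'a. norm (cinner a b) \<le> norm a * norm b * K"
    by (rule exI[of _ 1]) (simp add: cinner_Cauchy_Schwarz)
  show "cinner (r *\<^sub>R x) y = r *\<^sub>R cinner x y" for r and x y :: 'a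
    by (simp only: scaleR_conv_of_real scaleR_scaleC[of r x] cinner_scaleC_left)
  show "cinner x (r *\<^sub>R y) = r *\<^sub>R cinner x y" for r and x y :: 'a
    by (simp only: scaleR_conv_of_real scaleR_scaleC[of r y] cinner_scaleC_right complex_cnj_complex_of_real)
qed (auto simp: cinner_add_left cinner_add_right)

interpretation cinner: bounded_bilinear "cinner :: 'a::complex_inner \<Rightarrow> _"
  by (rule bounded_bilinear_cinner)

lemma bounded_bilinear_scaleC: "bounded_bilinear (scaleC :: complex \<Rightarrow> 'a::complex_inner \<Rightarrow> _)"
proof
  show "\<exists>K. \<forall>a. \<forall>b::'a. norm (a *\<^sub>C b) \<le> norm a * norm b * K"
    by (intro exI[of _ 1]) (simp add: norm_scaleC)
  show "(r *\<^sub>R c) *\<^sub>C x = r *\<^sub>R (c *\<^sub>C x)" for r c and x :: 'a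
    by (simp only: scaleR_conv_of_real scaleR_scaleC[of r "c *\<^sub>C x"] scaleC_scaleC)
qed (auto simp: scaleC_add_left scaleC_add_right scaleR_scaleC scaleC_scaleC
    scaleR_conv_of_real mult.commute)

interpretation scaleC: bounded_bilinear "scaleC :: complex \<Rightarrow> 'a::complex_inner \<Rightarrow> _"
  by (rule bounded_bilinear_scaleC)

lemma cinner_eq_zero_all: "(\<And>x. cinner x y = 0) \<Longrightarrow> y = 0" for y :: "'a::complex_inner"
  using cinner_self[of y] by simp

lemma cinner_commute_zero: "cinner x y = 0 \<Longrightarrow> cinner y x = 0" for y :: "'a::complex_inner"
  by (metis cinner_commute complex_cnj_zero)

definition complex_linear :: "('a::complex_inner \<Rightarrow> 'b::complex_inner) \<Rightarrow> bool" where
  "complex_linear T \<longleftrightarrow> (\<forall>x y. T (x + y) = T x + T y) \<and> (\<forall>c x. T (c *\<^sub>C x) = c *\<^sub>C T x)"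

lemma complex_linear_linear: "complex_linear T \<Longrightarrow> linear T"
  by (auto simp: complex_linear_def scaleR_scaleC intro!: linearI)

lemma complex_linear_scaleC: "complex_linear T \<Longrightarrow> T (c *\<^sub>C x) = c *\<^sub>C T x"
  by (auto simp: complex_linear_def)

lemmas complex_linear_add = linear_add[OF complex_linear_linear]
  and complex_linear_diff = linear_diff[OF complex_linear_linear]
  and complex_linear_0 = linear_0[OF complex_linear_linear]
  and complex_linear_sum = linear_sum[OF complex_linear_linear]

text \<open>Polarization, for a sesquilinear form given by two linear maps.\<close>

lemma cinner_polarization:
  fixes S T :: "'a::complex_inner \<Rightarrow> 'b::complex_inner"
  assumes "complex_linear S" "complex_linear T"
  shows "4 * cinner (S x) (T y) = cinner (S (x + y)) (T (x + y)) - cinner (S (x - y)) (T (x - y))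
    + \<i> * cinner (S (x + \<i> *\<^sub>C y)) (T (x + \<i> *\<^sub>C y)) - \<i> * cinner (S (x - \<i> *\<^sub>C y)) (T (x - \<i> *\<^sub>C y))"
  using assms
  by (simp add: complex_linear_add complex_linear_diff complex_linear_scaleC cinner.add_left
      cinner.add_right cinner.diff_left cinner.diff_right cinner_scaleC_left cinner_scaleC_right)
    (simp add: algebra_simps)

lemma complex_linear_id: "complex_linear (\<lambda>x. x)"
  by (simp add: complex_linear_def)

text \<open>Polarization recovers the sesquilinear form from its diagonal, which works over complex
  scalars. Identities between spectral projections are proved below by comparing diagonal values,
  that is, values of measures.\<close>

lemma complex_linear_eqI:
  fixes S T :: "'a::complex_inner \<Rightarrow> 'a"
  assumes "complex_linear S" "complex_linear T" "\<And>x. cinner (S x) x = cinner (T x) x"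
  shows "S = T"
proof
  fix x
  have "cinner (S x) y = cinner (T x) y" for y
    using cinner_polarization[OF assms(1) complex_linear_id, of x y]
      cinner_polarization[OF assms(2) complex_linear_id, of x y]
    unfolding assms(3) by (metis mult_left_cancel zero_neq_numeral)
  then have "cinner (S x - T x) (S x - T x) = 0" by (simp add: cinner.diff_left)
  then show "S x = T x" by (simp add: cinner_self)
qed

text \<open>The projection theorem in the form used to prove surjectivity: a minimizing sequence for
  the distance of \<open>y\<close> to \<open>M\<close> is Cauchy, and the vector from its limit to
  \<open>y\<close> is orthogonal to \<open>M\<close>, hence zero.\<close>

lemma closed_subspace_eq_UNIV:
  fixes M :: "'a::complex_hilbert_space set"
  assumes cl: "closed M" and add: "\<And>x y. x \<in> M \<Longrightarrow> y \<in> M \<Longrightarrow> x + y \<in> M"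
    and sc: "\<And>c x. x \<in> M \<Longrightarrow> c *\<^sub>C x \<in> M" and ne: "M \<noteq> {}"
    and orth: "\<And>z. (\<And>x. x \<in> M \<Longrightarrow> cinner x z = 0) \<Longrightarrow> z = 0"
  shows "M = UNIV"
proof -
  have "y \<in> M" for y
  proof -
    define \<delta> where "\<delta> = infdist y M"
    have le: "\<delta> \<le> norm (y - m)" if "m \<in> M" for m
      using infdist_le[OF that, of y] by (simp add: \<delta>_def dist_norm)
    have "\<delta> \<ge> 0" by (simp add: \<delta>_def infdist_nonneg)
    have "\<exists>m\<in>M. norm (y - m) < \<delta> + 1 / real (Suc n)" for n
    proof (rule ccontr)
      assume "\<not> ?thesis"
      then have "\<delta> + 1 / real (Suc n) \<le> infdist y M"
        unfolding infdist_def using ne by (auto intro!: cINF_greatest simp: dist_norm not_less)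
      then show False by (simp add: \<delta>_def divide_le_0_iff)
    qed
    then obtain m where m: "m n \<in> M" "norm (y - m n) < \<delta> + 1 / real (Suc n)" for n
      by metis
    \<comment> \<open>Parallelogram law: the midpoint of \<open>u\<close> and \<open>w\<close> lies
      in \<open>M\<close>, so its distance to \<open>y\<close> is at least \<delta>, which bounds
      the other diagonal.\<close>
    have par: "(norm (u - w))\<^sup>2 \<le> 2 * (norm (y - u))\<^sup>2 + 2 * (norm (y - w))\<^sup>2 - 4 * \<delta>\<^sup>2"
      if "u \<in> M" "w \<in> M" for u w
    proof -
      have "(1/2) *\<^sub>C (u + w) \<in> M" using that by (intro sc add)
      then have "\<delta> \<le> norm (y - (1/2) *\<^sub>R (u + w))" using le by (simp add: scaleR_scaleC)
      also have "y - (1/2) *\<^sub>R (u + w) = (1/2) *\<^sub>R ((y - u) + (y - w))"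
        by (simp add: algebra_simps flip: scaleR_left_distrib)
      finally have "2 * \<delta> \<le> norm ((y - u) + (y - w))" by simp
      then have "(2 * \<delta>)\<^sup>2 \<le> (norm ((y - u) + (y - w)))\<^sup>2"
        using \<open>\<delta> \<ge> 0\<close> by (intro power_mono) auto
      moreover have "(norm ((y - w) - (y - u)))\<^sup>2 + (norm ((y - u) + (y - w)))\<^sup>2
          = 2 * (norm (y - u))\<^sup>2 + 2 * (norm (y - w))\<^sup>2"
        unfolding norm_sq_add norm_sq_diff using arg_cong[OF cinner_commute, of Re] by simp
      ultimately show ?thesis by (simp add: power_mult_distrib)
    qed
    have "Cauchy m"
    proof (rule CauchyI)
      fix e :: real assume "e > 0"
      define c where "c n = 4 * ((\<delta> + 1 / real (Suc n))\<^sup>2 - \<delta>\<^sup>2)" for n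
      have "c \<longlonglongrightarrow> 4 * ((\<delta> + 0)\<^sup>2 - \<delta>\<^sup>2)"
        unfolding c_def by (intro tendsto_intros lim_const_over_n filterlim_compose[OF _ filterlim_Suc, of "\<lambda>n. 1 / real n"])
      then have "\<forall>\<^sub>F n in sequentially. c n < e\<^sup>2"
        using \<open>e > 0\<close> by (intro order_tendstoD(2)[of c "4 * ((\<delta> + 0)\<^sup>2 - \<delta>\<^sup>2)"]) auto
      then obtain N where N: "c N < e\<^sup>2" by (auto simp: eventually_sequentially)
      have "norm (m i - m j) < e" if "i \<ge> N" "j \<ge> N" for i j
      proof -
        have *: "(norm (y - m i))\<^sup>2 \<le> (\<delta> + 1 / real (Suc N))\<^sup>2" if "i \<ge> N" for i
        proof (rule power_mono)
          have "1 / real (Suc i) \<le> 1 / real (Suc N)" using that by (simp add: frac_le)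
          then show "norm (y - m i) \<le> \<delta> + 1 / real (Suc N)" using m(2)[of i] by linarith
        qed simp
        have "(norm (m i - m j))\<^sup>2 \<le> c N"
          using par[OF m(1) m(1), of i j] *[OF that(1)] *[OF that(2)] by (simp add: c_def)
        then have "(norm (m i - m j))\<^sup>2 < e\<^sup>2" using N by simp
        then show ?thesis using \<open>e > 0\<close> by (simp add: power_less_imp_less_base)
      qed
      then show "\<exists>M. \<forall>i\<ge>M. \<forall>n\<ge>M. norm (m i - m n) < e" by blast
    qed
    then obtain z where z: "m \<longlonglongrightarrow> z" using Cauchy_convergent_iff convergent_def by blast
    have zM: "z \<in> M" using cl m(1) z closed_sequentially by blast
    have "norm (y - z) \<le> \<delta>"
    proof (rule LIMSEQ_le)
      show "(\<lambda>n. norm (y - m n)) \<longlonglongrightarrow> norm (y - z)" by (intro tendsto_intros z)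
      have "(\<lambda>n. \<delta> + 1 / real (Suc n)) \<longlonglongrightarrow> \<delta> + 0"
        by (intro tendsto_intros lim_const_over_n filterlim_compose[OF _ filterlim_Suc, of "\<lambda>n. 1 / real n"])
      then show "(\<lambda>n. \<delta> + 1 / real (Suc n)) \<longlonglongrightarrow> \<delta>" by simp
    qed (use m(2) less_imp_le in blast)
    then have nz: "norm (y - z) = \<delta>" using le[OF zM] by simp
    have "cinner x (y - z) = 0" if x: "x \<in> M" for x
    proof (cases "x = 0")
      case False
      \<comment> \<open>As in the Cauchy-Schwarz inequality: moving from \<open>z\<close> by the
        projection of \<open>y - z\<close> to the line of \<open>x\<close> would shorten the
        distance to \<open>y\<close> unless the inner product is zero.\<close>
      define c where "c = cinner (y - z) x / of_real ((norm x)\<^sup>2)"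
      have nx: "norm x > 0" using False by simp
      have "\<delta> \<le> norm (y - (z + c *\<^sub>C x))" by (intro le add zM sc x)
      then have "\<delta>\<^sup>2 \<le> (norm ((y - z) - c *\<^sub>C x))\<^sup>2" using \<open>\<delta> \<ge> 0\<close> by (intro power_mono) (simp_all add: algebra_simps)
      also have "\<dots> = \<delta>\<^sup>2 + (cmod c * norm x)\<^sup>2 - 2 * Re (cnj c * cinner (y - z) x)"
        by (simp add: norm_sq_diff nz norm_scaleC cinner_scaleC_right)
      also have "cnj c * cinner (y - z) x = of_real ((cmod (cinner (y - z) x))\<^sup>2 / (norm x)\<^sup>2)"
        by (simp add: c_def mult.commute complex_norm_square del: of_real_power)
      also have "(cmod c * norm x)\<^sup>2 = (cmod (cinner (y - z) x))\<^sup>2 / (norm x)\<^sup>2"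
        using nx by (simp add: c_def norm_divide norm_mult power2_eq_square)
      finally have "(cmod (cinner (y - z) x))\<^sup>2 / (norm x)\<^sup>2 \<le> 0" by simp
      then have "cinner (y - z) x = 0" using nx by (simp add: divide_le_0_iff)
      then show ?thesis by (rule cinner_commute_zero)
    qed (simp add: cinner.zero_left)
    then have "y - z = 0" by (rule orth)
    then show "y \<in> M" using zM by simp
  qed
  then show ?thesis by blast
qed

section \<open>The Cayley transform of a selfadjoint operator\<close>

lemma selfadjoint_type_hspace_iff:
  "selfadjoint type_hspace A \<longleftrightarrow>
    (\<forall>u::'h::complex_hilbert_space. \<forall>e>0. \<exists>\<phi>\<in>Domain A. norm (u - \<phi>) < e) \<and>
    (\<forall>u w. (u, w) \<in> A \<longleftrightarrow> (\<forall>\<phi> \<xi>. (\<phi>, \<xi>) \<in> A \<longrightarrow> cinner \<xi> u = cinner \<phi> w))"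
proof -
  have "sqrt (Re (cinner x x)) = norm x" for x :: 'h
    by (simp add: norm_eq_sqrt_cinner)
  then have 1: "densely_defined type_hspace A \<longleftrightarrow>
      (\<forall>u::'h. \<forall>e>0. \<exists>\<phi>\<in>Domain A. norm (u - \<phi>) < e)"
    by (simp add: densely_defined_def type_hspace_def)
  have "adjoint_operator type_hspace A =
      {(u, w). \<forall>\<phi> \<xi>. (\<phi>, \<xi>) \<in> A \<longrightarrow> cinner \<xi> u = cinner \<phi> w}"
    by (simp add: adjoint_operator_def type_hspace_def Ball_def)
  then have 2: "adjoint_operator type_hspace A = A \<longleftrightarrow>
      (\<forall>u w. (u, w) \<in> A \<longleftrightarrow> (\<forall>\<phi> \<xi>. (\<phi>, \<xi>) \<in> A \<longrightarrow> cinner \<xi> u = cinner \<phi> w))"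
    by (simp only: set_eq_iff split_paired_All mem_Collect_eq prod.case) metis
  show ?thesis
    unfolding selfadjoint_def 1 2 by (simp add: type_hspace_def)
qed

text \<open>An element of \<open>D\<close> closer to \<open>z\<close> than \<open>norm z\<close>
  cannot be orthogonal to \<open>z\<close>.\<close>

lemma dense_orthogonal_zero:
  assumes dense: "\<forall>u::'h::complex_hilbert_space. \<forall>e>0. \<exists>\<phi>\<in>D. norm (u - \<phi>) < e"
    and orth: "\<And>\<phi>. \<phi> \<in> D \<Longrightarrow> cinner \<phi> z = 0"
  shows "z = 0"
proof (rule ccontr)
  assume "z \<noteq> 0"
  then have nz: "norm z > 0" by simp
  then obtain \<phi> where \<phi>: "\<phi> \<in> D" "norm (z - \<phi>) < norm z" using dense by blast
  have "(norm z)\<^sup>2 = cmod (cinner (z - \<phi>) z)"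
    using orth[OF \<phi>(1)] by (simp add: cinner.diff_left cinner_self norm_power)
  also have "\<dots> \<le> norm (z - \<phi>) * norm z" by (rule cinner_Cauchy_Schwarz)
  also have "\<dots> < norm z * norm z" using \<phi>(2) nz by simp
  finally show False by (simp add: power2_eq_square)
qed

text \<open>For \<open>u = g - U g\<close> and \<open>w = \<i> *\<^sub>C (g + U g)\<close> one has w
  + i u = 2i g and w - i u = 2i U g, so \<open>U\<close> is (A - i)(A + i)^-1. Without fixed vectors
  1 - U is injective, which makes the graph single valued.\<close>

definition cayley_transform :: "'h::complex_hilbert_space operator \<Rightarrow> ('h \<Rightarrow> 'h) \<Rightarrow> bool" where
  "cayley_transform A U \<longleftrightarrow> complex_linear U \<and> (\<forall>g. norm (U g) = norm g) \<and> surj U \<and>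
     (\<forall>g. U g = g \<longrightarrow> g = 0) \<and> A = range (\<lambda>g. (g - U g, \<i> *\<^sub>C (g + U g)))"

section \<open>Surjectivity of A + i and A - i, and the Cayley transform\<close>

locale selfadjoint_operator =
  fixes A :: "'h::complex_hilbert_space operator"
  assumes selfadj: "selfadjoint type_hspace A"
begin

lemma dense: "\<forall>u. \<forall>e>0. \<exists>\<phi>\<in>Domain A. norm (u - \<phi>) < e"
  using selfadj unfolding selfadjoint_type_hspace_iff by (rule conjunct1)

lemma mem_iff: "(u, w) \<in> A \<longleftrightarrow> (\<forall>\<phi> \<xi>. (\<phi>, \<xi>) \<in> A \<longrightarrow> cinner \<xi> u = cinner \<phi> w)"
proof -
  have *: "\<forall>u w. (u, w) \<in> A \<longleftrightarrow> (\<forall>\<phi> \<xi>. (\<phi>, \<xi>) \<in> A \<longrightarrow> cinner \<xi> u = cinner \<phi> w)"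
    using selfadj unfolding selfadjoint_type_hspace_iff by (rule conjunct2)
  show ?thesis using spec[OF spec[OF *, of u], of w] .
qed

lemma symmetric: "(u, w) \<in> A \<Longrightarrow> (u', w') \<in> A \<Longrightarrow> cinner w u' = cinner u w'"
  by (rule mem_iff[THEN iffD1, rule_format])

lemma memI: "(\<And>\<phi> \<xi>. (\<phi>, \<xi>) \<in> A \<Longrightarrow> cinner \<xi> u = cinner \<phi> w) \<Longrightarrow> (u, w) \<in> A"
  by (rule mem_iff[THEN iffD2, rule_format])

lemma mem_add: "(u, w) \<in> A \<Longrightarrow> (u', w') \<in> A \<Longrightarrow> (u + u', w + w') \<in> A"
  by (rule memI) (subst cinner.add_right, subst cinner.add_right, rule arg_cong2[where f = "(+)"]; rule symmetric)

lemma mem_scale: "(u, w) \<in> A \<Longrightarrow> (c *\<^sub>C u, c *\<^sub>C w) \<in> A"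
  by (rule memI) (subst cinner_scaleC_right, subst cinner_scaleC_right, rule arg_cong2[where f = "(*)", OF refl], rule symmetric)

lemma mem_zero: "(0, 0) \<in> A"
  by (rule memI) (simp add: cinner.zero_right)

lemma mem_diff: "(u, w) \<in> A \<Longrightarrow> (u', w') \<in> A \<Longrightarrow> (u - u', w - w') \<in> A"
  using mem_add[OF _ mem_scale[of u' w' "-1"], of u w] by (simp add: scaleC_minus1)

lemma Im_quadratic_form: "(u, w) \<in> A \<Longrightarrow> Im (cinner w u) = 0"
  using symmetric[of u w u w] cinner_commute[of w u] by (simp add: complex_eq_iff)

text \<open>The cross term is 2 Re (cnj s * cinner w u); \<open>cinner w u\<close> is real and
  \<open>s\<close> imaginary, so it vanishes. This identity yields injectivity and closed range of A
  + s, and isometry of the Cayley transform.\<close>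

lemma norm_plus_imaginary:
  assumes "(u, w) \<in> A" "Re s = 0" "cmod s = 1"
  shows "(norm (w + s *\<^sub>C u))\<^sup>2 = (norm w)\<^sup>2 + (norm u)\<^sup>2"
  using assms Im_quadratic_form[OF assms(1)]
  by (simp add: norm_sq_add norm_scaleC cinner_scaleC_right)

text \<open>Membership in the graph is a family of equations between inner products, each of which
  passes to limits.\<close>

lemma closed_graph:
  assumes "\<And>n. (u n, w n) \<in> A" "u \<longlonglongrightarrow> u'" "w \<longlonglongrightarrow> w'"
  shows "(u', w') \<in> A"
proof (rule memI)
  fix \<phi> \<xi> assume *: "(\<phi>, \<xi>) \<in> A"
  have eq: "cinner \<xi> (u n) = cinner \<phi> (w n)" for n by (rule symmetric[OF * assms(1)])
  have "(\<lambda>n. cinner \<xi> (u n)) \<longlonglongrightarrow> cinner \<xi> u'"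
    by (intro cinner.tendsto tendsto_const assms)
  moreover have "(\<lambda>n. cinner \<xi> (u n)) \<longlonglongrightarrow> cinner \<phi> w'"
    unfolding eq by (intro cinner.tendsto tendsto_const assms)
  ultimately show "cinner \<xi> u' = cinner \<phi> w'" by (rule LIMSEQ_unique)
qed

text \<open>The range is closed because \<open>norm_plus_imaginary\<close> controls both components
  of a graph element by their combination; a vector orthogonal to it would be an eigenvector for an
  imaginary eigenvalue, which symmetry excludes.\<close>

lemma range_plus_imaginary:
  assumes s: "Re s = 0" "cmod s = 1"
  shows "\<exists>u w. (u, w) \<in> A \<and> w + s *\<^sub>C u = g"
proof -
  define R where "R = {w + s *\<^sub>C u |u w. (u, w) \<in> A}"
  have "R = UNIV"
  proof (rule closed_subspace_eq_UNIV)
    show "x + y \<in> R" if "x \<in> R" "y \<in> R" for x y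
    proof -
      obtain u w where "(u, w) \<in> A" "x = w + s *\<^sub>C u" using \<open>x \<in> R\<close> R_def by blast
      moreover obtain u' w' where "(u', w') \<in> A" "y = w' + s *\<^sub>C u'" using \<open>y \<in> R\<close> R_def by blast
      ultimately show ?thesis unfolding R_def
        by (intro CollectI exI[of _ "u + u'"] exI[of _ "w + w'"]) (simp add: scaleC_add_right mem_add)
    qed
    show "c *\<^sub>C x \<in> R" if x: "x \<in> R" for c x
    proof -
      obtain u w where "(u, w) \<in> A" "x = w + s *\<^sub>C u"
        using x by (auto simp: R_def)
      then show ?thesis unfolding R_def
        by (intro CollectI exI[of _ "c *\<^sub>C u"] exI[of _ "c *\<^sub>C w"])
          (simp add: scaleC_add_right scaleC_scaleC mult.commute mem_scale)
    qed
    show "R \<noteq> {}" using mem_zero by (auto simp: R_def)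
    show "z = 0" if orth: "\<And>x. x \<in> R \<Longrightarrow> cinner x z = 0" for z
    proof -
      \<comment> \<open>Orthogonality to the range is exactly the adjoint relation for the pair
        \<open>z\<close>, \<open>- cnj s *\<^sub>C z\<close>, and selfadjointness puts this pair
        into the graph.\<close>
      have "(z, - cnj s *\<^sub>C z) \<in> A"
      proof (rule memI)
        fix \<phi> \<xi> assume "(\<phi>, \<xi>) \<in> A"
        then have "cinner (\<xi> + s *\<^sub>C \<phi>) z = 0" by (intro orth) (auto simp: R_def)
        then show "cinner \<xi> z = cinner \<phi> (- cnj s *\<^sub>C z)"
          by (simp add: cinner.add_left cinner_scaleC_left cinner_scaleC_right add_eq_0_iff2)
      qed
      from Im_quadratic_form[OF this] s show "z = 0"
        by (auto simp: cinner_scaleC_left cinner_self cmod_def)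
    qed
    show "closed R"
    proof (rule closed_sequential_limits[THEN iffD2], intro allI impI, elim conjE)
      fix x l assume "\<forall>n. x n \<in> R" and l: "x \<longlonglongrightarrow> l"
      then have "\<forall>n. \<exists>u w. (u, w) \<in> A \<and> x n = w + s *\<^sub>C u" unfolding R_def by blast
      then obtain u w where uw: "\<And>n. (u n, w n) \<in> A" "\<And>n. x n = w n + s *\<^sub>C u n" by metis
      have "Cauchy x" using l LIMSEQ_imp_Cauchy by blast
      have le: "norm (u m - u n) \<le> norm (x m - x n) \<and> norm (w m - w n) \<le> norm (x m - x n)" for m n
      proof -
        have "(norm (x m - x n))\<^sup>2 = (norm (w m - w n))\<^sup>2 + (norm (u m - u n))\<^sup>2"
          using norm_plus_imaginary[OF mem_diff[OF uw(1)[of m] uw(1)[of n]] s]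
          by (simp add: uw(2) scaleC.diff_right algebra_simps)
        then have "(norm (u m - u n))\<^sup>2 \<le> (norm (x m - x n))\<^sup>2" "(norm (w m - w n))\<^sup>2 \<le> (norm (x m - x n))\<^sup>2"
          by simp_all
        then show ?thesis using power2_le_imp_le norm_ge_zero by blast
      qed
      have Cauchy_le: "Cauchy y" if "\<And>m n. norm (y m - y n) \<le> norm (x m - x n)" for y :: "nat \<Rightarrow> 'h"
      proof (rule CauchyI)
        fix e :: real assume "e > 0"
        then obtain M where "\<forall>m\<ge>M. \<forall>n\<ge>M. norm (x m - x n) < e" using CauchyD[OF \<open>Cauchy x\<close>] by blast
        then show "\<exists>M. \<forall>m\<ge>M. \<forall>n\<ge>M. norm (y m - y n) < e" using that le_less_trans by blast
      qed
      have "Cauchy u" "Cauchy w" using le by (auto intro: Cauchy_le)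
      then obtain u' w' where lim: "u \<longlonglongrightarrow> u'" "w \<longlonglongrightarrow> w'"
        using Cauchy_convergent_iff convergent_def by metis
      have "x \<longlonglongrightarrow> w' + s *\<^sub>C u'"
        unfolding uw(2)[abs_def] by (intro tendsto_add lim scaleC.tendsto tendsto_const)
      then have "l = w' + s *\<^sub>C u'" using l LIMSEQ_unique by blast
      then show "l \<in> R" using closed_graph[OF uw(1) lim] by (auto simp: R_def)
    qed
  qed
  then have "g \<in> R" by simp
  then show ?thesis by (auto simp: R_def)
qed

theorem cayley_transform_exists: "\<exists>U. cayley_transform A U"
proof -
  have ii: "Re \<i> = 0" "cmod \<i> = 1" and mi: "Re (-\<i>) = 0" "cmod (-\<i>) = 1" by auto
  have half: "(1 / (2 * \<i>)) *\<^sub>C (2 * \<i>) *\<^sub>C x = x" for x :: 'h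
    by (simp only: scaleC_scaleC) (simp add: scaleC_one)
  have half': "(2 * \<i>) *\<^sub>C (1 / (2 * \<i>)) *\<^sub>C x = x" for x :: 'h
    by (simp only: scaleC_scaleC) (simp add: scaleC_one)
  have two: "(2 * \<i>) *\<^sub>C x = \<i> *\<^sub>C x + \<i> *\<^sub>C x" for x :: 'h
    by (simp add: scaleC_add_left[symmetric])
  have "\<exists>u. (u, (2 * \<i>) *\<^sub>C g - \<i> *\<^sub>C u) \<in> A" for g
  proof -
    obtain u w where "(u, w) \<in> A" and w: "w + \<i> *\<^sub>C u = (2 * \<i>) *\<^sub>C g"
      using range_plus_imaginary[OF ii] by blast
    then show ?thesis by (intro exI[of _ u]) (simp add: w[symmetric])
  qed
  \<comment> \<open>\<open>f\<close> is 2i (A + i)^-1, which leads to the Cayley transform as 1 -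
    f.\<close>
  then obtain f where f: "\<And>g. (f g, (2 * \<i>) *\<^sub>C g - \<i> *\<^sub>C f g) \<in> A" by metis
  have uniq: "f g = u" if "(u, (2 * \<i>) *\<^sub>C g - \<i> *\<^sub>C u) \<in> A" for u g
  proof -
    have "(f g - u, - (\<i> *\<^sub>C (f g - u))) \<in> A"
      using mem_diff[OF f[of g] that] by (simp add: scaleC.diff_right)
    from norm_plus_imaginary[OF this ii] have "(norm (f g - u))\<^sup>2 = 0"
      by (simp add: norm_scaleC)
    then show ?thesis by simp
  qed
  define U where "U g = g - f g" for g
  have eq: "(2 * \<i>) *\<^sub>C g - \<i> *\<^sub>C f g = \<i> *\<^sub>C (g + U g)" for g
    by (simp add: U_def two scaleC.add_right scaleC.diff_right)
  have gr: "(g - U g, \<i> *\<^sub>C (g + U g)) \<in> A" for g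
    using f[of g] unfolding eq by (simp add: U_def)
  have fadd: "f (x + y) = f x + f y" for x y
    using mem_add[OF f f, of x y] by (intro uniq) (simp add: scaleC_add_right algebra_simps)
  have fsc: "f (c *\<^sub>C x) = c *\<^sub>C f x" for c x
    using mem_scale[OF f, of c x]
    by (intro uniq) (simp add: scaleC.diff_right scaleC_scaleC mult.commute mult.left_commute)
  have lin: "complex_linear U"
    by (simp add: complex_linear_def U_def fadd fsc scaleC.diff_right)
  \<comment> \<open>2i U g = w - i u and 2i g = w + i u for the same graph element
    \<open>(u, w)\<close>, and both have squared norm
    \<open>(norm w)\<^sup>2 + (norm u)\<^sup>2\<close>.\<close>
  have nrm: "norm (U g) = norm g" for g
  proof -
    have "(norm ((2 * \<i>) *\<^sub>C U g))\<^sup>2 = (norm (\<i> *\<^sub>C (g + U g) + (- \<i>) *\<^sub>C (g - U g)))\<^sup>2"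
      by (simp add: two scaleC.add_right scaleC.diff_right scaleC.minus_left)
    also have "\<dots> = (norm (\<i> *\<^sub>C (g + U g) + \<i> *\<^sub>C (g - U g)))\<^sup>2"
      by (simp only: norm_plus_imaginary[OF gr mi] norm_plus_imaginary[OF gr ii])
    also have "\<dots> = (norm ((2 * \<i>) *\<^sub>C g))\<^sup>2"
      by (simp add: two scaleC.add_right scaleC.diff_right scaleC.minus_left)
    finally show ?thesis by (simp add: norm_scaleC)
  qed
  have "surj U"
  \<comment> \<open>Solving w - i u = 2i h gives the preimage h + u; the choice operator merely
    names such a \<open>u\<close>, because \<open>surjI\<close> expects a right inverse.\<close>
  proof (rule surjI)
    fix h
    obtain u w where uw: "(u, w) \<in> A" "w + (-\<i>) *\<^sub>C u = (2 * \<i>) *\<^sub>C h"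
      using range_plus_imaginary[OF mi] by blast
    then have "w = (2 * \<i>) *\<^sub>C h + \<i> *\<^sub>C u" by (simp add: scaleC.minus_left algebra_simps)
    then have "f (h + u) = u" using uw(1) by (intro uniq) (simp add: two scaleC.add_right)
    then show "U ((\<lambda>h. h + (SOME u. f (h + u) = u)) h) = h"
      by (simp add: U_def) (metis (mono_tags) someI_ex)
  qed
  moreover have "g = 0" if "U g = g" for g
  proof -
    \<comment> \<open>A fixed vector \<open>g\<close> produces a graph element over 0; symmetry then
      makes 2i g orthogonal to the dense domain.\<close>
    have "(0, (2 * \<i>) *\<^sub>C g) \<in> A" using gr[of g] that by (simp add: two scaleC.add_right)
    then have "cinner \<phi> ((2 * \<i>) *\<^sub>C g) = 0" if "\<phi> \<in> Domain A" for \<phi>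
      using that symmetric[of \<phi> _ 0 "(2 * \<i>) *\<^sub>C g"] by (auto simp: cinner.zero_right)
    then have "(2 * \<i>) *\<^sub>C g = 0" using dense_orthogonal_zero[OF dense] by blast
    then show "g = 0" by (metis half scaleC.zero_right)
  qed
  moreover have "A = range (\<lambda>g. (g - U g, \<i> *\<^sub>C (g + U g)))"
  proof (intro equalityI subsetI)
    fix x assume "x \<in> A"
    then obtain u w where uw: "x = (u, w)" "(u, w) \<in> A" by (cases x) auto
    define g where "g = (1 / (2 * \<i>)) *\<^sub>C (w + \<i> *\<^sub>C u)"
    have g: "(2 * \<i>) *\<^sub>C g = w + \<i> *\<^sub>C u" by (simp only: g_def half')
    have "f g = u" using uw(2) by (intro uniq) (simp add: g)
    then have "x = (g - U g, \<i> *\<^sub>C (g + U g))"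
      unfolding eq[symmetric] by (simp add: uw(1) U_def g)
    then show "x \<in> range (\<lambda>g. (g - U g, \<i> *\<^sub>C (g + U g)))" by blast
  qed (use gr in auto)
  ultimately show ?thesis using lin nrm unfolding cayley_transform_def by blast
qed

end

section \<open>Spectral measures of isometries on the circle\<close>

text \<open>Orthogonality of the characters of the circle: for a nonzero frequency the
  antiderivative is periodic, so its values at both ends cancel.\<close>

lemma integral_cis_circle:
  "has_bochner_integral lborel (\<lambda>\<theta>. indicator {0..2*pi} \<theta> *\<^sub>R cis (of_int l * \<theta>))
     (if l = 0 then 2 * pi else 0)"
proof (cases "l = 0")
  case True
  have "has_bochner_integral lborel (\<lambda>\<theta>. indicator {0..2*pi} \<theta> *\<^sub>R (1::complex))
     (measure lborel {0..2*pi} *\<^sub>R 1)"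
    by (intro has_bochner_integral_indicator) auto
  then show ?thesis using True by (simp add: scaleR_conv_of_real cis_zero)
next
  case False
  let ?F = "\<lambda>\<theta>. cis (of_int l * \<theta>) / (\<i> * of_int l)"
  have "has_bochner_integral lborel (\<lambda>\<theta>. indicator {0..2*pi} \<theta> *\<^sub>R cis (of_int l * \<theta>))
     (?F (2 * pi) - ?F 0)"
  proof (rule has_bochner_integral_FTC_Icc)
    fix x :: real
    show "(?F has_vector_derivative cis (of_int l * x)) (at x within {0..2*pi})"
      unfolding cis_conv_exp of_real_mult of_real_of_int_eq using False
      by (intro has_vector_derivative_real_field[of "\<lambda>z. exp (\<i> * (of_int l * z)) / (\<i> * of_int l)"])
        (auto intro!: derivative_eq_intros simp: mult.commute[of _ \<i>])
  qed (auto intro!: continuous_intros)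
  moreover have "cis (of_int l * (2 * pi)) = 1"
    using cis_multiple_2pi[of "of_int l"] by (simp add: mult.commute mult.left_commute)
  ultimately show ?thesis using False by (simp add: cis_zero)
qed

lemma isometry_cinner:
  assumes "complex_linear U" "\<And>g. norm (U g) = norm g"
  shows "cinner (U x) (U y) = cinner x y"
  using cinner_polarization[OF assms(1) assms(1), of x y]
    cinner_polarization[OF complex_linear_id complex_linear_id, of x y]
  by (simp add: cinner_self assms(2)) (metis mult_left_cancel zero_neq_numeral)

lemma complex_linear_funpow: "complex_linear U \<Longrightarrow> complex_linear (U ^^ n)"
  for U :: "'a::complex_inner \<Rightarrow> 'a"
  by (induction n) (auto simp: complex_linear_def)

lemma isometry_funpow_norm:
  "(\<And>g. norm (U g) = norm g) \<Longrightarrow> norm ((U ^^ n) g) = norm g" for U :: "'a::complex_inner \<Rightarrow> 'a"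
  by (induction n) auto

text \<open>The trigonometric moment problem: the Fejer means of the moments of U are nonnegative because
  they are squared norms, so that a weak limit of these densities exists.\<close>

lemma circle_measure_exists_normalized:
  fixes U :: "'h::complex_inner \<Rightarrow> 'h"
  assumes lin: "complex_linear U" and iso: "\<And>g. norm (U g) = norm g" and \<phi>: "norm \<phi> = 1"
  shows "\<exists>M. prob_space M \<and> sets M = sets borel \<and> (AE z in M. cmod z = 1) \<and>
    (\<forall>k. (\<integral>z. z ^ k \<partial>M) = cinner ((U ^^ k) \<phi>) \<phi>)"
proof -
  have cisc: "continuous_on UNIV (\<lambda>\<theta>. cis (t * \<theta>))" for t
    unfolding cis_conv_exp
    by (intro continuous_on_exp continuous_on_mult continuous_on_const continuous_on_of_real continuous_on_id)
  have cism [measurable]: "cis \<in> borel_measurable borel"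
    using borel_measurable_continuous_onI[OF cisc[of 1]] by simp
  \<comment> \<open>With these weights the squared norm of \<open>S n \<theta>\<close>, divided by 2
    pi n, is the Fejer mean of the Fourier series with the moments \<open>c k\<close> as
    coefficients; it is nonnegative by construction.\<close>
  define S where "S n \<theta> = (\<Sum>k<n. cis (- real k * \<theta>) *\<^sub>C (U ^^ k) \<phi>)" for n \<theta>
  define D where "D n \<theta> = indicator {0..2*pi} \<theta> * ((norm (S n \<theta>))\<^sup>2 / (2 * pi * n))" for n :: nat and \<theta> :: real
  define c where "c k = cinner ((U ^^ k) \<phi>) \<phi>" for k
  have "continuous_on UNIV (S n)" for n
    unfolding S_def by (intro continuous_intros scaleC.continuous_on)
  then have "continuous_on UNIV (\<lambda>\<theta>. (norm (S n \<theta>))\<^sup>2 * (1 / (2 * pi * n)))" for n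
    by (intro continuous_on_mult continuous_on_power continuous_on_norm continuous_on_const)
  then have Scont: "continuous_on UNIV (\<lambda>\<theta>. (norm (S n \<theta>))\<^sup>2 / (2 * pi * n))" for n
    by simp
  have Dmeas [measurable]: "D n \<in> borel_measurable borel" for n
    unfolding D_def using borel_measurable_continuous_onI[OF Scont[of n]] by measurable
  have Dnn: "D n \<theta> \<ge> 0" for n \<theta> by (simp add: D_def)
  have pw: "cinner ((U ^^ (k + m)) \<phi>) ((U ^^ k) \<phi>) = c m" for k m
    by (simp add: funpow_add c_def isometry_cinner complex_linear_funpow lin isometry_funpow_norm iso)
  \<comment> \<open>Of the pairs \<open>(j, k)\<close> only those with \<open>j = k + m\<close>
    survive integration, and there are \<open>n - m\<close> of them; this is the origin of the Fejer
    factor.\<close>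
  have fourier: "has_bochner_integral lborel (\<lambda>\<theta>. D n \<theta> *\<^sub>R cis (real m * \<theta>)) (of_nat (n - m) / of_nat n * c m)"
    if n: "n > 0" for n m
  proof -
    let ?J = "\<lambda>j k. int m - int j + int k"
    have "has_bochner_integral lborel
        (\<lambda>\<theta>. \<Sum>j<n. \<Sum>k<n. (indicator {0..2*pi} \<theta> *\<^sub>R cis (of_int (?J j k) * \<theta>)) *
           (cinner ((U ^^ j) \<phi>) ((U ^^ k) \<phi>) / (2 * pi * n)))
        (\<Sum>j<n. \<Sum>k<n. (if ?J j k = 0 then 2 * pi else 0) * (cinner ((U ^^ j) \<phi>) ((U ^^ k) \<phi>) / (2 * pi * n)))"
      by (intro has_bochner_integral_sum has_bochner_integral_mult_left integral_cis_circle)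
    also have "(\<lambda>\<theta>. \<Sum>j<n. \<Sum>k<n. (indicator {0..2*pi} \<theta> *\<^sub>R cis (of_int (?J j k) * \<theta>)) *
           (cinner ((U ^^ j) \<phi>) ((U ^^ k) \<phi>) / (2 * pi * n))) = (\<lambda>\<theta>. D n \<theta> *\<^sub>R cis (real m * \<theta>))"
    proof
      fix \<theta>
      have "complex_of_real ((norm (S n \<theta>))\<^sup>2) = (\<Sum>j<n. \<Sum>k<n. cis (- real j * \<theta>) * cis (real k * \<theta>) *
          cinner ((U ^^ j) \<phi>) ((U ^^ k) \<phi>))"
        unfolding cinner_self[symmetric] S_def
        by (simp add: cinner.sum_left cinner.sum_right cinner_scaleC_left cinner_scaleC_right cis_cnj mult.assoc sum_distrib_left)
          (subst sum.swap, simp only: mult.left_commute)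
      then have "complex_of_real ((norm (S n \<theta>))\<^sup>2) * cis (real m * \<theta>) = (\<Sum>j<n. \<Sum>k<n. cis (- real j * \<theta>) *
          cis (real k * \<theta>) * cinner ((U ^^ j) \<phi>) ((U ^^ k) \<phi>) * cis (real m * \<theta>))"
        by (simp only: sum_distrib_right)
      also have "\<dots> = (\<Sum>j<n. \<Sum>k<n. cis (of_int (?J j k) * \<theta>) * cinner ((U ^^ j) \<phi>) ((U ^^ k) \<phi>))"
      proof (intro sum.cong refl)
        fix j k
        have "cis (of_int (?J j k) * \<theta>) = cis (- real j * \<theta>) * cis (real k * \<theta>) * cis (real m * \<theta>)"
          unfolding cis_mult by (rule arg_cong[where f = cis]) (simp add: algebra_simps)
        then show "cis (- real j * \<theta>) * cis (real k * \<theta>) * cinner ((U ^^ j) \<phi>) ((U ^^ k) \<phi>) * cis (real m * \<theta>)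
            = cis (of_int (?J j k) * \<theta>) * cinner ((U ^^ j) \<phi>) ((U ^^ k) \<phi>)"
          by (simp only: ac_simps)
      qed
      finally have *: "complex_of_real ((norm (S n \<theta>))\<^sup>2) * cis (real m * \<theta>)
          = (\<Sum>j<n. \<Sum>k<n. cis (of_int (?J j k) * \<theta>) * cinner ((U ^^ j) \<phi>) ((U ^^ k) \<phi>))" .
      show "(\<Sum>j<n. \<Sum>k<n. (indicator {0..2*pi} \<theta> *\<^sub>R cis (of_int (?J j k) * \<theta>)) *
           (cinner ((U ^^ j) \<phi>) ((U ^^ k) \<phi>) / (2 * pi * n))) = D n \<theta> *\<^sub>R cis (real m * \<theta>)"
      proof -
        have aux1: "(x *\<^sub>R z) * (w / complex_of_real y) = complex_of_real (x / y) * (z * w)" for x y z w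
          by (simp add: scaleR_conv_of_real)
        have aux2: "complex_of_real (x / y) * (complex_of_real s * z) = (x * (s / y)) *\<^sub>R z" for x y s z
          by (simp add: scaleR_conv_of_real)
        have "(\<Sum>j<n. \<Sum>k<n. (indicator {0..2*pi} \<theta> *\<^sub>R cis (of_int (?J j k) * \<theta>)) *
           (cinner ((U ^^ j) \<phi>) ((U ^^ k) \<phi>) / (2 * pi * n)))
           = complex_of_real (indicator {0..2*pi} \<theta> / (2 * pi * n)) *
             (\<Sum>j<n. \<Sum>k<n. cis (of_int (?J j k) * \<theta>) * cinner ((U ^^ j) \<phi>) ((U ^^ k) \<phi>))"
          unfolding sum_distrib_left by (intro sum.cong refl) (rule aux1)
        also have "\<dots> = D n \<theta> *\<^sub>R cis (real m * \<theta>)"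
          unfolding *[symmetric] D_def
          by (rule aux2)
        finally show ?thesis .
      qed
    qed
    also have "(\<Sum>j<n. \<Sum>k<n. (if ?J j k = 0 then 2 * pi else 0) * (cinner ((U ^^ j) \<phi>) ((U ^^ k) \<phi>) / (2 * pi * n)))
        = (\<Sum>k<n. \<Sum>j<n. if j = k + m then c m / n else 0)"
    proof (subst sum.swap, intro sum.cong refl)
      fix k j
      show "(if ?J j k = 0 then 2 * pi else 0) * (cinner ((U ^^ j) \<phi>) ((U ^^ k) \<phi>) / (2 * pi * n))
        = (if j = k + m then c m / n else 0)"
      proof (cases "j = k + m")
        case True
        then show ?thesis using pw[of k m] pi_neq_zero by simp
      next
        case False
        then have "?J j k \<noteq> 0" by linarith
        then show ?thesis using False by simp
      qed
    qed
    \<comment> \<open>\<open>n - m\<close> is truncated subtraction, so no term is left when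
      \<open>m\<close> is at least \<open>n\<close>.\<close>
    also have "\<dots> = (\<Sum>k<n. if k < n - m then c m / n else 0)"
      by (intro sum.cong refl) auto
    also have "\<dots> = (\<Sum>k<n - m. c m / n)"
      by (intro sum.mono_neutral_cong_right) auto
    also have "\<dots> = of_nat (n - m) / of_nat n * c m" by simp
    finally show ?thesis .
  qed
  define N where "N n = density lborel (\<lambda>\<theta>. ennreal (D (Suc n) \<theta>))" for n
  have c0: "c 0 = 1" by (simp add: c_def cinner_self \<phi>)
  have mass: "has_bochner_integral lborel (\<lambda>\<theta>. D (Suc n) \<theta>) 1" for n
  proof -
    have "has_bochner_integral lborel (\<lambda>\<theta>. Re (D (Suc n) \<theta> *\<^sub>R cis (real 0 * \<theta>))) (Re (of_nat (Suc n - 0) / of_nat (Suc n) * c 0))"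
      by (intro has_bochner_integral_bounded_linear[OF bounded_linear_Re] fourier) simp
    also have "Re (of_nat (Suc n - 0) / of_nat (Suc n) * c 0) = 1"
      by (simp add: c0 del: of_nat_Suc)
    finally show ?thesis by (simp add: cis_zero)
  qed
  have total: "(\<integral>\<^sup>+\<theta>. ennreal (D (Suc n) \<theta>) \<partial>lborel) = 1" for n
    using mass[of n] Dnn by (subst nn_integral_eq_integral) (auto simp: has_bochner_integral_iff)
  have rd: "real_distribution (N n)" for n
  proof -
    have "prob_space (N n)"
      by standard (simp add: N_def emeasure_density total)
    then show ?thesis
      by (simp add: real_distribution_def real_distribution_axioms_def N_def)
  qed
  \<comment> \<open>All densities live on [0, 2 pi], which lies in (-1, 8] since pi < 4; mass cannot
    escape, and a subsequence converges weakly.\<close>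
  have "tight N"
    unfolding tight_def
  proof (intro conjI allI impI rd)
    fix e :: real assume "e > 0"
    have "measure (N n) {-1<..8} = 1" for n
    proof -
      have "emeasure (N n) {-1<..8} = (\<integral>\<^sup>+\<theta>. ennreal (D (Suc n) \<theta>) * indicator {-1<..8} \<theta> \<partial>lborel)"
        by (simp add: N_def emeasure_density)
      also have "\<dots> = (\<integral>\<^sup>+\<theta>. ennreal (D (Suc n) \<theta>) \<partial>lborel)"
        using pi_less_4 by (intro nn_integral_cong) (auto simp: D_def indicator_def)
      finally show ?thesis by (simp add: total measure_def)
    qed
    then show "\<exists>a b. a < b \<and> (\<forall>n. 1 - e < measure (N n) {a<..b})"
      using \<open>e > 0\<close> by (intro exI[of _ "-1"] exI[of _ 8]) auto
  qed
  from tight_imp_convergent_subsubsequence[OF this strict_mono_id]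
  obtain r M where "strict_mono r \<and> real_distribution M \<and> weak_conv_m (N \<circ> id \<circ> r) M"
    by (elim exE)
  then have r: "strict_mono r" and M: "real_distribution M" "weak_conv_m (N \<circ> id \<circ> r) M"
    by simp_all
  interpret M: real_distribution M by (rule M(1))
  have moments: "(\<integral>\<theta>. cis (real m * \<theta>) \<partial>M) = c m" for m
  proof (rule LIMSEQ_unique)
    have rd': "real_distribution ((N \<circ> id \<circ> r) n)" for n using rd[of "r n"] by (simp only: o_apply id_apply)
    have ic: "isCont (\<lambda>\<theta>. cis (real m * \<theta>)) x" for x
      using cisc[of "real m"] by (simp only: continuous_on_eq_continuous_at[OF open_UNIV] UNIV_I simp_thms ball_UNIV)
    have b1: "norm (cis (real m * x)) \<le> 1" for x by (simp only: norm_cis order_refl)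
    show "(\<lambda>n. (\<integral>\<theta>. cis (real m * \<theta>) \<partial>(N \<circ> id \<circ> r) n)) \<longlonglongrightarrow> (\<integral>\<theta>. cis (real m * \<theta>) \<partial>M)"
      by (rule weak_conv_imp_integral_bdd_continuous_conv[OF rd' M ic b1])
    have eq: "(\<integral>\<theta>. cis (real m * \<theta>) \<partial>N n) = of_nat (Suc n - m) / of_nat (Suc n) * c m" for n
    proof -
      have "(\<integral>\<theta>. cis (real m * \<theta>) \<partial>N n) = (\<integral>\<theta>. D (Suc n) \<theta> *\<^sub>R cis (real m * \<theta>) \<partial>lborel)"
        unfolding N_def by (subst integral_density) (simp_all add: Dnn)
      then show ?thesis using fourier[of "Suc n" m] by (simp add: has_bochner_integral_iff)
    qed
    \<comment> \<open>The Fejer factor is 1 - m / (n + 1) once \<open>n\<close> is at least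
      \<open>m\<close>, and it tends to 1.\<close>
    have "(\<lambda>n. complex_of_real (1 - real m / real (Suc n)) * c m) \<longlonglongrightarrow> complex_of_real (1 - 0) * c m"
      by (intro tendsto_intros lim_const_over_n filterlim_compose[OF _ filterlim_Suc, of "\<lambda>n. real m / real n"])
    moreover have "\<forall>\<^sub>F n in sequentially. complex_of_real (1 - real m / real (Suc n)) * c m =
          (\<integral>\<theta>. cis (real m * \<theta>) \<partial>N n)"
      unfolding eventually_sequentially
    proof (intro exI[of _ m] allI impI)
      fix n assume "m \<le> n"
      then have "of_nat (Suc n - m) / of_nat (Suc n) = complex_of_real (1 - real m / real (Suc n))"
        by (simp add: of_nat_diff field_simps del: of_nat_Suc)
      then show "complex_of_real (1 - real m / real (Suc n)) * c m = (\<integral>\<theta>. cis (real m * \<theta>) \<partial>N n)"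
        unfolding eq by simp
    qed
    ultimately have "(\<lambda>n. (\<integral>\<theta>. cis (real m * \<theta>) \<partial>N n)) \<longlonglongrightarrow> complex_of_real (1 - 0) * c m"
      by (rule Lim_transform_eventually)
    then have "(\<lambda>n. (\<integral>\<theta>. cis (real m * \<theta>) \<partial>N n)) \<longlonglongrightarrow> c m" by simp
    from LIMSEQ_subseq_LIMSEQ[OF this r] show "(\<lambda>n. (\<integral>\<theta>. cis (real m * \<theta>) \<partial>(N \<circ> id \<circ> r) n)) \<longlonglongrightarrow> c m"
      by (simp add: o_def)
  qed
  \<comment> \<open>\<open>cis\<close> wraps the line around the circle and turns the Fourier
    coefficients of \<open>M\<close> into moments.\<close>
  show ?thesis
  proof (intro exI[of _ "distr M borel cis"] conjI allI)
    show "prob_space (distr M borel cis)"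
      by (intro M.prob_space_distr) simp
    show "AE z in distr M borel cis. cmod z = 1"
      by (rule AE_distr_iff[THEN iffD2]) simp_all
    show "(\<integral>z. z ^ k \<partial>distr M borel cis) = cinner ((U ^^ k) \<phi>) \<phi>" for k
      using moments[of k] unfolding c_def by (subst integral_distr) (simp_all add: Complex.DeMoivre)
  qed simp
qed

text \<open>Both sides are quadratic in \<phi>, so the normalized case is rescaled by
  \<open>(norm \<phi>)\<^sup>2\<close>; \<phi> = 0 cannot be normalized and receives the null
  measure.\<close>

lemma circle_measure_exists:
  fixes U :: "'h::complex_inner \<Rightarrow> 'h"
  assumes lin: "complex_linear U" and iso: "\<And>g. norm (U g) = norm g"
  shows "\<exists>M. finite_measure M \<and> sets M = sets borel \<and> (AE z in M. cmod z = 1) \<and>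
    (\<forall>k. (\<integral>z. z ^ k \<partial>M) = cinner ((U ^^ k) \<phi>) \<phi>)"
proof (cases "\<phi> = 0")
  case True
  then show ?thesis
    by (intro exI[of _ "null_measure borel"])
      (auto simp: cinner.zero_right intro!: finite_measureI AE_I[where N = UNIV])
next
  case False
  define \<psi> where "\<psi> = (1 / norm \<phi>) *\<^sub>R \<phi>"
  have "norm \<psi> = 1" using False by (simp add: \<psi>_def)
  then obtain M where M: "prob_space M" "sets M = sets borel" "AE z in M. cmod z = 1"
    "\<And>k. (\<integral>z. z ^ k \<partial>M) = cinner ((U ^^ k) \<psi>) \<psi>"
    using circle_measure_exists_normalized[OF lin iso] by blast
  interpret prob_space M by fact
  have [measurable_cong]: "sets M = sets borel" by fact
  let ?N = "density M (\<lambda>_. ennreal ((norm \<phi>)\<^sup>2))"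
  show ?thesis
  proof (intro exI[of _ ?N] conjI allI)
    show "finite_measure ?N"
      by (rule finite_measureI) (auto simp: emeasure_density emeasure_space_1 ennreal_mult_eq_top_iff)
    show "AE z in ?N. cmod z = 1"
      using M(3) by (subst AE_density) auto
    fix k
    have "(\<integral>z. z ^ k \<partial>?N) = (norm \<phi>)\<^sup>2 *\<^sub>R (\<integral>z. z ^ k \<partial>M)"
      by (subst integral_density) auto
    also have "\<dots> = (norm \<phi>)\<^sup>2 *\<^sub>R ((1 / norm \<phi>) *\<^sub>R (1 / norm \<phi>) *\<^sub>R cinner ((U ^^ k) \<phi>) \<phi>)"
      unfolding M(4) \<psi>_def
      by (simp only: linear_scale[OF complex_linear_linear[OF complex_linear_funpow[OF lin]]]
          cinner.scaleR_left cinner.scaleR_right)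
    also have "\<dots> = cinner ((U ^^ k) \<phi>) \<phi>"
      using False by (simp add: power2_eq_square scaleR_scaleR)
    finally show "(\<integral>z. z ^ k \<partial>?N) = cinner ((U ^^ k) \<phi>) \<phi>" .
  qed (use M(2) in simp)
qed

section \<open>Functions bounded on the unit circle and squared L2 distances\<close>

lemma borel_measurable_cnj [measurable]: "cnj \<in> borel_measurable borel"
  by (intro borel_measurable_continuous_onI continuous_on_cnj continuous_on_id)

text \<open>Boundedness is demanded on the unit circle only: the measures below are carried by it,
  while \<open>z\<close> and its powers are unbounded on the plane.\<close>

definition circle_bounded :: "(complex \<Rightarrow> 'a::real_normed_vector) \<Rightarrow> bool" where
  "circle_bounded g \<longleftrightarrow> g \<in> borel_measurable borel \<and> (\<exists>B. \<forall>z. cmod z = 1 \<longrightarrow> norm (g z) \<le> B)"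

lemma circle_bounded_measurable: "circle_bounded g \<Longrightarrow> g \<in> borel_measurable borel"
  by (simp add: circle_bounded_def)

lemma circle_bounded_bound: "circle_bounded g \<Longrightarrow> \<exists>B. \<forall>z. cmod z = 1 \<longrightarrow> norm (g z) \<le> B"
  by (simp add: circle_bounded_def)

lemma circle_boundedI:
  "g \<in> borel_measurable borel \<Longrightarrow> (\<And>z. cmod z = 1 \<Longrightarrow> norm (g z) \<le> B) \<Longrightarrow> circle_bounded g"
  by (auto simp: circle_bounded_def)

lemma circle_bounded_const: "circle_bounded (\<lambda>z. c)"
  by (rule circle_boundedI[where B = "norm c"]) auto

lemma circle_bounded_id: "circle_bounded (\<lambda>z. z)"
  by (rule circle_boundedI[where B = 1]) auto

lemma circle_bounded_indicator: "B \<in> sets borel \<Longrightarrow> circle_bounded (\<lambda>z. indicator B z :: 'a::real_normed_algebra_1)"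
  by (rule circle_boundedI[where B = 1]) (auto simp: indicator_def)

lemma circle_bounded_add:
  fixes f g :: "complex \<Rightarrow> 'a::{real_normed_vector, second_countable_topology}"
  assumes "circle_bounded f" "circle_bounded g"
  shows "circle_bounded (\<lambda>z. f z + g z)"
proof -
  obtain B where B: "\<forall>z. cmod z = 1 \<longrightarrow> norm (f z) \<le> B" using circle_bounded_bound[OF assms(1)] ..
  obtain C where C: "\<forall>z. cmod z = 1 \<longrightarrow> norm (g z) \<le> C" using circle_bounded_bound[OF assms(2)] ..
  have "norm (f z + g z) \<le> B + C" if "cmod z = 1" for z
    by (rule norm_triangle_mono) (use B C that in auto)
  moreover have "(\<lambda>z. f z + g z) \<in> borel_measurable borel"
    by (intro borel_measurable_add circle_bounded_measurable assms)
  ultimately show ?thesis unfolding circle_bounded_def by blast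
qed

lemma circle_bounded_mult:
  fixes f g :: "complex \<Rightarrow> 'a::{real_normed_algebra, second_countable_topology}"
  assumes "circle_bounded f" "circle_bounded g"
  shows "circle_bounded (\<lambda>z. f z * g z)"
proof -
  obtain B where B: "\<forall>z. cmod z = 1 \<longrightarrow> norm (f z) \<le> B" using circle_bounded_bound[OF assms(1)] ..
  obtain C where C: "\<forall>z. cmod z = 1 \<longrightarrow> norm (g z) \<le> C" using circle_bounded_bound[OF assms(2)] ..
  have "norm (f z * g z) \<le> B * C" if "cmod z = 1" for z
    by (rule order_trans[OF norm_mult_ineq], rule mult_mono') (use B C that in auto)
  moreover have "(\<lambda>z. f z * g z) \<in> borel_measurable borel"
    by (intro borel_measurable_times circle_bounded_measurable assms)
  ultimately show ?thesis unfolding circle_bounded_def by blast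
qed

lemma circle_bounded_norm: "circle_bounded g \<Longrightarrow> circle_bounded (\<lambda>z. norm (g z))"
  by (auto simp: circle_bounded_def)

lemma circle_bounded_cnj: "circle_bounded g \<Longrightarrow> circle_bounded (\<lambda>z. cnj (g z))"
  by (auto simp: circle_bounded_def)

lemma circle_bounded_of_real: "circle_bounded g \<Longrightarrow> circle_bounded (\<lambda>z. complex_of_real (g z))"
  by (auto simp: circle_bounded_def)

lemma circle_bounded_diff:
  "circle_bounded f \<Longrightarrow> circle_bounded g \<Longrightarrow> circle_bounded (\<lambda>z. f z - g z)"
  for f g :: "complex \<Rightarrow> complex"
  using circle_bounded_add[of f "\<lambda>z. (-1) * g z"] circle_bounded_mult[of "\<lambda>_. -1" g]
  by (simp add: circle_bounded_const)

lemma circle_bounded_power: "circle_bounded f \<Longrightarrow> circle_bounded (\<lambda>z. f z ^ n)"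
  for f :: "complex \<Rightarrow> 'a::{real_normed_algebra_1, second_countable_topology}"
  by (induction n) (auto intro: circle_bounded_mult circle_bounded_const)

lemmas circle_bounded_intros = circle_bounded_const circle_bounded_id circle_bounded_indicator
  circle_bounded_add circle_bounded_mult circle_bounded_norm circle_bounded_cnj
  circle_bounded_of_real circle_bounded_diff circle_bounded_power

definition circle_measure :: "complex measure \<Rightarrow> bool" where
  "circle_measure M \<longleftrightarrow> finite_measure M \<and> sets M = sets borel \<and> (AE z in M. cmod z = 1)"

lemma circle_bounded_integrable:
  fixes g :: "complex \<Rightarrow> 'a::{banach, second_countable_topology}"
  assumes "circle_measure M" "circle_bounded g"
  shows "integrable M g"
proof -
  interpret finite_measure M using assms(1) by (simp add: circle_measure_def)
  obtain B where "\<forall>z. cmod z = 1 \<longrightarrow> norm (g z) \<le> B" using circle_bounded_bound[OF assms(2)] ..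
  then have "AE z in M. norm (g z) \<le> B"
    using assms(1) by (auto simp: circle_measure_def)
  moreover have "g \<in> borel_measurable M"
    using assms measurable_cong_sets[of M borel borel borel]
    by (auto simp: circle_measure_def circle_bounded_def)
  ultimately show ?thesis by (rule integrable_const_bound)
qed

lemma norm_add_sq_le: "(norm (x + y))\<^sup>2 \<le> 2 * (norm x)\<^sup>2 + 2 * (norm y)\<^sup>2"
proof -
  have "(norm (x + y))\<^sup>2 \<le> (norm x + norm y)\<^sup>2" by (intro power_mono norm_triangle_ineq) auto
  also have "\<dots> \<le> 2 * (norm x)\<^sup>2 + 2 * (norm y)\<^sup>2"
    using sum_squares_bound[of "norm x" "norm y"] by (simp add: power2_sum)
  finally show ?thesis .
qed

text \<open>Distances stay squared so that they are plain integrals; the price is a factor 2 in the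
  triangle inequality below.\<close>

definition L2_dist_sq :: "complex measure \<Rightarrow> (complex \<Rightarrow> complex) \<Rightarrow> (complex \<Rightarrow> complex) \<Rightarrow> real" where
  "L2_dist_sq M g h = (\<integral>z. (cmod (g z - h z))\<^sup>2 \<partial>M)"

lemma L2_dist_sq_nonneg: "L2_dist_sq M g h \<ge> 0"
  by (simp add: L2_dist_sq_def)

lemma L2_dist_sq_commute: "L2_dist_sq M g h = L2_dist_sq M h g"
  by (simp add: L2_dist_sq_def norm_minus_commute)

lemma L2_dist_sq_add_le:
  assumes M: "circle_measure M" and cb: "circle_bounded f" "circle_bounded g" "circle_bounded h" "circle_bounded k"
  shows "L2_dist_sq M (\<lambda>z. f z + g z) (\<lambda>z. h z + k z) \<le> 2 * L2_dist_sq M f h + 2 * L2_dist_sq M g k"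
proof -
  have "(\<integral>z. (cmod ((f z + g z) - (h z + k z)))\<^sup>2 \<partial>M) \<le>
      (\<integral>z. 2 * (cmod (f z - h z))\<^sup>2 + 2 * (cmod (g z - k z))\<^sup>2 \<partial>M)"
  proof (rule integral_mono)
    show "(cmod ((f z + g z) - (h z + k z)))\<^sup>2 \<le> 2 * (cmod (f z - h z))\<^sup>2 + 2 * (cmod (g z - k z))\<^sup>2" for z
      using norm_add_sq_le[of "f z - h z" "g z - k z"] by (simp add: algebra_simps)
  qed (intro circle_bounded_integrable[OF M] circle_bounded_intros cb)+
  also have "\<dots> = 2 * (\<integral>z. (cmod (f z - h z))\<^sup>2 \<partial>M) + 2 * (\<integral>z. (cmod (g z - k z))\<^sup>2 \<partial>M)"
    by (subst Bochner_Integration.integral_add)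
      (auto intro!: circle_bounded_integrable[OF M] circle_bounded_intros cb)
  finally show ?thesis by (simp add: L2_dist_sq_def)
qed

lemma L2_dist_sq_triangle:
  assumes M: "circle_measure M" and cb: "circle_bounded f" "circle_bounded g" "circle_bounded h"
  shows "L2_dist_sq M f h \<le> 2 * L2_dist_sq M f g + 2 * L2_dist_sq M g h"
proof -
  have "L2_dist_sq M (\<lambda>z. f z + g z) (\<lambda>z. g z + h z) = L2_dist_sq M f h"
    by (simp add: L2_dist_sq_def)
  then show ?thesis
    using L2_dist_sq_add_le[OF M cb(1,2,2,3)] by simp
qed

section \<open>Trigonometric polynomials in a unitary operator\<close>

locale unitary_operator =
  fixes U :: "'h::complex_hilbert_space \<Rightarrow> 'h"
  assumes lin: "complex_linear U" and iso: "norm (U g) = norm g" and surj: "surj U"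
begin

definition V where "V = inv U"

lemma U_V: "U (V x) = x"
  using surj by (simp add: V_def surj_f_inv_f)

lemma U_inj: "U x = U y \<Longrightarrow> x = y"
  using iso[of "x - y"] by (simp add: complex_linear_diff[OF lin])

lemma V_U: "V (U x) = x"
  using U_V U_inj by blast

lemma V_lin: "complex_linear V"
  unfolding complex_linear_def
  by (metis U_V V_U complex_linear_add[OF lin] complex_linear_scaleC[OF lin])

lemma U_adjoint: "cinner (U x) y = cinner x (V y)"
  using isometry_cinner[OF lin iso, of x "V y"] by (simp add: U_V)

lemma V_adjoint: "cinner (V x) y = cinner x (U y)"
  using isometry_cinner[OF lin iso, of "V x" y] by (simp add: U_V)

definition \<mu> :: "'h \<Rightarrow> complex measure" where
  "\<mu> \<phi> = (SOME M. finite_measure M \<and> sets M = sets borel \<and> (AE z in M. cmod z = 1) \<and>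
    (\<forall>k. (\<integral>z. z ^ k \<partial>M) = cinner ((U ^^ k) \<phi>) \<phi>))"

lemma \<mu>: "finite_measure (\<mu> \<phi>) \<and> sets (\<mu> \<phi>) = sets borel \<and> (AE z in \<mu> \<phi>. cmod z = 1) \<and>
    (\<forall>k. (\<integral>z. z ^ k \<partial>\<mu> \<phi>) = cinner ((U ^^ k) \<phi>) \<phi>)"
  unfolding \<mu>_def by (rule someI_ex) (rule circle_measure_exists[OF lin iso])

lemma sets_\<mu>[measurable_cong, simp]: "sets (\<mu> \<phi>) = sets borel"
  and space_\<mu>[simp]: "space (\<mu> \<phi>) = UNIV"
  and AE_\<mu>: "AE z in \<mu> \<phi>. cmod z = 1"
  and circle_measure_\<mu>: "circle_measure (\<mu> \<phi>)"
  and moment_\<mu>: "(\<integral>z. z ^ k \<partial>\<mu> \<phi>) = cinner ((U ^^ k) \<phi>) \<phi>"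
  using \<mu>[of \<phi>] sets_eq_imp_space_eq[of "\<mu> \<phi>" borel] by (auto simp: circle_measure_def)

sublocale \<mu>: finite_measure "\<mu> \<phi>" for \<phi>
  using \<mu> by blast

lemmas integrable_\<mu> = circle_bounded_integrable[OF circle_measure_\<mu>]

text \<open>Pairs a polynomial in \<open>z\<close> and \<open>cnj z\<close> with the operator
  obtained by substituting \<open>U\<close> for \<open>z\<close> and its inverse \<open>V\<close>
  for \<open>cnj z\<close>, which is 1/z on the circle. Being a relation, it involves no choice of
  coefficients, and facts about both components follow by one induction.\<close>

inductive trig :: "(complex \<Rightarrow> complex) \<Rightarrow> ('h \<Rightarrow> 'h) \<Rightarrow> bool" where
  one: "trig (\<lambda>z. 1) (\<lambda>\<phi>. \<phi>)"
| fwd: "trig h T \<Longrightarrow> trig (\<lambda>z. z * h z) (\<lambda>\<phi>. U (T \<phi>))"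
| bwd: "trig h T \<Longrightarrow> trig (\<lambda>z. cnj z * h z) (\<lambda>\<phi>. V (T \<phi>))"
| add: "trig h T \<Longrightarrow> trig k S \<Longrightarrow> trig (\<lambda>z. h z + k z) (\<lambda>\<phi>. T \<phi> + S \<phi>)"
| scale: "trig h T \<Longrightarrow> trig (\<lambda>z. c * h z) (\<lambda>\<phi>. c *\<^sub>C T \<phi>)"

lemma trig_diff:
  assumes "trig h T" "trig k S" shows "trig (\<lambda>z. h z - k z) (\<lambda>\<phi>. T \<phi> - S \<phi>)"
  using add[OF assms(1) scale[OF assms(2), of "-1"]] by (simp add: scaleC_minus1)

lemma trig_bounded: "trig h T \<Longrightarrow> circle_bounded h"
  by (induction rule: trig.induct) (auto intro!: circle_bounded_intros)

lemma trig_linear: "trig h T \<Longrightarrow> complex_linear T"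
  by (induction rule: trig.induct)
    (auto simp: complex_linear_def complex_linear_add[OF lin] complex_linear_scaleC[OF lin]
      complex_linear_add[OF V_lin] complex_linear_scaleC[OF V_lin] scaleC_add_right scaleC_scaleC mult.commute)

lemma trig_commute: "trig h T \<Longrightarrow> T (U x) = U (T x)"
  by (induction rule: trig.induct)
    (auto simp: U_V V_U complex_linear_add[OF lin] complex_linear_scaleC[OF lin])

lemma trig_mult: "trig h T \<Longrightarrow> trig k S \<Longrightarrow> trig (\<lambda>z. h z * k z) (\<lambda>\<phi>. T (S \<phi>))"
proof (induction rule: trig.induct)
  case (fwd h T)
  then show ?case using trig.fwd by (simp add: mult.assoc)
next
  case (bwd h T)
  then show ?case using trig.bwd by (simp add: mult.assoc)
next
  case (add h T k S)
  then show ?case using trig.add by (simp add: distrib_right)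
next
  case (scale h T)
  then show ?case using trig.scale by (simp add: mult.assoc)
qed simp

lemma trig_adjoint:
  "trig h T \<Longrightarrow> \<exists>S. trig (\<lambda>z. cnj (h z)) S \<and> (\<forall>x y. cinner (T x) y = cinner x (S y))"
proof (induction rule: trig.induct)
  case one
  then show ?case using trig.one by auto
next
  case (fwd h T)
  then obtain S where S: "trig (\<lambda>z. cnj (h z)) S" "\<And>x y. cinner (T x) y = cinner x (S y)" by blast
  show ?case
    using trig_mult[OF S(1) trig.bwd[OF trig.one]]
    by (intro exI[of _ "\<lambda>\<phi>. S (V \<phi>)"]) (auto simp: S(2) U_adjoint mult.commute)
next
  case (bwd h T)
  then obtain S where S: "trig (\<lambda>z. cnj (h z)) S" "\<And>x y. cinner (T x) y = cinner x (S y)" by blast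
  show ?case
    using trig_mult[OF S(1) trig.fwd[OF trig.one]]
    by (intro exI[of _ "\<lambda>\<phi>. S (U \<phi>)"]) (auto simp: S(2) V_adjoint mult.commute)
next
  case (add h T k S)
  then obtain T' S' where S: "trig (\<lambda>z. cnj (h z)) T'" "\<And>x y. cinner (T x) y = cinner x (T' y)"
    "trig (\<lambda>z. cnj (k z)) S'" "\<And>x y. cinner (S x) y = cinner x (S' y)" by blast
  show ?case
    using trig.add[OF S(1,3)]
    by (intro exI[of _ "\<lambda>\<phi>. T' \<phi> + S' \<phi>"]) (auto simp: S(2,4) cinner.add_left cinner.add_right)
next
  case (scale h T c)
  then obtain S where S: "trig (\<lambda>z. cnj (h z)) S" "\<And>x y. cinner (T x) y = cinner x (S y)" by blast
  show ?case
    using trig.scale[OF S(1), of "cnj c"]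
    by (intro exI[of _ "\<lambda>\<phi>. cnj c *\<^sub>C S \<phi>"]) (auto simp: S(2) cinner_scaleC_left cinner_scaleC_right)
qed

text \<open>The extra factor with exponents \<open>k\<close> and \<open>l\<close> makes the
  induction work: the rules \<open>fwd\<close> and \<open>bwd\<close> multiply by \<open>z\<close>
  or \<open>cnj z\<close>, which raises one of the exponents.\<close>

lemma trig_integral_aux:
  "trig h T \<Longrightarrow> (\<integral>z. z ^ k * cnj z ^ l * h z \<partial>\<mu> \<phi>) = cinner (T ((U ^^ k) \<phi>)) ((U ^^ l) \<phi>)"
proof (induction arbitrary: k l rule: trig.induct)
  case one
  have reduce: "z ^ (l + m) * cnj z ^ l = z ^ m" if "cmod z = 1" for z l m
  proof -
    have "z * cnj z = 1" using that by (simp add: complex_norm_square[symmetric])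
    then have "(z * cnj z) ^ l = 1" by simp
    then show ?thesis by (simp add: power_add power_mult_distrib mult.assoc mult.left_commute)
  qed
  have pw: "cinner ((U ^^ (l + m)) \<phi>) ((U ^^ l) \<phi>) = cinner ((U ^^ m) \<phi>) \<phi>" for l m
    by (simp add: funpow_add isometry_cinner complex_linear_funpow lin isometry_funpow_norm iso)
  \<comment> \<open>On the circle the factors cancel to \<open>z ^ m\<close>, a known moment; the
    opposite order of the exponents follows by conjugation.\<close>
  have up: "(\<integral>z. z ^ (l + m) * cnj z ^ l * 1 \<partial>\<mu> \<phi>) = cinner ((U ^^ (l + m)) \<phi>) ((U ^^ l) \<phi>)" for l m
  proof -
    have "(\<integral>z. z ^ (l + m) * cnj z ^ l * 1 \<partial>\<mu> \<phi>) = (\<integral>z. z ^ m \<partial>\<mu> \<phi>)"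
      using AE_\<mu>[of \<phi>] by (intro integral_cong_AE) (auto simp: reduce)
    then show ?thesis by (simp add: moment_\<mu> pw)
  qed
  show ?case
  proof (cases "l \<le> k")
    case True
    then show ?thesis using up[of l "k - l"] by simp
  next
    case False
    then have "(\<integral>z. z ^ l * cnj z ^ k * 1 \<partial>\<mu> \<phi>) = cinner ((U ^^ l) \<phi>) ((U ^^ k) \<phi>)"
      using up[of k "l - k"] by simp
    then have "cnj (\<integral>z. z ^ l * cnj z ^ k * 1 \<partial>\<mu> \<phi>) = cinner ((U ^^ k) \<phi>) ((U ^^ l) \<phi>)"
      by (simp flip: cinner_commute)
    then show ?thesis by (simp add: mult.commute flip: Bochner_Integration.integral_cnj)
  qed
next
  case (fwd h T)
  have "U (T ((U ^^ k) \<phi>)) = T ((U ^^ Suc k) \<phi>)" using trig_commute[OF fwd.hyps] by simp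
  then show ?case using fwd.IH[of "Suc k" l] by (simp add: mult.assoc mult.left_commute mult.commute)
next
  case (bwd h T)
  then show ?case using bwd.IH[of k "Suc l"] by (simp add: V_adjoint mult.assoc mult.left_commute mult.commute)
next
  case (add h T k' S)
  have "(\<integral>z. z ^ k * cnj z ^ l * (h z + k' z) \<partial>\<mu> \<phi>) =
     (\<integral>z. z ^ k * cnj z ^ l * h z \<partial>\<mu> \<phi>) + (\<integral>z. z ^ k * cnj z ^ l * k' z \<partial>\<mu> \<phi>)"
    unfolding distrib_left
    by (intro Bochner_Integration.integral_add integrable_\<mu> circle_bounded_intros
        trig_bounded[OF add.hyps(1)] trig_bounded[OF add.hyps(2)])
  then show ?case by (simp add: add.IH cinner.add_left)
next
  case (scale h T c)
  have "(\<integral>z. z ^ k * cnj z ^ l * (c * h z) \<partial>\<mu> \<phi>) = (\<integral>z. c * (z ^ k * cnj z ^ l * h z) \<partial>\<mu> \<phi>)"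
    by (simp add: ac_simps)
  then show ?case by (simp add: scale.IH cinner_scaleC_left)
qed

lemma trig_integral: "trig h T \<Longrightarrow> (\<integral>z. h z \<partial>\<mu> \<phi>) = cinner (T \<phi>) \<phi>"
  using trig_integral_aux[where k = 0 and l = 0] by simp

text \<open>\<open>h z * cnj (h z)\<close> corresponds to the adjoint of \<open>T\<close> composed
  with \<open>T\<close>, so its integral is a squared norm. This isometry transports L2
  approximation on the circle to the Hilbert space.\<close>

lemma trig_norm:
  assumes "trig h T" shows "(\<integral>z. (cmod (h z))\<^sup>2 \<partial>\<mu> \<phi>) = (norm (T \<phi>))\<^sup>2"
proof -
  obtain S where S: "trig (\<lambda>z. cnj (h z)) S" "\<And>x y. cinner (T x) y = cinner x (S y)"
    using trig_adjoint[OF assms] by blast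
  have "cinner (T (S x)) y = cinner (S (T x)) y" for x y
  proof -
    have comm: "T (S x) = S (T x)" for x
    proof -
      have *: "trig k R \<Longrightarrow> R (V x) = V (R x)" for k R x
        by (metis U_V V_U trig_commute)
      have "trig k R \<Longrightarrow> T (R x) = R (T x)" for k R
        by (induction rule: trig.induct)
          (simp_all add: trig_commute[OF assms] *[OF assms] complex_linear_add[OF trig_linear[OF assms]]
            complex_linear_scaleC[OF trig_linear[OF assms]])
      then show ?thesis using S(1) by blast
    qed
    show ?thesis by (simp add: comm)
  qed
  have "complex_of_real (\<integral>z. (cmod (h z))\<^sup>2 \<partial>\<mu> \<phi>) = (\<integral>z. h z * cnj (h z) \<partial>\<mu> \<phi>)"
    unfolding complex_norm_square[symmetric] by (rule integral_complex_of_real[symmetric])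
  also have "\<dots> = cinner (S (T \<phi>)) \<phi>"
    using trig_integral[OF trig_mult[OF S(1) assms], of \<phi>] by (simp add: mult.commute)
  also have "\<dots> = cnj (cinner \<phi> (S (T \<phi>)))"
    by (rule cinner_commute)
  also have "\<dots> = complex_of_real ((norm (T \<phi>))\<^sup>2)"
    unfolding S(2)[symmetric] cinner_self by simp
  finally show ?thesis using of_real_eq_iff by blast
qed

lemma trig_dist: "trig h T \<Longrightarrow> trig k S \<Longrightarrow> L2_dist_sq (\<mu> \<phi>) h k = (norm (T \<phi> - S \<phi>))\<^sup>2"
  unfolding L2_dist_sq_def using trig_norm[OF trig_diff] by blast

text \<open>One polynomial has to serve all vectors of \<open>F\<close> at once: additivity of a
  limit operator compares the three vectors \<open>x\<close>, \<open>y\<close> and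
  \<open>x + y\<close>, whose measures differ.\<close>

definition trig_approx :: "'h set \<Rightarrow> (complex \<Rightarrow> complex) \<Rightarrow> bool" where
  "trig_approx F g \<longleftrightarrow> circle_bounded g \<and>
    (\<forall>e>0. \<exists>h T. trig h T \<and> (\<forall>\<phi>\<in>F. L2_dist_sq (\<mu> \<phi>) g h < e))"

lemma trig_approx_trig:
  assumes "trig h T" shows "trig_approx F h"
  unfolding trig_approx_def
proof (intro conjI allI impI trig_bounded[OF assms])
  fix e :: real assume "e > 0"
  then show "\<exists>k S. trig k S \<and> (\<forall>\<phi>\<in>F. L2_dist_sq (\<mu> \<phi>) h k < e)"
    using assms by (intro exI[of _ h] exI[of _ T]) (auto simp: L2_dist_sq_def)
qed

lemma trig_approx_add:
  assumes "trig_approx F g" "trig_approx F g'" shows "trig_approx F (\<lambda>z. g z + g' z)"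
  unfolding trig_approx_def
proof (intro conjI allI impI)
  show "circle_bounded (\<lambda>z. g z + g' z)"
    using assms by (auto simp: trig_approx_def intro: circle_bounded_intros)
  fix e :: real assume "e > 0"
  then have "e / 4 > 0" by simp
  then obtain h T h' T' where h: "trig h T" "\<And>\<phi>. \<phi> \<in> F \<Longrightarrow> L2_dist_sq (\<mu> \<phi>) g h < e / 4"
    "trig h' T'" "\<And>\<phi>. \<phi> \<in> F \<Longrightarrow> L2_dist_sq (\<mu> \<phi>) g' h' < e / 4"
    using assms unfolding trig_approx_def by metis
  have "L2_dist_sq (\<mu> \<phi>) (\<lambda>z. g z + g' z) (\<lambda>z. h z + h' z) < e" if "\<phi> \<in> F" for \<phi>
    using L2_dist_sq_add_le[OF circle_measure_\<mu>, of g g' h h' \<phi>] h(2)[OF that] h(4)[OF that]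
      assms trig_bounded[OF h(1)] trig_bounded[OF h(3)] by (simp add: trig_approx_def)
  then show "\<exists>h T. trig h T \<and> (\<forall>\<phi>\<in>F. L2_dist_sq (\<mu> \<phi>) (\<lambda>z. g z + g' z) h < e)"
    using trig.add[OF h(1,3)] by blast
qed

lemma trig_approx_uminus:
  assumes "trig_approx F g" shows "trig_approx F (\<lambda>z. - g z)"
  unfolding trig_approx_def
proof (intro conjI allI impI)
  show "circle_bounded (\<lambda>z. - g z)"
    using assms circle_bounded_mult[of "\<lambda>_. -1" g] by (simp add: trig_approx_def circle_bounded_const)
  fix e :: real assume "e > 0"
  then obtain h T where h: "trig h T" "\<And>\<phi>. \<phi> \<in> F \<Longrightarrow> L2_dist_sq (\<mu> \<phi>) g h < e"
    using assms unfolding trig_approx_def by metis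
  have "L2_dist_sq (\<mu> \<phi>) (\<lambda>z. - g z) (\<lambda>z. -1 * h z) = L2_dist_sq (\<mu> \<phi>) g h" for \<phi>
    by (simp add: L2_dist_sq_def norm_minus_commute)
  then show "\<exists>h T. trig h T \<and> (\<forall>\<phi>\<in>F. L2_dist_sq (\<mu> \<phi>) (\<lambda>z. - g z) h < e)"
    using trig.scale[OF h(1), of "-1"] h(2) by (metis (no_types, lifting))
qed

lemma trig_approx_limit:
  assumes "circle_bounded g"
    and "\<And>e. e > 0 \<Longrightarrow> \<exists>g'. trig_approx F g' \<and> (\<forall>\<phi>\<in>F. L2_dist_sq (\<mu> \<phi>) g g' < e)"
  shows "trig_approx F g"
  unfolding trig_approx_def
proof (intro conjI allI impI assms(1))
  fix e :: real assume "e > 0"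
  then have e: "e / 4 > 0" by simp
  obtain g' where g': "trig_approx F g'" "\<And>\<phi>. \<phi> \<in> F \<Longrightarrow> L2_dist_sq (\<mu> \<phi>) g g' < e / 4"
    using assms(2)[OF e] by blast
  obtain h T where h: "trig h T" "\<And>\<phi>. \<phi> \<in> F \<Longrightarrow> L2_dist_sq (\<mu> \<phi>) g' h < e / 4"
    using g'(1) e unfolding trig_approx_def by metis
  have "L2_dist_sq (\<mu> \<phi>) g h < e" if "\<phi> \<in> F" for \<phi>
    using L2_dist_sq_triangle[OF circle_measure_\<mu> assms(1), of g' h \<phi>] g'(2)[OF that] h(2)[OF that]
      g'(1) trig_bounded[OF h(1)] by (simp add: trig_approx_def)
  then show "\<exists>h T. trig h T \<and> (\<forall>\<phi>\<in>F. L2_dist_sq (\<mu> \<phi>) g h < e)" using h(1) by blast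
qed

lemma trig_polynomial:
  "real_polynomial_function p \<Longrightarrow> \<exists>T. trig (\<lambda>z. complex_of_real (p z)) T"
proof (induction rule: real_polynomial_function.induct)
  case (linear f)
  then interpret bounded_linear f .
  define a b where "a = complex_of_real (f 1)" and "b = complex_of_real (f \<i>)"
  \<comment> \<open>Re z = (z + cnj z) / 2 and Im z = (z - cnj z) / (2i); the factors 1 match the
    functions produced by the rules of \<open>trig\<close>.\<close>
  have "complex_of_real (f z) = (a / 2 + b / (2 * \<i>)) * (z * 1) + (a / 2 - b / (2 * \<i>)) * (cnj z * 1)" for z
  proof -
    have "f z = f (Re z *\<^sub>R 1 + Im z *\<^sub>R \<i>)"
      by (rule arg_cong[where f = f]) (simp add: complex_eq_iff)
    also have "\<dots> = Re z * f 1 + Im z * f \<i>" by (simp only: add scaleR real_scaleR_def)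
    finally show ?thesis by (simp add: a_def b_def complex_eq_iff)
  qed
  then show ?case
    using trig.add[OF trig.scale[OF trig.fwd[OF trig.one]] trig.scale[OF trig.bwd[OF trig.one]]]
    by (metis (no_types, lifting) ext)
next
  case (const c)
  then show ?case using trig.scale[OF trig.one, of "of_real c"] by auto
next
  case (add f g)
  then obtain T S where "trig (\<lambda>z. complex_of_real (f z)) T" "trig (\<lambda>z. complex_of_real (g z)) S" by blast
  from trig.add[OF this] show ?case unfolding of_real_add by blast
next
  case (mult f g)
  then obtain T S where "trig (\<lambda>z. complex_of_real (f z)) T" "trig (\<lambda>z. complex_of_real (g z)) S" by blast
  from trig_mult[OF this] show ?case unfolding of_real_mult by blast
qed

text \<open>The indicator of \<open>C\<close> is a pointwise limit of continuous tent functions, and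
  by Stone-Weierstrass each of these is close to a polynomial uniformly on the circle.\<close>

lemma trig_approx_closed:
  assumes "closed C" "finite F" shows "trig_approx F (indicator C)"
\<comment> \<open>\<open>infdist\<close> to the empty set is 0 by convention, so the tent functions
  would be constantly 1 in this case.\<close>
proof (cases "C = {}")
  case True
  then show ?thesis using trig_approx_trig[OF trig.scale[OF trig.one, of 0], of F] by (simp add: indicator_def[abs_def])
next
  case False
  have C [measurable]: "C \<in> sets borel" using assms by simp
  define f where "f n z = max 0 (1 - real n * infdist z C)" for n :: nat and z :: complex
  have f_cont: "continuous_on UNIV (f n)" for n
    unfolding f_def by (intro continuous_intros)
  have f_meas [measurable]: "f n \<in> borel_measurable borel" for n
    by (rule borel_measurable_continuous_onI[OF f_cont])
  have f_bound: "0 \<le> f n z" "f n z \<le> 1" for n z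
    using infdist_nonneg[of z C] by (auto simp: f_def)
  have f_cb: "circle_bounded (\<lambda>z. complex_of_real (f n z))" for n
    using f_bound by (intro circle_bounded_of_real circle_boundedI[where B = 1]) auto
  have lim: "(\<lambda>n. L2_dist_sq (\<mu> \<phi>) (indicator C) (\<lambda>z. of_real (f n z))) \<longlonglongrightarrow> 0" for \<phi>
  proof -
    have "(\<lambda>n. \<integral>z. (cmod (indicator C z - of_real (f n z)))\<^sup>2 \<partial>\<mu> \<phi>) \<longlonglongrightarrow> (\<integral>z. 0 \<partial>\<mu> \<phi>)"
    proof (rule integral_dominated_convergence[where w = "\<lambda>_. 1"])
      show "AE z in \<mu> \<phi>. (\<lambda>n. (cmod (indicator C z - of_real (f n z)))\<^sup>2) \<longlonglongrightarrow> 0"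
      proof (rule AE_I2)
        fix z
        have "(\<lambda>n. f n z) \<longlonglongrightarrow> indicator C z"
        proof (cases "z \<in> C")
          case True
          then show ?thesis by (simp add: f_def)
        next
          case z: False
          then have pos: "infdist z C > 0"
            using in_closed_iff_infdist_zero[OF assms(1) False] infdist_nonneg[of z C] by (simp add: less_le)
          obtain N :: nat where N: "real N * infdist z C > 1" using reals_Archimedean3[OF pos] by blast
          have "f n z = 0" if "n \<ge> N" for n
          proof -
            have "real N * infdist z C \<le> real n * infdist z C" using that pos by simp
            then show ?thesis using N by (simp add: f_def)
          qed
          then show ?thesis using z
            by (intro tendsto_eventually) (auto simp: eventually_sequentially)
        qed
        then have "(\<lambda>n. (cmod (indicator C z - of_real (f n z)))\<^sup>2) \<longlonglongrightarrow> (cmod (indicator C z - of_real (indicator C z)))\<^sup>2"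
          by (intro tendsto_intros)
        then show "(\<lambda>n. (cmod (indicator C z - of_real (f n z)))\<^sup>2) \<longlonglongrightarrow> 0"
          by (cases "z \<in> C") simp_all
      qed
      show "AE z in \<mu> \<phi>. norm ((cmod (indicator C z - of_real (f n z)))\<^sup>2) \<le> 1" for n
      proof (rule AE_I2)
        fix z
        have "indicator C z - complex_of_real (f n z) = of_real (indicator C z - f n z)"
          by (simp add: indicator_def)
        then have "cmod (indicator C z - of_real (f n z)) \<le> 1"
          using f_bound[of n z] by (simp only: norm_of_real) (auto simp: indicator_def)
        then show "norm ((cmod (indicator C z - of_real (f n z)))\<^sup>2) \<le> 1"
          by (simp add: power_le_one)
      qed
    qed (auto simp: integrable_\<mu> circle_bounded_const)
    then show ?thesis by (simp add: L2_dist_sq_def)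
  qed
  have fn: "trig_approx F (\<lambda>z. of_real (f n z))" for n
  proof (rule trig_approx_limit[OF f_cb])
    fix e :: real assume "e > 0"
    \<comment> \<open>A positive bound for the total masses of all measures involved; \<delta> is
      chosen so that a uniform error \<delta> means a squared L2 error below
      \<open>e\<close>.\<close>
    define K where "K = 1 + (\<Sum>\<phi>\<in>F. measure (\<mu> \<phi>) UNIV)"
    have K: "K > 0" by (simp add: K_def add_pos_nonneg sum_nonneg)
    define \<delta> where "\<delta> = sqrt (e / (2 * K))"
    have \<delta>: "\<delta> > 0" "\<delta>\<^sup>2 = e / (2 * K)" using \<open>e > 0\<close> K by (auto simp: \<delta>_def)
    obtain p where p: "real_polynomial_function p" "\<And>z. z \<in> sphere 0 1 \<Longrightarrow> \<bar>f n z - p z\<bar> < \<delta>"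
      using Stone_Weierstrass_real_polynomial_function[OF _ continuous_on_subset[OF f_cont] \<delta>(1), of "sphere 0 1"]
      by (auto simp: compact_sphere)
    obtain T where T: "trig (\<lambda>z. complex_of_real (p z)) T" using trig_polynomial[OF p(1)] by blast
    have "L2_dist_sq (\<mu> \<phi>) (\<lambda>z. of_real (f n z)) (\<lambda>z. of_real (p z)) < e" if \<phi>: "\<phi> \<in> F" for \<phi>
    proof -
      have "L2_dist_sq (\<mu> \<phi>) (\<lambda>z. of_real (f n z)) (\<lambda>z. of_real (p z)) \<le> (\<integral>z. \<delta>\<^sup>2 \<partial>\<mu> \<phi>)"
        unfolding L2_dist_sq_def
      proof (rule integral_mono_AE)
        show "AE z in \<mu> \<phi>. (cmod (complex_of_real (f n z) - complex_of_real (p z)))\<^sup>2 \<le> \<delta>\<^sup>2"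
          using AE_\<mu>[of \<phi>]
        proof (rule AE_mp, intro AE_I2 impI)
          fix z :: complex assume "cmod z = 1"
          then show "(cmod (complex_of_real (f n z) - complex_of_real (p z)))\<^sup>2 \<le> \<delta>\<^sup>2"
            using p(2)[of z] by (intro power_mono) (auto simp flip: of_real_diff)
        qed
      qed (intro integrable_\<mu> circle_bounded_intros f_cb trig_bounded[OF T])+
      also have "\<dots> = measure (\<mu> \<phi>) UNIV * \<delta>\<^sup>2" by simp
      also have "\<dots> \<le> K * \<delta>\<^sup>2"
        using member_le_sum[of \<phi> F "\<lambda>\<phi>. measure (\<mu> \<phi>) UNIV"] \<phi> assms(2)
        by (intro mult_right_mono) (auto simp: K_def)
      also have "\<dots> < e" using K \<open>e > 0\<close> by (simp add: \<delta>)
      finally show ?thesis .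
    qed
    then show "\<exists>g'. trig_approx F g' \<and> (\<forall>\<phi>\<in>F. L2_dist_sq (\<mu> \<phi>) (\<lambda>z. of_real (f n z)) g' < e)"
      using trig_approx_trig[OF T] by blast
  qed
  show ?thesis
  proof (rule trig_approx_limit)
    show "circle_bounded (indicator C :: complex \<Rightarrow> complex)" using circle_bounded_indicator[OF C] .
    fix e :: real assume "e > 0"
    then have "\<forall>\<^sub>F n in sequentially. \<forall>\<phi>\<in>F. L2_dist_sq (\<mu> \<phi>) (indicator C) (\<lambda>z. of_real (f n z)) < e"
      using lim by (intro eventually_ball_finite assms(2) ballI order_tendstoD(2)) auto
    then obtain n where "\<forall>\<phi>\<in>F. L2_dist_sq (\<mu> \<phi>) (indicator C) (\<lambda>z. of_real (f n z)) < e"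
      by (auto simp: eventually_sequentially)
    then show "\<exists>g'. trig_approx F g' \<and> (\<forall>\<phi>\<in>F. L2_dist_sq (\<mu> \<phi>) (indicator C) g' < e)"
      using fn by blast
  qed
qed

text \<open>Dynkin argument from the closed sets, which are stable under intersection: a complement
  has 1 minus the indicator, and disjoint countable unions are L2 limits of finite ones.\<close>

lemma trig_approx_indicator:
  assumes F: "finite F" and B: "B \<in> sets borel" shows "trig_approx F (indicator B)"
proof -
  have sig: "B \<in> sigma_sets UNIV (Collect closed)"
    using B by (simp add: borel_eq_closed)
  have "Int_stable (Collect closed :: complex set set)" "Collect closed \<subseteq> Pow (UNIV :: complex set)"
    by (auto simp: Int_stable_def)
  from this sig show ?thesis
  proof (induction rule: sigma_sets_induct_disjoint)
    case (basic A)
    then show ?case using trig_approx_closed F by blast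
  next
    case empty
    then show ?case using trig_approx_closed[OF closed_empty F] .
  next
    case (compl A)
    have "trig_approx F (\<lambda>z. 1 + - indicator A z)"
      by (intro trig_approx_add trig_approx_uminus compl trig_approx_trig[OF trig.one])
    moreover have "(\<lambda>z. 1 + - indicator A z) = (indicator (UNIV - A) :: complex \<Rightarrow> complex)"
      by (auto simp: indicator_def)
    ultimately show ?case by simp
  next
    case (union A)
    have Am [measurable]: "A i \<in> sets borel" for i
      using union.hyps(2) by (auto simp: borel_eq_closed)
    have fin: "trig_approx F (indicator (\<Union>i<n. A i))" for n
    proof (induction n)
      case 0
      then show ?case using trig_approx_closed[OF closed_empty F] by (simp add: indicator_def[abs_def])
    next
      case (Suc n)
      have "(indicator (\<Union>i<Suc n. A i) :: complex \<Rightarrow> complex) = (\<lambda>z. indicator (\<Union>i<n. A i) z + indicator (A n) z)"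
      proof
        fix z
        have "A n \<inter> A i = {}" if "i < n" for i
          using disjoint_family_onD[OF union.hyps(1) UNIV_I UNIV_I, of n i] that by simp
        then have "A n \<inter> (\<Union>i<n. A i) = {}" by blast
        then show "(indicator (\<Union>i<Suc n. A i) z :: complex) = indicator (\<Union>i<n. A i) z + indicator (A n) z"
          by (auto simp: indicator_def lessThan_Suc)
      qed
      then show ?case using trig_approx_add[OF Suc union.IH[of n]] by simp
    qed
    have lim: "(\<lambda>n. L2_dist_sq (\<mu> \<phi>) (indicator (\<Union>i. A i)) (indicator (\<Union>i<n. A i))) \<longlonglongrightarrow> 0" for \<phi>
    proof -
      have "(\<lambda>n. \<integral>z. (cmod (indicator (\<Union>i. A i) z - indicator (\<Union>i<n. A i) z))\<^sup>2 \<partial>\<mu> \<phi>) \<longlonglongrightarrow> (\<integral>z. 0 \<partial>\<mu> \<phi>)"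
      proof (rule integral_dominated_convergence[where w = "\<lambda>_. 1"])
        show "AE z in \<mu> \<phi>. (\<lambda>n. (cmod (indicator (\<Union>i. A i) z - indicator (\<Union>i<n. A i) z))\<^sup>2) \<longlonglongrightarrow> 0"
        proof (rule AE_I2)
          fix z
          show "(\<lambda>n. (cmod (indicator (\<Union>i. A i) z - indicator (\<Union>i<n. A i) z))\<^sup>2) \<longlonglongrightarrow> 0"
          proof (cases "z \<in> (\<Union>i. A i)")
            case True
            then obtain i where "z \<in> A i" by blast
            then have "n > i \<Longrightarrow> z \<in> (\<Union>i<n. A i)" for n by auto
            then show ?thesis using True
              by (intro tendsto_eventually) (auto simp: eventually_sequentially intro!: exI[of _ "Suc i"])
          next
            case False
            then show ?thesis by (simp add: indicator_def)
          qed
        qed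
      qed (auto simp: indicator_def integrable_\<mu> circle_bounded_const)
      then show ?thesis by (simp add: L2_dist_sq_def)
    qed
    show ?case
    proof (rule trig_approx_limit)
      show "circle_bounded (indicator (\<Union>i. A i) :: complex \<Rightarrow> complex)"
        by (rule circle_bounded_indicator) simp
      fix e :: real assume "e > 0"
      then have "\<forall>\<^sub>F n in sequentially. \<forall>\<phi>\<in>F. L2_dist_sq (\<mu> \<phi>) (indicator (\<Union>i. A i)) (indicator (\<Union>i<n. A i)) < e"
        using lim by (intro eventually_ball_finite F ballI order_tendstoD(2)) auto
      then obtain n where "\<forall>\<phi>\<in>F. L2_dist_sq (\<mu> \<phi>) (indicator (\<Union>i. A i)) (indicator (\<Union>i<n. A i)) < e"
        by (auto simp: eventually_sequentially)
      then show "\<exists>g'. trig_approx F g' \<and> (\<forall>\<phi>\<in>F. L2_dist_sq (\<mu> \<phi>) (indicator (\<Union>i. A i)) g' < e)"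
        using fin by blast
    qed
  qed
qed

end

section \<open>Spectral projections as limits of trigonometric polynomials\<close>

context unitary_operator
begin

text \<open>The vector 1_B(U) \<phi>, pinned down by its distance to all trigonometric approximants
  instead of by a chosen sequence; the 2 is the constant of
  \<open>L2_dist_sq_triangle\<close>.\<close>

definition E :: "complex set \<Rightarrow> 'h \<Rightarrow> 'h" where
  "E B \<phi> = (SOME g. \<forall>h T. trig h T \<longrightarrow> (norm (g - T \<phi>))\<^sup>2 \<le> 2 * L2_dist_sq (\<mu> \<phi>) (indicator B) h)"

lemma trig_approx_sequence:
  assumes F: "finite F" and B: "B \<in> sets borel"
  shows "\<exists>h T. (\<forall>n::nat. trig (h n) (T n)) \<and> (\<forall>\<phi>\<in>F. (\<lambda>n. L2_dist_sq (\<mu> \<phi>) (indicator B) (h n)) \<longlonglongrightarrow> 0)"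
proof -
  have "\<exists>h T. trig h T \<and> (\<forall>\<phi>\<in>F. L2_dist_sq (\<mu> \<phi>) (indicator B) h < 1 / real (Suc n))" for n
    using trig_approx_indicator[OF F B] unfolding trig_approx_def by (metis of_nat_0_less_iff zero_less_Suc zero_less_divide_1_iff)
  then obtain h T where hT: "\<And>n. trig (h n) (T n)"
    "\<And>n \<phi>. \<phi> \<in> F \<Longrightarrow> L2_dist_sq (\<mu> \<phi>) (indicator B) (h n) < 1 / real (Suc n)" by metis
  have "(\<lambda>n. L2_dist_sq (\<mu> \<phi>) (indicator B) (h n)) \<longlonglongrightarrow> 0" if "\<phi> \<in> F" for \<phi>
  proof (rule tendsto_sandwich[where f = "\<lambda>_. 0" and h = "\<lambda>n. 1 / real (Suc n)"])
    show "(\<lambda>n. 1 / real (Suc n)) \<longlonglongrightarrow> 0"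
      by (rule filterlim_compose[OF lim_const_over_n filterlim_Suc])
  qed (use hT(2)[OF that] in \<open>auto simp: L2_dist_sq_nonneg less_imp_le\<close>)
  then show ?thesis using hT(1) by blast
qed

text \<open>By \<open>trig_dist\<close>, polynomials converging to the indicator in L2 yield a
  Cauchy sequence \<open>T n \<phi>\<close>; the inequality holds for its members up to a vanishing
  term and passes to the limit.\<close>

lemma E_approx_exists:
  assumes B: "B \<in> sets borel"
  shows "\<exists>g. \<forall>h T. trig h T \<longrightarrow> (norm (g - T \<phi>))\<^sup>2 \<le> 2 * L2_dist_sq (\<mu> \<phi>) (indicator B) h"
proof -
  let ?I = "indicator B :: complex \<Rightarrow> complex"
  have cb: "circle_bounded ?I" by (rule circle_bounded_indicator[OF B])
  obtain h T where hT: "\<And>n::nat. trig (h n) (T n)"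
    and lim: "(\<lambda>n. L2_dist_sq (\<mu> \<phi>) ?I (h n)) \<longlonglongrightarrow> 0"
    using trig_approx_sequence[of "{\<phi>}", OF _ B] by auto
  have le: "(norm (T n \<phi> - S \<phi>))\<^sup>2 \<le> 2 * L2_dist_sq (\<mu> \<phi>) ?I (h n) + 2 * L2_dist_sq (\<mu> \<phi>) ?I k"
    if "trig k S" for n k S
    using L2_dist_sq_triangle[OF circle_measure_\<mu> trig_bounded[OF hT] cb trig_bounded[OF that]]
    unfolding trig_dist[OF hT that, symmetric] by (metis L2_dist_sq_commute)
  have "Cauchy (\<lambda>n. T n \<phi>)"
  proof (rule CauchyI)
    fix e :: real assume "e > 0"
    then have "\<forall>\<^sub>F n in sequentially. L2_dist_sq (\<mu> \<phi>) ?I (h n) < e\<^sup>2 / 4"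
      using lim by (intro order_tendstoD(2)) auto
    then obtain N where N: "\<And>n. n \<ge> N \<Longrightarrow> L2_dist_sq (\<mu> \<phi>) ?I (h n) < e\<^sup>2 / 4"
      by (auto simp: eventually_sequentially)
    have "norm (T m \<phi> - T n \<phi>) < e" if "m \<ge> N" "n \<ge> N" for m n
    proof -
      have "(norm (T m \<phi> - T n \<phi>))\<^sup>2 < e\<^sup>2"
        using le[OF hT, of m n] N[OF that(1)] N[OF that(2)] by simp
      then show ?thesis using \<open>e > 0\<close> by (simp add: power_less_imp_less_base)
    qed
    then show "\<exists>M. \<forall>m\<ge>M. \<forall>n\<ge>M. norm (T m \<phi> - T n \<phi>) < e" by blast
  qed
  then obtain g where g: "(\<lambda>n. T n \<phi>) \<longlonglongrightarrow> g" using Cauchy_convergent_iff convergent_def by blast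
  have "(norm (g - S \<phi>))\<^sup>2 \<le> 2 * L2_dist_sq (\<mu> \<phi>) ?I k" if "trig k S" for k S
  proof (rule LIMSEQ_le)
    show "(\<lambda>n. (norm (T n \<phi> - S \<phi>))\<^sup>2) \<longlonglongrightarrow> (norm (g - S \<phi>))\<^sup>2"
      by (intro tendsto_intros g)
    show "(\<lambda>n. 2 * L2_dist_sq (\<mu> \<phi>) ?I (h n) + 2 * L2_dist_sq (\<mu> \<phi>) ?I k) \<longlonglongrightarrow> 2 * L2_dist_sq (\<mu> \<phi>) ?I k"
      using tendsto_add[OF tendsto_mult[OF tendsto_const[of 2] lim] tendsto_const[of "2 * L2_dist_sq (\<mu> \<phi>) ?I k"]]
      by simp
  qed (use le[OF that] in blast)
  then show ?thesis by blast
qed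

lemma E_approx:
  assumes "B \<in> sets borel" "trig h T"
  shows "(norm (E B \<phi> - T \<phi>))\<^sup>2 \<le> 2 * L2_dist_sq (\<mu> \<phi>) (indicator B) h"
  using someI_ex[OF E_approx_exists[OF assms(1), of \<phi>]] assms(2) unfolding E_def by blast

lemma E_sequence:
  assumes F: "finite F" and B: "B \<in> sets borel"
  shows "\<exists>h T. (\<forall>n::nat. trig (h n) (T n)) \<and> (\<forall>\<phi>\<in>F.
    (\<lambda>n. L2_dist_sq (\<mu> \<phi>) (indicator B) (h n)) \<longlonglongrightarrow> 0 \<and> (\<lambda>n. T n \<phi>) \<longlonglongrightarrow> E B \<phi>)"
proof -
  obtain h T where hT: "\<And>n::nat. trig (h n) (T n)"
    and lim: "\<forall>\<phi>\<in>F. (\<lambda>n. L2_dist_sq (\<mu> \<phi>) (indicator B) (h n)) \<longlonglongrightarrow> 0"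
    using trig_approx_sequence[OF F B] by blast
  have "(\<lambda>n. T n \<phi>) \<longlonglongrightarrow> E B \<phi>" if "\<phi> \<in> F" for \<phi>
  proof -
    have "(\<lambda>n. (norm (E B \<phi> - T n \<phi>))\<^sup>2) \<longlonglongrightarrow> 0"
    proof (rule tendsto_sandwich[where f = "\<lambda>_. 0" and h = "\<lambda>n. 2 * L2_dist_sq (\<mu> \<phi>) (indicator B) (h n)"])
      show "(\<lambda>n. 2 * L2_dist_sq (\<mu> \<phi>) (indicator B) (h n)) \<longlonglongrightarrow> 0"
        using tendsto_mult[OF tendsto_const[of 2] lim[rule_format, OF that]] by simp
    qed (use E_approx[OF B hT] in auto)
    then have "(\<lambda>n. norm (E B \<phi> - T n \<phi>)) \<longlonglongrightarrow> 0"
      using tendsto_real_sqrt by fastforce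
    then show ?thesis
      by (simp add: LIM_zero_iff norm_minus_commute tendsto_norm_zero_iff)
  qed
  then show ?thesis using hT lim by blast
qed

lemma E_linear:
  assumes B: "B \<in> sets borel" shows "complex_linear (E B)"
  unfolding complex_linear_def
proof (intro conjI allI)
  fix x y
  obtain h T where hT': "\<forall>n::nat. trig (h n) (T n)"
    and lim': "\<forall>\<phi>\<in>{x, y, x + y}. (\<lambda>n. T n \<phi>) \<longlonglongrightarrow> E B \<phi>"
    using E_sequence[of "{x, y, x + y}", OF _ B] by blast
  note hT = hT'[rule_format] and lim = lim'[rule_format]
  have "(\<lambda>n. T n (x + y)) \<longlonglongrightarrow> E B x + E B y"
    using tendsto_add[OF lim[of x] lim[of y]] by (simp add: complex_linear_add[OF trig_linear[OF hT]])
  then show "E B (x + y) = E B x + E B y" using lim[of "x + y"] LIMSEQ_unique by blast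
next
  fix c x
  obtain h T where hT': "\<forall>n::nat. trig (h n) (T n)"
    and lim': "\<forall>\<phi>\<in>{x, c *\<^sub>C x}. (\<lambda>n. T n \<phi>) \<longlonglongrightarrow> E B \<phi>"
    using E_sequence[of "{x, c *\<^sub>C x}", OF _ B] by blast
  note hT = hT'[rule_format] and lim = lim'[rule_format]
  have "(\<lambda>n. T n (c *\<^sub>C x)) \<longlonglongrightarrow> c *\<^sub>C E B x"
    using scaleC.tendsto[OF tendsto_const lim[of x]] by (simp add: complex_linear_scaleC[OF trig_linear[OF hT]])
  then show "E B (c *\<^sub>C x) = c *\<^sub>C E B x" using lim[of "c *\<^sub>C x"] LIMSEQ_unique by blast
qed

text \<open>A bounded weight w may be inserted because convergence in \<open>L\<^sub>2\<close> of a finite measure implies convergence in \<open>L\<^sub>1\<close>.\<close>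

lemma weighted_limits:
  assumes B: "B \<in> sets borel" and h: "\<And>n::nat. circle_bounded (h n)" and w: "circle_bounded w"
    and lim: "(\<lambda>n. L2_dist_sq (\<mu> \<phi>) (indicator B) (h n)) \<longlonglongrightarrow> 0"
  shows "(\<lambda>n. \<integral>z. w z * h n z \<partial>\<mu> \<phi>) \<longlonglongrightarrow> (\<integral>z. w z * indicator B z \<partial>\<mu> \<phi>)"
    and "(\<lambda>n. \<integral>z. w z * of_real ((cmod (h n z))\<^sup>2) \<partial>\<mu> \<phi>) \<longlonglongrightarrow> (\<integral>z. w z * indicator B z \<partial>\<mu> \<phi>)"
proof -
  let ?I = "indicator B :: complex \<Rightarrow> complex"
  have cb: "circle_bounded ?I" by (rule circle_bounded_indicator[OF B])
  obtain W0 where W0: "\<forall>z. cmod z = 1 \<longrightarrow> cmod (w z) \<le> W0" using circle_bounded_bound[OF w] ..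
  define W where "W = \<bar>W0\<bar>"
  have W: "W \<ge> 0" "cmod z = 1 \<Longrightarrow> cmod (w z) \<le> W" for z using W0[rule_format, of z] by (auto simp: W_def)
  define d where "d n = L2_dist_sq (\<mu> \<phi>) ?I (h n)" for n
  define m where "m = measure (\<mu> \<phi>) UNIV"
  have L1: "(\<lambda>n. \<integral>z. cmod (?I z - h n z) \<partial>\<mu> \<phi>) \<longlonglongrightarrow> 0"
  proof (rule LIMSEQ_I)
    fix e :: real assume "e > 0"
    \<comment> \<open>From t <= \<delta> + t^2 / \<delta>, with \<delta> times the total mass below
      e / 2, a small L2 norm bounds the L1 norm.\<close>
    define \<delta> where "\<delta> = e / (2 * (m + 1))"
    have "m \<ge> 0" by (simp add: m_def)
    then have \<delta>: "\<delta> > 0" "\<delta> * m < e / 2 + 0" using \<open>e > 0\<close> by (auto simp: \<delta>_def field_simps)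
    have bound: "(\<integral>z. cmod (?I z - h n z) \<partial>\<mu> \<phi>) \<le> \<delta> * m + d n / \<delta>" for n
    proof -
      have "(\<integral>z. cmod (?I z - h n z) \<partial>\<mu> \<phi>) \<le> (\<integral>z. \<delta> + (cmod (?I z - h n z))\<^sup>2 * (1 / \<delta>) \<partial>\<mu> \<phi>)"
      proof (rule integral_mono)
        show "cmod (?I z - h n z) \<le> \<delta> + (cmod (?I z - h n z))\<^sup>2 * (1 / \<delta>)" for z
        proof -
          have "2 * (\<delta> * cmod (?I z - h n z)) \<le> \<delta>\<^sup>2 + (cmod (?I z - h n z))\<^sup>2"
            using sum_squares_bound[of \<delta> "cmod (?I z - h n z)"] by simp
          then have "\<delta> * cmod (?I z - h n z) \<le> \<delta>\<^sup>2 + (cmod (?I z - h n z))\<^sup>2"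
            using mult_nonneg_nonneg[OF less_imp_le[OF \<delta>(1)] norm_ge_zero[of "?I z - h n z"]] by linarith
          then show ?thesis using \<delta>(1) by (simp add: field_simps power2_eq_square)
        qed
      qed (intro integrable_\<mu> circle_bounded_intros cb h)+
      also have "\<dots> = \<delta> * m + d n / \<delta>"
        by (subst Bochner_Integration.integral_add, (intro integrable_\<mu> circle_bounded_intros cb h)+)
          (simp add: d_def L2_dist_sq_def m_def)
      finally show ?thesis .
    qed
    have "\<forall>\<^sub>F n in sequentially. d n < \<delta> * (e / 2)"
      using lim \<delta>(1) \<open>e > 0\<close> unfolding d_def by (intro order_tendstoD(2)) auto
    then obtain N where N: "\<And>n. n \<ge> N \<Longrightarrow> d n < \<delta> * (e / 2)" by (auto simp: eventually_sequentially)
    have "norm ((\<integral>z. cmod (?I z - h n z) \<partial>\<mu> \<phi>) - 0) < e" if "n \<ge> N" for n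
    proof -
      have "d n / \<delta> < e / 2" using N[OF that] \<delta>(1) by (simp add: field_simps)
      moreover have nn: "0 \<le> (\<integral>z. cmod (?I z - h n z) \<partial>\<mu> \<phi>)"
        by (rule Bochner_Integration.integral_nonneg) simp
      ultimately show ?thesis
        using bound[of n] \<delta>(2) unfolding diff_0_right real_norm_def abs_of_nonneg[OF nn] by linarith
    qed
    then show "\<exists>N. \<forall>n\<ge>N. norm ((\<integral>z. cmod (?I z - h n z) \<partial>\<mu> \<phi>) - 0) < e" by blast
  qed
  show "(\<lambda>n. \<integral>z. w z * h n z \<partial>\<mu> \<phi>) \<longlonglongrightarrow> (\<integral>z. w z * ?I z \<partial>\<mu> \<phi>)"
  proof (rule LIM_zero_cancel, rule Lim_null_comparison)
    show "\<forall>\<^sub>F n in sequentially. norm ((\<integral>z. w z * h n z \<partial>\<mu> \<phi>) - (\<integral>z. w z * ?I z \<partial>\<mu> \<phi>))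
        \<le> W * (\<integral>z. cmod (?I z - h n z) \<partial>\<mu> \<phi>)"
    proof (rule always_eventually, rule allI)
      fix n
      have "(\<integral>z. w z * h n z \<partial>\<mu> \<phi>) - (\<integral>z. w z * ?I z \<partial>\<mu> \<phi>) = (\<integral>z. w z * (h n z - ?I z) \<partial>\<mu> \<phi>)"
        by (subst Bochner_Integration.integral_diff[symmetric])
          (auto intro!: integrable_\<mu> circle_bounded_intros cb h w simp: right_diff_distrib)
      also have "norm \<dots> \<le> (\<integral>z. norm (w z * (h n z - ?I z)) \<partial>\<mu> \<phi>)"
        by (rule integral_norm_bound)
      also have "\<dots> \<le> (\<integral>z. W * cmod (?I z - h n z) \<partial>\<mu> \<phi>)"
      proof (rule integral_mono_AE)
        show "AE z in \<mu> \<phi>. norm (w z * (h n z - ?I z)) \<le> W * cmod (?I z - h n z)"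
          using AE_\<mu>[of \<phi>] by eventually_elim (auto simp: norm_mult norm_minus_commute intro!: mult_right_mono W)
      qed (intro integrable_\<mu> circle_bounded_intros cb h w)+
      finally show "norm ((\<integral>z. w z * h n z \<partial>\<mu> \<phi>) - (\<integral>z. w z * ?I z \<partial>\<mu> \<phi>))
        \<le> W * (\<integral>z. cmod (?I z - h n z) \<partial>\<mu> \<phi>)" by simp
    qed
    show "(\<lambda>n. W * (\<integral>z. cmod (?I z - h n z) \<partial>\<mu> \<phi>)) \<longlonglongrightarrow> 0"
      using tendsto_mult[OF tendsto_const[of W] L1] by simp
  qed
  show "(\<lambda>n. \<integral>z. w z * of_real ((cmod (h n z))\<^sup>2) \<partial>\<mu> \<phi>) \<longlonglongrightarrow> (\<integral>z. w z * ?I z \<partial>\<mu> \<phi>)"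
  proof (rule LIM_zero_cancel, rule Lim_null_comparison)
    show "\<forall>\<^sub>F n in sequentially. norm ((\<integral>z. w z * of_real ((cmod (h n z))\<^sup>2) \<partial>\<mu> \<phi>) - (\<integral>z. w z * ?I z \<partial>\<mu> \<phi>))
        \<le> W * (2 * (\<integral>z. cmod (?I z - h n z) \<partial>\<mu> \<phi>) + d n)"
    proof (rule always_eventually, rule allI)
      fix n
      have "(\<integral>z. w z * of_real ((cmod (h n z))\<^sup>2) \<partial>\<mu> \<phi>) - (\<integral>z. w z * ?I z \<partial>\<mu> \<phi>)
          = (\<integral>z. w z * (of_real ((cmod (h n z))\<^sup>2) - ?I z) \<partial>\<mu> \<phi>)"
        by (subst Bochner_Integration.integral_diff[symmetric])
          (auto intro!: integrable_\<mu> circle_bounded_intros cb h w simp: right_diff_distrib simp del: of_real_power)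
      also have "norm \<dots> \<le> (\<integral>z. norm (w z * (of_real ((cmod (h n z))\<^sup>2) - ?I z)) \<partial>\<mu> \<phi>)"
        by (rule integral_norm_bound)
      also have "\<dots> \<le> (\<integral>z. W * (2 * cmod (?I z - h n z) + (cmod (?I z - h n z))\<^sup>2) \<partial>\<mu> \<phi>)"
      proof (rule integral_mono_AE)
        \<comment> \<open>On \<open>B\<close>, with t = |1 - x|, the difference |x|^2 - 1 factors
          into (|x| - 1)(|x| + 1) and is at most t (t + 2) in modulus; off \<open>B\<close> it is
          |x|^2 itself.\<close>
        have sq: "cmod (of_real ((cmod x)\<^sup>2) - ?I z) \<le> 2 * cmod (?I z - x) + (cmod (?I z - x))\<^sup>2" for x z
        proof (cases "z \<in> B")
          case True
          define t where "t = cmod (1 - x)"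
          have t: "\<bar>cmod x - 1\<bar> \<le> t"
            using norm_triangle_ineq3[of x 1] by (simp add: t_def norm_minus_commute)
          have "\<bar>(cmod x)\<^sup>2 - 1\<bar> = \<bar>cmod x - 1\<bar> * (cmod x + 1)"
            by (simp add: power2_eq_square square_diff_one_factored abs_mult mult.commute)
          also have "\<dots> \<le> t * (t + 2)" using t by (intro mult_mono) auto
          finally have "\<bar>(cmod x)\<^sup>2 - 1\<bar> \<le> 2 * t + t\<^sup>2" by (simp add: algebra_simps power2_eq_square)
          moreover have "cmod (of_real ((cmod x)\<^sup>2) - 1) = \<bar>(cmod x)\<^sup>2 - 1\<bar>"
            using norm_of_real[of "(cmod x)\<^sup>2 - 1", where 'a = complex] by (simp only: of_real_diff of_real_1)
          ultimately show ?thesis using True by (simp add: t_def)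
        qed (simp add: norm_power)
        show "AE z in \<mu> \<phi>. norm (w z * (of_real ((cmod (h n z))\<^sup>2) - ?I z)) \<le>
            W * (2 * cmod (?I z - h n z) + (cmod (?I z - h n z))\<^sup>2)"
          using AE_\<mu>[of \<phi>] unfolding norm_mult
          by eventually_elim (rule mult_mono, auto intro: W sq simp del: of_real_power)
      qed (intro integrable_\<mu> circle_bounded_intros cb h w)+
      also have "\<dots> = W * (2 * (\<integral>z. cmod (?I z - h n z) \<partial>\<mu> \<phi>) + d n)"
        by (subst integral_mult_right_zero, subst Bochner_Integration.integral_add,
            (intro integrable_\<mu> circle_bounded_intros cb h)+) (simp add: d_def L2_dist_sq_def)
      finally show "norm ((\<integral>z. w z * of_real ((cmod (h n z))\<^sup>2) \<partial>\<mu> \<phi>) - (\<integral>z. w z * ?I z \<partial>\<mu> \<phi>))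
        \<le> W * (2 * (\<integral>z. cmod (?I z - h n z) \<partial>\<mu> \<phi>) + d n)" .
    qed
    have "(\<lambda>n. W * (2 * (\<integral>z. cmod (?I z - h n z) \<partial>\<mu> \<phi>) + d n)) \<longlonglongrightarrow> W * (2 * 0 + 0)"
      unfolding d_def by (intro tendsto_intros L1 lim)
    then show "(\<lambda>n. W * (2 * (\<integral>z. cmod (?I z - h n z) \<partial>\<mu> \<phi>) + d n)) \<longlonglongrightarrow> 0" by simp
  qed
qed

lemma integral_indicator_complex:
  assumes "B \<in> sets borel" shows "(\<integral>z. indicator B z \<partial>\<mu> \<phi>) = complex_of_real (measure (\<mu> \<phi>) B)"
proof -
  have "(\<integral>z. indicator B z \<partial>\<mu> \<phi>) = (\<integral>z. complex_of_real (indicator B z) \<partial>\<mu> \<phi>)"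
    by (intro Bochner_Integration.integral_cong) (auto simp: indicator_def)
  then show ?thesis using assms by (simp only: integral_complex_of_real) simp
qed

lemma E_quadratic:
  assumes B: "B \<in> sets borel" shows "cinner (E B \<phi>) \<phi> = of_real (measure (\<mu> \<phi>) B)"
proof -
  obtain h T where hT': "\<forall>n::nat. trig (h n) (T n)"
    and lim: "(\<lambda>n. L2_dist_sq (\<mu> \<phi>) (indicator B) (h n)) \<longlonglongrightarrow> 0" "(\<lambda>n. T n \<phi>) \<longlonglongrightarrow> E B \<phi>"
    using E_sequence[of "{\<phi>}", OF _ B] by blast
  note hT = hT'[rule_format]
  have "(\<lambda>n. \<integral>z. h n z \<partial>\<mu> \<phi>) \<longlonglongrightarrow> (\<integral>z. indicator B z \<partial>\<mu> \<phi>)"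
    using weighted_limits(1)[OF B trig_bounded[OF hT] circle_bounded_const[of 1] lim(1)] by simp
  moreover note integral_indicator_complex[OF B, of \<phi>]
  moreover have "(\<lambda>n. \<integral>z. h n z \<partial>\<mu> \<phi>) \<longlonglongrightarrow> cinner (E B \<phi>) \<phi>"
    unfolding trig_integral[OF hT] by (intro cinner.tendsto lim tendsto_const)
  ultimately show ?thesis using LIMSEQ_unique by metis
qed

text \<open>Describes the measure of \<open>S \<phi>\<close> through that of \<phi>: applying k(U)
  to the vector multiplies the density by |k|^2.\<close>

lemma E_weighted_norm:
  assumes B: "B \<in> sets borel" and k: "trig k S"
  shows "complex_of_real ((norm (E B (S \<phi>)))\<^sup>2) = (\<integral>z. complex_of_real ((cmod (k z))\<^sup>2) * indicator B z \<partial>\<mu> \<phi>)"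
proof -
  obtain h T where hT': "\<forall>n::nat. trig (h n) (T n)"
    and lim: "(\<lambda>n. L2_dist_sq (\<mu> \<phi>) (indicator B) (h n)) \<longlonglongrightarrow> 0" "(\<lambda>n. T n (S \<phi>)) \<longlonglongrightarrow> E B (S \<phi>)"
    using E_sequence[of "{\<phi>, S \<phi>}", OF _ B] by blast
  note hT = hT'[rule_format]
  have l1: "(\<lambda>n. \<integral>z. complex_of_real ((cmod (k z))\<^sup>2) * of_real ((cmod (h n z))\<^sup>2) \<partial>\<mu> \<phi>)
      \<longlonglongrightarrow> (\<integral>z. complex_of_real ((cmod (k z))\<^sup>2) * indicator B z \<partial>\<mu> \<phi>)"
    by (rule weighted_limits(2)[OF B trig_bounded[OF hT] _ lim(1)])
      (intro circle_bounded_intros trig_bounded[OF k])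
  have eq: "(\<integral>z. complex_of_real ((cmod (k z))\<^sup>2) * of_real ((cmod (h n z))\<^sup>2) \<partial>\<mu> \<phi>)
      = complex_of_real ((norm (T n (S \<phi>)))\<^sup>2)" for n
  proof -
    have "(\<integral>z. complex_of_real ((cmod (k z))\<^sup>2) * of_real ((cmod (h n z))\<^sup>2) \<partial>\<mu> \<phi>)
        = (\<integral>z. complex_of_real ((cmod (h n z * k z))\<^sup>2) \<partial>\<mu> \<phi>)"
      by (simp add: norm_mult power_mult_distrib mult.commute)
    then show ?thesis
      using trig_norm[OF trig_mult[OF hT[of n] k], of \<phi>] by (simp only: integral_complex_of_real)
  qed
  have "(\<lambda>n. complex_of_real ((norm (T n (S \<phi>)))\<^sup>2)) \<longlonglongrightarrow> of_real ((norm (E B (S \<phi>)))\<^sup>2)"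
    by (intro tendsto_intros lim(2))
  then show ?thesis using l1 unfolding eq by (rule LIMSEQ_unique)
qed

lemma E_norm:
  assumes B: "B \<in> sets borel" shows "(norm (E B \<phi>))\<^sup>2 = measure (\<mu> \<phi>) B"
proof -
  have "complex_of_real ((norm (E B \<phi>))\<^sup>2) = of_real (measure (\<mu> \<phi>) B)"
    using E_weighted_norm[OF B trig.one, of \<phi>] integral_indicator_complex[OF B, of \<phi>] by simp
  then show ?thesis using of_real_eq_iff by blast
qed

end

context unitary_operator
begin

lemma E_symmetric:
  assumes B: "B \<in> sets borel" shows "cinner (E B x) y = cinner x (E B y)"
proof -
  have q: "cinner (E B z) z = cinner z (E B z)" for z
    using E_quadratic[OF B, of z] cinner_commute[of z "E B z"] by simp
  have "4 * cinner (E B x) y = 4 * cinner x (E B y)"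
    unfolding cinner_polarization[OF E_linear[OF B] complex_linear_id] q
    by (rule cinner_polarization[OF complex_linear_id E_linear[OF B], symmetric])
  then show ?thesis by simp
qed

text \<open>Both sides are linear with the same quadratic form: symmetry turns that of the square
  into \<open>(norm (E B x))\<^sup>2\<close>, which is \<open>measure (\<mu> x) B\<close>.\<close>

lemma E_idem:
  assumes B: "B \<in> sets borel" shows "E B (E B \<phi>) = E B \<phi>"
proof -
  have "(\<lambda>\<phi>. E B (E B \<phi>)) = E B"
  proof (rule complex_linear_eqI)
    show "complex_linear (\<lambda>\<phi>. E B (E B \<phi>))"
      using E_linear[OF B] by (simp add: complex_linear_def)
    show "cinner (E B (E B x)) x = cinner (E B x) x" for x
      unfolding E_symmetric[OF B, of "E B x"] cinner_self E_norm[OF B] E_quadratic[OF B] by (rule refl)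
  qed (rule E_linear[OF B])
  then show ?thesis by (rule fun_cong)
qed

lemma E_UNIV: "E UNIV \<phi> = \<phi>"
proof -
  have "measure (\<mu> x) UNIV = (norm x)\<^sup>2" for x
    using moment_\<mu>[where k = 0 and \<phi> = x] by (simp add: cinner_self scaleR_conv_of_real flip: of_real_power)
  then have "E UNIV = (\<lambda>\<phi>. \<phi>)"
    by (intro complex_linear_eqI E_linear complex_linear_id) (simp_all add: E_quadratic cinner_self)
  then show ?thesis by simp
qed

lemma E_union:
  assumes B: "B \<in> sets borel" "C \<in> sets borel" "B \<inter> C = {}"
  shows "E (B \<union> C) \<phi> = E B \<phi> + E C \<phi>"
proof -
  have "E (B \<union> C) = (\<lambda>\<phi>. E B \<phi> + E C \<phi>)"
  proof (rule complex_linear_eqI)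
    show "complex_linear (\<lambda>\<phi>. E B \<phi> + E C \<phi>)"
      using E_linear[OF B(1)] E_linear[OF B(2)] by (simp add: complex_linear_def scaleC_add_right)
    show "cinner (E (B \<union> C) x) x = cinner (E B x + E C x) x" for x
      using \<mu>.finite_measure_Union[of B x C] B by (simp add: cinner.add_left E_quadratic)
  qed (use B in \<open>simp add: E_linear\<close>)
  then show ?thesis by (rule fun_cong)
qed

text \<open>The squared norm of the remainder is the measure of the part of the union not yet
  covered, which tends to 0.\<close>

lemma E_sums:
  fixes B :: "nat \<Rightarrow> complex set"
  assumes B: "range B \<subseteq> sets borel" and dis: "disjoint_family B"
  shows "(\<lambda>i. E (B i) \<phi>) sums E (\<Union>i. B i) \<phi>"
proof -
  have Bm [measurable]: "B i \<in> sets borel" for i using B by blast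
  define P where "P n = (\<Union>i<n. B i)" for n
  have Pm [measurable]: "P n \<in> sets borel" for n unfolding P_def by measurable
  define R where "R = (\<Union>i. B i)"
  have Rm [measurable]: "R \<in> sets borel" unfolding R_def by measurable
  have PR: "P n \<subseteq> R" for n by (auto simp: P_def R_def)
  have part: "(\<Sum>i<n. E (B i) \<phi>) = E (P n) \<phi>" for n
  proof (induction n)
    case 0
    have "(norm (E {} \<phi>))\<^sup>2 = 0" by (simp add: E_norm)
    then show ?case by (simp add: P_def)
  next
    case (Suc n)
    have "B n \<inter> B i = {}" if "i < n" for i
      using disjoint_family_onD[OF dis UNIV_I UNIV_I, of n i] that by simp
    then have "P n \<inter> B n = {}" by (auto simp: P_def)
    moreover have "P (Suc n) = P n \<union> B n" by (auto simp: P_def lessThan_Suc)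
    ultimately show ?case using Suc E_union[of "P n" "B n" \<phi>] by simp
  qed
  have "(\<lambda>n. measure (\<mu> \<phi>) (P n)) \<longlonglongrightarrow> measure (\<mu> \<phi>) (\<Union>n. P n)"
    by (intro \<mu>.finite_Lim_measure_incseq incseq_SucI) (auto simp: P_def lessThan_Suc)
  moreover have "(\<Union>n. P n) = R" by (auto simp: P_def R_def)
  ultimately have "(\<lambda>n. measure (\<mu> \<phi>) R - measure (\<mu> \<phi>) (P n)) \<longlonglongrightarrow> measure (\<mu> \<phi>) R - measure (\<mu> \<phi>) R"
    by (intro tendsto_intros) simp
  moreover have "measure (\<mu> \<phi>) R - measure (\<mu> \<phi>) (P n) = (norm (E R \<phi> - E (P n) \<phi>))\<^sup>2" for n
  proof -
    have "E R \<phi> - E (P n) \<phi> = E (R - P n) \<phi>"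
      using E_union[of "P n" "R - P n" \<phi>] PR[of n] by (simp add: Un_absorb1)
    then show ?thesis using \<mu>.finite_measure_Diff[of R \<phi> "P n"] PR[of n] by (simp add: E_norm)
  qed
  ultimately have "(\<lambda>n. (norm (E R \<phi> - E (P n) \<phi>))\<^sup>2) \<longlonglongrightarrow> 0" by simp
  then have "(\<lambda>n. norm (E R \<phi> - E (P n) \<phi>)) \<longlonglongrightarrow> 0"
    using tendsto_real_sqrt by fastforce
  from tendsto_diff[OF tendsto_const[of "E R \<phi>"] tendsto_norm_zero_cancel[OF this]]
  have "(\<lambda>n. E (P n) \<phi>) \<longlonglongrightarrow> E R \<phi>" by simp
  then show ?thesis unfolding sums_def part R_def .
qed

lemma E_commute:
  assumes B: "B \<in> sets borel" shows "E B (U \<phi>) = U (E B \<phi>)"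
proof -
  obtain h T where hT': "\<forall>n::nat. trig (h n) (T n)"
    and lim: "(\<lambda>n. T n \<phi>) \<longlonglongrightarrow> E B \<phi>" "(\<lambda>n. T n (U \<phi>)) \<longlonglongrightarrow> E B (U \<phi>)"
    using E_sequence[of "{\<phi>, U \<phi>}", OF _ B] by blast
  note hT = hT'[rule_format]
  have "bounded_linear U"
    using complex_linear_linear[OF lin] iso
    by (intro bounded_linear_intro[where K = 1]) (auto simp: linear_add linear_scale)
  from bounded_linear.tendsto[OF this lim(1)]
  have "(\<lambda>n. T n (U \<phi>)) \<longlonglongrightarrow> U (E B \<phi>)" by (simp add: trig_commute[OF hT])
  then show ?thesis by (rule LIMSEQ_unique[OF lim(2)])
qed

lemma trig_power: "trig (\<lambda>z. z ^ k) (U ^^ k)"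
proof (induction k)
  case 0
  then show ?case using trig.one by (simp add: id_def)
next
  case (Suc k)
  then show ?case using trig.fwd[OF Suc] by (simp add: o_def)
qed

lemma trig_sum:
  assumes "\<And>j. j < (n::nat) \<Longrightarrow> \<exists>T. trig (h j) T"
  shows "\<exists>T. trig (\<lambda>z. \<Sum>j<n. h j z) T"
  using assms
proof (induction n)
  case 0
  then show ?case using trig.scale[OF trig.one, of 0] by auto
next
  case (Suc n)
  obtain T where "trig (\<lambda>z. \<Sum>j<n. h j z) T" using Suc by auto
  moreover obtain S where "trig (h n) S" using Suc.prems[of n] by auto
  ultimately show ?case using trig.add by (simp only: sum.lessThan_Suc) blast
qed

end

text \<open>The coordinate on the circle which is inverse to \<open>r \<mapsto> (r - \<i>) / (r + \<i>)\<close>; the point 1, which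
  corresponds to infinity, is sent to the junk value 0.\<close>

definition circle_coord :: "complex \<Rightarrow> real" where
  "circle_coord z = - 2 * Im z / (cmod (1 - z))\<^sup>2"

lemma circle_coord_measurable [measurable]: "circle_coord \<in> borel_measurable borel"
proof -
  have "Im \<in> borel_measurable borel" by (intro borel_measurable_continuous_onI continuous_intros)
  then show ?thesis unfolding circle_coord_def by measurable
qed

context
  fixes z :: complex
  assumes z: "cmod z = 1"
begin

lemma circle_norm_one_minus: "(cmod (1 - z))\<^sup>2 = 2 - 2 * Re z"
proof -
  have "(Re z)\<^sup>2 + (Im z)\<^sup>2 = 1" using z cmod_power2[of z] by simp
  then show ?thesis unfolding cmod_power2 by (simp add: power2_eq_square algebra_simps)
qed

lemma circle_coord_times: "(cmod (1 - z))\<^sup>2 * circle_coord z = - 2 * Im z"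
  by (cases "z = 1") (auto simp: circle_coord_def)

text \<open>For z = (r - i) / (r + i) one has 1 - z = 2i / (r + i), so |1 - z|^2 = 4 / (r^2 +
  1).\<close>

lemma circle_coord_sq: "z \<noteq> 1 \<Longrightarrow> (cmod (1 - z))\<^sup>2 * ((circle_coord z)\<^sup>2 + 1) = 4"
proof -
  assume "z \<noteq> 1"
  define N where "N = (cmod (1 - z))\<^sup>2"
  have N: "N \<noteq> 0" using \<open>z \<noteq> 1\<close> by (simp add: N_def)
  have "(Re z)\<^sup>2 + (Im z)\<^sup>2 = 1" using z cmod_power2[of z] by simp
  then have "4 * (Im z)\<^sup>2 = N * (4 - N)"
    unfolding N_def circle_norm_one_minus by (simp add: power2_eq_square algebra_simps)
  moreover have "N * ((circle_coord z)\<^sup>2 + 1) = 4 * (Im z)\<^sup>2 / N + N"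
    using N by (simp add: circle_coord_def flip: N_def) (simp add: field_simps power2_eq_square)
  ultimately show "(cmod (1 - z))\<^sup>2 * ((circle_coord z)\<^sup>2 + 1) = 4"
    using N by (simp add: N_def)
qed

end

section \<open>From the circle to the real line\<close>

locale cayley_operator = unitary_operator U for U :: "'h::complex_hilbert_space \<Rightarrow> 'h" +
  assumes fixed: "U g = g \<Longrightarrow> g = 0"
begin

text \<open>At the point 1 the factor |1 - z|^2 vanishes, so \<open>E {1}\<close> annihilates \<phi>
  - U \<phi>; hence \<open>E {1} \<phi>\<close> is a fixed vector of \<open>U\<close>, that is, 0.
  The point that \<open>circle_coord\<close> sends to a junk value therefore carries no
  mass.\<close>

lemma \<mu>_one: "measure (\<mu> \<phi>) {1} = 0"
proof -
  have "of_real ((norm (E {1} (\<phi> - U \<phi>)))\<^sup>2) = (\<integral>z. complex_of_real ((cmod (1 - z * 1))\<^sup>2) * indicator {1} z \<partial>\<mu> \<phi>)"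
    using E_weighted_norm[OF _ trig_diff[OF trig.one trig.fwd[OF trig.one]], of "{1}" \<phi>] by simp
  also have "\<dots> = (\<integral>z. 0 \<partial>\<mu> \<phi>)"
    by (intro Bochner_Integration.integral_cong) (auto simp: indicator_def)
  finally have "E {1} (\<phi> - U \<phi>) = 0" by simp
  then have "U (E {1} \<phi>) = E {1} \<phi>"
    by (simp add: complex_linear_diff[OF E_linear] E_commute)
  then have "E {1} \<phi> = 0" by (rule fixed)
  then show ?thesis using E_norm[of "{1}" \<phi>] by simp
qed

lemma AE_ne_one: "AE z in \<mu> \<phi>. z \<noteq> 1"
proof (rule AE_I[of _ _ "{1}"])
  show "emeasure (\<mu> \<phi>) {1} = 0" using \<mu>_one[of \<phi>] by (simp add: \<mu>.emeasure_eq_measure)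
qed auto

text \<open>\<open>E_weighted_norm\<close> with k(z) = 1 - z. The vectors g - U g form the domain of
  the operator, and this density cancels the growth of \<open>circle_coord\<close> near 1.\<close>

lemma \<mu>_range: "\<mu> (g - U g) = density (\<mu> g) (\<lambda>z. ennreal ((cmod (1 - z))\<^sup>2))"
proof (rule measure_eqI)
  fix B assume "B \<in> sets (\<mu> (g - U g))"
  then have B [measurable]: "B \<in> sets borel" by simp
  have int: "integrable (\<mu> g) (\<lambda>z. (cmod (1 - z))\<^sup>2 * indicator B z)"
    by (intro integrable_\<mu> circle_bounded_intros B)
  have "complex_of_real (measure (\<mu> (g - U g)) B) = (\<integral>z. complex_of_real ((cmod (1 - z * 1))\<^sup>2) * indicator B z \<partial>\<mu> g)"
    using E_weighted_norm[OF B trig_diff[OF trig.one trig.fwd[OF trig.one]], of g] E_norm[OF B, of "g - U g"]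
    by simp
  also have "\<dots> = (\<integral>z. complex_of_real ((cmod (1 - z))\<^sup>2 * indicator B z) \<partial>\<mu> g)"
    by (intro Bochner_Integration.integral_cong) (auto simp: indicator_def)
  finally have "measure (\<mu> (g - U g)) B = (\<integral>z. (cmod (1 - z))\<^sup>2 * indicator B z \<partial>\<mu> g)"
    by (simp only: integral_complex_of_real of_real_eq_iff)
  then have "emeasure (\<mu> (g - U g)) B = (\<integral>\<^sup>+z. ennreal ((cmod (1 - z))\<^sup>2 * indicator B z) \<partial>\<mu> g)"
    using int by (simp add: \<mu>.emeasure_eq_measure nn_integral_eq_integral)
  also have "\<dots> = (\<integral>\<^sup>+z. ennreal ((cmod (1 - z))\<^sup>2) * indicator B z \<partial>\<mu> g)"
    by (intro nn_integral_cong) (auto simp: indicator_def)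
  finally show "emeasure (\<mu> (g - U g)) B = emeasure (density (\<mu> g) (\<lambda>z. ennreal ((cmod (1 - z))\<^sup>2))) B"
    by (simp add: emeasure_density)
qed simp

lemma integrable_coord_range: "integrable (\<mu> (g - U g)) (\<lambda>z. (circle_coord z)\<^sup>2)"
proof -
  have "circle_bounded (\<lambda>z. (cmod (1 - z))\<^sup>2 * (circle_coord z)\<^sup>2)"
  proof (rule circle_boundedI)
    fix z :: complex assume z: "cmod z = 1"
    have "(cmod (1 - z))\<^sup>2 * (circle_coord z)\<^sup>2 \<le> 4"
    proof (cases "z = 1")
      case False
      then show ?thesis using circle_coord_sq[OF z] by (simp add: distrib_left) (smt (verit) zero_le_power2)
    qed simp
    then show "norm ((cmod (1 - z))\<^sup>2 * (circle_coord z)\<^sup>2) \<le> 4" by simp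
  qed measurable
  then show ?thesis unfolding \<mu>_range by (subst integrable_density) (auto intro: integrable_\<mu>)
qed

text \<open>|1 - z|^2 times the coordinate is -2 Im z, whose integral is read off the first moment
  \<open>cinner (U g) g\<close>; expanding the right-hand side gives the same number because
  \<open>U\<close> is isometric.\<close>

lemma integral_coord_range:
  "(\<integral>z. complex_of_real (circle_coord z) \<partial>\<mu> (g - U g)) = cinner (\<i> *\<^sub>C (g + U g)) (g - U g)"
proof -
  have "(\<integral>z. complex_of_real (circle_coord z) \<partial>\<mu> (g - U g))
      = (\<integral>z. (cmod (1 - z))\<^sup>2 *\<^sub>R complex_of_real (circle_coord z) \<partial>\<mu> g)"
    unfolding \<mu>_range by (subst integral_density) auto
  also have "\<dots> = (\<integral>z. complex_of_real (- 2 * Im z) \<partial>\<mu> g)"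
  proof (rule integral_cong_AE)
    show "AE z in \<mu> g. (cmod (1 - z))\<^sup>2 *\<^sub>R complex_of_real (circle_coord z) = complex_of_real (- 2 * Im z)"
      using AE_\<mu>[of g]
    proof eventually_elim
      case (elim z)
      show ?case unfolding circle_coord_times[OF elim, symmetric] by (simp add: scaleR_conv_of_real)
    qed
  qed measurable
  also have "\<dots> = complex_of_real (\<integral>z. - 2 * Im z \<partial>\<mu> g)"
    by (rule integral_complex_of_real)
  also have "\<dots> = complex_of_real (- 2 * Im (\<integral>z. z ^ 1 \<partial>\<mu> g))"
    by (simp add: integrable_\<mu> circle_bounded_id flip: integral_Im)
  also have "\<dots> = of_real (- 2 * Im (cinner (U g) g))"
    unfolding moment_\<mu> by simp
  also have "\<dots> = cinner (\<i> *\<^sub>C (g + U g)) (g - U g)"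
    using cinner_commute[of g "U g"]
    by (simp add: cinner_scaleC_left cinner.add_left cinner.diff_right cinner_self iso complex_eq_iff)
  finally show ?thesis .
qed

text \<open>The hypothesis says that 1 / |1 - z|^2 is integrable, so formally g = (1 - U)^-1 \<phi>.
  The Cesaro means \<open>a n\<close> of the powers tend to 0 off the point 1, and 1 - a n = (1 - z)
  h n with a polynomial \<open>h n\<close>. Thus h_n(U) \<phi> is Cauchy, and its image under 1 - U
  tends to \<phi>.\<close>

lemma range_if_integrable:
  assumes "integrable (\<mu> \<phi>) (\<lambda>z. (circle_coord z)\<^sup>2)" shows "\<exists>g. \<phi> = g - U g"
proof -
  define a where "a n z = (\<Sum>j<Suc n. z ^ j) / of_nat (Suc n)" for n and z :: complex
  define N where "N z = (cmod (1 - z))\<^sup>2" for z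
  have am [measurable]: "a n \<in> borel_measurable borel" for n unfolding a_def by measurable
  have Nm [measurable]: "N \<in> borel_measurable borel" unfolding N_def by measurable
  define h where "h n z = (1 / of_nat (Suc n)) * (\<Sum>j<Suc n. \<Sum>k<j. z ^ k)" for n and z :: complex
  have "\<exists>T. trig (h n) T" for n
  proof -
    have "\<exists>T. trig (\<lambda>z. \<Sum>j<Suc n. \<Sum>k<j. z ^ k) T"
      by (rule trig_sum, rule trig_sum, rule exI, rule trig_power)
    then show ?thesis unfolding h_def using trig.scale by blast
  qed
  then obtain T where T: "trig (h n) (T n)" for n by metis
  \<comment> \<open>Each 1 - z^j is 1 - z times a geometric sum; averaging over \<open>j\<close>
    gives \<open>h n\<close>.\<close>
  have ha: "1 - a n z = h n z - z * h n z" for n z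
  proof -
    have "(1 - z) * (\<Sum>k<j. z ^ k) = 1 - z ^ j" for j using one_diff_power_eq[of z j] by simp
    then have "(1 - z) * (\<Sum>j<Suc n. \<Sum>k<j. z ^ k) = (\<Sum>j<Suc n. 1 - z ^ j)"
      by (simp only: sum_distrib_left)
    also have "\<dots> = of_nat (Suc n) - (\<Sum>j<Suc n. z ^ j)" by (simp only: sum_subtractf sum_constant) simp
    finally have "(1 - z) * (\<Sum>j<Suc n. \<Sum>k<j. z ^ k) = of_nat (Suc n) - (\<Sum>j<Suc n. z ^ j)" .
    then have "(1 - z) * h n z = (of_nat (Suc n) - (\<Sum>j<Suc n. z ^ j)) / of_nat (Suc n)"
      unfolding h_def by (simp only: mult.left_commute[of "1 - z"]) simp
    also have "\<dots> = 1 - a n z" unfolding a_def diff_divide_distrib by (simp del: of_nat_Suc sum.lessThan_Suc)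
    finally show ?thesis by (simp add: algebra_simps)
  qed
  have a1: "cmod (a n z) \<le> 1" if "cmod z = 1" for n z
  proof -
    have "cmod (\<Sum>j<Suc n. z ^ j) \<le> (\<Sum>j<Suc n. cmod (z ^ j))" by (rule norm_sum)
    also have "\<dots> = real (Suc n)" using that by (simp add: norm_power)
    finally show ?thesis unfolding a_def norm_divide norm_of_nat
      by (simp add: divide_le_eq del: of_nat_Suc sum.lessThan_Suc)
  qed
  have a0: "(\<lambda>n. a n z) \<longlonglongrightarrow> 0" if z: "cmod z = 1" "z \<noteq> 1" for z
  proof (rule Lim_null_comparison)
    show "(\<lambda>n. 2 / cmod (1 - z) / real (Suc n)) \<longlonglongrightarrow> 0"
      by (rule filterlim_compose[OF lim_const_over_n filterlim_Suc])
    show "\<forall>\<^sub>F n in sequentially. norm (a n z) \<le> 2 / cmod (1 - z) / real (Suc n)"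
    proof (rule always_eventually, rule allI)
      fix n
      have "(1 - z) * (\<Sum>j<Suc n. z ^ j) = 1 - z ^ Suc n" using one_diff_power_eq[of z "Suc n"] by simp
      then have "cmod (1 - z) * cmod (\<Sum>j<Suc n. z ^ j) = cmod (1 - z ^ Suc n)"
        by (metis norm_mult)
      also have "\<dots> \<le> 2" using norm_triangle_ineq4[of 1 "z ^ Suc n"] z by (simp add: norm_power norm_mult)
      finally have "cmod (\<Sum>j<Suc n. z ^ j) \<le> 2 / cmod (1 - z)"
        using z by (simp add: field_simps del: sum.lessThan_Suc)
      then show "norm (a n z) \<le> 2 / cmod (1 - z) / real (Suc n)"
        unfolding a_def norm_divide norm_of_nat by (intro divide_right_mono) auto
    qed
  qed
  have good: "AE z in \<mu> \<phi>. cmod z = 1 \<and> z \<noteq> 1" using AE_\<mu> AE_ne_one by eventually_elim simp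
  have N1: "1 / N z = ((circle_coord z)\<^sup>2 + 1) / 4" if "cmod z = 1" "z \<noteq> 1" for z
    using circle_coord_sq[OF that] that by (simp add: N_def field_simps)
  have intN: "integrable (\<mu> \<phi>) (\<lambda>z. 1 / N z)"
  proof (subst integrable_cong_AE)
    show "integrable (\<mu> \<phi>) (\<lambda>z. ((circle_coord z)\<^sup>2 + 1) / 4)"
      by (intro integrable_divide_zero Bochner_Integration.integrable_add assms integrable_\<mu> circle_bounded_const)
    show "AE z in \<mu> \<phi>. 1 / N z = ((circle_coord z)\<^sup>2 + 1) / 4"
      using good by eventually_elim (use N1 in blast)
  qed measurable
  define d where "d n = (\<integral>z. (cmod (a n z))\<^sup>2 / N z \<partial>\<mu> \<phi>)" for n
  have le1: "(cmod (a n z))\<^sup>2 \<le> 1" if "cmod z = 1" for n z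
    using a1[OF that] by (simp add: power_le_one)
  have intd: "integrable (\<mu> \<phi>) (\<lambda>z. (cmod (a n z))\<^sup>2 / N z)" for n
  proof (rule Bochner_Integration.integrable_bound[OF intN])
    show "AE z in \<mu> \<phi>. norm ((cmod (a n z))\<^sup>2 / N z) \<le> norm (1 / N z)"
      using good by eventually_elim (simp add: N_def divide_right_mono le1)
  qed measurable
  have d0: "d \<longlonglongrightarrow> 0"
  proof -
    have "d \<longlonglongrightarrow> (\<integral>z. 0 \<partial>\<mu> \<phi>)"
      unfolding d_def
    proof (rule integral_dominated_convergence[OF _ _ intN])
      show "AE z in \<mu> \<phi>. (\<lambda>n. (cmod (a n z))\<^sup>2 / N z) \<longlonglongrightarrow> 0"
        using good
      proof eventually_elim
        case (elim z)
        then have "(\<lambda>n. (cmod (a n z))\<^sup>2 / N z) \<longlonglongrightarrow> (cmod 0)\<^sup>2 / N z"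
          by (intro tendsto_intros a0) (auto simp: N_def)
        then show ?case by simp
      qed
      show "AE z in \<mu> \<phi>. norm ((cmod (a n z))\<^sup>2 / N z) \<le> 1 / N z" for n
        using good by eventually_elim (simp add: N_def divide_right_mono le1)
    qed measurable
    then show ?thesis by simp
  qed
  \<comment> \<open>(1 - z)(h n - h m) = a m - a n, so division by 1 - z costs exactly the
    integrable weight 1 / N.\<close>
  have bound: "(norm (T n \<phi> - T m \<phi>))\<^sup>2 \<le> 2 * d n + 2 * d m" for n m
  proof -
    have "(norm (T n \<phi> - T m \<phi>))\<^sup>2 = (\<integral>z. (cmod (h n z - h m z))\<^sup>2 \<partial>\<mu> \<phi>)"
      using trig_dist[OF T[of n] T[of m]] by (simp add: L2_dist_sq_def)
    also have "\<dots> \<le> (\<integral>z. 2 * ((cmod (a n z))\<^sup>2 / N z) + 2 * ((cmod (a m z))\<^sup>2 / N z) \<partial>\<mu> \<phi>)"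
    proof (rule integral_mono_AE)
      show "AE z in \<mu> \<phi>. (cmod (h n z - h m z))\<^sup>2 \<le> 2 * ((cmod (a n z))\<^sup>2 / N z) + 2 * ((cmod (a m z))\<^sup>2 / N z)"
        using good
      proof eventually_elim
        case (elim z)
        have "(1 - z) * (h n z - h m z) = (h n z - z * h n z) - (h m z - z * h m z)"
          by (simp add: algebra_simps)
        then have "(1 - z) * (h n z - h m z) = a m z + - a n z"
          unfolding ha[symmetric] by simp
        then have "N z * (cmod (h n z - h m z))\<^sup>2 = (cmod (a m z + - a n z))\<^sup>2"
          unfolding N_def by (metis norm_mult power_mult_distrib)
        also have "\<dots> \<le> 2 * (cmod (a m z))\<^sup>2 + 2 * (cmod (a n z))\<^sup>2"
          using norm_add_sq_le[of "a m z" "- a n z"] by simp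
        finally show ?case using elim by (simp add: N_def field_simps)
      qed
      show "integrable (\<mu> \<phi>) (\<lambda>z. (cmod (h n z - h m z))\<^sup>2)"
        by (intro integrable_\<mu> circle_bounded_intros trig_bounded[OF T])
    qed (intro Bochner_Integration.integrable_add integrable_mult_right intd)
    also have "\<dots> = 2 * d n + 2 * d m"
      unfolding d_def
      by (subst Bochner_Integration.integral_add, (intro integrable_mult_right intd)+) (simp only: integral_mult_right_zero)
    finally show ?thesis .
  qed
  have "Cauchy (\<lambda>n. T n \<phi>)"
  proof (rule CauchyI)
    fix e :: real assume "e > 0"
    then have "\<forall>\<^sub>F n in sequentially. d n < e\<^sup>2 / 4"
      using d0 by (intro order_tendstoD(2)) auto
    then obtain M where M: "\<And>n. n \<ge> M \<Longrightarrow> d n < e\<^sup>2 / 4"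
      by (auto simp: eventually_sequentially)
    have "norm (T m \<phi> - T n \<phi>) < e" if "m \<ge> M" "n \<ge> M" for m n
    proof -
      have "(norm (T m \<phi> - T n \<phi>))\<^sup>2 < e\<^sup>2"
        using bound[of m n] M[OF that(1)] M[OF that(2)] by simp
      then show ?thesis using \<open>e > 0\<close> by (simp add: power_less_imp_less_base)
    qed
    then show "\<exists>M. \<forall>m\<ge>M. \<forall>n\<ge>M. norm (T m \<phi> - T n \<phi>) < e" by blast
  qed
  then obtain g where g: "(\<lambda>n. T n \<phi>) \<longlonglongrightarrow> g" using Cauchy_convergent_iff convergent_def by blast
  have "bounded_linear U"
    using complex_linear_linear[OF lin] iso
    by (intro bounded_linear_intro[where K = 1]) (auto simp: linear_add linear_scale)
  from tendsto_diff[OF g bounded_linear.tendsto[OF this g]]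
  have lim1: "(\<lambda>n. T n \<phi> - U (T n \<phi>)) \<longlonglongrightarrow> g - U g" .
  have "(\<lambda>n. (norm (\<phi> - (T n \<phi> - U (T n \<phi>))))\<^sup>2) \<longlonglongrightarrow> 0"
  proof -
    have "(norm (\<phi> - (T n \<phi> - U (T n \<phi>))))\<^sup>2 = (\<integral>z. (cmod (a n z))\<^sup>2 \<partial>\<mu> \<phi>)" for n
      using trig_dist[OF trig.one trig_diff[OF T[of n] trig.fwd[OF T[of n]]], of \<phi>]
      by (simp add: L2_dist_sq_def flip: ha)
    moreover have "(\<lambda>n. \<integral>z. (cmod (a n z))\<^sup>2 \<partial>\<mu> \<phi>) \<longlonglongrightarrow> (\<integral>z. 0 \<partial>\<mu> \<phi>)"
    proof (rule integral_dominated_convergence[where w = "\<lambda>_. 1"])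
      show "AE z in \<mu> \<phi>. (\<lambda>n. (cmod (a n z))\<^sup>2) \<longlonglongrightarrow> 0"
        using good
      proof eventually_elim
        case (elim z)
        then have "(\<lambda>n. (cmod (a n z))\<^sup>2) \<longlonglongrightarrow> (cmod 0)\<^sup>2" by (intro tendsto_intros a0) auto
        then show ?case by simp
      qed
      show "AE z in \<mu> \<phi>. norm ((cmod (a n z))\<^sup>2) \<le> 1" for n
        using good by eventually_elim (simp add: le1)
    qed (auto simp: integrable_\<mu> circle_bounded_const)
    ultimately show ?thesis by simp
  qed
  then have "(\<lambda>n. norm (\<phi> - (T n \<phi> - U (T n \<phi>)))) \<longlonglongrightarrow> 0"
    using tendsto_real_sqrt by fastforce
  from tendsto_diff[OF tendsto_const[of \<phi>] tendsto_norm_zero_cancel[OF this]]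
  have "(\<lambda>n. T n \<phi> - U (T n \<phi>)) \<longlonglongrightarrow> \<phi>" by simp
  then show ?thesis using LIMSEQ_unique[OF lim1] by blast
qed

definition real_E :: "real set \<Rightarrow> 'h \<Rightarrow> 'h" where
  "real_E B = E (circle_coord -` B)"

lemma vimage_coord: "B \<in> sets borel \<Longrightarrow> circle_coord -` B \<in> sets borel"
  using measurable_sets[OF circle_coord_measurable, of B] by simp

lemma projection_valued_real_E: "projection_valued_measure real_E"
  unfolding projection_valued_measure_def
proof (intro conjI ballI allI impI)
  fix B :: "nat \<Rightarrow> real set" and \<phi>
  assume B: "range B \<subseteq> sets borel" "disjoint_family B"
  have "(\<lambda>i. E (circle_coord -` B i) \<phi>) sums E (\<Union>i. circle_coord -` B i) \<phi>"
    using B by (intro E_sums) (auto intro!: vimage_coord simp: disjoint_family_on_def)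
  then show "(\<lambda>i. real_E (B i) \<phi>) sums real_E (\<Union>i. B i) \<phi>"
    by (simp add: real_E_def vimage_UN)
qed (simp_all add: real_E_def vimage_coord E_idem E_symmetric E_UNIV)

lemma scalar_spectral_measure_real_E: "scalar_spectral_measure real_E \<phi> = distr (\<mu> \<phi>) borel circle_coord"
  unfolding scalar_spectral_measure_def distr_def
proof (simp, rule measure_of_eq)
  fix B :: "real set" assume "B \<in> sigma_sets UNIV (sets borel)"
  then have "B \<in> sets borel" by (metis sets.sigma_sets_eq space_borel)
  then show "ennreal (Re (cinner (real_E B \<phi>) \<phi>)) = emeasure (\<mu> \<phi>) (circle_coord -` B)"
    by (simp add: real_E_def E_quadratic vimage_coord \<mu>.emeasure_eq_measure)
qed simp

text \<open>Change of variables: the second moment of the image measure is the integral of the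
  squared coordinate, finite exactly for the vectors g - U g.\<close>

lemma is_spectral_measure_real_E:
  "is_spectral_measure (range (\<lambda>g. (g - U g, \<i> *\<^sub>C (g + U g)))) real_E"
  unfolding is_spectral_measure_def
proof (intro conjI projection_valued_real_E)
  have cm: "circle_coord \<in> \<mu> \<phi> \<rightarrow>\<^sub>M borel" for \<phi> by measurable
  have "integrable (scalar_spectral_measure real_E \<phi>) (\<lambda>r. r\<^sup>2) \<longleftrightarrow> integrable (\<mu> \<phi>) (\<lambda>z. (circle_coord z)\<^sup>2)" for \<phi>
    unfolding scalar_spectral_measure_real_E by (rule integrable_distr_eq[OF cm]) measurable
  moreover have "integrable (\<mu> \<phi>) (\<lambda>z. (circle_coord z)\<^sup>2) \<longleftrightarrow> (\<exists>g. \<phi> = g - U g)" for \<phi>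
    using range_if_integrable integrable_coord_range by blast
  ultimately show "Domain (range (\<lambda>g. (g - U g, \<i> *\<^sub>C (g + U g)))) =
      {\<phi>. integrable (scalar_spectral_measure real_E \<phi>) (\<lambda>r. r\<^sup>2)}"
    by (auto simp: Domain_unfold)
  have "(\<integral>r. complex_of_real r \<partial>scalar_spectral_measure real_E (g - U g)) = cinner (\<i> *\<^sub>C (g + U g)) (g - U g)" for g
    unfolding scalar_spectral_measure_real_E integral_coord_range[symmetric] by (rule integral_distr[OF cm]) measurable
  then show "\<forall>(\<phi>, \<xi>)\<in>range (\<lambda>g. (g - U g, \<i> *\<^sub>C (g + U g))).
      cinner \<xi> \<phi> = (\<integral>r. complex_of_real r \<partial>scalar_spectral_measure real_E \<phi>)"
    by auto
qed

end

theorem spectral_theorem: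
  fixes A :: "'h::complex_hilbert_space operator"
  assumes "selfadjoint type_hspace A" shows "\<exists>E. is_spectral_measure A E"
proof -
  interpret selfadjoint_operator A by standard (rule assms)
  obtain U where "cayley_transform A U" using cayley_transform_exists by blast
  then have U: "complex_linear U" "\<And>g. norm (U g) = norm g" "surj U" "\<And>g. U g = g \<Longrightarrow> g = 0"
    "A = range (\<lambda>g. (g - U g, \<i> *\<^sub>C (g + U g)))"
    unfolding cayley_transform_def by simp_all
  interpret cayley_operator U by unfold_locales (fact U)+
  show ?thesis unfolding U(5) using is_spectral_measure_real_E by blast
qed

section \<open>Point spectrum and spectral measure\<close>

locale pvm =
  fixes E :: "real set \<Rightarrow> 'h \<Rightarrow> 'h::complex_hilbert_space"
  assumes pvm: "projection_valued_measure E"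
begin

lemma pvm_symmetric: "B \<in> sets borel \<Longrightarrow> cinner (E B \<phi>) \<psi> = cinner \<phi> (E B \<psi>)"
  and pvm_idem: "B \<in> sets borel \<Longrightarrow> E B (E B \<phi>) = E B \<phi>"
  and pvm_UNIV: "E UNIV \<phi> = \<phi>"
  and pvm_sums: "range C \<subseteq> sets borel \<Longrightarrow> disjoint_family C \<Longrightarrow> (\<lambda>i::nat. E (C i) \<phi>) sums E (\<Union>i. C i) \<phi>"
  using pvm unfolding projection_valued_measure_def by simp_all

text \<open>Linearity is a consequence of symmetry: against every test vector \<open>E B\<close> can
  be moved to the other argument of the inner product.\<close>

lemma pvm_linear:
  assumes B: "B \<in> sets borel" shows "complex_linear (E B)"
proof -
  have eqI: "x = y" if "\<And>w. cinner w x = cinner w y" for x y :: 'h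
    using cinner_eq_zero_all[of "x - y"] that by (simp add: cinner.diff_right)
  show ?thesis unfolding complex_linear_def
    by (intro conjI allI; rule eqI)
      (simp_all add: cinner.add_right cinner_scaleC_right flip: pvm_symmetric[OF B])
qed

text \<open>The empty set repeated is a disjoint family, and a constant series converges for the
  constant 0 alone.\<close>

lemma pvm_empty: "E {} \<phi> = 0"
proof -
  have "summable (\<lambda>i::nat. E {} \<phi>)"
    using pvm_sums[of "\<lambda>_. {}" \<phi>] by (auto simp: summable_def disjoint_family_on_def)
  then show ?thesis by (simp add: summable_const_iff)
qed

lemma pvm_quadratic:
  assumes B: "B \<in> sets borel" shows "cinner (E B \<phi>) \<phi> = of_real ((norm (E B \<phi>))\<^sup>2)"
  using pvm_symmetric[OF B, of "E B \<phi>" \<phi>] pvm_idem[OF B, of \<phi>] cinner_self[of "E B \<phi>"] by simp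

abbreviation \<mu> where "\<mu> \<equiv> scalar_spectral_measure E"

lemma sets_\<mu> [simp, measurable_cong]: "sets (\<mu> \<phi>) = sets borel"
proof -
  have "sigma_sets UNIV (sets (borel :: real measure)) = sets borel"
    using sets.sigma_sets_eq[of "borel :: real measure"] by simp
  then show ?thesis by (simp add: scalar_spectral_measure_def)
qed

lemma space_\<mu> [simp]: "space (\<mu> \<phi>) = UNIV"
  by (simp add: scalar_spectral_measure_def)

lemma emeasure_\<mu>:
  assumes B: "B \<in> sets borel" shows "emeasure (\<mu> \<phi>) B = ennreal ((norm (E B \<phi>))\<^sup>2)"
proof -
  have "emeasure (\<mu> \<phi>) B = ennreal (Re (cinner (E B \<phi>) \<phi>))"
  proof (rule emeasure_measure_of[of _ UNIV "sets borel" "\<lambda>B. ennreal (Re (cinner (E B \<phi>) \<phi>))"])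
    show "\<mu> \<phi> = measure_of UNIV (sets borel) (\<lambda>B. ennreal (Re (cinner (E B \<phi>) \<phi>)))"
      by (rule scalar_spectral_measure_def)
    show "positive (sets (\<mu> \<phi>)) (\<lambda>B. ennreal (Re (cinner (E B \<phi>) \<phi>)))"
      by (simp add: positive_def pvm_empty cinner.zero_left)
    show "countably_additive (sets (\<mu> \<phi>)) (\<lambda>B. ennreal (Re (cinner (E B \<phi>) \<phi>)))"
    proof (rule countably_additiveI)
      fix C :: "nat \<Rightarrow> real set" assume C: "range C \<subseteq> sets (\<mu> \<phi>)" "disjoint_family C"
      have "(\<lambda>i. Re (cinner (E (C i) \<phi>) \<phi>)) sums Re (cinner (E (\<Union>i. C i) \<phi>) \<phi>)"
        using pvm_sums[of C \<phi>] C
        by (intro bounded_linear.sums[OF bounded_linear_Re]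
            bounded_linear.sums[OF cinner.bounded_linear_left]) simp
      moreover have "0 \<le> Re (cinner (E (C i) \<phi>) \<phi>)" for i
        using C(1) by (subst pvm_quadratic) auto
      ultimately show "(\<Sum>i. ennreal (Re (cinner (E (C i) \<phi>) \<phi>))) = ennreal (Re (cinner (E (\<Union>i. C i) \<phi>) \<phi>))"
        by (intro suminf_ennreal_eq)
    qed
  qed (use B in auto)
  then show ?thesis by (simp add: pvm_quadratic[OF B] del: of_real_power)
qed

sublocale \<mu>: finite_measure "\<mu> \<phi>" for \<phi>
  by (rule finite_measureI) (simp add: emeasure_\<mu>)

lemma measure_\<mu>: "B \<in> sets borel \<Longrightarrow> measure (\<mu> \<phi>) B = (norm (E B \<phi>))\<^sup>2"
  by (simp add: measure_def emeasure_\<mu>)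

lemma pvm_union:
  assumes B: "B \<in> sets borel" "C \<in> sets borel" "B \<inter> C = {}"
  shows "E (B \<union> C) \<phi> = E B \<phi> + E C \<phi>"
proof -
  have "E (B \<union> C) = (\<lambda>\<phi>. E B \<phi> + E C \<phi>)"
  proof (rule complex_linear_eqI)
    show "complex_linear (\<lambda>\<phi>. E B \<phi> + E C \<phi>)"
      using pvm_linear[OF B(1)] pvm_linear[OF B(2)] by (simp add: complex_linear_def scaleC_add_right)
    show "cinner (E (B \<union> C) x) x = cinner (E B x + E C x) x" for x
      using \<mu>.finite_measure_Union[of B x C] B
      by (simp add: cinner.add_left pvm_quadratic measure_\<mu> del: of_real_power flip: of_real_add)
  qed (use B in \<open>simp add: pvm_linear\<close>)
  then show ?thesis by (rule fun_cong)
qed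

text \<open>The vector \<open>E B \<phi>\<close> already carries its whole mass on \<open>B\<close>,
  so additivity leaves none for \<open>C\<close>.\<close>

lemma pvm_disjoint:
  assumes B: "B \<in> sets borel" "C \<in> sets borel" "B \<inter> C = {}"
  shows "E C (E B \<phi>) = 0"
proof -
  let ?y = "E B \<phi>"
  have "measure (\<mu> ?y) (B \<union> C) = measure (\<mu> ?y) B + measure (\<mu> ?y) C"
    using \<mu>.finite_measure_Union[of B ?y C] B by simp
  moreover have "measure (\<mu> ?y) B = measure (\<mu> ?y) UNIV"
    using B by (simp add: measure_\<mu> pvm_idem pvm_UNIV)
  moreover have "measure (\<mu> ?y) (B \<union> C) \<le> measure (\<mu> ?y) UNIV"
    using \<mu>.bounded_measure[of ?y "B \<union> C"] by simp
  ultimately have "measure (\<mu> ?y) C \<le> 0" by simp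
  then show ?thesis using B by (simp add: measure_\<mu>)
qed

lemma pvm_Int:
  assumes B: "B \<in> sets borel" "C \<in> sets borel"
  shows "E C (E B \<phi>) = E (B \<inter> C) \<phi>"
proof -
  have 1: "E C (E B \<phi>) = E (B \<inter> C) (E B \<phi>)"
  proof -
    have "(B \<inter> C) \<union> (C - B) = C" by blast
    moreover have "E ((B \<inter> C) \<union> (C - B)) (E B \<phi>) = E (B \<inter> C) (E B \<phi>) + E (C - B) (E B \<phi>)"
      using B by (intro pvm_union) auto
    moreover have "E (C - B) (E B \<phi>) = 0" using B by (intro pvm_disjoint) auto
    ultimately show ?thesis by simp
  qed
  have "E B \<phi> = E (B \<inter> C) \<phi> + E (B - C) \<phi>"
  proof -
    have "(B \<inter> C) \<union> (B - C) = B" by blast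
    moreover have "E ((B \<inter> C) \<union> (B - C)) \<phi> = E (B \<inter> C) \<phi> + E (B - C) \<phi>"
      using B by (intro pvm_union) auto
    ultimately show ?thesis by simp
  qed
  then have "E (B \<inter> C) (E B \<phi>) = E (B \<inter> C) (E (B \<inter> C) \<phi>) + E (B \<inter> C) (E (B - C) \<phi>)"
    using B by (simp add: complex_linear_add[OF pvm_linear])
  also have "E (B \<inter> C) (E (B - C) \<phi>) = 0"
    using B by (intro pvm_disjoint) auto
  also have "E (B \<inter> C) (E (B \<inter> C) \<phi>) = E (B \<inter> C) \<phi>"
    using B by (simp add: pvm_idem)
  finally show ?thesis using 1 by simp
qed

lemma pvm_Compl: "B \<in> sets borel \<Longrightarrow> E (- B) \<phi> = \<phi> - E B \<phi>"
  using pvm_union[of B "- B" \<phi>] by (simp add: pvm_UNIV) (metis add_diff_cancel_left')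

lemma pvm_contraction: "B \<in> sets borel \<Longrightarrow> norm (E B \<phi>) \<le> norm \<phi>"
  using \<mu>.bounded_measure[of \<phi> B] measure_\<mu>[of B \<phi>] measure_\<mu>[of UNIV \<phi>]
  by (simp add: pvm_UNIV)

text \<open>Vectors in the range of a bounded spectral projection lie in the domain, because their measure has bounded support.\<close>

lemma integrable_range:
  assumes B: "B \<in> sets borel" "bounded B" shows "integrable (\<mu> (E B \<phi>)) (\<lambda>r. r\<^sup>2)"
    and "AE r in \<mu> (E B \<phi>). r \<in> B"
proof -
  have "emeasure (\<mu> (E B \<phi>)) (- B) = 0"
    using B pvm_disjoint[of B "- B" \<phi>] by (simp add: emeasure_\<mu>)
  then show AE: "AE r in \<mu> (E B \<phi>). r \<in> B"
    using B by (intro AE_I[of _ _ "- B"]) auto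
  obtain K where K: "\<forall>x\<in>B. norm x \<le> K" using B(2) bounded_iff by blast
  show "integrable (\<mu> (E B \<phi>)) (\<lambda>r. r\<^sup>2)"
  proof (rule \<mu>.integrable_const_bound)
    show "AE r in \<mu> (E B \<phi>). norm (r\<^sup>2) \<le> K\<^sup>2"
      using AE by eventually_elim (use K power_mono[of "\<bar>_\<bar>" K 2] in force)
  qed measurable
qed

end

text \<open>The link between \<open>A\<close> and \<open>E\<close> consists of the domain and the
  quadratic form; that spectral projections are compatible with \<open>A\<close> has to be extracted
  from these.\<close>

locale spectral_resolution = selfadjoint_operator A + pvm E
  for A :: "'h::complex_hilbert_space operator" and E :: "real set \<Rightarrow> 'h \<Rightarrow> 'h" +
  assumes domain_iff: "Domain A = {\<phi>. integrable (scalar_spectral_measure E \<phi>) (\<lambda>r. r\<^sup>2)}"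
    and form: "(\<phi>, \<xi>) \<in> A \<Longrightarrow> cinner \<xi> \<phi> = (\<integral>r. complex_of_real r \<partial>scalar_spectral_measure E \<phi>)"
begin

lemma form_expand:
  assumes "(u, w) \<in> A" "(u', w') \<in> A"
  shows "cinner (w + c *\<^sub>C w') (u + c *\<^sub>C u') =
    cinner w u + c * cnj c * cinner w' u' + of_real (2 * Re (cnj c * cinner w u'))"
proof -
  have "cinner w' u = cnj (cinner w u')"
    using symmetric[OF assms] cinner_commute[of w' u] by simp
  then show ?thesis
    by (simp add: cinner.add_left cinner.add_right cinner_scaleC_left cinner_scaleC_right complex_eq_iff algebra_simps)
qed

text \<open>Turning the component \<open>E (- B) \<theta>\<close> by a unit scalar \<open>c\<close>
  changes neither the spectral measure nor, therefore, the quadratic form of \<open>A\<close>. The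
  cross term in the expansion of the form is then independent of \<open>c\<close>, hence
  zero.\<close>

lemma form_orthogonal:
  assumes B: "B \<in> sets borel" and \<theta>: "\<theta> \<in> Domain A" and \<xi>: "(E B \<theta>, \<xi>) \<in> A"
  shows "cinner \<xi> (E (- B) \<theta>) = 0"
proof -
  obtain \<zeta> where "(\<theta>, \<zeta>) \<in> A" using \<theta> by blast
  then have \<eta>: "(E (- B) \<theta>, \<zeta> - \<xi>) \<in> A"
    using mem_diff[OF _ \<xi>] B by (simp add: pvm_Compl)
  have "\<mu> (E B \<theta> + c *\<^sub>C E (- B) \<theta>) = \<mu> \<theta>" if c: "cmod c = 1" for c
  proof (rule measure_eqI)
    fix C assume "C \<in> sets (\<mu> (E B \<theta> + c *\<^sub>C E (- B) \<theta>))"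
    then have C: "C \<in> sets borel" by simp
    have orth: "cinner (E (B \<inter> C) \<theta>) (E (- B \<inter> C) \<theta>) = 0"
    proof -
      have "(B \<inter> C) \<inter> (- B \<inter> C) = {}" by blast
      then show ?thesis
        using pvm_symmetric[of "B \<inter> C" \<theta> "E (- B \<inter> C) \<theta>"] pvm_disjoint[of "- B \<inter> C" "B \<inter> C" \<theta>] B C
        by (simp add: cinner.zero_right Int_commute)
    qed
    have "(norm (E C (E B \<theta> + d *\<^sub>C E (- B) \<theta>)))\<^sup>2 = (norm (E (B \<inter> C) \<theta>))\<^sup>2 + (norm (E (- B \<inter> C) \<theta>))\<^sup>2"
      if "cmod d = 1" for d
      using B C that
      by (simp add: complex_linear_add[OF pvm_linear] complex_linear_scaleC[OF pvm_linear] pvm_Int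
          norm_sq_add norm_scaleC cinner_scaleC_right orth)
    from this[of c] this[of 1] c
    have "(norm (E C (E B \<theta> + c *\<^sub>C E (- B) \<theta>)))\<^sup>2 = (norm (E C (E B \<theta> + E (- B) \<theta>)))\<^sup>2"
      by (simp add: scaleC_one)
    also have "E B \<theta> + E (- B) \<theta> = \<theta>" using B by (simp add: pvm_Compl)
    finally show "emeasure (\<mu> (E B \<theta> + c *\<^sub>C E (- B) \<theta>)) C = emeasure (\<mu> \<theta>) C"
      using C by (simp add: emeasure_\<mu>)
  qed simp
  then have q: "cinner (\<xi> + c *\<^sub>C (\<zeta> - \<xi>)) (E B \<theta> + c *\<^sub>C E (- B) \<theta>) = (\<integral>r. complex_of_real r \<partial>\<mu> \<theta>)"
    if "cmod c = 1" for c
    using form[OF mem_add[OF \<xi> mem_scale[OF \<eta>, of c]]] that by simp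
  let ?w = "cinner \<xi> (E (- B) \<theta>)"
  have unit: "c * cnj c = 1" if "cmod c = 1" for c using that by (simp add: complex_norm_square[symmetric])
  have e: "(\<integral>r. complex_of_real r \<partial>\<mu> \<theta>) = cinner \<xi> (E B \<theta>) + cinner (\<zeta> - \<xi>) (E (- B) \<theta>) + of_real (2 * Re (cnj c * ?w))"
    if "cmod c = 1" for c
    using form_expand[OF \<xi> \<eta>, of c] by (simp only: q[OF that] unit[OF that] mult_1_left)
  have "Re (cnj c * ?w) = Re (cnj c' * ?w)" if "cmod c = 1" "cmod c' = 1" for c c'
  proof -
    have "complex_of_real (2 * Re (cnj c * ?w)) = complex_of_real (2 * Re (cnj c' * ?w))"
      using e[OF that(1)] e[OF that(2)] by (metis add_left_cancel)
    then show ?thesis by (simp only: of_real_eq_iff)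
  qed
  \<comment> \<open>A quantity that changes sign with \<open>c\<close> and is constant must be 0; c
    = 1 gives the real part and c = i the imaginary part.\<close>
  from this[of 1 "-1"] this[of \<i> "-\<i>"] show ?thesis by (simp add: complex_eq_iff)
qed

text \<open>The vector A \<phi> - r \<phi> is orthogonal to the domain. On the range of
  \<open>E {r}\<close> the form of \<open>A\<close> is \<open>r\<close> times the inner product,
  which is polarized; on the complementary part \<open>form_orthogonal\<close> applies.\<close>

lemma eigenvector_of_projection:
  assumes \<phi>: "E {r} \<phi> = \<phi>" shows "(\<phi>, complex_of_real r *\<^sub>C \<phi>) \<in> A"
proof -
  have range: "\<exists>\<xi>. (\<psi>, \<xi>) \<in> A" "(\<integral>x. complex_of_real x \<partial>\<mu> \<psi>) = of_real r * cinner \<psi> \<psi>"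
    if "E {r} \<psi> = \<psi>" for \<psi>
  proof -
    have "\<psi> \<in> Domain A" unfolding domain_iff using integrable_range(1)[of "{r}" \<psi>] that by simp
    then show "\<exists>\<xi>. (\<psi>, \<xi>) \<in> A" by blast
    have "AE x in \<mu> (E {r} \<psi>). x \<in> {r}" by (rule integrable_range(2)) auto
    then have "AE x in \<mu> \<psi>. complex_of_real x = of_real r" unfolding that by eventually_elim simp
    then have "(\<integral>x. complex_of_real x \<partial>\<mu> \<psi>) = (\<integral>x. complex_of_real r \<partial>\<mu> \<psi>)"
      by (intro integral_cong_AE) auto
    also have "\<dots> = of_real r * cinner \<psi> \<psi>"
      by (simp add: measure_\<mu> pvm_UNIV cinner_self scaleR_conv_of_real)
    finally show "(\<integral>x. complex_of_real x \<partial>\<mu> \<psi>) = of_real r * cinner \<psi> \<psi>" .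
  qed
  obtain \<xi> where \<xi>: "(\<phi>, \<xi>) \<in> A" using range(1)[OF \<phi>] by blast
  have "cinner \<psi> (\<xi> - complex_of_real r *\<^sub>C \<phi>) = 0" if \<psi>D: "\<psi> \<in> Domain A" for \<psi>
  proof -
    define \<psi>1 where "\<psi>1 = E {r} \<psi>"
    have E1: "E {r} \<psi>1 = \<psi>1" by (simp add: \<psi>1_def pvm_idem)
    obtain \<eta> where \<eta>: "(\<psi>1, \<eta>) \<in> A" using range(1)[OF E1] by blast
    have lin: "E {r} (\<phi> + c *\<^sub>C \<psi>1) = \<phi> + c *\<^sub>C \<psi>1" for c
      by (simp add: complex_linear_add[OF pvm_linear] complex_linear_scaleC[OF pvm_linear] E1 \<phi>)
    have "cinner (\<xi> + c *\<^sub>C \<eta>) (\<phi> + c *\<^sub>C \<psi>1) = of_real r * cinner (\<phi> + c *\<^sub>C \<psi>1) (\<phi> + c *\<^sub>C \<psi>1)" for c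
      using form[OF mem_add[OF \<xi> mem_scale[OF \<eta>, of c]]] range(2)[OF lin[of c]] by simp
    moreover have "cinner (\<phi> + c *\<^sub>C \<psi>1) (\<phi> + c *\<^sub>C \<psi>1) =
        cinner \<phi> \<phi> + c * cnj c * cinner \<psi>1 \<psi>1 + of_real (2 * Re (cnj c * cinner \<phi> \<psi>1))" for c
      using cinner_commute[of \<psi>1 \<phi>]
      by (simp add: cinner.add_left cinner.add_right cinner_scaleC_left cinner_scaleC_right complex_eq_iff algebra_simps)
    moreover have "cinner \<xi> \<phi> = of_real r * cinner \<phi> \<phi>" "cinner \<eta> \<psi>1 = of_real r * cinner \<psi>1 \<psi>1"
      using form[OF \<xi>] form[OF \<eta>] range(2)[OF \<phi>] range(2)[OF E1] by simp_all
    ultimately have "Re (cnj c * cinner \<xi> \<psi>1) = r * Re (cnj c * cinner \<phi> \<psi>1)" for c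
      using arg_cong[OF form_expand[OF \<xi> \<eta>, of c], of Re] by (simp add: algebra_simps)
    from this[of 1] this[of \<i>] have 1: "cinner \<xi> \<psi>1 = of_real r * cinner \<phi> \<psi>1"
      by (simp add: complex_eq_iff)
    have \<psi>c: "E (- {r}) \<psi> \<in> Domain A" and \<phi>D: "\<phi> \<in> Domain A"
    proof -
      obtain \<zeta> where "(\<psi>, \<zeta>) \<in> A" using \<psi>D by blast
      then show "E (- {r}) \<psi> \<in> Domain A"
        using mem_diff[OF _ \<eta>] by (auto simp: pvm_Compl \<psi>1_def intro: DomainI)
    qed (use \<xi> in blast)
    \<comment> \<open>Built so that \<open>E {r} \<theta>\<close> is \<phi> while the complementary
      component is that of \<psi>, the shape required by \<open>form_orthogonal\<close>.\<close>
    define \<theta> where "\<theta> = \<phi> + E (- {r}) \<psi>"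
    have "\<theta> \<in> Domain A" using \<psi>c \<phi>D mem_add unfolding \<theta>_def by blast
    moreover have E\<theta>: "E {r} \<theta> = \<phi>"
      using pvm_disjoint[of "- {r}" "{r}" \<psi>] by (simp add: \<theta>_def complex_linear_add[OF pvm_linear] \<phi>)
    ultimately have "cinner \<xi> (E (- {r}) \<theta>) = 0" using \<xi> by (intro form_orthogonal) auto
    moreover have "E (- {r}) \<theta> = E (- {r}) \<psi>" by (simp add: pvm_Compl[of "{r}" \<theta>] E\<theta>) (simp add: \<theta>_def)
    ultimately have 2: "cinner \<xi> (E (- {r}) \<psi>) = 0" by simp
    have 3: "cinner \<phi> (E (- {r}) \<psi>) = 0"
      using pvm_symmetric[of "- {r}" \<phi> \<psi>] by (simp add: pvm_Compl[of "{r}" \<phi>] \<phi> cinner.zero_left)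
    have \<psi>: "\<psi> = \<psi>1 + E (- {r}) \<psi>" by (simp add: \<psi>1_def pvm_Compl)
    have "cinner \<xi> \<psi> = of_real r * cinner \<phi> \<psi>"
      by (subst (1 2) \<psi>) (simp add: cinner.add_right 1 2 3)
    then have "cnj (cinner \<xi> \<psi>) = of_real r * cnj (cinner \<phi> \<psi>)" by simp
    then show ?thesis by (simp add: cinner.diff_right cinner_scaleC_right flip: cinner_commute)
  qed
  then have "\<xi> - complex_of_real r *\<^sub>C \<phi> = 0" using dense_orthogonal_zero[OF dense] by blast
  then show ?thesis using \<xi> by simp
qed

text \<open>For every bounded \<open>B\<close> the integral of x - r over \<open>B\<close> vanishes:
  with \<xi> the image of \<open>E B \<phi>\<close> under \<open>A\<close>, the number
  \<open>cinner \<xi> \<phi>\<close> is computed once by symmetry and once by the form. Bounded sets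
  on one side of \<open>r\<close>, at positive distance, then have measure 0.\<close>

lemma projection_of_eigenvector:
  assumes \<phi>: "(\<phi>, complex_of_real r *\<^sub>C \<phi>) \<in> A" shows "E {r} \<phi> = \<phi>"
proof -
  have first_moment: "(\<integral>x. (x - r) * indicator B x \<partial>\<mu> \<phi>) = 0"
    if B: "B \<in> sets borel" "bounded B" for B
  proof -
    obtain K where K: "\<forall>x\<in>B. norm x \<le> K" using B(2) bounded_iff by blast
    have "E B \<phi> \<in> Domain A" unfolding domain_iff using integrable_range(1)[OF B] by simp
    then obtain \<xi> where \<xi>: "(E B \<phi>, \<xi>) \<in> A" by blast
    have density: "\<mu> (E B \<phi>) = density (\<mu> \<phi>) (indicator B)"
    proof (rule measure_eqI)
      fix C assume "C \<in> sets (\<mu> (E B \<phi>))"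
      then have C: "C \<in> sets borel" by simp
      then show "emeasure (\<mu> (E B \<phi>)) C = emeasure (density (\<mu> \<phi>) (indicator B)) C"
        using B by (simp add: emeasure_\<mu> pvm_Int emeasure_density indicator_inter_arith[symmetric])
    qed simp
    have "(\<integral>x. complex_of_real x \<partial>\<mu> (E B \<phi>)) = complex_of_real (\<integral>x. x * indicator B x \<partial>\<mu> \<phi>)"
    proof -
      have "(\<integral>x. complex_of_real x \<partial>\<mu> (E B \<phi>)) = complex_of_real (\<integral>x. x \<partial>\<mu> (E B \<phi>))"
        by (rule integral_complex_of_real)
      also have "(\<integral>x. x \<partial>\<mu> (E B \<phi>)) = (\<integral>x. x \<partial>density (\<mu> \<phi>) (\<lambda>x. ennreal (indicator B x)))"
        unfolding density by (simp add: ennreal_indicator)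
      also have "\<dots> = (\<integral>x. indicator B x *\<^sub>R x \<partial>\<mu> \<phi>)"
        using B by (intro integral_density) auto
      finally show ?thesis by (simp add: mult.commute)
    qed
    then have "cinner \<xi> (E B \<phi>) = complex_of_real (\<integral>x. x * indicator B x \<partial>\<mu> \<phi>)"
      using form[OF \<xi>] by simp
    moreover have "cinner \<xi> \<phi> = of_real r * of_real (measure (\<mu> \<phi>) B)"
      using symmetric[OF \<xi> \<phi>] B by (simp add: cinner_scaleC_right pvm_quadratic measure_\<mu>)
    moreover have "cinner \<xi> \<phi> = cinner \<xi> (E B \<phi>)"
      using form_orthogonal[OF B(1) _ \<xi>] \<phi> B by (auto simp: pvm_Compl cinner.diff_right)
    ultimately have eq: "(\<integral>x. x * indicator B x \<partial>\<mu> \<phi>) = r * measure (\<mu> \<phi>) B"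
      by (metis of_real_eq_iff of_real_mult)
    have "integrable (\<mu> \<phi>) (\<lambda>x. x * indicator B x)"
    proof (rule \<mu>.integrable_const_bound)
      show "AE x in \<mu> \<phi>. norm (x * indicator B x) \<le> \<bar>K\<bar>"
        using K by (intro AE_I2) (auto simp: indicator_def intro: order_trans[OF _ abs_ge_self])
    qed (use B in measurable)
    moreover have "integrable (\<mu> \<phi>) (\<lambda>x. r * indicator B x)"
      using B by (intro integrable_mult_right integrable_real_indicator) (auto simp: \<mu>.emeasure_finite less_top[symmetric])
    ultimately have "(\<integral>x. x * indicator B x - r * indicator B x \<partial>\<mu> \<phi>) = 0"
      using B by (subst Bochner_Integration.integral_diff) (simp_all add: eq)
    then show ?thesis by (simp add: left_diff_distrib)
  qed
  have null: "measure (\<mu> \<phi>) B = 0" if B: "B \<in> sets borel" "bounded B" and e: "e > 0"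
    and s: "s = 1 \<or> s = -1" and far: "\<And>x. x \<in> B \<Longrightarrow> s * (x - r) \<ge> e" for B and e s :: real
  proof -
    obtain K where K: "\<forall>x\<in>B. norm x \<le> K" using B(2) bounded_iff by blast
    have "e * measure (\<mu> \<phi>) B = (\<integral>x. e * indicator B x \<partial>\<mu> \<phi>)" using B by simp
    also have "\<dots> \<le> (\<integral>x. s * ((x - r) * indicator B x) \<partial>\<mu> \<phi>)"
    proof (rule integral_mono)
      show "integrable (\<mu> \<phi>) (\<lambda>x. e * indicator B x)"
        using B by (intro integrable_mult_right integrable_real_indicator) (auto simp: \<mu>.emeasure_finite less_top[symmetric])
      show "integrable (\<mu> \<phi>) (\<lambda>x. s * ((x - r) * indicator B x))"
      proof (intro integrable_mult_right \<mu>.integrable_const_bound)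
        show "AE x in \<mu> \<phi>. norm ((x - r) * indicator B x) \<le> \<bar>K\<bar> + \<bar>r\<bar>"
        proof (rule AE_I2)
          fix x
          show "norm ((x - r) * indicator B x) \<le> \<bar>K\<bar> + \<bar>r\<bar>"
          proof (cases "x \<in> B")
            case True
            then have "\<bar>x\<bar> \<le> K" using K by simp
            then show ?thesis using True abs_triangle_ineq4[of x r] by simp
          qed simp
        qed
      qed (use B in measurable)
      show "e * indicator B x \<le> s * ((x - r) * indicator B x)" for x
        using far[of x] by (auto simp: indicator_def)
    qed
    also have "\<dots> = 0" using first_moment[OF B] by simp
    finally show ?thesis using e measure_nonneg[of "\<mu> \<phi>" B] by (simp add: mult_le_0_iff)
  qed
  \<comment> \<open>Bounded sets at positive distance from \<open>r\<close>, each a union of two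
    pieces to which \<open>null\<close> applies; together they exhaust the complement of
    \<open>r\<close>.\<close>
  define S where "S n = {r + 1 / real (Suc n)..r + real n} \<union> {r - real n..r - 1 / real (Suc n)}" for n
  have "measure (\<mu> \<phi>) {r + 1 / real (Suc n)..r + real n} = 0" for n
    by (rule null[where e = "1 / real (Suc n)" and s = 1]) auto
  moreover have "measure (\<mu> \<phi>) {r - real n..r - 1 / real (Suc n)} = 0" for n
    by (rule null[where e = "1 / real (Suc n)" and s = "-1"]) (auto simp: algebra_simps)
  ultimately have "S n \<in> null_sets (\<mu> \<phi>)" for n
    unfolding S_def by (intro null_sets.Un) (simp_all add: null_sets_def \<mu>.emeasure_eq_measure)
  then have "(\<Union>n. S n) \<in> null_sets (\<mu> \<phi>)" by blast
  moreover have "- {r} \<subseteq> (\<Union>n. S n)"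
  proof
    fix x assume "x \<in> - {r}"
    then have "\<bar>x - r\<bar> > 0" by simp
    then obtain n where n: "inverse (real (Suc n)) < \<bar>x - r\<bar>" using reals_Archimedean by blast
    obtain m where m: "\<bar>x - r\<bar> \<le> real m" using real_arch_simple by blast
    have "1 / real (Suc (max n m)) \<le> 1 / real (Suc n)" by (simp add: frac_le)
    then have "1 / real (Suc (max n m)) \<le> \<bar>x - r\<bar>" "\<bar>x - r\<bar> \<le> real (max n m)"
      using n m by (simp_all add: inverse_eq_divide)
    then have "x \<in> S (max n m)" unfolding S_def by (auto simp: abs_real_def split: if_splits)
    then show "x \<in> (\<Union>n. S n)" by blast
  qed
  ultimately have "- {r} \<in> null_sets (\<mu> \<phi>)" using null_sets_subset[of "\<Union>n. S n" "\<mu> \<phi>" "- {r}"] by simp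
  then have "E (- {r}) \<phi> = 0" by (simp add: null_sets_def emeasure_\<mu>)
  then show ?thesis by (simp add: pvm_Compl)
qed

lemma point_spectrum_iff: "r \<in> point_spectrum type_hspace A \<longleftrightarrow> (\<exists>\<phi>. E {r} \<phi> \<noteq> 0)"
proof
  assume "r \<in> point_spectrum type_hspace A"
  then obtain \<phi> where "(\<phi>, complex_of_real r *\<^sub>C \<phi>) \<in> A" "cinner \<phi> \<phi> \<noteq> 0"
    by (auto simp: point_spectrum_def type_hspace_def)
  then show "\<exists>\<phi>. E {r} \<phi> \<noteq> 0"
    using projection_of_eigenvector[of \<phi> r] by (intro exI[of _ \<phi>]) (auto simp: cinner.zero_left)
next
  assume "\<exists>\<phi>. E {r} \<phi> \<noteq> 0"
  then obtain \<phi> where "E {r} \<phi> \<noteq> 0" ..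
  moreover have "(E {r} \<phi>, complex_of_real r *\<^sub>C E {r} \<phi>) \<in> A"
    by (rule eigenvector_of_projection) (simp add: pvm_idem)
  ultimately show "r \<in> point_spectrum type_hspace A"
    by (auto simp: point_spectrum_def type_hspace_def cinner_self intro!: exI[of _ "E {r} \<phi>"])
qed

end

section \<open>Eigenvalues as atoms of measurable kernels\<close>

lemma spectral_resolution_spectral_measure:
  assumes "selfadjoint type_hspace A" shows "spectral_resolution A (spectral_measure A)"
proof -
  have "is_spectral_measure A (spectral_measure A)"
    unfolding spectral_measure_def using spectral_theorem[OF assms] by (rule someI_ex)
  then show ?thesis using assms by unfold_locales (auto simp: is_spectral_measure_def)
qed

text \<open>The projection satisfies the definite description, and a linear operator with the same
  quadratic form equals it. Through these functions the measurability of a family of operators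
  reaches its spectral measures.\<close>

lemma borel_calculus_indicator:
  assumes A: "selfadjoint type_hspace A" and B: "B \<in> sets borel"
  shows "borel_calculus (\<lambda>z. indicator B (Re z)) A = spectral_measure A B"
proof -
  interpret spectral_resolution A "spectral_measure A"
    by (rule spectral_resolution_spectral_measure[OF A])
  let ?E = "spectral_measure A"
  have q: "(\<integral>r. indicator B (Re (complex_of_real r)) \<partial>\<mu> \<phi>) = cinner (?E B \<phi>) \<phi>" for \<phi>
  proof -
    have "(\<integral>r. indicator B (Re (complex_of_real r)) \<partial>\<mu> \<phi>) = (\<integral>r. complex_of_real (indicator B r) \<partial>\<mu> \<phi>)"
      by (intro Bochner_Integration.integral_cong) (auto simp: indicator_def)
    then show ?thesis using B by (simp add: pvm_quadratic measure_\<mu>)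
  qed
  show ?thesis
    unfolding borel_calculus_def q
  proof (rule the_equality)
    have "bounded_linear (?E B)"
      using complex_linear_linear[OF pvm_linear[OF B]] pvm_contraction[OF B]
      by (intro bounded_linear_intro[where K = 1]) (auto simp: linear_add linear_scale)
    then show "bounded_linear (?E B) \<and> (\<forall>c \<phi>. ?E B (c *\<^sub>C \<phi>) = c *\<^sub>C ?E B \<phi>) \<and>
        (\<forall>\<phi>. cinner (?E B \<phi>) \<phi> = cinner (?E B \<phi>) \<phi>)"
      using pvm_linear[OF B] by (simp add: complex_linear_def)
    fix T assume T: "bounded_linear T \<and> (\<forall>c \<phi>. T (c *\<^sub>C \<phi>) = c *\<^sub>C T \<phi>) \<and>
        (\<forall>\<phi>. cinner (T \<phi>) \<phi> = cinner (?E B \<phi>) \<phi>)"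
    then have "complex_linear T"
      by (simp add: complex_linear_def linear_add bounded_linear.linear)
    then show "T = ?E B" using T pvm_linear[OF B] by (intro complex_linear_eqI) auto
  qed
qed

text \<open>The spectral projection of a point is nonzero if and only if it is nonzero on some
  member of a dense sequence, so the eigenvalues are the atoms of countably many scalar spectral
  measures.\<close>

lemma point_spectrum_kernels:
  fixes J :: "'w \<Rightarrow> 'h::complex_hilbert_space operator"
  assumes J: "measurable_family M J" and sep: "\<exists>S::'h set. countable S \<and> closure S = UNIV"
  obtains K :: "nat \<Rightarrow> 'w \<Rightarrow> real measure"
  where "\<And>k. K k \<in> measurable M (subprob_algebra borel)"
    "\<And>\<omega>. \<omega> \<in> space M \<Longrightarrow> point_spectrum type_hspace (J \<omega>) = {r. \<exists>k. emeasure (K k \<omega>) {r} \<noteq> 0}"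
proof -
  obtain S :: "'h set" where S: "countable S" "closure S = UNIV" using sep by blast
  then have "S \<noteq> {}" by auto
  define \<psi> where "\<psi> k = from_nat_into S k" for k
  have range\<psi>: "range \<psi> = S" unfolding \<psi>_def using S(1) \<open>S \<noteq> {}\<close> by (simp add: range_from_nat_into)
  \<comment> \<open>Scaling by 1 / (1 + norm) bounds the total mass by 1, as a subprobability kernel
    requires, and makes sense for the zero vector too.\<close>
  define \<phi> where "\<phi> k = (1 / (1 + norm (\<psi> k))) *\<^sub>R \<psi> k" for k
  have \<phi>1: "norm (\<phi> k) \<le> 1" for k by (simp add: \<phi>_def divide_le_eq not_less add_nonneg_nonneg)
  define K where "K k \<omega> = scalar_spectral_measure (spectral_measure (J \<omega>)) (\<phi> k)" for k \<omega>
  have sa: "selfadjoint type_hspace (J \<omega>)" if "\<omega> \<in> space M" for \<omega>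
    using J that by (simp add: measurable_family_def)
  show thesis
  proof
    show "K k \<in> measurable M (subprob_algebra borel)" for k
    proof (rule measurable_subprob_algebra)
      fix \<omega> assume \<omega>: "\<omega> \<in> space M"
      interpret spectral_resolution "J \<omega>" "spectral_measure (J \<omega>)"
        by (rule spectral_resolution_spectral_measure[OF sa[OF \<omega>]])
      show "sets (K k \<omega>) = sets borel" by (simp add: K_def)
      show "subprob_space (K k \<omega>)"
      proof
        show "emeasure (K k \<omega>) (space (K k \<omega>)) \<le> 1"
          using \<phi>1[of k] by (simp add: K_def emeasure_\<mu> pvm_UNIV power_le_one)
      qed (simp add: K_def)
    next
      fix B :: "real set" assume B: "B \<in> sets borel"
      have "(\<lambda>z. indicator B (Re z) :: complex) \<in> borel_measurable borel"
        using B by measurable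
      moreover have "bounded (range (\<lambda>z. indicator B (Re z) :: complex))"
        by (rule boundedI[where B = 1]) (auto simp: indicator_def)
      ultimately have m: "(\<lambda>\<omega>. cinner (borel_calculus (\<lambda>z. indicator B (Re z)) (J \<omega>) (\<phi> k)) (\<phi> k)) \<in> borel_measurable M"
        using J unfolding measurable_family_def by blast
      have "(\<lambda>\<omega>. ennreal (Re (cinner (borel_calculus (\<lambda>z. indicator B (Re z)) (J \<omega>) (\<phi> k)) (\<phi> k)))) \<in> borel_measurable M"
        by (rule measurable_compose[OF measurable_compose[OF m borel_measurable_Re] measurable_ennreal])
      then show "(\<lambda>\<omega>. emeasure (K k \<omega>) B) \<in> borel_measurable M"
      proof (rule measurable_cong[THEN iffD1, rotated])
        fix \<omega> assume \<omega>: "\<omega> \<in> space M"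
        interpret spectral_resolution "J \<omega>" "spectral_measure (J \<omega>)"
          by (rule spectral_resolution_spectral_measure[OF sa[OF \<omega>]])
        show "ennreal (Re (cinner (borel_calculus (\<lambda>z. indicator B (Re z)) (J \<omega>) (\<phi> k)) (\<phi> k))) = emeasure (K k \<omega>) B"
          unfolding borel_calculus_indicator[OF sa[OF \<omega>] B] pvm_quadratic[OF B] K_def emeasure_\<mu>[OF B] by simp
      qed
    qed
    fix \<omega> assume \<omega>: "\<omega> \<in> space M"
    interpret spectral_resolution "J \<omega>" "spectral_measure (J \<omega>)"
      by (rule spectral_resolution_spectral_measure[OF sa[OF \<omega>]])
    let ?E = "spectral_measure (J \<omega>)"
    have "(\<exists>x. ?E {r} x \<noteq> 0) \<longleftrightarrow> (\<exists>k. emeasure (K k \<omega>) {r} \<noteq> 0)" for r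
    proof -
      have sing: "{r} \<in> sets borel" by simp
      have "emeasure (K k \<omega>) {r} \<noteq> 0 \<longleftrightarrow> ?E {r} (\<psi> k) \<noteq> 0" for k
      proof -
        have "?E {r} (\<phi> k) = (1 / (1 + norm (\<psi> k))) *\<^sub>R ?E {r} (\<psi> k)"
          unfolding \<phi>_def by (rule linear_scale[OF complex_linear_linear[OF pvm_linear[OF sing]]])
        moreover have "1 + norm (\<psi> k) > 0" by (intro add_pos_nonneg) auto
        moreover from this have "\<not> 1 + norm (\<psi> k) < 0" "1 + norm (\<psi> k) \<noteq> 0" by linarith+
        ultimately show ?thesis by (simp add: K_def emeasure_\<mu>)
      qed
      moreover have "(\<exists>x. ?E {r} x \<noteq> 0) \<longleftrightarrow> (\<exists>k. ?E {r} (\<psi> k) \<noteq> 0)"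
      proof
        assume "\<exists>x. ?E {r} x \<noteq> 0"
        then obtain x where x: "?E {r} x \<noteq> 0" ..
        then have "norm (?E {r} x) > 0" by simp
        then obtain y where y: "y \<in> S" "dist y x < norm (?E {r} x)"
          using S(2) closure_approachable[of x S] by blast
        have "?E {r} x = ?E {r} y + ?E {r} (x - y)"
          by (simp add: complex_linear_diff[OF pvm_linear[OF sing]])
        moreover have "norm (?E {r} (x - y)) < norm (?E {r} x)"
          using pvm_contraction[OF sing, of "x - y"] y(2) by (simp add: dist_norm norm_minus_commute)
        ultimately have "?E {r} y \<noteq> 0" by auto
        then show "\<exists>k. ?E {r} (\<psi> k) \<noteq> 0" using y(1) range\<psi> by (metis rangeE)
      qed blast
      ultimately show ?thesis by simp
    qed
    then show "point_spectrum type_hspace (J \<omega>) = {r. \<exists>k. emeasure (K k \<omega>) {r} \<noteq> 0}"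
      by (auto simp: point_spectrum_iff)
  qed
qed

text \<open>A finite measure has countably many atoms. For the second claim the projection along
  \<open>r\<close> is replaced by integrals: the mass of those atoms that lie in the section of
  \<open>T\<close> is nonzero for some kernel precisely when the section contains an eigenvalue, and
  integrals over kernels are measurable in \<omega>.\<close>

lemma
  fixes J :: "'w \<Rightarrow> 'h::complex_hilbert_space operator"
  assumes J: "measurable_family M J" and sep: "\<exists>S::'h set. countable S \<and> closure S = UNIV"
  shows countable_point_spectrum: "\<omega> \<in> space M \<Longrightarrow> countable (point_spectrum type_hspace (J \<omega>))"
    and measurable_point_spectrum_meets: "T \<in> sets (M \<Otimes>\<^sub>M borel) \<Longrightarrow>
      {\<omega> \<in> space M. \<exists>r\<in>point_spectrum type_hspace (J \<omega>). (\<omega>, r) \<in> T} \<in> sets M"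
proof -
  obtain K :: "nat \<Rightarrow> 'w \<Rightarrow> real measure" where K': "\<forall>k. K k \<in> measurable M (subprob_algebra borel)"
    and ps': "\<forall>\<omega>\<in>space M. point_spectrum type_hspace (J \<omega>) = {r. \<exists>k. emeasure (K k \<omega>) {r} \<noteq> 0}"
    by (rule point_spectrum_kernels[OF J sep]) blast
  note K [measurable] = K'[rule_format] and ps = ps'[rule_format]
  have Ksub: "subprob_space (K k \<omega>)" and Ksets: "sets (K k \<omega>) = sets borel" if "\<omega> \<in> space M" for k \<omega>
    using subprob_space_kernel[OF K that] sets_kernel[OF K that] by auto
  show "countable (point_spectrum type_hspace (J \<omega>))" if \<omega>: "\<omega> \<in> space M"
  proof -
    have "countable {r. emeasure (K k \<omega>) {r} \<noteq> 0}" for k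
    proof -
      interpret subprob_space "K k \<omega>" by (rule Ksub[OF \<omega>])
      show ?thesis using countable_support by (simp add: emeasure_eq_measure)
    qed
    moreover have "point_spectrum type_hspace (J \<omega>) = (\<Union>k. {r. emeasure (K k \<omega>) {r} \<noteq> 0})"
      using ps[OF \<omega>] by auto
    ultimately show ?thesis by simp
  qed
  assume T [measurable]: "T \<in> sets (M \<Otimes>\<^sub>M borel)"
  \<comment> \<open>\<open>{snd x}\<close> is a section of the diagonal, a measurable set, which
    makes the mass of this moving point jointly measurable.\<close>
  have atom [measurable]: "(\<lambda>x. emeasure (K k (fst x)) {snd x}) \<in> borel_measurable (M \<Otimes>\<^sub>M borel)" for k
  proof -
    have "{x \<in> space ((M \<Otimes>\<^sub>M borel) \<Otimes>\<^sub>M (borel :: real measure)). snd (fst x) = snd x} \<in> sets ((M \<Otimes>\<^sub>M borel) \<Otimes>\<^sub>M borel)"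
      by measurable
    also have "{x \<in> space ((M \<Otimes>\<^sub>M borel) \<Otimes>\<^sub>M (borel :: real measure)). snd (fst x) = snd x} =
        (SIGMA x:space (M \<Otimes>\<^sub>M borel). {snd x})"
      by (auto simp: space_pair_measure)
    finally show ?thesis by (rule emeasure_measurable_subprob_algebra2) measurable
  qed
  define g where "g k \<omega> r = (if (\<omega>, r) \<in> T \<and> emeasure (K k \<omega>) {r} \<noteq> 0 then 1 else 0 :: ennreal)" for k \<omega> r
  have g [measurable]: "(\<lambda>(\<omega>, r). g k \<omega> r) \<in> borel_measurable (M \<Otimes>\<^sub>M borel)" for k
  proof -
    have "(\<lambda>x. if x \<in> T \<and> emeasure (K k (fst x)) {snd x} \<noteq> 0 then 1 else 0 :: ennreal) \<in> borel_measurable (M \<Otimes>\<^sub>M borel)"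
      by measurable
    then show ?thesis by (simp add: g_def case_prod_beta)
  qed
  have int [measurable]: "(\<lambda>\<omega>. \<integral>\<^sup>+r. g k \<omega> r \<partial>K k \<omega>) \<in> borel_measurable M" for k
    by (rule nn_integral_measurable_subprob_algebra2[OF g K])
  have "(\<exists>r\<in>point_spectrum type_hspace (J \<omega>). (\<omega>, r) \<in> T) \<longleftrightarrow> (\<exists>k. (\<integral>\<^sup>+r. g k \<omega> r \<partial>K k \<omega>) \<noteq> 0)"
    if \<omega>: "\<omega> \<in> space M" for \<omega>
  proof
    assume "\<exists>r\<in>point_spectrum type_hspace (J \<omega>). (\<omega>, r) \<in> T"
    then obtain r k where r: "(\<omega>, r) \<in> T" "emeasure (K k \<omega>) {r} \<noteq> 0" using ps[OF \<omega>] by blast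
    have "emeasure (K k \<omega>) {r} = (\<integral>\<^sup>+s. indicator {r} s \<partial>K k \<omega>)"
      using Ksets[OF \<omega>, of k] by simp
    also have "\<dots> \<le> (\<integral>\<^sup>+s. g k \<omega> s \<partial>K k \<omega>)"
      using r by (intro nn_integral_mono) (auto simp: g_def indicator_def)
    finally have "(\<integral>\<^sup>+s. g k \<omega> s \<partial>K k \<omega>) \<noteq> 0" using r(2) by auto
    then show "\<exists>k. (\<integral>\<^sup>+r. g k \<omega> r \<partial>K k \<omega>) \<noteq> 0" ..
  next
    assume "\<exists>k. (\<integral>\<^sup>+r. g k \<omega> r \<partial>K k \<omega>) \<noteq> 0"
    then obtain k where k: "(\<integral>\<^sup>+r. g k \<omega> r \<partial>K k \<omega>) \<noteq> 0" ..
    have "\<exists>r. g k \<omega> r \<noteq> 0"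
    proof (rule ccontr)
      assume "\<not> (\<exists>r. g k \<omega> r \<noteq> 0)"
      then show False using k by simp
    qed
    then show "\<exists>r\<in>point_spectrum type_hspace (J \<omega>). (\<omega>, r) \<in> T"
      using ps[OF \<omega>] by (auto simp: g_def split: if_splits)
  qed
  then have "{\<omega> \<in> space M. \<exists>r\<in>point_spectrum type_hspace (J \<omega>). (\<omega>, r) \<in> T} =
      {\<omega> \<in> space M. \<exists>k. (\<integral>\<^sup>+r. g k \<omega> r \<partial>K k \<omega>) \<noteq> 0}" by blast
  also have "\<dots> \<in> sets M" by measurable
  finally show "{\<omega> \<in> space M. \<exists>r\<in>point_spectrum type_hspace (J \<omega>). (\<omega>, r) \<in> T} \<in> sets M" .
qed

section \<open>Absolutely continuous functions\<close>

text \<open>At points of differentiability the gauge enforces the straddle estimate, with total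
  error at most \<epsilon> (t - s). Points of \<open>N\<close> get intervals inside an open set of
  small measure, where absolute continuity bounds the increments. With the gauge integral,
  integrability of \<open>g\<close> is part of the conclusion.\<close>

theorem absolutely_continuous_FTC:
  fixes F g :: "real \<Rightarrow> complex"
  assumes st: "s \<le> t" and ac: "absolutely_continuous_on s t F" and N: "negligible N"
    and deriv: "\<And>x. x \<in> {s..t} - N \<Longrightarrow> (F has_vector_derivative g x) (at x)"
  shows "(g has_integral (F t - F s)) {s..t}"
proof -
  \<comment> \<open>Resetting \<open>g\<close> to 0 on \<open>N\<close> removes these tags from the
    Riemann sums, so that there it remains to estimate the increments of \<open>F\<close>.\<close>
  define g0 where "g0 x = (if x \<in> N then 0 else g x)" for x
  have "(g0 has_integral (F t - F s)) {s..t}"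
    unfolding has_integral_real
  proof (intro allI impI)
    fix e :: real assume e: "e > 0"
    define \<epsilon> where "\<epsilon> = e / (2 * (t - s + 1))"
    have \<epsilon>: "\<epsilon> > 0" "\<epsilon> * (t - s) < e / 2"
      using e st by (auto simp: \<epsilon>_def field_simps)
    from ac[unfolded absolutely_continuous_on_def, THEN spec, of "e / 2", THEN mp]
    obtain d where d: "d > 0" and acd': "\<forall>D::(real \<times> real) set. finite D \<longrightarrow>
        (\<forall>(x, y)\<in>D. s \<le> x \<and> x \<le> y \<and> y \<le> t) \<longrightarrow> disjoint_family_on (\<lambda>(x, y). {x<..<y}) D \<longrightarrow>
        (\<Sum>(x, y)\<in>D. y - x) < d \<longrightarrow> (\<Sum>(x, y)\<in>D. cmod (F y - F x)) < e / 2"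
      using e by (auto simp only: half_gt_zero)
    note acd = acd'[THEN spec, THEN mp, THEN mp, THEN mp, THEN mp]
    have Nnull: "N \<in> null_sets lebesgue" using N by (simp add: negligible_iff_null_sets)
    obtain T where T: "open T" "N \<subseteq> T" "T - N \<in> lmeasurable" "emeasure lebesgue (T - N) < ennreal d"
      using sets_lebesgue_outer_open[of N d] Nnull d by blast
    have Tm: "T \<in> lmeasurable" and mT: "measure lebesgue T < d"
    proof -
      have eq: "emeasure lebesgue T = emeasure lebesgue (T - N)"
        using Nnull T(1) by (simp add: emeasure_Diff_null_set)
      then show "T \<in> lmeasurable"
        using T by (intro fmeasurableI) (auto simp: less_top[symmetric] fmeasurable_def)
      show "measure lebesgue T < d"
        using T(4) eq d by (simp add: measure_def) (metis enn2real_less_iff ennreal_less_top order.strict_trans)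
    qed
    have "\<exists>\<delta>>0. \<forall>y. norm (y - x) < \<delta> \<longrightarrow> norm (F y - F x - (y - x) *\<^sub>R g x) \<le> \<epsilon> * norm (y - x)"
      if "x \<in> {s..t} - N" for x
      using deriv[OF that] \<epsilon>(1) unfolding has_vector_derivative_def has_derivative_at_alt by blast
    then obtain \<delta> where \<delta>: "\<And>x. x \<in> {s..t} - N \<Longrightarrow> \<delta> x > 0"
      "\<And>x y. x \<in> {s..t} - N \<Longrightarrow> norm (y - x) < \<delta> x \<Longrightarrow> norm (F y - F x - (y - x) *\<^sub>R g x) \<le> \<epsilon> * norm (y - x)"
      by metis
    define \<gamma> where "\<gamma> x = (if x \<in> N then T else if x \<in> {s..t} then ball x (\<delta> x) else UNIV)" for x
    have gauge: "gauge \<gamma>" using T(1,2) \<delta>(1) by (auto simp: gauge_def \<gamma>_def)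
    have fine_bound: "norm ((\<Sum>(x, k)\<in>\<D>. measure lborel k *\<^sub>R g0 x) - (F t - F s)) < e"
      if D: "\<D> tagged_division_of {s..t}" "\<gamma> fine \<D>" for \<D>
    proof -
      have fin: "finite \<D>" using D(1) by blast
      have mem: "x \<in> k" "k \<subseteq> {s..t}" "k = {Inf k..Sup k}" "Inf k \<le> Sup k" "measure lborel k = Sup k - Inf k"
        if xk: "(x, k) \<in> \<D>" for x k
      proof -
        show x: "x \<in> k" and sub: "k \<subseteq> {s..t}" using tagged_division_ofD(2,3)[OF D(1) xk] by auto
        obtain u v where "k = cbox u v" using tagged_division_ofD(4)[OF D(1) xk] by blast
        then have k: "k = {u..v}" "u \<le> v" using x by auto
        then show "k = {Inf k..Sup k}" "Inf k \<le> Sup k" "measure lborel k = Sup k - Inf k" by auto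
      qed
      have disj: "interior k \<inter> interior k' = {}"
        if "(x, k) \<in> \<D>" "(x', k') \<in> \<D>" "(x, k) \<noteq> (x', k')" for x k x' k'
        using tagged_division_ofD(5)[OF D(1) that] .
      have FTC: "F t - F s = (\<Sum>(x, k)\<in>\<D>. F (Sup k) - F (Inf k))"
        using additive_tagged_division_1[OF st D(1), of F] by simp
      \<comment> \<open>Degenerate intervals are left out so that interiors are nonempty; disjoint
        interiors then force different tagged intervals to have different pairs of
        endpoints.\<close>
      define DN where "DN = {(x, k) \<in> \<D>. x \<in> N \<and> Inf k < Sup k}"
      define \<psi> where "\<psi> = (\<lambda>(x :: real, k :: real set). (Inf k, Sup k))"
      have DNsub: "DN \<subseteq> \<D>" by (auto simp: DN_def)
      have finDN: "finite DN" using DNsub fin finite_subset by blast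
      have interior_DN: "interior k = {Inf k<..<Sup k}" "{Inf k<..<Sup k} \<noteq> {}" if "(x, k) \<in> DN" for x k
      proof -
        have "(x, k) \<in> \<D>" and lt: "Inf k < Sup k" using that by (auto simp: DN_def)
        then show "interior k = {Inf k<..<Sup k}" using mem(3) interior_atLeastAtMost_real by metis
        show "{Inf k<..<Sup k} \<noteq> {}" using lt by simp
      qed
      have inj: "inj_on \<psi> DN"
      proof (rule inj_onI, clarify)
        fix x k x' k' assume a: "(x, k) \<in> DN" "(x', k') \<in> DN" "\<psi> (x, k) = \<psi> (x', k')"
        show "x = x' \<and> k = k'"
        proof (rule ccontr)
          assume "\<not> (x = x' \<and> k = k')"
          then have "interior k \<inter> interior k' = {}" using disj a(1,2) DNsub by blast
          then show False using interior_DN[OF a(1)] interior_DN[OF a(2)] a(3) by (simp add: \<psi>_def)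
        qed
      qed
      have dfam: "disjoint_family_on (\<lambda>(x, y). {x<..<y}) (\<psi> ` DN)"
        unfolding disjoint_family_on_def
      proof (intro ballI impI)
        fix i j assume "i \<in> \<psi> ` DN" "j \<in> \<psi> ` DN" and ne: "i \<noteq> j"
        then obtain x k x' k' where a: "(x, k) \<in> DN" "(x', k') \<in> DN" "i = \<psi> (x, k)" "j = \<psi> (x', k')"
          by auto
        then have "(x, k) \<noteq> (x', k')" using ne by auto
        then have "interior k \<inter> interior k' = {}" using disj a(1,2) DNsub by blast
        then show "(case i of (x, y) \<Rightarrow> {x<..<y}) \<inter> (case j of (x, y) \<Rightarrow> {x<..<y}) = {}"
          using interior_DN(1)[OF a(1)] interior_DN(1)[OF a(2)] by (simp add: \<psi>_def a(3,4))
      qed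
      have "(\<Sum>(x, y)\<in>\<psi> ` DN. y - x) = (\<Sum>i\<in>\<psi> ` DN. measure lebesgue (case i of (x, y) \<Rightarrow> {x<..<y}))"
        by (intro sum.cong refl) (auto simp: \<psi>_def DN_def)
      also have "\<dots> = measure lebesgue (\<Union>i\<in>\<psi> ` DN. case i of (x, y) \<Rightarrow> {x<..<y})"
      proof (rule measure_finite_Union[symmetric])
        show "emeasure lebesgue (case i of (x, y) \<Rightarrow> {x<..<y}) \<noteq> \<infinity>" for i :: "real \<times> real"
          using emeasure_lborel_box_finite[of "fst i" "snd i"] by (simp add: split_beta less_top)
      qed (use finDN dfam in auto)
      also have "\<dots> \<le> measure lebesgue T"
      proof (rule measure_mono_fmeasurable[OF _ _ Tm])
        show "(\<Union>i\<in>\<psi> ` DN. case i of (x, y) \<Rightarrow> {x<..<y}) \<subseteq> T"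
        proof
          fix z assume "z \<in> (\<Union>i\<in>\<psi> ` DN. case i of (x, y) \<Rightarrow> {x<..<y})"
          then obtain x k where a: "(x, k) \<in> DN" "z \<in> {Inf k<..<Sup k}" by (auto simp: \<psi>_def)
          then have m: "(x, k) \<in> \<D>" "x \<in> N" by (auto simp: DN_def)
          have "k \<subseteq> \<gamma> x" using D(2) m(1) unfolding fine_def by blast
          then have "k \<subseteq> T" using m(2) by (simp add: \<gamma>_def)
          moreover have "z \<in> {Inf k..Sup k}" using a(2) by simp
          ultimately show "z \<in> T" using mem(3)[OF m(1)] by blast
        qed
        show "(\<Union>i\<in>\<psi> ` DN. case i of (x, y) \<Rightarrow> {x<..<y}) \<in> sets lebesgue"
          using finDN by (intro sets.finite_UN) (auto simp: split_beta)
      qed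
      finally have len: "(\<Sum>(x, y)\<in>\<psi> ` DN. y - x) < d" using mT by linarith
      have "\<forall>(x, y)\<in>\<psi> ` DN. s \<le> x \<and> x \<le> y \<and> y \<le> t"
      proof
        fix i assume "i \<in> \<psi> ` DN"
        then obtain x k where a: "(x, k) \<in> DN" "i = (Inf k, Sup k)" by (auto simp: \<psi>_def)
        then have m: "(x, k) \<in> \<D>" using DNsub by blast
        then have "{Inf k..Sup k} \<subseteq> {s..t}" using mem(2,3)[OF m] by simp
        then show "case i of (x, y) \<Rightarrow> s \<le> x \<and> x \<le> y \<and> y \<le> t" using mem(4)[OF m] a(2) by simp
      qed
      from acd[OF _ this dfam len] finDN
      have "(\<Sum>(x, y)\<in>\<psi> ` DN. cmod (F y - F x)) < e / 2" by simp
      also have "(\<Sum>(x, y)\<in>\<psi> ` DN. cmod (F y - F x)) = (\<Sum>(x, k)\<in>DN. cmod (F (Sup k) - F (Inf k)))"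
        by (subst sum.reindex[OF inj]) (simp add: \<psi>_def split_beta)
      finally have part1: "(\<Sum>(x, k)\<in>DN. cmod (F (Sup k) - F (Inf k))) < e / 2" .
      have bound: "norm (measure lborel k *\<^sub>R g0 x - (F (Sup k) - F (Inf k))) \<le>
          (if (x, k) \<in> DN then cmod (F (Sup k) - F (Inf k)) else 0) + \<epsilon> * measure lborel k"
        if m: "(x, k) \<in> \<D>" for x k
      proof (cases "x \<in> N")
        case True
        then show ?thesis
        proof (cases "Inf k < Sup k")
          case False
          then have "Inf k = Sup k" using mem(4)[OF m] by simp
          then show ?thesis using True mem(5)[OF m] by (simp add: g0_def)
        qed (use True m \<epsilon>(1) mem(5)[OF m] in \<open>auto simp: g0_def DN_def norm_minus_commute\<close>)
      next
        case False
        have xs: "x \<in> {s..t} - N" using False mem(1,2)[OF m] by blast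
        have "k \<subseteq> \<gamma> x" using D(2) m unfolding fine_def by blast
        then have kb: "k \<subseteq> ball x (\<delta> x)" using False xs by (simp add: \<gamma>_def)
        have ends: "Inf k \<in> k" "Sup k \<in> k" "Inf k \<le> x" "x \<le> Sup k"
          using mem(1,3,4)[OF m] by (metis atLeastAtMost_iff order_refl)+
        have 1: "norm (F (Sup k) - F x - (Sup k - x) *\<^sub>R g x) \<le> \<epsilon> * norm (Sup k - x)"
          by (rule \<delta>(2)[OF xs]) (use kb ends in \<open>auto simp: dist_real_def\<close>)
        have 2: "norm (F (Inf k) - F x - (Inf k - x) *\<^sub>R g x) \<le> \<epsilon> * norm (Inf k - x)"
          by (rule \<delta>(2)[OF xs]) (use kb ends in \<open>auto simp: dist_real_def\<close>)
        have "measure lborel k *\<^sub>R g0 x - (F (Sup k) - F (Inf k)) =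
           (F (Inf k) - F x - (Inf k - x) *\<^sub>R g x) - (F (Sup k) - F x - (Sup k - x) *\<^sub>R g x)"
          using False by (simp add: mem(5)[OF m] g0_def algebra_simps)
        also have "norm \<dots> \<le> \<epsilon> * norm (Inf k - x) + \<epsilon> * norm (Sup k - x)"
          using norm_triangle_ineq4 1 2 by (meson add_mono order_trans)
        also have "\<dots> = \<epsilon> * measure lborel k" using ends(3,4) by (simp add: mem(5)[OF m] algebra_simps)
        finally show ?thesis by (simp add: add_increasing)
      qed
      have "norm ((\<Sum>(x, k)\<in>\<D>. measure lborel k *\<^sub>R g0 x) - (F t - F s)) =
          norm (\<Sum>(x, k)\<in>\<D>. measure lborel k *\<^sub>R g0 x - (F (Sup k) - F (Inf k)))"
        unfolding FTC by (simp add: sum_subtractf split_beta)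
      also have "\<dots> \<le> (\<Sum>(x, k)\<in>\<D>. (if (x, k) \<in> DN then cmod (F (Sup k) - F (Inf k)) else 0) + \<epsilon> * measure lborel k)"
        by (rule sum_norm_le) (use bound in auto)
      also have "\<dots> = (\<Sum>(x, k)\<in>\<D>. if (x, k) \<in> DN then cmod (F (Sup k) - F (Inf k)) else 0) + \<epsilon> * (\<Sum>(x, k)\<in>\<D>. measure lborel k)"
        by (simp add: split_beta sum.distrib sum_distrib_left)
      also have "(\<Sum>(x, k)\<in>\<D>. if (x, k) \<in> DN then cmod (F (Sup k) - F (Inf k)) else 0) = (\<Sum>(x, k)\<in>DN. cmod (F (Sup k) - F (Inf k)))"
        using fin DNsub by (intro sum.mono_neutral_cong_right) auto
      also have "(\<Sum>(x, k)\<in>\<D>. measure lborel k) = t - s"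
        using additive_content_tagged_division[of \<D> s t] D(1) st by simp
      finally show ?thesis using part1 \<epsilon>(2) by linarith
    qed
    show "\<exists>\<gamma>. gauge \<gamma> \<and> (\<forall>\<D>. \<D> tagged_division_of {s..t} \<and> \<gamma> fine \<D> \<longrightarrow>
        norm ((\<Sum>(x, k)\<in>\<D>. measure lborel k *\<^sub>R g0 x) - (F t - F s)) < e)"
    proof (intro exI[of _ \<gamma>] conjI allI impI gauge, elim conjE)
      fix \<D> assume "\<D> tagged_division_of {s..t}" "\<gamma> fine \<D>"
      then show "norm ((\<Sum>(x, k)\<in>\<D>. measure lborel k *\<^sub>R g0 x) - (F t - F s)) < e"
        by (rule fine_bound)
    qed
  qed
  then show ?thesis by (rule has_integral_spike[OF N, rotated]) (simp add: g0_def)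
qed

text \<open>Points at which the difference quotients stay away from g are covered, in the sense of Vitali, by
  intervals on which Henstock's lemma is violated.\<close>

theorem has_vector_derivative_indefinite_integral:
  fixes g :: "real \<Rightarrow> real"
  assumes g: "g integrable_on {s..t}"
  obtains N where "negligible N"
    "\<And>x. x \<in> {s<..<t} - N \<Longrightarrow> ((\<lambda>x. integral {s..x} g) has_vector_derivative g x) (at x)"
proof -
  define F where "F x = integral {s..x} g" for x
  have Fdiff: "F v - F u = integral {u..v} g" if "s \<le> u" "u \<le> v" "v \<le> t" for u v
  proof -
    have "integral {s..u} g + integral {u..v} g = integral {s..v} g"
      using that g integrable_subinterval_real[OF g, of s v] by (intro Henstock_Kurzweil_Integration.integral_combine) auto
    then show ?thesis by (simp add: F_def)
  qed
  \<comment> \<open>\<open>y\<close> witnesses that the difference quotient at \<open>x\<close>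
    misses \<open>g x\<close> by at least 1 / (n + 1).\<close>
  define bad where "bad n x y \<longleftrightarrow> y \<in> {s..t} \<and> y \<noteq> x \<and> \<bar>y - x\<bar> / real (Suc n) \<le> \<bar>F y - F x - (y - x) * g x\<bar>" for n x y
  define E where "E n = {x \<in> {s<..<t}. \<forall>\<delta>>0. \<exists>y. \<bar>y - x\<bar> < \<delta> \<and> bad n x y}" for n
  have "negligible (E n)" for n
    unfolding negligible_outer_le
  proof (intro allI impI)
    fix e :: real assume e: "e > 0"
    then have "e / real (Suc n) > 0" by simp
    then obtain \<gamma> where \<gamma>: "gauge \<gamma>" and H: "\<And>p. p tagged_partial_division_of {s..t} \<Longrightarrow> \<gamma> fine p \<Longrightarrow>
        (\<Sum>(x, k)\<in>p. norm (measure lborel k *\<^sub>R g x - integral k g)) < e / real (Suc n)"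
      using Henstock_lemma[of g s t "e / real (Suc n)"] g by (auto simp: cbox_interval)
    \<comment> \<open>The interval between \<open>x\<close> and \<open>y\<close>, written as a
      closed ball around its midpoint to match the Vitali covering theorem.\<close>
    define k where "k = (\<lambda>(x :: real, y). cball ((x + y) / 2) (\<bar>y - x\<bar> / 2))"
    have k_eq: "k (x, y) = {min x y..max x y}" for x y
      by (auto simp: k_def cball_eq_atLeastAtMost min_def max_def field_simps)
    define I where "I = {(x, y). x \<in> E n \<and> bad n x y \<and> k (x, y) \<subseteq> \<gamma> x}"
    have rpos: "0 < \<bar>snd i - fst i\<bar> / 2" if "i \<in> I" for i
      using that by (auto simp: I_def bad_def)
    have cover: "\<exists>i. i \<in> I \<and> x \<in> cball ((fst i + snd i) / 2) (\<bar>snd i - fst i\<bar> / 2) \<and> \<bar>snd i - fst i\<bar> / 2 < d"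
      if x: "x \<in> E n" and d: "d > 0" for x d
    proof -
      obtain r where r: "r > 0" "ball x r \<subseteq> \<gamma> x"
        using \<gamma> unfolding gauge_def by (meson open_contains_ball)
      have "\<forall>\<delta>>0. \<exists>y. \<bar>y - x\<bar> < \<delta> \<and> bad n x y" using x by (simp add: E_def)
      then have "\<exists>y. \<bar>y - x\<bar> < min r d \<and> bad n x y"
        by (rule allE[where x = "min r d"]) (use r(1) d in simp)
      then obtain y where y: "\<bar>y - x\<bar> < min r d" "bad n x y" by blast
      have "k (x, y) \<subseteq> ball x r" using y(1) by (auto simp: k_eq dist_real_def)
      then have "(x, y) \<in> I" using x y(2) r(2) by (auto simp: I_def)
      moreover have "x \<in> k (x, y)" by (simp add: k_eq)
      ultimately show ?thesis using y(1) by (intro exI[of _ "(x, y)"]) (auto simp: k_def)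
    qed
    obtain C where C: "countable C" "C \<subseteq> I"
      "pairwise (\<lambda>i j. disjnt (cball ((fst i + snd i) / 2) (\<bar>snd i - fst i\<bar> / 2)) (cball ((fst j + snd j) / 2) (\<bar>snd j - fst j\<bar> / 2))) C"
      "negligible (E n - (\<Union>i\<in>C. cball ((fst i + snd i) / 2) (\<bar>snd i - fst i\<bar> / 2)))"
      by (rule Vitali_covering_theorem_cballs[of I "\<lambda>i. \<bar>snd i - fst i\<bar> / 2" "E n" "\<lambda>i. (fst i + snd i) / 2"])
        (use rpos cover in blast)+
    have kC: "cball ((fst i + snd i) / 2) (\<bar>snd i - fst i\<bar> / 2) = k i" for i by (simp add: k_def split_beta)
    note C = C[unfolded kC]
    \<comment> \<open>A finite disjoint subfamily is a tagged partial division fine for \<gamma>.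
      Badness bounds each length by n + 1 times its Henstock error, and these errors sum to less
      than e / (n + 1).\<close>
    have bound: "measure lebesgue (\<Union>i\<in>C'. k i) \<le> e" if C': "C' \<subseteq> C" "finite C'" for C'
    proof -
      define p where "p = (\<lambda>i. (fst i, k i)) ` C'"
      have C'I: "i \<in> C' \<Longrightarrow> i \<in> I" for i using C' C(2) by blast
      have disj: "k i \<inter> k j = {}" if "i \<in> C'" "j \<in> C'" "i \<noteq> j" for i j
        using C(3) C'(1) that by (auto simp: pairwise_def disjnt_def)
      have fk: "fst i \<in> k i" for i by (cases i) (simp add: k_eq)
      have ksub: "k i \<subseteq> {s..t}" if "i \<in> C'" for i
        using C'I[OF that] by (cases i) (auto simp: I_def E_def bad_def k_eq)
      have inj: "inj_on (\<lambda>i. (fst i, k i)) C'"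
        by (rule inj_onI) (use disj fk in blast)
      have part: "p tagged_partial_division_of {s..t}"
        unfolding tagged_partial_division_of_def p_def
      proof (intro conjI allI impI)
        show "finite ((\<lambda>i. (fst i, k i)) ` C')" using C'(2) by simp
      next
        fix x K assume "(x, K) \<in> (\<lambda>i. (fst i, k i)) ` C'"
        then obtain i where i: "i \<in> C'" "x = fst i" "K = k i" by auto
        then show "x \<in> K" "K \<subseteq> {s..t}" using fk ksub by auto
        show "\<exists>a b. K = cbox a b" using i(3) by (cases i) (auto simp: k_eq cbox_interval)
      next
        fix x1 K1 x2 K2
        assume "(x1, K1) \<in> (\<lambda>i. (fst i, k i)) ` C' \<and> (x2, K2) \<in> (\<lambda>i. (fst i, k i)) ` C' \<and> (x1, K1) \<noteq> (x2, K2)"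
        then obtain i j where "i \<in> C'" "j \<in> C'" "i \<noteq> j" "K1 = k i" "K2 = k j" by auto
        then have "K1 \<inter> K2 = {}" using disj by blast
        then show "interior K1 \<inter> interior K2 = {}" using interior_subset by blast
      qed
      have "k i \<subseteq> \<gamma> (fst i)" if "i \<in> C'" for i
        using C'I[OF that] by (cases i) (auto simp: I_def)
      then have "\<gamma> fine p" unfolding fine_def p_def by blast
      note Hp = H[OF part this]
      have each: "measure lborel (k i) \<le> real (Suc n) * norm (measure lborel (k i) *\<^sub>R g (fst i) - integral (k i) g)" if "i \<in> C'" for i
      proof -
        obtain x y where i: "i = (x, y)" by (cases i)
        have b: "bad n x y" and xs: "x \<in> {s<..<t}" using C'I[OF that] by (auto simp: I_def i E_def)
        have c: "measure lborel (k i) = \<bar>y - x\<bar>" by (simp add: i k_eq max_def min_def)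
        have "\<bar>y - x\<bar> * g x - integral (k i) g = (if x \<le> y then 1 else -1) * ((y - x) * g x - (F y - F x))"
          using Fdiff[of x y] Fdiff[of y x] b xs by (auto simp: i k_eq max_def min_def bad_def algebra_simps)
        moreover have "norm (measure lborel (k i) *\<^sub>R g (fst i) - integral (k i) g) = \<bar>\<bar>y - x\<bar> * g x - integral (k i) g\<bar>"
          unfolding c real_scaleR_def real_norm_def by (simp add: i)
        ultimately have "norm (measure lborel (k i) *\<^sub>R g (fst i) - integral (k i) g) = \<bar>F y - F x - (y - x) * g x\<bar>"
          by (simp only:) (auto simp: abs_mult)
        moreover have "\<bar>y - x\<bar> \<le> real (Suc n) * \<bar>F y - F x - (y - x) * g x\<bar>"
          using b by (simp add: bad_def field_simps del: of_nat_Suc)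
        ultimately show ?thesis by (simp only: c)
      qed
      have "measure lebesgue (\<Union>i\<in>C'. k i) \<le> (\<Sum>i\<in>C'. measure lebesgue (k i))"
        using C'(2) by (intro measure_UNION_le) (auto simp: k_def split_beta)
      also have "\<dots> = (\<Sum>i\<in>C'. measure lborel (k i))"
        by (intro sum.cong refl) (auto simp: k_def split_beta)
      also have "\<dots> \<le> (\<Sum>i\<in>C'. real (Suc n) * norm (measure lborel (k i) *\<^sub>R g (fst i) - integral (k i) g))"
        by (intro sum_mono each)
      also have "\<dots> = real (Suc n) * (\<Sum>(x, k)\<in>p. norm (measure lborel k *\<^sub>R g x - integral k g))"
        unfolding p_def by (subst sum.reindex[OF inj]) (simp add: sum_distrib_left)
      also have "\<dots> \<le> real (Suc n) * (e / real (Suc n))"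
        using Hp by (intro mult_left_mono) auto
      also have "\<dots> = e" by simp
      finally show ?thesis .
    qed
    have km: "k i \<in> lmeasurable" for i by (simp add: k_def split_beta)
    have U: "(\<Union>i\<in>C. k i) \<in> lmeasurable" "measure lebesgue (\<Union>i\<in>C. k i) \<le> e"
      by (rule fmeasurable_UN_bound[OF C(1) km bound] measure_UN_bound[OF C(1) km bound]; assumption)+
    let ?R = "E n - (\<Union>i\<in>C. k i)"
    have R: "?R \<in> null_sets lebesgue" using C(4) by (simp add: negligible_iff_null_sets)
    show "\<exists>T. E n \<subseteq> T \<and> T \<in> lmeasurable \<and> measure lebesgue T \<le> e"
    proof (intro exI[of _ "(\<Union>i\<in>C. k i) \<union> ?R"] conjI)
      show "(\<Union>i\<in>C. k i) \<union> ?R \<in> lmeasurable"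
        by (rule fmeasurable.Un[OF U(1) negligible_imp_measurable[OF C(4)]])
      have "measure lebesgue ((\<Union>i\<in>C. k i) \<union> ?R) = measure lebesgue (\<Union>i\<in>C. k i)"
        using U(1) R by (intro measure_Un_null_set) auto
      then show "measure lebesgue ((\<Union>i\<in>C. k i) \<union> ?R) \<le> e" using U(2) by simp
    qed auto
  qed
  then have neg: "negligible (\<Union>n. E n)" by (intro negligible_countable_Union) auto
  have "(F has_vector_derivative g x) (at x)" if x: "x \<in> {s<..<t} - (\<Union>n. E n)" for x
    unfolding has_vector_derivative_def has_derivative_at_alt
  proof (intro conjI allI impI)
    fix e :: real assume "e > 0"
    then obtain n where n: "inverse (real (Suc n)) < e" using reals_Archimedean by blast
    obtain \<delta> where \<delta>: "\<delta> > 0" "\<And>y. \<bar>y - x\<bar> < \<delta> \<Longrightarrow> \<not> bad n x y"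
      using x unfolding E_def by blast
    define d where "d = min \<delta> (min (x - s) (t - x))"
    have "norm (F y - F x - (y - x) *\<^sub>R g x) \<le> e * norm (y - x)" if "norm (y - x) < d" for y
    proof (cases "y = x")
      case False
      have "y \<in> {s..t}" using that by (auto simp: d_def)
      then have "\<bar>F y - F x - (y - x) * g x\<bar> < \<bar>y - x\<bar> / real (Suc n)"
        using \<delta>(2)[of y] that False by (auto simp: bad_def d_def)
      also have "\<dots> = inverse (real (Suc n)) * \<bar>y - x\<bar>" by (simp add: field_simps)
      also have "\<dots> \<le> e * \<bar>y - x\<bar>" using n by (intro mult_right_mono) auto
      finally show ?thesis by simp
    qed simp
    moreover have "d > 0" using x \<delta>(1) by (simp add: d_def)
    ultimately show "\<exists>d>0. \<forall>y. norm (y - x) < d \<longrightarrow> norm (F y - F x - (y - x) *\<^sub>R g x) \<le> e * norm (y - x)" by blast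
  qed (rule bounded_linear_scaleR_left)
  then show thesis using that[OF neg] by (simp add: F_def[abs_def])
qed

section \<open>Calculus of absolutely continuous functions\<close>

lemma sigma_finite_lebesgue: "sigma_finite_measure (lebesgue :: real measure)"
proof
  have "(\<Union>n. cball 0 (real n)) = (UNIV :: real set)"
    using real_arch_simple by (auto simp: dist_real_def)
  then show "\<exists>A::real set set. countable A \<and> A \<subseteq> sets lebesgue \<and> \<Union> A = space lebesgue \<and> (\<forall>a\<in>A. emeasure lebesgue a \<noteq> \<infinity>)"
    by (intro exI[of _ "range (\<lambda>n::nat. cball 0 (real n))"])
      (auto simp: fmeasurableD2[OF lmeasurable_cball, simplified])
qed

lemma ac_dominated:
  assumes G: "absolutely_continuous_on s t G" and H: "absolutely_continuous_on s t H" and C: "C \<ge> 0"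
    and le: "\<And>x y. s \<le> x \<Longrightarrow> x \<le> y \<Longrightarrow> y \<le> t \<Longrightarrow> cmod (F y - F x) \<le> C * (cmod (G y - G x) + cmod (H y - H x))"
  shows "absolutely_continuous_on s t F"
  unfolding absolutely_continuous_on_def
proof (intro allI impI)
  fix e :: real assume e: "e > 0"
  define e' where "e' = e / (2 * C + 1)"
  have e': "e' > 0" "2 * C * e' < e" using e C by (auto simp: e'_def field_simps)
  obtain d1 where d1: "d1 > 0" "\<forall>D::(real \<times> real) set. finite D \<longrightarrow> (\<forall>(x, y)\<in>D. s \<le> x \<and> x \<le> y \<and> y \<le> t) \<longrightarrow>
        disjoint_family_on (\<lambda>(x, y). {x<..<y}) D \<longrightarrow> (\<Sum>(x, y)\<in>D. y - x) < d1 \<longrightarrow>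
        (\<Sum>(x, y)\<in>D. cmod (G y - G x)) < e'"
    using G[unfolded absolutely_continuous_on_def, THEN spec, of e', THEN mp, OF e'(1)] by (elim exE conjE) (rule that)
  obtain d2 where d2: "d2 > 0" "\<forall>D::(real \<times> real) set. finite D \<longrightarrow> (\<forall>(x, y)\<in>D. s \<le> x \<and> x \<le> y \<and> y \<le> t) \<longrightarrow>
        disjoint_family_on (\<lambda>(x, y). {x<..<y}) D \<longrightarrow> (\<Sum>(x, y)\<in>D. y - x) < d2 \<longrightarrow>
        (\<Sum>(x, y)\<in>D. cmod (H y - H x)) < e'"
    using H[unfolded absolutely_continuous_on_def, THEN spec, of e', THEN mp, OF e'(1)] by (elim exE conjE) (rule that)
  have "(\<Sum>(x, y)\<in>D. cmod (F y - F x)) < e"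
    if D: "finite D" "\<forall>(x, y)\<in>D. s \<le> x \<and> x \<le> y \<and> y \<le> t" "disjoint_family_on (\<lambda>(x, y). {x<..<y}) D"
      "(\<Sum>(x, y)\<in>D. y - x) < min d1 d2" for D :: "(real \<times> real) set"
  proof -
    have g: "(\<Sum>(x, y)\<in>D. cmod (G y - G x)) < e'"
      by (rule d1(2)[THEN spec, THEN mp, THEN mp, THEN mp, THEN mp, OF D(1-3)]) (use D(4) in simp)
    have h: "(\<Sum>(x, y)\<in>D. cmod (H y - H x)) < e'"
      by (rule d2(2)[THEN spec, THEN mp, THEN mp, THEN mp, THEN mp, OF D(1-3)]) (use D(4) in simp)
    have "(\<Sum>(x, y)\<in>D. cmod (F y - F x)) \<le> (\<Sum>(x, y)\<in>D. C * (cmod (G y - G x) + cmod (H y - H x)))"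
      using D(2) le by (intro sum_mono) auto
    also have "\<dots> = C * ((\<Sum>(x, y)\<in>D. cmod (G y - G x)) + (\<Sum>(x, y)\<in>D. cmod (H y - H x)))"
      by (simp add: split_beta sum_distrib_left[symmetric] sum.distrib[symmetric])
    also have "\<dots> \<le> C * (e' + e')" using g h C by (intro mult_left_mono) auto
    also have "\<dots> < e" using e'(2) by (simp add: algebra_simps)
    finally show ?thesis .
  qed
  then show "\<exists>d>0. \<forall>D. finite D \<longrightarrow> (\<forall>(x, y)\<in>D. s \<le> x \<and> x \<le> y \<and> y \<le> t) \<longrightarrow>
        disjoint_family_on (\<lambda>(x, y). {x<..<y}) D \<longrightarrow> (\<Sum>(x, y)\<in>D. y - x) < d \<longrightarrow>
        (\<Sum>(x, y)\<in>D. cmod (F y - F x)) < e"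
    using d1(1) d2(1) by (intro exI[of _ "min d1 d2"]) auto
qed

lemma ac_of_real: "absolutely_continuous_on s t (\<lambda>x. complex_of_real x)"
  unfolding absolutely_continuous_on_def
proof (intro allI impI)
  fix e :: real assume "e > 0"
  have "(\<Sum>(x, y)\<in>D. cmod (complex_of_real y - complex_of_real x)) = (\<Sum>(x, y)\<in>D. y - x)"
    if "\<forall>(x, y)\<in>D. s \<le> x \<and> x \<le> y \<and> y \<le> t" for D
    using that by (intro sum.cong refl) (auto simp flip: of_real_diff)
  then show "\<exists>d>0. \<forall>D. finite D \<longrightarrow> (\<forall>(x, y)\<in>D. s \<le> x \<and> x \<le> y \<and> y \<le> t) \<longrightarrow>
        disjoint_family_on (\<lambda>(x, y). {x<..<y}) D \<longrightarrow> (\<Sum>(x, y)\<in>D. y - x) < d \<longrightarrow>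
        (\<Sum>(x, y)\<in>D. cmod (complex_of_real y - complex_of_real x)) < e"
    using \<open>e > 0\<close> by (intro exI[of _ e]) auto
qed

lemma ac_lipschitz:
  assumes "\<And>x y. s \<le> x \<Longrightarrow> x \<le> y \<Longrightarrow> y \<le> t \<Longrightarrow> cmod (F y - F x) \<le> C * (y - x)" "C \<ge> 0"
  shows "absolutely_continuous_on s t F"
proof (rule ac_dominated[OF ac_of_real ac_of_real assms(2)])
  fix x y assume xy: "s \<le> x" "x \<le> y" "y \<le> t"
  have "cmod (F y - F x) \<le> C * (y - x)" by (rule assms(1)[OF xy])
  also have "\<dots> \<le> C * (cmod (complex_of_real y - complex_of_real x) + cmod (complex_of_real y - complex_of_real x))"
    using xy assms(2) by (intro mult_left_mono) (auto simp flip: of_real_diff)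
  finally show "cmod (F y - F x) \<le> C * (cmod (complex_of_real y - complex_of_real x) + cmod (complex_of_real y - complex_of_real x))" .
qed

lemma ac_subinterval:
  assumes "absolutely_continuous_on s t F" "s \<le> s'" "t' \<le> t" shows "absolutely_continuous_on s' t' F"
  unfolding absolutely_continuous_on_def
proof (intro allI impI)
  fix e :: real assume e: "e > 0"
  obtain d where d: "d > 0" "\<forall>D::(real \<times> real) set. finite D \<longrightarrow> (\<forall>(x, y)\<in>D. s \<le> x \<and> x \<le> y \<and> y \<le> t) \<longrightarrow>
        disjoint_family_on (\<lambda>(x, y). {x<..<y}) D \<longrightarrow> (\<Sum>(x, y)\<in>D. y - x) < d \<longrightarrow>
        (\<Sum>(x, y)\<in>D. cmod (F y - F x)) < e"
    using assms(1)[unfolded absolutely_continuous_on_def, THEN spec, of e, THEN mp, OF e] by (elim exE conjE) (rule that)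
  have "\<forall>(x, y)\<in>D. s \<le> x \<and> x \<le> y \<and> y \<le> t" if "\<forall>(x, y)\<in>D. s' \<le> x \<and> x \<le> y \<and> y \<le> t'" for D :: "(real \<times> real) set"
    using that assms(2,3) by force
  then show "\<exists>d>0. \<forall>D. finite D \<longrightarrow> (\<forall>(x, y)\<in>D. s' \<le> x \<and> x \<le> y \<and> y \<le> t') \<longrightarrow>
        disjoint_family_on (\<lambda>(x, y). {x<..<y}) D \<longrightarrow> (\<Sum>(x, y)\<in>D. y - x) < d \<longrightarrow>
        (\<Sum>(x, y)\<in>D. cmod (F y - F x)) < e"
    using d by (intro exI[of _ d]) simp
qed

lemma ac_continuous_on:
  assumes "absolutely_continuous_on s t F" shows "continuous_on {s..t} F"
  unfolding continuous_on_iff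
proof (intro ballI allI impI)
  fix x e :: real assume x: "x \<in> {s..t}" and e: "e > 0"
  obtain d where d: "d > 0" "\<forall>D::(real \<times> real) set. finite D \<longrightarrow> (\<forall>(x, y)\<in>D. s \<le> x \<and> x \<le> y \<and> y \<le> t) \<longrightarrow>
        disjoint_family_on (\<lambda>(x, y). {x<..<y}) D \<longrightarrow> (\<Sum>(x, y)\<in>D. y - x) < d \<longrightarrow>
        (\<Sum>(x, y)\<in>D. cmod (F y - F x)) < e"
    using assms[unfolded absolutely_continuous_on_def, THEN spec, of e, THEN mp, OF e] by (elim exE conjE) (rule that)
  have *: "cmod (F y - F x) < e" if "x \<in> {s..t}" "y \<in> {s..t}" "x \<le> y" "y - x < d" for x y
    using d(2)[THEN spec, of "{(x, y)}"] that by (simp add: disjoint_family_on_def)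
  show "\<exists>d>0. \<forall>y\<in>{s..t}. dist y x < d \<longrightarrow> dist (F y) (F x) < e"
  proof (intro exI[of _ d] conjI ballI impI d(1))
    fix y assume "y \<in> {s..t}" "dist y x < d"
    then show "dist (F y) (F x) < e"
      using *[of x y] *[of y x] x by (cases "x \<le> y") (auto simp: dist_norm norm_minus_commute)
  qed
qed

lemma ac_mult:
  assumes F: "absolutely_continuous_on s t F" and G: "absolutely_continuous_on s t G"
  shows "absolutely_continuous_on s t (\<lambda>x. F x * G x)"
proof -
  obtain B where B: "\<forall>x\<in>F ` {s..t}. norm x \<le> B"
    using compact_imp_bounded[OF compact_continuous_image[OF ac_continuous_on[OF F]]] bounded_iff by blast
  obtain C where C: "\<forall>x\<in>G ` {s..t}. norm x \<le> C"
    using compact_imp_bounded[OF compact_continuous_image[OF ac_continuous_on[OF G]]] bounded_iff by blast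
  let ?K = "\<bar>B\<bar> + \<bar>C\<bar>"
  show ?thesis
  proof (rule ac_dominated[OF F G, of ?K])
    fix x y assume xy: "s \<le> x" "x \<le> y" "y \<le> t"
    have b: "cmod (F y) \<le> ?K" "cmod (G x) \<le> ?K"
      using B[rule_format, of "F y"] C[rule_format, of "G x"] xy by auto
    have "F y * G y - F x * G x = (F y - F x) * G x + F y * (G y - G x)" by (simp add: algebra_simps)
    then have "cmod (F y * G y - F x * G x) \<le> cmod (F y - F x) * cmod (G x) + cmod (F y) * cmod (G y - G x)"
      by (metis norm_mult norm_triangle_ineq)
    also have "\<dots> \<le> cmod (F y - F x) * ?K + ?K * cmod (G y - G x)"
      using b by (intro add_mono mult_left_mono mult_right_mono) auto
    finally show "cmod (F y * G y - F x * G x) \<le> ?K * (cmod (F y - F x) + cmod (G y - G x))"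
      by (simp add: algebra_simps)
  qed simp
qed

lemma ac_add:
  assumes F: "absolutely_continuous_on s t F" and G: "absolutely_continuous_on s t G"
  shows "absolutely_continuous_on s t (\<lambda>x. F x + G x)"
proof (rule ac_dominated[OF F G, of 1])
  fix x y
  have "(F y + G y) - (F x + G x) = (F y - F x) + (G y - G x)" by simp
  then show "cmod ((F y + G y) - (F x + G x)) \<le> 1 * (cmod (F y - F x) + cmod (G y - G x))"
    using norm_triangle_ineq by (simp only: mult_1_left)
qed simp

lemma ac_const: "absolutely_continuous_on s t (\<lambda>x. c)"
  by (rule ac_lipschitz[of _ _ _ 0]) auto

lemma ac_power: "absolutely_continuous_on s t F \<Longrightarrow> absolutely_continuous_on s t (\<lambda>x. F x ^ n)"
  by (induction n) (auto intro: ac_const ac_mult)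

lemma ac_diff:
  "absolutely_continuous_on s t F \<Longrightarrow> absolutely_continuous_on s t G \<Longrightarrow> absolutely_continuous_on s t (\<lambda>x. F x - G x)"
  using ac_add[OF _ ac_mult[OF ac_const[of s t "-1"]], of F G] by simp

text \<open>Split |h| at a level \<open>n\<close>: the part above it, \<open>W n\<close>, has
  integral below e / 2 by dominated convergence, and the part below contributes at most
  \<open>n\<close> times the total length.\<close>

lemma ac_indefinite_integral:
  fixes h :: "real \<Rightarrow> real"
  assumes h: "h absolutely_integrable_on {s..t}"
  shows "absolutely_continuous_on s t (\<lambda>x. complex_of_real (integral {s..x} h))"
  unfolding absolutely_continuous_on_def
proof (intro allI impI)
  fix e :: real assume e: "e > 0"
  define w where "w = (\<lambda>x. indicator {s..t} x * \<bar>h x\<bar>)"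
  have w: "integrable lebesgue w"
    using set_integrable_abs[OF h] by (simp add: set_integrable_def w_def)
  then have wm [measurable]: "w \<in> borel_measurable lebesgue" by simp
  define W where "W n x = (if w x \<le> real n then 0 else w x)" for n :: nat and x
  have Wm [measurable]: "W n \<in> borel_measurable lebesgue" for n unfolding W_def by measurable
  have Wle: "norm (W n x) \<le> w x" for n x by (auto simp: W_def w_def)
  have Wint: "integrable lebesgue (W n)" for n
    by (rule Bochner_Integration.integrable_bound[OF w]) (auto simp: W_def)
  have "(\<lambda>n. \<integral>x. W n x \<partial>lebesgue) \<longlonglongrightarrow> (\<integral>x. 0 \<partial>(lebesgue :: real measure))"
  proof (rule integral_dominated_convergence[OF _ _ w])
    show "AE x in lebesgue. (\<lambda>n. W n x) \<longlonglongrightarrow> 0"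
    proof (rule AE_I2)
      fix x
      obtain N where N: "w x \<le> real N" using real_arch_simple by blast
      then have "W n x = 0" if "n \<ge> N" for n using that by (simp add: W_def)
      then show "(\<lambda>n. W n x) \<longlonglongrightarrow> 0" by (intro tendsto_eventually) (auto simp: eventually_sequentially)
    qed
  qed (simp_all add: Wle[unfolded real_norm_def])
  then have "\<forall>\<^sub>F n in sequentially. (\<integral>x. W n x \<partial>lebesgue) < e / 2"
    using e by (intro order_tendstoD(2)[of _ 0]) auto
  then obtain n where n: "(\<integral>x. W n x \<partial>lebesgue) < e / 2" by (auto simp: eventually_sequentially)
  define d where "d = e / (2 * (real n + 1))"
  have d: "d > 0" "real n * d < e / 2" using e by (auto simp: d_def field_simps)
  have "(\<Sum>(x, y)\<in>D. cmod (complex_of_real (integral {s..y} h) - complex_of_real (integral {s..x} h))) < e"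
    if D: "finite D" "\<forall>(x, y)\<in>D. s \<le> x \<and> x \<le> y \<and> y \<le> t" "disjoint_family_on (\<lambda>(x, y). {x<..<y}) D"
      "(\<Sum>(x, y)\<in>D. y - x) < d" for D :: "(real \<times> real) set"
  proof -
    define I where "I = (\<lambda>i::real \<times> real. {fst i<..<snd i})"
    have Im [measurable]: "I i \<in> sets lebesgue" for i by (simp add: I_def)
    have IW: "integrable lebesgue (\<lambda>x. indicator (I i) x * W n x)" for i
      using integrable_mult_indicator[OF Im Wint, of i n] by simp
    have each: "cmod (complex_of_real (integral {s..snd i} h) - complex_of_real (integral {s..fst i} h)) \<le>
        (\<integral>x. indicator (I i) x * W n x \<partial>lebesgue) + real n * (snd i - fst i)" if i: "i \<in> D" for i
    proof -
      obtain x y where ixy: "i = (x, y)" by (cases i)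
      have xy: "s \<le> x" "x \<le> y" "y \<le> t" using D(2) i ixy by auto
      have hi: "h integrable_on {s..t}" using h by (rule set_lebesgue_integral_eq_integral(1))
      have hxy: "h absolutely_integrable_on {x..y}"
        using h by (rule set_integrable_subset) (use xy in auto)
      have hxyo: "h absolutely_integrable_on {x<..<y}"
        by (rule set_integrable_subset[OF hxy]) (auto intro: less_imp_le)
      have "integral {s..x} h + integral {x..y} h = integral {s..y} h"
        using xy integrable_subinterval_real[OF hi, of s y]
        by (intro Henstock_Kurzweil_Integration.integral_combine) auto
      then have "cmod (complex_of_real (integral {s..snd i} h) - complex_of_real (integral {s..fst i} h)) = \<bar>integral {x..y} h\<bar>"
        by (simp add: ixy flip: of_real_diff)
      also have "integral {x..y} h = integral {x<..<y} h"
        by (simp add: integral_open_interval_real)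
      also have "\<dots> = (LINT \<tau>:{x<..<y}|lebesgue. h \<tau>)"
        by (rule set_lebesgue_integral_eq_integral(2)[symmetric, OF hxyo])
      also have "\<bar>\<dots>\<bar> \<le> (LINT \<tau>:{x<..<y}|lebesgue. \<bar>h \<tau>\<bar>)"
        using set_integral_norm_bound[OF hxyo] by simp
      also have "\<dots> \<le> (\<integral>\<tau>. indicator (I i) \<tau> * W n \<tau> + real n * indicator {x<..<y} \<tau> \<partial>lebesgue)"
        unfolding set_lebesgue_integral_def
      proof (rule integral_mono)
        show "integrable lebesgue (\<lambda>\<tau>. indicator {x<..<y} \<tau> *\<^sub>R \<bar>h \<tau>\<bar>)"
          using set_integrable_abs[OF hxyo] by (simp add: set_integrable_def)
        show "integrable lebesgue (\<lambda>\<tau>. indicator (I i) \<tau> * W n \<tau> + real n * indicator {x<..<y} \<tau>)"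
          using xy by (intro Bochner_Integration.integrable_add integrable_mult_right IW)
            (auto simp: integrable_indicator_iff)
        show "indicator {x<..<y} \<tau> *\<^sub>R \<bar>h \<tau>\<bar> \<le> indicator (I i) \<tau> * W n \<tau> + real n * indicator {x<..<y} \<tau>" for \<tau>
          using xy by (auto simp: I_def ixy W_def w_def indicator_def)
      qed
      also have "\<dots> = (\<integral>\<tau>. indicator (I i) \<tau> * W n \<tau> \<partial>lebesgue) + real n * (snd i - fst i)"
        using xy by (subst Bochner_Integration.integral_add)
          (auto simp: ixy integrable_indicator_iff intro!: IW integrable_mult_right)
      finally show ?thesis .
    qed
    have "(\<Sum>(x, y)\<in>D. cmod (complex_of_real (integral {s..y} h) - complex_of_real (integral {s..x} h)))
        \<le> (\<Sum>i\<in>D. (\<integral>x. indicator (I i) x * W n x \<partial>lebesgue) + real n * (snd i - fst i))"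
      unfolding split_beta by (intro sum_mono each)
    also have "\<dots> = (\<integral>x. (\<Sum>i\<in>D. indicator (I i) x * W n x) \<partial>lebesgue) + real n * (\<Sum>(x, y)\<in>D. y - x)"
      by (subst Bochner_Integration.integral_sum)
        (auto simp: sum.distrib sum_distrib_left split_beta intro!: IW)
    also have "(\<integral>x. (\<Sum>i\<in>D. indicator (I i) x * W n x) \<partial>lebesgue) \<le> (\<integral>x. W n x \<partial>lebesgue)"
    proof (rule integral_mono)
      show "integrable lebesgue (\<lambda>x. \<Sum>i\<in>D. indicator (I i) x * W n x)"
        by (intro Bochner_Integration.integrable_sum IW)
      fix x
      have "disjoint_family_on I D" using D(3) by (simp add: I_def disjoint_family_on_def split_beta)
      then have "(\<Sum>i\<in>D. indicator (I i) x) = (indicator (\<Union>i\<in>D. I i) x :: real)"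
        using indicator_UN_disjoint[OF D(1)] by metis
      then have "(\<Sum>i\<in>D. indicator (I i) x * W n x) = indicator (\<Union>i\<in>D. I i) x * W n x"
        by (simp flip: sum_distrib_right)
      also have "\<dots> \<le> W n x" by (auto simp: indicator_def W_def w_def)
      finally show "(\<Sum>i\<in>D. indicator (I i) x * W n x) \<le> W n x" .
    qed (rule Wint)
    also have "(\<integral>x. W n x \<partial>lebesgue) + real n * (\<Sum>(x, y)\<in>D. y - x) \<le> (\<integral>x. W n x \<partial>lebesgue) + real n * d"
      using D(4) by (intro add_left_mono mult_left_mono) auto
    finally show ?thesis using n d(2) by linarith
  qed
  then show "\<exists>d>0. \<forall>D. finite D \<longrightarrow> (\<forall>(x, y)\<in>D. s \<le> x \<and> x \<le> y \<and> y \<le> t) \<longrightarrow>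
        disjoint_family_on (\<lambda>(x, y). {x<..<y}) D \<longrightarrow> (\<Sum>(x, y)\<in>D. y - x) < d \<longrightarrow>
        (\<Sum>(x, y)\<in>D. cmod (complex_of_real (integral {s..y} h) - complex_of_real (integral {s..x} h))) < e"
    using d(1) by blast
qed

section \<open>Linear second order equations with integrable coefficients\<close>

text \<open>Picard iterates for \<open>u'' = k u\<close> with \<open>u = A\<close> and \<open>u' = B\<close> at \<open>x\<^sub>0\<close>, in the form of a Volterra equation.\<close>

primrec volterra_iter :: "real \<Rightarrow> (real \<Rightarrow> real) \<Rightarrow> real \<Rightarrow> real \<Rightarrow> nat \<Rightarrow> real \<Rightarrow> real" where
  "volterra_iter x0 k A B 0 = (\<lambda>x. A + B * (x - x0))"
| "volterra_iter x0 k A B (Suc n) =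
     (\<lambda>x. LINT t:closed_segment x0 x|lebesgue. \<bar>x - t\<bar> * k t * volterra_iter x0 k A B n t)"

definition volterra_sol :: "real \<Rightarrow> (real \<Rightarrow> real) \<Rightarrow> real \<Rightarrow> real \<Rightarrow> real \<Rightarrow> real" where
  "volterra_sol x0 k A B x = (\<Sum>n. volterra_iter x0 k A B n x)"

text \<open>The sign turns the integral over the unordered segment into one from \<open>x0\<close>
  to \<open>x\<close>. An explicit formula, rather than a derivative of \<open>volterra_sol\<close>,
  also has values at regular endpoints and is visibly measurable in parameters.\<close>

definition volterra_der :: "real \<Rightarrow> (real \<Rightarrow> real) \<Rightarrow> real \<Rightarrow> real \<Rightarrow> real \<Rightarrow> real" where
  "volterra_der x0 k A B x =
     B + (if x0 \<le> x then 1 else -1) * (LINT t:closed_segment x0 x|lebesgue. k t * volterra_sol x0 k A B t)"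

lemma closed_segment_indicator_measurable [measurable]:
  fixes x0 :: real
  shows "(\<lambda>(x, t). indicator (closed_segment x0 x) t :: real) \<in> borel_measurable (borel \<Otimes>\<^sub>M lebesgue)"
proof -
  have [measurable]: "(\<lambda>x::real. x) \<in> borel_measurable lebesgue"
    by (rule measurable_completion) simp
  have [measurable]: "(\<lambda>p. snd p) \<in> borel_measurable ((borel :: real measure) \<Otimes>\<^sub>M (lebesgue :: real measure))"
    by (rule measurable_compose[OF measurable_snd]) measurable
  have "(\<lambda>p. if min x0 (fst p) \<le> snd p \<and> snd p \<le> max x0 (fst p) then 1 else 0 :: real)
      \<in> borel_measurable (borel \<Otimes>\<^sub>M lebesgue)"
    by measurable
  then show ?thesis
    by (rule measurable_cong[THEN iffD1, rotated]) (auto simp: closed_segment_eq_real_ivl indicator_def split: if_splits)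
qed

text \<open>Fubini along the recursion: each iterate is a parameter integral of a jointly measurable
  integrand, and the solution is the sum of a series of such functions. This is the purpose of the
  explicit construction.\<close>

lemma volterra_measurable:
  fixes k :: "'l \<Rightarrow> real \<Rightarrow> real"
  assumes k: "(\<lambda>(l, t). k l t) \<in> borel_measurable (M \<Otimes>\<^sub>M lebesgue)"
  shows volterra_iter_measurable: "(\<lambda>(l, x). volterra_iter x0 (k l) A B n x) \<in> borel_measurable (M \<Otimes>\<^sub>M borel)"
    and volterra_sol_measurable: "(\<lambda>(l, x). volterra_sol x0 (k l) A B x) \<in> borel_measurable (M \<Otimes>\<^sub>M borel)"
    and volterra_der_measurable: "(\<lambda>l. volterra_der x0 (k l) A B x) \<in> borel_measurable M"
proof -
  interpret L: sigma_finite_measure "lebesgue :: real measure" by (rule sigma_finite_lebesgue)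
  have id: "(\<lambda>x::real. x) \<in> borel_measurable lebesgue"
    by (rule measurable_completion) simp
  \<comment> \<open>The iterates are Borel in \<open>x\<close> but are integrated against
    \<open>lebesgue\<close>, whose sigma-algebra is larger.\<close>
  have lb: "(\<lambda>p. h (fst p) (snd p)) \<in> borel_measurable (N \<Otimes>\<^sub>M lebesgue)"
    if "(\<lambda>(l, x). h l x) \<in> borel_measurable (N \<Otimes>\<^sub>M borel)" for h :: "'n \<Rightarrow> real \<Rightarrow> real" and N
  proof -
    have "(\<lambda>p. (fst p, snd p)) \<in> (N \<Otimes>\<^sub>M (lebesgue :: real measure)) \<rightarrow>\<^sub>M (N \<Otimes>\<^sub>M borel)"
    proof (rule measurable_Pair)
      show "(\<lambda>p. snd p) \<in> borel_measurable (N \<Otimes>\<^sub>M (lebesgue :: real measure))"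
        by (rule measurable_compose[OF measurable_snd id])
    qed (rule measurable_fst)
    from measurable_compose[OF this that] show ?thesis by simp
  qed
  show iter: "(\<lambda>(l, x). volterra_iter x0 (k l) A B n x) \<in> borel_measurable (M \<Otimes>\<^sub>M borel)" for n
  proof (induction n)
    case 0
    then show ?case by (simp add: split_beta)
  next
    case (Suc n)
    let ?N = "(M \<Otimes>\<^sub>M (borel :: real measure)) \<Otimes>\<^sub>M (lebesgue :: real measure)"
    have m1 [measurable]: "(\<lambda>p. (fst (fst p), snd p)) \<in> ?N \<rightarrow>\<^sub>M M \<Otimes>\<^sub>M lebesgue" by measurable
    have m2 [measurable]: "(\<lambda>p. (snd (fst p), snd p)) \<in> ?N \<rightarrow>\<^sub>M borel \<Otimes>\<^sub>M lebesgue" by measurable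
    have s [measurable]: "(\<lambda>p. snd p) \<in> borel_measurable ?N" by (rule measurable_compose[OF measurable_snd id])
    have k' [measurable]: "(\<lambda>p. k (fst (fst p)) (snd p)) \<in> borel_measurable ?N"
      using measurable_compose[OF m1 k] by simp
    have i' [measurable]: "(\<lambda>p. indicator (closed_segment x0 (snd (fst p))) (snd p) :: real) \<in> borel_measurable ?N"
      using measurable_compose[OF m2 closed_segment_indicator_measurable] by simp
    have v' [measurable]: "(\<lambda>p. volterra_iter x0 (k (fst (fst p))) A B n (snd p)) \<in> borel_measurable ?N"
      using measurable_compose[OF m1 lb[OF Suc]] by simp
    have "(\<lambda>q. \<integral>t. indicator (closed_segment x0 (snd q)) t *
        (\<bar>snd q - t\<bar> * k (fst q) t * volterra_iter x0 (k (fst q)) A B n t) \<partial>lebesgue) \<in> borel_measurable (M \<Otimes>\<^sub>M borel)"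
    proof (rule L.borel_measurable_lebesgue_integral)
      have "(\<lambda>p. indicator (closed_segment x0 (snd (fst p))) (snd p) *
        (\<bar>snd (fst p) - snd p\<bar> * k (fst (fst p)) (snd p) * volterra_iter x0 (k (fst (fst p))) A B n (snd p))) \<in> borel_measurable ?N"
        by measurable
      then show "(\<lambda>(q, t). indicator (closed_segment x0 (snd q)) t *
        (\<bar>snd q - t\<bar> * k (fst q) t * volterra_iter x0 (k (fst q)) A B n t)) \<in> borel_measurable ?N"
        by (simp add: split_beta)
    qed
    then show ?case by (simp add: split_beta set_lebesgue_integral_def)
  qed
  then have iter': "(\<lambda>p. volterra_iter x0 (k (fst p)) A B n (snd p)) \<in> borel_measurable (M \<Otimes>\<^sub>M borel)" for n
    by (simp add: split_beta)
  show sol: "(\<lambda>(l, x). volterra_sol x0 (k l) A B x) \<in> borel_measurable (M \<Otimes>\<^sub>M borel)"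
    unfolding volterra_sol_def split_beta by (intro borel_measurable_suminf iter')
  have k' [measurable]: "(\<lambda>p. k (fst p) (snd p)) \<in> borel_measurable (M \<Otimes>\<^sub>M lebesgue)"
    using k by (simp add: split_beta)
  have sx [measurable]: "(\<lambda>p. indicator (closed_segment x0 x) (snd p) :: real) \<in> borel_measurable (M \<Otimes>\<^sub>M lebesgue)"
    by (rule measurable_compose[OF measurable_snd]) simp
  have sol' [measurable]: "(\<lambda>p. volterra_sol x0 (k (fst p)) A B (snd p)) \<in> borel_measurable (M \<Otimes>\<^sub>M lebesgue)"
    by (rule lb[OF sol])
  have [measurable]: "closed_segment x0 x \<in> sets lebesgue" by simp
  have "(\<lambda>l. \<integral>t. indicator (closed_segment x0 x) t * (k l t * volterra_sol x0 (k l) A B t) \<partial>lebesgue) \<in> borel_measurable M"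
  proof (rule L.borel_measurable_lebesgue_integral)
    have "(\<lambda>p. indicator (closed_segment x0 x) (snd p) * (k (fst p) (snd p) * volterra_sol x0 (k (fst p)) A B (snd p)))
        \<in> borel_measurable (M \<Otimes>\<^sub>M lebesgue)"
      by measurable
    then show "(\<lambda>(l, t). indicator (closed_segment x0 x) t * (k l t * volterra_sol x0 (k l) A B t)) \<in> borel_measurable (M \<Otimes>\<^sub>M lebesgue)"
      by (simp add: split_beta)
  qed
  then show "(\<lambda>l. volterra_der x0 (k l) A B x) \<in> borel_measurable M"
    unfolding volterra_der_def set_lebesgue_integral_def real_scaleR_def by measurable
qed

locale volterra_interval =
  fixes k :: "real \<Rightarrow> real" and s t x0 :: real and A B :: real
  assumes k_int: "k absolutely_integrable_on {s..t}" and k_meas: "k \<in> borel_measurable lebesgue"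
    and x0: "x0 \<in> {s..t}"
begin

abbreviation "it \<equiv> volterra_iter x0 k A B"
abbreviation "u \<equiv> volterra_sol x0 k A B"

lemma id_meas [measurable]: "(\<lambda>x::real. x) \<in> borel_measurable lebesgue"
  by (rule measurable_completion) simp

lemma it_meas [measurable]: "it n \<in> borel_measurable borel" and u_meas [measurable]: "u \<in> borel_measurable borel"
proof -
  have k: "(\<lambda>(l::unit, t). k t) \<in> borel_measurable (count_space UNIV \<Otimes>\<^sub>M lebesgue)"
    using k_meas by measurable
  have "(\<lambda>x. ((), x)) \<in> borel \<rightarrow>\<^sub>M (count_space UNIV \<Otimes>\<^sub>M (borel :: real measure))" by measurable
  from measurable_compose[OF this volterra_iter_measurable[OF k]] measurable_compose[OF this volterra_sol_measurable[OF k]]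
  show "it n \<in> borel_measurable borel" "u \<in> borel_measurable borel" by simp_all
qed

definition G where "G x = integral {s..x} (\<lambda>t. \<bar>k t\<bar>)"
definition L where "L = t - s"
definition C where "C = \<bar>A\<bar> + \<bar>B\<bar> * L"

lemma L_nonneg: "L \<ge> 0" and C_nonneg: "C \<ge> 0"
  using x0 by (auto simp: L_def C_def)

lemma seg_sub: "x \<in> {s..t} \<Longrightarrow> closed_segment x0 x \<subseteq> {s..t}"
  using x0 by (auto simp: closed_segment_eq_real_ivl split: if_splits)

lemma seg_integral:
  fixes h :: "real \<Rightarrow> real"
  assumes h: "h absolutely_integrable_on {s..t}" and x: "x \<in> {s..t}"
  shows "(LINT \<tau>:closed_segment x0 x|lebesgue. h \<tau>) = (if x0 \<le> x then 1 else -1) * (integral {s..x} h - integral {s..x0} h)"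
  proof -
  have hi: "h integrable_on {s..t}" using h by (rule set_lebesgue_integral_eq_integral(1))
  have comb: "integral {s..y} h + integral {y..z} h = integral {s..z} h" if "s \<le> y" "y \<le> z" "z \<le> t" for y z
    using that integrable_subinterval_real[OF hi, of s z]
    by (intro Henstock_Kurzweil_Integration.integral_combine) auto
  have "(LINT \<tau>:closed_segment x0 x|lebesgue. h \<tau>) = integral (closed_segment x0 x) h"
    by (rule set_lebesgue_integral_eq_integral(2), rule set_integrable_subset[OF h]) (use seg_sub[OF x] in auto)
  then show ?thesis
    using comb[of x0 x] comb[of x x0] x x0 by (auto simp: closed_segment_eq_real_ivl)
qed

lemma k_times_bounded:
  assumes h: "h \<in> borel_measurable borel" and b: "\<And>\<tau>. \<tau> \<in> {s..t} \<Longrightarrow> \<bar>h \<tau>\<bar> \<le> K"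
  shows "(\<lambda>\<tau>. k \<tau> * h \<tau>) absolutely_integrable_on {s..t}"
  unfolding set_integrable_def
proof (rule Bochner_Integration.integrable_bound)
  show "integrable lebesgue (\<lambda>\<tau>. K * (indicator {s..t} \<tau> *\<^sub>R \<bar>k \<tau>\<bar>))"
    using set_integrable_abs[OF k_int] by (simp add: set_integrable_def)
  have hl: "h \<in> borel_measurable lebesgue" using measurable_compose[OF id_meas h] by simp
  show "(\<lambda>\<tau>. indicator {s..t} \<tau> *\<^sub>R (k \<tau> * h \<tau>)) \<in> borel_measurable lebesgue"
    using k_meas hl by measurable
  show "AE \<tau> in lebesgue. norm (indicator {s..t} \<tau> *\<^sub>R (k \<tau> * h \<tau>)) \<le> norm (K * (indicator {s..t} \<tau> *\<^sub>R \<bar>k \<tau>\<bar>))"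
  proof (rule AE_I2)
    fix \<tau>
    show "norm (indicator {s..t} \<tau> *\<^sub>R (k \<tau> * h \<tau>)) \<le> norm (K * (indicator {s..t} \<tau> *\<^sub>R \<bar>k \<tau>\<bar>))"
    proof (cases "\<tau> \<in> {s..t}")
      case True
      have "\<bar>k \<tau>\<bar> * \<bar>h \<tau>\<bar> \<le> \<bar>k \<tau>\<bar> * \<bar>K\<bar>"
        using b[OF True] by (intro mult_left_mono) auto
      then show ?thesis using True by (simp add: abs_mult mult.commute)
    qed simp
  qed
qed

lemma G_mono: "s \<le> x \<Longrightarrow> x \<le> y \<Longrightarrow> y \<le> t \<Longrightarrow> G x \<le> G y"
proof -
  assume xy: "s \<le> x" "x \<le> y" "y \<le> t"
  have ki: "(\<lambda>t. \<bar>k t\<bar>) integrable_on {s..t}"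
    using set_lebesgue_integral_eq_integral(1)[OF set_integrable_abs[OF k_int]] .
  show "G x \<le> G y" unfolding G_def
    using xy by (intro integral_subset_le) (auto intro: integrable_subinterval_real[OF ki])
qed

lemma G_continuous: "continuous_on {s..t} G"
proof -
  have "continuous_on {s..t} (\<lambda>x. complex_of_real (G x))"
    unfolding G_def by (intro ac_continuous_on ac_indefinite_integral set_integrable_abs k_int)
  from continuous_on_Re[OF this] show ?thesis by simp
qed

text \<open>The chain rule for \<open>(G - G(x\<^sub>0))\<^sup>n\<^sup>+\<^sup>1\<close>, which produces the factorials in the Picard estimate.\<close>

lemma power_integral:
  assumes x: "x \<in> {s..t}"
  shows "(LINT \<tau>:closed_segment x0 x|lebesgue. \<bar>k \<tau>\<bar> * \<bar>G \<tau> - G x0\<bar> ^ n) = \<bar>G x - G x0\<bar> ^ Suc n / real (Suc n)"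
    and "(\<lambda>\<tau>. \<bar>k \<tau>\<bar> * \<bar>G \<tau> - G x0\<bar> ^ n) absolutely_integrable_on {s..t}"
proof -
  let ?H = "\<lambda>\<tau>. G \<tau> - G x0"
  have ki: "(\<lambda>t. \<bar>k t\<bar>) integrable_on {s..t}"
    using set_lebesgue_integral_eq_integral(1)[OF set_integrable_abs[OF k_int]] .
  obtain N where N: "negligible N" and der: "\<And>x. x \<in> {s<..<t} - N \<Longrightarrow> (G has_vector_derivative \<bar>k x\<bar>) (at x)"
    using has_vector_derivative_indefinite_integral[OF ki] unfolding G_def[abs_def] by metis
  have ac: "absolutely_continuous_on s t (\<lambda>x. complex_of_real (?H x) ^ Suc n)"
    unfolding of_real_diff by (intro ac_power ac_diff ac_const) (auto simp: G_def intro!: ac_indefinite_integral set_integrable_abs k_int)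
  let ?g = "\<lambda>\<tau>. complex_of_real (real (Suc n) * ?H \<tau> ^ n * \<bar>k \<tau>\<bar>)"
  have FTC: "(?g has_integral (complex_of_real (?H y) ^ Suc n - complex_of_real (?H w) ^ Suc n)) {w..y}"
    if "s \<le> w" "w \<le> y" "y \<le> t" for w y
  proof (rule absolutely_continuous_FTC[where N = "N \<union> {s, t}"])
    show "w \<le> y" by fact
    show "absolutely_continuous_on w y (\<lambda>x. complex_of_real (?H x) ^ Suc n)"
      by (rule ac_subinterval[OF ac]) (use that in auto)
    show "negligible (N \<union> {s, t})" using N by (simp add: negligible_Un)
    fix x assume "x \<in> {w..y} - (N \<union> {s, t})"
    then have "x \<in> {s<..<t} - N" using that by auto
    from der[OF this] have "(G has_real_derivative \<bar>k x\<bar>) (at x)"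
      by (simp add: has_real_derivative_iff_has_vector_derivative)
    then have "(?H has_real_derivative \<bar>k x\<bar> - 0) (at x)" by (intro DERIV_diff DERIV_const)
    from DERIV_power[OF this, of "Suc n"]
    have "((\<lambda>x. ?H x ^ Suc n) has_real_derivative real (Suc n) * ?H x ^ n * \<bar>k x\<bar>) (at x)"
      by (simp add: mult_ac del: power_Suc of_nat_Suc)
    then have "((\<lambda>x. complex_of_real (?H x ^ Suc n)) has_vector_derivative ?g x) (at x)"
      by (intro has_vector_derivative_of_real) (simp add: has_real_derivative_iff_has_vector_derivative)
    then show "((\<lambda>x. complex_of_real (?H x) ^ Suc n) has_vector_derivative ?g x) (at x)"
      by (simp only: of_real_power)
  qed
  have FTCr: "((\<lambda>\<tau>. ?H \<tau> ^ n * \<bar>k \<tau>\<bar>) has_integral ((?H y ^ Suc n - ?H w ^ Suc n) / real (Suc n))) {w..y}"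
    if "s \<le> w" "w \<le> y" "y \<le> t" for w y
  proof -
    have "((\<lambda>\<tau>. Re (?g \<tau>)) has_integral Re (complex_of_real (?H y) ^ Suc n - complex_of_real (?H w) ^ Suc n)) {w..y}"
      using has_integral_linear[OF FTC[OF that] bounded_linear_Re] by (simp only: o_def)
    then have "((\<lambda>\<tau>. real (Suc n) * (?H \<tau> ^ n * \<bar>k \<tau>\<bar>)) has_integral (?H y ^ Suc n - ?H w ^ Suc n)) {w..y}"
      by (simp only: of_real_power[symmetric] of_real_diff[symmetric] Re_complex_of_real mult.assoc)
    from has_integral_mult_right[OF this, of "1 / real (Suc n)"] show ?thesis
      by (simp del: power_Suc of_nat_Suc)
  qed
  have Hb: "\<bar>?H \<tau> ^ n\<bar> \<le> \<bar>G t\<bar> ^ n" if "\<tau> \<in> {s..t}" for \<tau>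
  proof -
    have "G s = 0" by (simp add: G_def)
    then have "0 \<le> G \<tau>" "G \<tau> \<le> G t" "0 \<le> G x0" "G x0 \<le> G t"
      using G_mono[of s \<tau>] G_mono[of \<tau> t] G_mono[of s x0] G_mono[of x0 t] that x0 by auto
    then have "\<bar>?H \<tau>\<bar> \<le> \<bar>G t\<bar>" by linarith
    then show ?thesis by (simp add: power_abs power_mono)
  qed
  \<comment> \<open>Freezing the argument outside \<open>{s..t}\<close> gives a continuous, hence
    Borel, function on the line with the same values on the interval.\<close>
  define Hc where "Hc \<tau> = G (max s (min t \<tau>)) - G x0" for \<tau>
  have "continuous_on UNIV Hc"
    unfolding Hc_def using x0
    by (intro continuous_intros continuous_on_compose2[OF G_continuous]) auto
  then have Hc: "Hc \<in> borel_measurable borel" by (rule borel_measurable_continuous_onI)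
  have HcH: "Hc \<tau> = ?H \<tau>" if "\<tau> \<in> {s..t}" for \<tau>
  proof -
    have "max s (min t \<tau>) = \<tau>" using that by auto
    then show ?thesis by (simp add: Hc_def)
  qed
  have "(\<lambda>\<tau>. k \<tau> * \<bar>Hc \<tau>\<bar> ^ n) absolutely_integrable_on {s..t}"
    by (rule k_times_bounded[where K = "\<bar>G t\<bar> ^ n"]) (use Hc Hb HcH in \<open>auto simp: power_abs\<close>)
  from set_integrable_abs[OF this]
  show ai: "(\<lambda>\<tau>. \<bar>k \<tau>\<bar> * \<bar>?H \<tau>\<bar> ^ n) absolutely_integrable_on {s..t}"
    by (rule set_integrable_cong[THEN iffD1, rotated -1]) (auto simp: abs_mult HcH power_abs)
  have "(LINT \<tau>:closed_segment x0 x|lebesgue. \<bar>k \<tau>\<bar> * \<bar>?H \<tau>\<bar> ^ n) = integral (closed_segment x0 x) (\<lambda>\<tau>. \<bar>k \<tau>\<bar> * \<bar>?H \<tau>\<bar> ^ n)"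
    by (rule set_lebesgue_integral_eq_integral(2), rule set_integrable_subset[OF ai]) (use seg_sub[OF x] in auto)
  also have "\<dots> = \<bar>?H x\<bar> ^ Suc n / real (Suc n)"
  proof (cases "x0 \<le> x")
    case True
    have "((\<lambda>\<tau>. \<bar>k \<tau>\<bar> * \<bar>?H \<tau>\<bar> ^ n) has_integral ((?H x ^ Suc n - ?H x0 ^ Suc n) / real (Suc n))) {x0..x}"
    proof (rule has_integral_eq[OF _ FTCr])
      show "?H \<tau> ^ n * \<bar>k \<tau>\<bar> = \<bar>k \<tau>\<bar> * \<bar>?H \<tau>\<bar> ^ n" if "\<tau> \<in> {x0..x}" for \<tau>
        using G_mono[of x0 \<tau>] that x x0 by simp
    qed (use True x x0 in auto)
    then show ?thesis using True G_mono[of x0 x] x x0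
      by (simp add: closed_segment_eq_real_ivl integral_unique)
  next
    case False
    \<comment> \<open>Left of \<open>x0\<close> the base of the power is nonpositive; the sign
      (-1)^n restores the absolute value.\<close>
    have "((\<lambda>\<tau>. (-1) ^ n * (?H \<tau> ^ n * \<bar>k \<tau>\<bar>)) has_integral (-1) ^ n * ((?H x0 ^ Suc n - ?H x ^ Suc n) / real (Suc n))) {x..x0}"
      using False x x0 by (intro has_integral_mult_right FTCr) auto
    moreover have "(-1) ^ n * ((?H x0 ^ Suc n - ?H x ^ Suc n) / real (Suc n)) = \<bar>?H x\<bar> ^ Suc n / real (Suc n)"
    proof -
      have "\<bar>?H x\<bar> = - ?H x" using G_mono[of x x0] False x x0 by simp
      then have "\<bar>?H x\<bar> ^ Suc n = (-1) ^ Suc n * ?H x ^ Suc n"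
        by (metis mult_minus1 power_mult_distrib)
      then show ?thesis by (simp del: of_nat_Suc)
    qed
    moreover have "(-1) ^ n * (?H \<tau> ^ n * \<bar>k \<tau>\<bar>) = \<bar>k \<tau>\<bar> * \<bar>?H \<tau>\<bar> ^ n" if "\<tau> \<in> {x..x0}" for \<tau>
    proof -
      have "\<bar>?H \<tau>\<bar> = - ?H \<tau>" using G_mono[of \<tau> x0] that x x0 by simp
      then have "\<bar>?H \<tau>\<bar> ^ n = (-1) ^ n * ?H \<tau> ^ n"
        by (metis mult_minus1 power_mult_distrib)
      then show ?thesis by simp
    qed
    ultimately have "((\<lambda>\<tau>. \<bar>k \<tau>\<bar> * \<bar>?H \<tau>\<bar> ^ n) has_integral (\<bar>?H x\<bar> ^ Suc n / real (Suc n))) {x..x0}"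
      using has_integral_eq[of "{x..x0}"] by (metis (no_types, lifting))
    then show ?thesis using False by (simp add: closed_segment_eq_real_ivl integral_unique)
  qed
  finally show "(LINT \<tau>:closed_segment x0 x|lebesgue. \<bar>k \<tau>\<bar> * \<bar>?H \<tau>\<bar> ^ n) = \<bar>?H x\<bar> ^ Suc n / real (Suc n)" .
qed

end

section \<open>Convergence of the Picard series and regularity of its sum\<close>

context volterra_interval
begin

lemma G_bound: "\<tau> \<in> {s..t} \<Longrightarrow> \<bar>G \<tau> - G x0\<bar> \<le> G t" and G_t_nonneg: "G t \<ge> 0"
proof -
  have "G s = 0" by (simp add: G_def)
  then show "G t \<ge> 0" using G_mono[of s t] x0 by simp
  assume "\<tau> \<in> {s..t}"
  then show "\<bar>G \<tau> - G x0\<bar> \<le> G t"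
    using \<open>G s = 0\<close> G_mono[of s \<tau>] G_mono[of \<tau> t] G_mono[of s x0] G_mono[of x0 t] x0 by auto
qed

lemma dist_bound: "x \<in> {s..t} \<Longrightarrow> y \<in> {s..t} \<Longrightarrow> \<bar>x - y\<bar> \<le> L"
  by (auto simp: L_def)

text \<open>Under the integral \<open>\<bar>x - \<tau>\<bar>\<close> costs a factor
  \<open>L\<close>, and \<open>power_integral\<close> turns the n-th power of |G - G x0| into the
  next power divided by n + 1.\<close>

lemma it_bound: "x \<in> {s..t} \<Longrightarrow> \<bar>it n x\<bar> \<le> C * (L * \<bar>G x - G x0\<bar>) ^ n / fact n"
proof (induction n arbitrary: x)
  case 0
  have "\<bar>B * (x - x0)\<bar> \<le> \<bar>B\<bar> * L"
    using dist_bound[OF 0 x0] by (simp add: abs_mult mult_left_mono)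
  then show ?case by (simp add: C_def)
next
  case (Suc n)
  let ?h = "\<lambda>\<tau>. \<bar>x - \<tau>\<bar> * it n \<tau>"
  let ?c = "C * L ^ Suc n / fact n"
  have c0: "?c \<ge> 0" using C_nonneg L_nonneg by simp
  have hb: "\<bar>?h \<tau>\<bar> \<le> ?c * \<bar>G \<tau> - G x0\<bar> ^ n" if "\<tau> \<in> {s..t}" for \<tau>
  proof -
    have "\<bar>x - \<tau>\<bar> * \<bar>it n \<tau>\<bar> \<le> L * (C * (L * \<bar>G \<tau> - G x0\<bar>) ^ n / fact n)"
      using dist_bound[OF Suc.prems that] Suc.IH[OF that] L_nonneg by (intro mult_mono) auto
    then show ?thesis by (simp add: abs_mult power_mult_distrib mult_ac)
  qed
  have hK: "\<bar>?h \<tau>\<bar> \<le> ?c * G t ^ n" if "\<tau> \<in> {s..t}" for \<tau>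
    using hb[OF that] mult_left_mono[OF power_mono[OF G_bound[OF that], of n] c0] by simp
  have hm: "?h \<in> borel_measurable borel" by measurable
  have ai: "(\<lambda>\<tau>. k \<tau> * ?h \<tau>) absolutely_integrable_on {s..t}"
    by (rule k_times_bounded[OF hm hK])
  have seg: "closed_segment x0 x \<subseteq> {s..t}" by (rule seg_sub[OF Suc.prems])
  have ais: "(\<lambda>\<tau>. k \<tau> * ?h \<tau>) absolutely_integrable_on closed_segment x0 x"
    by (rule set_integrable_subset[OF ai]) (use seg in auto)
  have pis: "(\<lambda>\<tau>. \<bar>k \<tau>\<bar> * \<bar>G \<tau> - G x0\<bar> ^ n) absolutely_integrable_on closed_segment x0 x"
    by (rule set_integrable_subset[OF power_integral(2)[OF Suc.prems]]) (use seg in auto)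
  have "it (Suc n) x = (LINT \<tau>:closed_segment x0 x|lebesgue. k \<tau> * ?h \<tau>)"
    by (simp add: mult_ac)
  also have "\<bar>\<dots>\<bar> \<le> (LINT \<tau>:closed_segment x0 x|lebesgue. \<bar>k \<tau> * ?h \<tau>\<bar>)"
    using set_integral_norm_bound[OF ais] by simp
  also have "\<dots> \<le> (LINT \<tau>:closed_segment x0 x|lebesgue. ?c * (\<bar>k \<tau>\<bar> * \<bar>G \<tau> - G x0\<bar> ^ n))"
  proof (rule set_integral_mono[OF set_integrable_abs[OF ais] set_integrable_mult_right])
    show "(\<lambda>\<tau>. \<bar>k \<tau>\<bar> * \<bar>G \<tau> - G x0\<bar> ^ n) absolutely_integrable_on closed_segment x0 x" by (rule pis)
    fix \<tau> assume "\<tau> \<in> closed_segment x0 x"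
    then have \<tau>: "\<tau> \<in> {s..t}" using seg by blast
    show "\<bar>k \<tau> * ?h \<tau>\<bar> \<le> ?c * (\<bar>k \<tau>\<bar> * \<bar>G \<tau> - G x0\<bar> ^ n)"
      unfolding abs_mult[of "k \<tau>" "?h \<tau>"] mult.left_commute[of ?c "\<bar>k \<tau>\<bar>"]
      by (rule mult_left_mono[OF hb[OF \<tau>] abs_ge_zero])
  qed
  also have "\<dots> = ?c * (\<bar>G x - G x0\<bar> ^ Suc n / real (Suc n))"
    by (simp only: set_integral_mult_right power_integral(1)[OF Suc.prems])
  also have "\<dots> = C * (L * \<bar>G x - G x0\<bar>) ^ Suc n / fact (Suc n)"
    by (simp add: power_mult_distrib fact_Suc field_simps del: power_Suc of_nat_Suc)
  finally show ?case .
qed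

lemma it_bound_const: "x \<in> {s..t} \<Longrightarrow> \<bar>it n x\<bar> \<le> C * ((L * G t) ^ n / fact n)"
proof -
  assume x: "x \<in> {s..t}"
  have "(L * \<bar>G x - G x0\<bar>) ^ n \<le> (L * G t) ^ n"
    using G_bound[OF x] L_nonneg by (intro power_mono mult_left_mono) auto
  then have "C * (L * \<bar>G x - G x0\<bar>) ^ n / fact n \<le> C * (L * G t) ^ n / fact n"
    using C_nonneg by (intro divide_right_mono mult_left_mono) auto
  then show ?thesis using it_bound[OF x, of n] by simp
qed

lemma exp_sums: "(\<lambda>n. C * ((L * G t) ^ n / fact n)) sums (C * exp (L * G t))"
  using sums_mult[OF exp_converges[of "L * G t"], of C] by (simp add: divide_inverse mult.commute)

lemma it_summable: "x \<in> {s..t} \<Longrightarrow> summable (\<lambda>n. it n x)"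
  by (rule summable_comparison_test'[OF sums_summable[OF exp_sums], of 0]) (simp only: real_norm_def it_bound_const)

lemma u_bound: "x \<in> {s..t} \<Longrightarrow> \<bar>u x\<bar> \<le> C * exp (L * G t)"
proof -
  assume x: "x \<in> {s..t}"
  have sa: "summable (\<lambda>n. \<bar>it n x\<bar>)"
    by (rule summable_comparison_test'[OF sums_summable[OF exp_sums], of 0])
      (use it_bound_const[OF x] in simp)
  have "\<bar>u x\<bar> \<le> (\<Sum>n. \<bar>it n x\<bar>)" unfolding volterra_sol_def by (rule summable_rabs[OF sa])
  also have "\<dots> \<le> C * exp (L * G t)"
    unfolding sums_unique[OF exp_sums] by (rule suminf_le[OF it_bound_const[OF x] sa sums_summable[OF exp_sums]])
  finally show ?thesis .
qed

abbreviation "g \<equiv> \<lambda>\<tau>. k \<tau> * u \<tau>"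

lemma g_int: "g absolutely_integrable_on {s..t}"
  by (rule k_times_bounded[OF u_meas u_bound])

lemma tg_int: "(\<lambda>\<tau>. \<tau> * g \<tau>) absolutely_integrable_on {s..t}"
proof -
  have "(\<lambda>\<tau>. k \<tau> * (\<tau> * u \<tau>)) absolutely_integrable_on {s..t}"
  proof (rule k_times_bounded[where K = "(\<bar>s\<bar> + \<bar>t\<bar>) * (C * exp (L * G t))"])
    show "\<bar>\<tau> * u \<tau>\<bar> \<le> (\<bar>s\<bar> + \<bar>t\<bar>) * (C * exp (L * G t))" if "\<tau> \<in> {s..t}" for \<tau>
      unfolding abs_mult using that u_bound[OF that] by (intro mult_mono) auto
  qed measurable
  then show ?thesis by (simp only: mult.left_commute)
qed

text \<open>Summing the recursion; the exponential majorant of the iterates justifies interchanging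
  sum and integral.\<close>

lemma volterra_equation:
  assumes x: "x \<in> {s..t}"
  shows "u x = A + B * (x - x0) + (LINT \<tau>:closed_segment x0 x|lebesgue. \<bar>x - \<tau>\<bar> * g \<tau>)"
proof -
  define f where "f n \<tau> = indicator (closed_segment x0 x) \<tau> * (k \<tau> * (\<bar>x - \<tau>\<bar> * it n \<tau>))" for n \<tau>
  let ?e = "\<lambda>n. C * ((L * G t) ^ n / fact n)"
  let ?w = "\<lambda>\<tau>. L * (indicator (closed_segment x0 x) \<tau> * \<bar>k \<tau>\<bar>)"
  have seg: "closed_segment x0 x \<subseteq> {s..t}" by (rule seg_sub[OF x])
  have e0: "?e n \<ge> 0" for n using C_nonneg L_nonneg G_t_nonneg by simp
  have hb: "\<bar>\<bar>x - \<tau>\<bar> * it n \<tau>\<bar> \<le> L * ?e n" if "\<tau> \<in> {s..t}" for \<tau> n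
    unfolding abs_mult abs_abs
    using dist_bound[OF x that] it_bound_const[OF that, of n] L_nonneg by (intro mult_mono) auto
  have fint: "integrable lebesgue (f n)" for n
  proof -
    have "(\<lambda>\<tau>. k \<tau> * (\<bar>x - \<tau>\<bar> * it n \<tau>)) absolutely_integrable_on {s..t}"
      by (rule k_times_bounded[OF _ hb]) measurable
    then have "(\<lambda>\<tau>. k \<tau> * (\<bar>x - \<tau>\<bar> * it n \<tau>)) absolutely_integrable_on closed_segment x0 x"
      by (rule set_integrable_subset) (use seg in auto)
    then show ?thesis by (simp add: set_integrable_def f_def[abs_def])
  qed
  have fb: "norm (f n \<tau>) \<le> ?w \<tau> * ?e n" for n \<tau>
  proof (cases "\<tau> \<in> closed_segment x0 x")
    case True
    then have "\<tau> \<in> {s..t}" using seg by blast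
    from mult_left_mono[OF hb[OF this, of n] abs_ge_zero[of "k \<tau>"]] show ?thesis
      using True by (simp add: f_def abs_mult mult_ac)
  qed (simp add: f_def)
  have wint: "integrable lebesgue ?w"
  proof -
    have "(\<lambda>\<tau>. \<bar>k \<tau>\<bar>) absolutely_integrable_on closed_segment x0 x"
      by (rule set_integrable_subset[OF set_integrable_abs[OF k_int]]) (use seg in auto)
    then show ?thesis by (simp add: set_integrable_def)
  qed
  have es: "summable ?e" by (rule sums_summable[OF exp_sums])
  have int_bound: "(\<integral>\<tau>. norm (f n \<tau>) \<partial>lebesgue) \<le> (\<integral>\<tau>. ?w \<tau> \<partial>lebesgue) * ?e n" for n
  proof -
    have "(\<integral>\<tau>. norm (f n \<tau>) \<partial>lebesgue) \<le> (\<integral>\<tau>. ?w \<tau> * ?e n \<partial>lebesgue)"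
      by (rule integral_mono[OF integrable_norm[OF fint] integrable_mult_left[OF wint] fb])
    then show ?thesis by (simp only: integral_mult_left_zero)
  qed
  have "(\<integral>\<tau>. (\<Sum>n. f n \<tau>) \<partial>lebesgue) = (\<Sum>n. \<integral>\<tau>. f n \<tau> \<partial>lebesgue)"
  proof (rule integral_suminf[OF fint])
    show "AE \<tau> in lebesgue. summable (\<lambda>n. norm (f n \<tau>))"
      by (intro AE_I2 summable_comparison_test'[OF summable_mult[OF es], of 0])
        (use fb in simp)
    show "summable (\<lambda>n. \<integral>\<tau>. norm (f n \<tau>) \<partial>lebesgue)"
      by (rule summable_comparison_test'[OF summable_mult[OF es], of 0])
        (use int_bound in simp)
  qed
  moreover have "(\<Sum>n. f n \<tau>) = indicator (closed_segment x0 x) \<tau> *\<^sub>R (\<bar>x - \<tau>\<bar> * g \<tau>)" for \<tau>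
  proof (cases "\<tau> \<in> closed_segment x0 x")
    case True
    then have "summable (\<lambda>n. it n \<tau>)" using seg it_summable by blast
    from suminf_mult[OF this, of "k \<tau> * \<bar>x - \<tau>\<bar>"] show ?thesis
      using True by (simp add: f_def volterra_sol_def mult_ac)
  qed (simp add: f_def)
  moreover have "(\<integral>\<tau>. f n \<tau> \<partial>lebesgue) = it (Suc n) x" for n
    by (simp add: f_def set_lebesgue_integral_def mult_ac)
  ultimately have "(LINT \<tau>:closed_segment x0 x|lebesgue. \<bar>x - \<tau>\<bar> * g \<tau>) = (\<Sum>n. it (Suc n) x)"
    by (simp only: set_lebesgue_integral_def)
  moreover have "u x = (\<Sum>n. it (Suc n) x) + it 0 x"
    unfolding volterra_sol_def using suminf_split_head[OF it_summable[OF x]] by simp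
  ultimately show ?thesis by simp
qed

definition V where "V x = integral {s..x} g"
definition Y where "Y x = integral {s..x} (\<lambda>\<tau>. \<tau> * g \<tau>)"
abbreviation "D \<equiv> volterra_der x0 k A B"

lemma D_eq: "x \<in> {s..t} \<Longrightarrow> D x = B + (V x - V x0)"
  unfolding volterra_der_def V_def by (subst seg_integral[OF g_int]) auto

text \<open>Splitting x - \<tau> confines the dependence on \<open>x\<close> to two indefinite
  integrals, from which continuity and the derivative are read off.\<close>

lemma u_eq:
  assumes x: "x \<in> {s..t}" shows "u x = A + B * (x - x0) + (x * (V x - V x0) - (Y x - Y x0))"
proof -
  have gi: "g integrable_on {s..t}" and ti: "(\<lambda>\<tau>. \<tau> * g \<tau>) integrable_on {s..t}"
    using set_lebesgue_integral_eq_integral(1)[OF g_int] set_lebesgue_integral_eq_integral(1)[OF tg_int] .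
  have I: "integral {s..y} (\<lambda>\<tau>. x * g \<tau> - \<tau> * g \<tau>) = x * V y - Y y" if "y \<in> {s..t}" for y
  proof -
    have gy: "g integrable_on {s..y}" "(\<lambda>\<tau>. \<tau> * g \<tau>) integrable_on {s..y}"
      using that by (auto intro: integrable_subinterval_real[OF gi] integrable_subinterval_real[OF ti])
    have "(\<lambda>\<tau>. x * g \<tau>) integrable_on {s..y}" using gy(1) by (rule integrable_on_mult_right)
    from Henstock_Kurzweil_Integration.integral_diff[OF this gy(2)] show ?thesis by (simp add: V_def Y_def)
  qed
  have ai: "(\<lambda>\<tau>. x * g \<tau> - \<tau> * g \<tau>) absolutely_integrable_on {s..t}"
    by (intro set_integral_diff(1) set_integrable_mult_right g_int tg_int)
  have "(LINT \<tau>:closed_segment x0 x|lebesgue. \<bar>x - \<tau>\<bar> * g \<tau>) =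
      (LINT \<tau>:closed_segment x0 x|lebesgue. (if x0 \<le> x then 1 else -1) * (x * g \<tau> - \<tau> * g \<tau>))"
  proof (rule set_lebesgue_integral_cong)
    show "\<forall>\<tau>. \<tau> \<in> closed_segment x0 x \<longrightarrow> \<bar>x - \<tau>\<bar> * g \<tau> = (if x0 \<le> x then 1 else -1) * (x * g \<tau> - \<tau> * g \<tau>)"
    proof (intro allI impI)
      fix \<tau> assume "\<tau> \<in> closed_segment x0 x"
      then have "\<bar>x - \<tau>\<bar> = (if x0 \<le> x then 1 else -1) * (x - \<tau>)"
        by (auto simp: closed_segment_eq_real_ivl split: if_splits)
      then show "\<bar>x - \<tau>\<bar> * g \<tau> = (if x0 \<le> x then 1 else -1) * (x * g \<tau> - \<tau> * g \<tau>)"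
        by (simp only: left_diff_distrib[of x \<tau> "g \<tau>"] mult.assoc)
    qed
  qed simp
  also have "\<dots> = x * (V x - V x0) - (Y x - Y x0)"
    unfolding set_integral_mult_right seg_integral[OF ai x] using I[OF x] I[OF x0] by (simp add: algebra_simps)
  finally show ?thesis using volterra_equation[OF x] by simp
qed

lemma D_ac: "absolutely_continuous_on s t (\<lambda>x. complex_of_real (D x))"
proof -
  have ac: "absolutely_continuous_on s t (\<lambda>x. complex_of_real (V x))"
    unfolding V_def by (rule ac_indefinite_integral[OF g_int])
  show ?thesis
  proof (rule ac_dominated[OF ac ac, of 1])
    fix x y assume "s \<le> x" "x \<le> y" "y \<le> t"
    then show "cmod (complex_of_real (D y) - complex_of_real (D x)) \<le>
        1 * (cmod (complex_of_real (V y) - complex_of_real (V x)) + cmod (complex_of_real (V y) - complex_of_real (V x)))"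
      by (simp add: D_eq flip: of_real_diff)
  qed simp
qed

lemma continuous_indefinite: "h absolutely_integrable_on {s..t} \<Longrightarrow> continuous_on {s..t} (\<lambda>x. integral {s..x} h)"
  for h :: "real \<Rightarrow> real"
  using indefinite_integral_continuous_1 set_lebesgue_integral_eq_integral(1) by blast

lemma D_continuous: "continuous_on {s..t} D" and u_continuous: "continuous_on {s..t} u"
proof -
  have V: "continuous_on {s..t} V" and Y: "continuous_on {s..t} Y"
    unfolding V_def[abs_def] Y_def[abs_def] by (rule continuous_indefinite g_int tg_int)+
  have "continuous_on {s..t} (\<lambda>x. B + (V x - V x0))" by (intro continuous_intros V)
  then show "continuous_on {s..t} D" by (rule continuous_on_eq) (simp add: D_eq)
  have "continuous_on {s..t} (\<lambda>x. A + B * (x - x0) + (x * (V x - V x0) - (Y x - Y x0)))" by (intro continuous_intros V Y)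
  then show "continuous_on {s..t} u" by (rule continuous_on_eq) (simp add: u_eq)
qed

text \<open>The error of the linear approximation is the integral of (y - \<tau>) g from
  \<open>x\<close> to \<open>y\<close>, at most |y - x| times the increment of the continuous
  function \<open>W\<close>. So \<open>u\<close> is differentiable at every interior point although
  \<open>g\<close> is merely integrable.\<close>

lemma u_derivative:
  assumes x: "x \<in> {s<..<t}" shows "(u has_vector_derivative D x) (at x)"
  unfolding has_vector_derivative_def has_derivative_at_alt
proof (intro conjI allI impI)
  fix e :: real assume e: "e > 0"
  define W where "W y = integral {s..y} (\<lambda>\<tau>. \<bar>g \<tau>\<bar>)" for y
  have "continuous_on {s..t} W" unfolding W_def by (rule continuous_indefinite[OF set_integrable_abs[OF g_int]])
  moreover have "x \<in> {s..t}" using x by auto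
  ultimately have "\<exists>d>0. \<forall>y\<in>{s..t}. dist y x < d \<longrightarrow> dist (W y) (W x) < e"
    using e unfolding continuous_on_iff by simp
  then obtain d where d: "d > 0" and d': "\<forall>y\<in>{s..t}. dist y x < d \<longrightarrow> dist (W y) (W x) < e" by (elim exE conjE)
  have bnd: "\<bar>(z * V z - Y z) - (z * V y - Y y)\<bar> \<le> \<bar>z - y\<bar> * \<bar>W z - W y\<bar> \<and>
      \<bar>(y * V z - Y z) - (y * V y - Y y)\<bar> \<le> \<bar>z - y\<bar> * \<bar>W z - W y\<bar>"
    if yz: "s \<le> y" "y \<le> z" "z \<le> t" for y z
  proof -
    have gi: "g integrable_on {s..t}" and ti: "(\<lambda>\<tau>. \<tau> * g \<tau>) integrable_on {s..t}"
      and ai: "(\<lambda>\<tau>. \<bar>g \<tau>\<bar>) integrable_on {s..t}"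
      using set_lebesgue_integral_eq_integral(1)[OF g_int] set_lebesgue_integral_eq_integral(1)[OF tg_int]
        set_lebesgue_integral_eq_integral(1)[OF set_integrable_abs[OF g_int]] .
    have comb: "integral {s..z} h - integral {s..y} h = integral {y..z} h" if h: "h integrable_on {s..t}" for h :: "real \<Rightarrow> real"
    proof -
      have "integral {s..y} h + integral {y..z} h = integral {s..z} h"
        using yz integrable_subinterval_real[OF h, of s z]
        by (intro Henstock_Kurzweil_Integration.integral_combine) auto
      then show ?thesis by simp
    qed
    have sub: "h integrable_on {s..t} \<Longrightarrow> h integrable_on {y..z}" for h :: "real \<Rightarrow> real"
      by (rule integrable_subinterval_real) (use yz in auto)
    have *: "\<bar>(p * V z - Y z) - (p * V y - Y y)\<bar> \<le> \<bar>z - y\<bar> * \<bar>W z - W y\<bar>" if p: "p = y \<or> p = z" for p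
    proof -
      have pi: "(\<lambda>\<tau>. p * g \<tau>) integrable_on {y..z}" using sub[OF gi] by (rule integrable_on_mult_right)
      have a1: "(p * V z - Y z) - (p * V y - Y y) = p * (V z - V y) - (Y z - Y y)" by (simp add: algebra_simps)
      have a2: "integral {y..z} (\<lambda>\<tau>. p * g \<tau> - \<tau> * g \<tau>) = p * (V z - V y) - (Y z - Y y)"
        unfolding V_def Y_def comb[OF gi] comb[OF ti]
        using Henstock_Kurzweil_Integration.integral_diff[OF pi sub[OF ti]] by simp
      have a3: "norm (integral {y..z} (\<lambda>\<tau>. p * g \<tau> - \<tau> * g \<tau>)) \<le> integral {y..z} (\<lambda>\<tau>. (z - y) * \<bar>g \<tau>\<bar>)"
      proof (rule integral_norm_bound_integral)
        show "(\<lambda>\<tau>. p * g \<tau> - \<tau> * g \<tau>) integrable_on {y..z}" by (rule integrable_diff[OF pi sub[OF ti]])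
        show "(\<lambda>\<tau>. (z - y) * \<bar>g \<tau>\<bar>) integrable_on {y..z}" using sub[OF ai] by (rule integrable_on_mult_right)
        show "norm (p * g \<tau> - \<tau> * g \<tau>) \<le> (z - y) * \<bar>g \<tau>\<bar>" if "\<tau> \<in> {y..z}" for \<tau>
        proof -
          have "\<bar>p - \<tau>\<bar> * \<bar>g \<tau>\<bar> \<le> (z - y) * \<bar>g \<tau>\<bar>" using that p by (intro mult_right_mono) auto
          then show ?thesis by (simp only: real_norm_def left_diff_distrib[symmetric] abs_mult[of "p - \<tau>"])
        qed
      qed
      have a4: "integral {y..z} (\<lambda>\<tau>. (z - y) * \<bar>g \<tau>\<bar>) = (z - y) * (W z - W y)"
        unfolding W_def comb[OF ai] by (rule Henstock_Kurzweil_Integration.integral_mult_right)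
      have "\<bar>p * (V z - V y) - (Y z - Y y)\<bar> \<le> (z - y) * (W z - W y)" using a3 unfolding a2 a4 real_norm_def .
      also have "\<dots> \<le> \<bar>(z - y) * (W z - W y)\<bar>" by (rule abs_ge_self)
      finally show ?thesis unfolding a1 abs_mult .
    qed
    show ?thesis by (rule conjI[OF *[OF disjI2[OF refl]] *[OF disjI1[OF refl]]])
  qed
  define d1 where "d1 = min d (min (x - s) (t - x))"
  have "norm (u y - u x - (y - x) *\<^sub>R D x) \<le> e * norm (y - x)" if "norm (y - x) < d1" for y
  proof -
    have y: "y \<in> {s..t}" and xs: "x \<in> {s..t}" using that x by (auto simp: d1_def)
    have b1: "u y - u x - (y - x) *\<^sub>R D x = (y * V y - Y y) - (y * V x - Y x)"
      unfolding u_eq[OF y] u_eq[OF xs] D_eq[OF xs] by (simp add: algebra_simps)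
    have b2: "\<bar>(y * V y - Y y) - (y * V x - Y x)\<bar> \<le> \<bar>y - x\<bar> * \<bar>W y - W x\<bar>"
    proof (cases "x \<le> y")
      case True
      then show ?thesis using bnd[of x y] y xs by simp
    next
      case False
      then have "\<bar>(y * V x - Y x) - (y * V y - Y y)\<bar> \<le> \<bar>x - y\<bar> * \<bar>W x - W y\<bar>"
        using bnd[of y x] y xs by simp
      then show ?thesis
        by (simp only: abs_minus_commute[of x y] abs_minus_commute[of "W x"] abs_minus_commute[of "y * V x - Y x"])
    qed
    have b3: "\<bar>y - x\<bar> * \<bar>W y - W x\<bar> \<le> \<bar>y - x\<bar> * e"
      using d'[rule_format, OF y] that by (intro mult_left_mono) (auto simp: dist_real_def d1_def)
    show ?thesis unfolding b1 real_norm_def using order_trans[OF b2 b3] by (simp only: mult.commute)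
  qed
  moreover have "d1 > 0" using x d by (simp add: d1_def)
  ultimately show "\<exists>d>0. \<forall>y. norm (y - x) < d \<longrightarrow> norm (u y - u x - (y - x) *\<^sub>R D x) \<le> e * norm (y - x)"
    by (intro exI[of _ d1] conjI allI impI)
qed (rule bounded_linear_scaleR_left)

text \<open>Lebesgue's differentiation theorem for the indefinite integral \<open>V\<close>.\<close>

lemma D_derivative:
  "\<exists>N. negligible N \<and> (\<forall>x\<in>{s<..<t} - N. (D has_vector_derivative k x * u x) (at x))"
proof -
  obtain N where N1: "negligible N" and N2: "\<And>x. x \<in> {s<..<t} - N \<Longrightarrow> ((\<lambda>x. integral {s..x} g) has_vector_derivative g x) (at x)"
    by (rule has_vector_derivative_indefinite_integral[OF set_lebesgue_integral_eq_integral(1)[OF g_int]]) (erule that)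
  have "(D has_vector_derivative g x) (at x)" if "x \<in> {s<..<t} - N" for x
  proof (rule has_vector_derivative_transform_within_open)
    show "((\<lambda>x. (B - V x0) + V x) has_vector_derivative g x) (at x)"
      using has_vector_derivative_add[OF has_vector_derivative_const N2[OF that], of "B - V x0"] by (simp add: V_def[abs_def])
    show "(B - V x0) + V y = D y" if "y \<in> {s<..<t}" for y using that by (simp add: D_eq)
  qed (use that in auto)
  then show ?thesis using N1 by (intro exI[of _ N] conjI ballI)
qed

end

section \<open>Solutions of the eigenvalue equation and their Wronskians\<close>

lemma einterval_set [simp]: "x \<in> einterval a b \<longleftrightarrow> a < ereal x \<and> ereal x < b"
  by (simp add: einterval_def)

lemma Icc_subset_einterval: "a < ereal s \<Longrightarrow> ereal t < b \<Longrightarrow> {s..t} \<subseteq> einterval a b"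
proof
  fix x assume "a < ereal s" "ereal t < b" "x \<in> {s..t}"
  then show "x \<in> einterval a b"
    using less_le_trans[of a "ereal s" "ereal x"] le_less_trans[of "ereal x" "ereal t" b] by simp
qed

lemma AE_einterval_negligible:
  "(AE x in lebesgue_on (einterval a b). Q x) \<longleftrightarrow> (\<exists>N. negligible N \<and> (\<forall>x\<in>einterval a b - N. Q x))"
proof -
  have "(AE x in lebesgue_on (einterval a b). Q x) \<longleftrightarrow> (AE x in lebesgue. x \<in> einterval a b \<longrightarrow> Q x)"
    by (subst AE_restrict_space_iff) auto
  also have "\<dots> \<longleftrightarrow> (\<exists>N. negligible N \<and> (\<forall>x\<in>einterval a b - N. Q x))"
  proof
    assume "AE x in lebesgue. x \<in> einterval a b \<longrightarrow> Q x"
    then obtain N where "N \<in> null_sets lebesgue" "{x. \<not> (x \<in> einterval a b \<longrightarrow> Q x)} \<subseteq> N"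
      unfolding eventually_ae_filter by auto
    then show "\<exists>N. negligible N \<and> (\<forall>x\<in>einterval a b - N. Q x)"
      unfolding negligible_iff_null_sets by (intro exI[of _ N]) auto
  next
    assume "\<exists>N. negligible N \<and> (\<forall>x\<in>einterval a b - N. Q x)"
    then obtain N where N: "negligible N" "\<forall>x\<in>einterval a b - N. Q x" by (elim exE conjE)
    show "AE x in lebesgue. x \<in> einterval a b \<longrightarrow> Q x"
      by (rule AE_I'[of N]) (use N in \<open>auto simp: negligible_iff_null_sets\<close>)
  qed
  finally show ?thesis .
qed

definition sl_solution :: "ereal \<Rightarrow> ereal \<Rightarrow> (real \<Rightarrow> real) \<Rightarrow> real \<Rightarrow> (real \<Rightarrow> complex) \<Rightarrow> bool" where
  "sl_solution a b q r u \<longleftrightarrow> sl_expression a b q u (\<lambda>x. complex_of_real r * u x)"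

text \<open>\<open>vderiv\<close> is defined by choice. The criterion lets an explicit
  \<open>u'\<close> take its place; the two agree on the open interval, so absolute continuity and
  second derivatives carry over.\<close>

lemma sl_solution_iff:
  "sl_solution a b q r u \<longleftrightarrow>
     (\<exists>u'. (\<forall>x\<in>einterval a b. (u has_vector_derivative u' x) (at x)) \<and>
        locally_absolutely_continuous a b u \<and> locally_absolutely_continuous a b u' \<and>
        (\<exists>N. negligible N \<and> (\<forall>x\<in>einterval a b - N. (u' has_vector_derivative of_real (q x - r) * u x) (at x))))"
    (is "_ \<longleftrightarrow> ?R")
  and sl_solution_vderiv: "sl_solution a b q r u \<Longrightarrow> x \<in> einterval a b \<Longrightarrow> (u has_vector_derivative vderiv u x) (at x)"
  and sl_solution_second: "sl_solution a b q r u \<Longrightarrow>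
     \<exists>N. negligible N \<and> (\<forall>x\<in>einterval a b - N. (vderiv u has_vector_derivative of_real (q x - r) * u x) (at x))"
proof -
  show vd: "(u has_vector_derivative vderiv u x) (at x)" if "sl_solution a b q r u" "x \<in> einterval a b" for x
    using that by (simp add: sl_solution_def sl_expression_def vector_derivative_works)
  show sec: "\<exists>N. negligible N \<and> (\<forall>x\<in>einterval a b - N. (vderiv u has_vector_derivative of_real (q x - r) * u x) (at x))"
    if s: "sl_solution a b q r u"
  proof -
    obtain N where N: "negligible N" "\<forall>x\<in>einterval a b - N. \<exists>u''. (vderiv u has_vector_derivative u'') (at x) \<and>
        - u'' + complex_of_real (q x) * u x = complex_of_real r * u x"
      using s unfolding sl_solution_def sl_expression_def AE_einterval_negligible by blast
    have "(vderiv u has_vector_derivative of_real (q x - r) * u x) (at x)" if x: "x \<in> einterval a b - N" for x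
    proof -
      obtain u'' where u'': "(vderiv u has_vector_derivative u'') (at x)" "- u'' + complex_of_real (q x) * u x = complex_of_real r * u x"
        using N(2)[rule_format, OF x] by (elim exE conjE)
      from u''(2) have "u'' = of_real (q x - r) * u x" by (simp add: algebra_simps)
      then show ?thesis using u''(1) by simp
    qed
    then show ?thesis using N(1) by blast
  qed
  show "sl_solution a b q r u \<longleftrightarrow> ?R"
  proof
    assume s: "sl_solution a b q r u"
    then show ?R using vd[OF s] sec[OF s] unfolding sl_solution_def sl_expression_def by (intro exI[of _ "vderiv u"]) simp
  next
    assume ?R
    then obtain u' N where u0: "\<forall>x\<in>einterval a b. (u has_vector_derivative u' x) (at x)"
      "locally_absolutely_continuous a b u" "locally_absolutely_continuous a b u'" "negligible N"
      "\<forall>x\<in>einterval a b - N. (u' has_vector_derivative of_real (q x - r) * u x) (at x)" by (elim exE conjE)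
    note u' = u0(1)[rule_format] u0(2-4) u0(5)[rule_format]
    have eq: "vderiv u x = u' x" if "x \<in> einterval a b" for x
      using u'(1)[OF that] by (rule vector_derivative_at)
    have ac: "absolutely_continuous_on s t (vderiv u)" if "a < ereal s" "s \<le> t" "ereal t < b" for s t
    proof (rule ac_dominated[of s t u' u' 1])
      show "absolutely_continuous_on s t u'" "absolutely_continuous_on s t u'"
        using u'(3) that by (simp_all add: locally_absolutely_continuous_def)
      fix x y assume "s \<le> x" "x \<le> y" "y \<le> t"
      then have "x \<in> {s..t}" "y \<in> {s..t}" by auto
      then have "x \<in> einterval a b" "y \<in> einterval a b" using Icc_subset_einterval[OF that(1,3)] by blast+
      then show "cmod (vderiv u y - vderiv u x) \<le> 1 * (cmod (u' y - u' x) + cmod (u' y - u' x))" by (simp only: eq) simp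
    qed simp
    have dd: "(vderiv u has_vector_derivative of_real (q x - r) * u x) (at x)" if x: "x \<in> einterval a b - N" for x
      by (rule has_vector_derivative_transform_within_open[OF u'(5)[OF x] open_einterval[of a b]])
        (use x in \<open>simp_all add: eq del: einterval_set\<close>)
    have "\<forall>x\<in>einterval a b - N. \<exists>u''. (vderiv u has_vector_derivative u'') (at x) \<and>
        - u'' + complex_of_real (q x) * u x = complex_of_real r * u x"
    proof (intro ballI)
      fix x assume x: "x \<in> einterval a b - N"
      show "\<exists>u''. (vderiv u has_vector_derivative u'') (at x) \<and> - u'' + complex_of_real (q x) * u x = complex_of_real r * u x"
        by (rule exI[of _ "complex_of_real (q x - r) * u x"]) (use dd[OF x] in \<open>simp add: algebra_simps\<close>)
    qed
    then have "AE x in interval_measure_on a b. \<exists>u''. (vderiv u has_vector_derivative u'') (at x) \<and>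
        - u'' + complex_of_real (q x) * u x = complex_of_real r * u x"
      unfolding AE_einterval_negligible using u'(4) by blast
    moreover have "\<forall>x\<in>einterval a b. u differentiable (at x)"
      using u'(1) by (blast intro: differentiableI_vector)
    ultimately show "sl_solution a b q r u"
      using u'(2) ac unfolding sl_solution_def sl_expression_def locally_absolutely_continuous_def by blast
  qed
qed

lemma sl_solution_ac:
  assumes "sl_solution a b q r u" "a < ereal s" "s \<le> t" "ereal t < b"
  shows "absolutely_continuous_on s t u" "absolutely_continuous_on s t (vderiv u)"
  using assms by (auto simp: sl_solution_def sl_expression_def locally_absolutely_continuous_def)

lemma sl_solution_combine:
  assumes u: "sl_solution a b q r u" and w: "sl_solution a b q r w"
  shows "sl_solution a b q r (\<lambda>x. A * u x + B * w x)"
    and "x \<in> einterval a b \<Longrightarrow> vderiv (\<lambda>x. A * u x + B * w x) x = A * vderiv u x + B * vderiv w x"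
proof -
  have d: "((\<lambda>x. A * u x + B * w x) has_vector_derivative A * vderiv u x + B * vderiv w x) (at x)" if "x \<in> einterval a b" for x
    by (intro has_vector_derivative_add has_vector_derivative_mult_right sl_solution_vderiv[OF u that] sl_solution_vderiv[OF w that])
  then show "x \<in> einterval a b \<Longrightarrow> vderiv (\<lambda>x. A * u x + B * w x) x = A * vderiv u x + B * vderiv w x"
    by (rule vector_derivative_at)
  obtain N where N0: "negligible N" "\<forall>x\<in>einterval a b - N. (vderiv u has_vector_derivative of_real (q x - r) * u x) (at x)"
    using sl_solution_second[OF u] by (elim exE conjE)
  note N = N0(1) N0(2)[rule_format]
  obtain N' where N0': "negligible N'" "\<forall>x\<in>einterval a b - N'. (vderiv w has_vector_derivative of_real (q x - r) * w x) (at x)"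
    using sl_solution_second[OF w] by (elim exE conjE)
  note N' = N0'(1) N0'(2)[rule_format]
  show "sl_solution a b q r (\<lambda>x. A * u x + B * w x)"
    unfolding sl_solution_iff
  proof (intro exI[of _ "\<lambda>x. A * vderiv u x + B * vderiv w x"] conjI ballI exI[of _ "N \<union> N'"])
    show "locally_absolutely_continuous a b (\<lambda>x. A * u x + B * w x)"
      "locally_absolutely_continuous a b (\<lambda>x. A * vderiv u x + B * vderiv w x)"
      unfolding locally_absolutely_continuous_def
      by (auto intro!: ac_add ac_mult ac_const sl_solution_ac[OF u] sl_solution_ac[OF w])
    show "negligible (N \<union> N')" using N(1) N'(1) by (rule negligible_Un)
    fix x assume x: "x \<in> einterval a b - (N \<union> N')"
    have "((\<lambda>x. A * vderiv u x + B * vderiv w x) has_vector_derivative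
        A * (of_real (q x - r) * u x) + B * (of_real (q x - r) * w x)) (at x)"
      by (intro has_vector_derivative_add has_vector_derivative_mult_right N(2) N'(2)) (use x in auto)
    moreover have "A * (complex_of_real (q x - r) * u x) + B * (of_real (q x - r) * w x) = of_real (q x - r) * (A * u x + B * w x)"
      by (simp add: algebra_simps)
    ultimately show "((\<lambda>x. A * vderiv u x + B * vderiv w x) has_vector_derivative of_real (q x - r) * (A * u x + B * w x)) (at x)"
      by (simp only:)
  qed (rule d)
qed

definition wronskian :: "(real \<Rightarrow> complex) \<Rightarrow> (real \<Rightarrow> complex) \<Rightarrow> real \<Rightarrow> complex" where
  "wronskian u w x = u x * vderiv w x - vderiv u x * w x"

text \<open>Lagrange's identity: the derivative of the Wronskian is (q2 - q1) u w almost everywhere,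
  since the common \<open>r\<close> cancels, and absolute continuity allows integrating it.\<close>

lemma wronskian_integral:
  assumes u: "sl_solution a b q1 r u" and w: "sl_solution a b q2 r w"
    and xy: "a < ereal x" "x \<le> y" "ereal y < b"
  shows "((\<lambda>\<tau>. complex_of_real (q2 \<tau> - q1 \<tau>) * (u \<tau> * w \<tau>)) has_integral (wronskian u w y - wronskian u w x)) {x..y}"
proof -
  obtain N where N0: "negligible N" "\<forall>x\<in>einterval a b - N. (vderiv u has_vector_derivative of_real (q1 x - r) * u x) (at x)"
    using sl_solution_second[OF u] by (elim exE conjE)
  note N = N0(1) N0(2)[rule_format]
  obtain N' where N0': "negligible N'" "\<forall>x\<in>einterval a b - N'. (vderiv w has_vector_derivative of_real (q2 x - r) * w x) (at x)"
    using sl_solution_second[OF w] by (elim exE conjE)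
  note N' = N0'(1) N0'(2)[rule_format]
  show ?thesis
  proof (rule absolutely_continuous_FTC[where N = "N \<union> N'"])
    show "absolutely_continuous_on x y (wronskian u w)"
      unfolding wronskian_def[abs_def]
      by (intro ac_diff ac_mult sl_solution_ac[OF u xy] sl_solution_ac[OF w xy])
    show "negligible (N \<union> N')" using N(1) N'(1) by (rule negligible_Un)
    fix \<tau> assume \<tau>: "\<tau> \<in> {x..y} - (N \<union> N')"
    then have m: "\<tau> \<in> einterval a b" using Icc_subset_einterval[OF xy(1,3)] by blast
    have "(wronskian u w has_vector_derivative
        (u \<tau> * (of_real (q2 \<tau> - r) * w \<tau>) + vderiv u \<tau> * vderiv w \<tau>) -
        (vderiv u \<tau> * vderiv w \<tau> + of_real (q1 \<tau> - r) * u \<tau> * w \<tau>)) (at \<tau>)"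
      unfolding wronskian_def[abs_def]
      by (intro has_vector_derivative_diff has_vector_derivative_mult sl_solution_vderiv[OF u m] sl_solution_vderiv[OF w m] N(2) N'(2))
        (use \<tau> m in auto)
    then show "(wronskian u w has_vector_derivative complex_of_real (q2 \<tau> - q1 \<tau>) * (u \<tau> * w \<tau>)) (at \<tau>)"
      by (simp add: algebra_simps)
  qed (rule xy)
qed

lemma wronskian_const:
  assumes u: "sl_solution a b q1 r u" and w: "sl_solution a b q2 r w"
    and xy: "a < ereal x" "x \<le> y" "ereal y < b" and eq: "\<And>\<tau>. x < \<tau> \<Longrightarrow> \<tau> < y \<Longrightarrow> q1 \<tau> = q2 \<tau>"
  shows "wronskian u w x = wronskian u w y"
proof -
  \<comment> \<open>The potentials are assumed equal strictly between \<open>x\<close> and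
    \<open>y\<close>; the two endpoints form a negligible set.\<close>
  have "((\<lambda>\<tau>. 0) has_integral (wronskian u w y - wronskian u w x)) {x..y}"
    by (rule has_integral_spike[OF _ _ wronskian_integral[OF u w xy], of "{x, y}"]) (auto simp: eq)
  then show ?thesis by (simp add: has_integral_0_eq)
qed

text \<open>Expansion of a 3 by 3 determinant in which the row of values (v, u, w) is repeated. It
  expresses a solution by two others whose Wronskian is nonzero.\<close>

lemma three_wronskians:
  "v x * wronskian u w x + u x * wronskian w v x + w x * wronskian v u x = 0"
  by (simp add: wronskian_def algebra_simps)

text \<open>The limits of (u, u') and (w, w') are both annihilated by the same unit vector (cos
  \<alpha>, sin \<alpha>), hence parallel, so their determinant is 0.\<close>

lemma boundary_wronskian:
  assumes "boundary_condition \<alpha> F u" "boundary_condition \<alpha> F w"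
  shows "(wronskian u w \<longlongrightarrow> 0) F"
proof -
  obtain l l' where u: "(u \<longlongrightarrow> l) F" "(vderiv u \<longlongrightarrow> l') F" "l * of_real (cos \<alpha>) + l' * of_real (sin \<alpha>) = 0"
    using assms(1) by (auto simp: boundary_condition_def)
  obtain m m' where w: "(w \<longlongrightarrow> m) F" "(vderiv w \<longlongrightarrow> m') F" "m * of_real (cos \<alpha>) + m' * of_real (sin \<alpha>) = 0"
    using assms(2) by (auto simp: boundary_condition_def)
  define C S where "C = complex_of_real (cos \<alpha>)" and "S = complex_of_real (sin \<alpha>)"
  have "C\<^sup>2 + S\<^sup>2 = 1"
    by (simp add: C_def S_def flip: of_real_power of_real_add)
  have "l * m' - l' * m = (C\<^sup>2 + S\<^sup>2) * (l * m' - l' * m)" by (simp add: \<open>C\<^sup>2 + S\<^sup>2 = 1\<close>)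
  also have "\<dots> = (l * C + l' * S) * (C * m' - S * m) + (m * C + m' * S) * (S * l - C * l')"
    by (simp add: power2_eq_square algebra_simps)
  also have "\<dots> = 0" using u(3) w(3) by (simp add: C_def S_def)
  finally have "l * m' - l' * m = 0" .
  moreover have "(wronskian u w \<longlongrightarrow> l * m' - l' * m) F"
    unfolding wronskian_def[abs_def] by (intro tendsto_intros u w)
  ultimately show ?thesis by simp
qed

lemma square_integrable_combine:
  assumes "square_integrable M u" "square_integrable M w" shows "square_integrable M (\<lambda>x. A * u x + B * w x)"
  unfolding square_integrable_def
proof (intro conjI)
  have [measurable]: "u \<in> borel_measurable M" "w \<in> borel_measurable M"
    using assms by (auto simp: square_integrable_def)
  show m: "(\<lambda>x. A * u x + B * w x) \<in> borel_measurable M" by measurable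
  show "integrable M (\<lambda>x. (cmod (A * u x + B * w x))\<^sup>2)"
  proof (rule Bochner_Integration.integrable_bound)
    show "integrable M (\<lambda>x. 2 * (cmod A)\<^sup>2 * (cmod (u x))\<^sup>2 + 2 * (cmod B)\<^sup>2 * (cmod (w x))\<^sup>2)"
      using assms by (simp add: square_integrable_def)
    show "AE x in M. norm ((cmod (A * u x + B * w x))\<^sup>2) \<le> norm (2 * (cmod A)\<^sup>2 * (cmod (u x))\<^sup>2 + 2 * (cmod B)\<^sup>2 * (cmod (w x))\<^sup>2)"
    proof (rule AE_I2)
      fix x
      show "norm ((cmod (A * u x + B * w x))\<^sup>2) \<le> norm (2 * (cmod A)\<^sup>2 * (cmod (u x))\<^sup>2 + 2 * (cmod B)\<^sup>2 * (cmod (w x))\<^sup>2)"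
        using norm_add_sq_le[of "A * u x" "B * w x"] by (simp add: norm_mult power_mult_distrib)
    qed
  qed measurable
qed

lemma square_integrable_subinterval:
  assumes u: "square_integrable (lebesgue_on (einterval a b)) u" and sub: "einterval a' b' \<subseteq> einterval a b"
  shows "square_integrable (lebesgue_on (einterval a' b')) u"
  unfolding square_integrable_def
proof (intro conjI)
  show "u \<in> borel_measurable (lebesgue_on (einterval a' b'))"
    using u sub unfolding square_integrable_def by (blast intro: measurable_restrict_mono)
  have "integrable lebesgue (\<lambda>x. indicator (einterval a b) x *\<^sub>R (cmod (u x))\<^sup>2)"
    using u unfolding square_integrable_def by (subst (asm) integrable_restrict_space) auto
  then have "integrable lebesgue (\<lambda>x. indicator (einterval a' b') x *\<^sub>R (indicator (einterval a b) x *\<^sub>R (cmod (u x))\<^sup>2))"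
    by (rule integrable_mult_indicator[rotated]) simp
  moreover have "(\<lambda>x. indicator (einterval a' b') x *\<^sub>R (indicator (einterval a b) x *\<^sub>R (cmod (u x))\<^sup>2)) =
      (\<lambda>x. indicator (einterval a' b') x *\<^sub>R (cmod (u x))\<^sup>2)"
  proof
    fix x show "indicator (einterval a' b') x *\<^sub>R (indicator (einterval a b) x *\<^sub>R (cmod (u x))\<^sup>2) =
      indicator (einterval a' b') x *\<^sub>R (cmod (u x))\<^sup>2"
      using subsetD[OF sub, of x] by (cases "x \<in> einterval a' b'") (simp_all del: einterval_set)
  qed
  ultimately show "integrable (lebesgue_on (einterval a' b')) (\<lambda>x. (cmod (u x))\<^sup>2)"
    by (subst integrable_restrict_space) auto
qed

lemma square_integrable_cong_interval:
  assumes eq: "\<And>x. x \<in> einterval a b \<Longrightarrow> u x = w x"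
  shows "square_integrable (lebesgue_on (einterval a b)) u \<longleftrightarrow> square_integrable (lebesgue_on (einterval a b)) w"
proof -
  have sp: "space (lebesgue_on (einterval a b)) = einterval a b" by (simp add: space_restrict_space)
  have "u \<in> borel_measurable (lebesgue_on (einterval a b)) \<longleftrightarrow> w \<in> borel_measurable (lebesgue_on (einterval a b))"
    by (rule measurable_cong) (simp only: sp eq)
  moreover have "integrable (lebesgue_on (einterval a b)) (\<lambda>x. (cmod (u x))\<^sup>2) \<longleftrightarrow>
      integrable (lebesgue_on (einterval a b)) (\<lambda>x. (cmod (w x))\<^sup>2)"
    by (rule Bochner_Integration.integrable_cong[OF refl]) (simp only: sp eq)
  ultimately show ?thesis unfolding square_integrable_def by simp
qed

lemma linear_relation_solve:
  fixes v :: complex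
  assumes "\<kappa> \<noteq> 0" "v * \<kappa> + u * p + w * s = 0"
  shows "v = (- p / \<kappa>) * u + (- s / \<kappa>) * w"
proof -
  have "v * \<kappa> = (v * \<kappa> + u * p + w * s) - u * p - w * s" by simp
  also have "\<dots> = - (u * p) - w * s" unfolding assms(2) by simp
  finally have "v = (- (u * p) - w * s) / \<kappa>" using assms(1) by (simp add: eq_divide_eq)
  then show ?thesis by (simp add: diff_divide_distrib mult.commute)
qed

text \<open>Two solutions subject to the same condition at an endpoint agree there up to a factor. In the limit point
  case a third, not square integrable, solution would otherwise be a combination of the two.\<close>

lemma left_wronskian_zero:
  assumes u: "sl_solution a b q1 r u" "square_integrable (interval_measure_on a b) u"
    and w: "sl_solution a b q2 r w" "square_integrable (interval_measure_on a b) w"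
    and c: "a < ereal c" "ereal c < b" and eq: "\<And>x. a < ereal x \<Longrightarrow> x < c \<Longrightarrow> q1 x = q2 x"
    and cases: "boundary_condition \<alpha> (at_right (real_of_ereal a)) u \<and> boundary_condition \<alpha> (at_right (real_of_ereal a)) w \<and> a \<noteq> -\<infinity> \<or>
      limit_point_at_left a b q1"
  shows "wronskian u w c = 0"
  using cases
proof (elim disjE conjE)
  assume bc: "boundary_condition \<alpha> (at_right (real_of_ereal a)) u" "boundary_condition \<alpha> (at_right (real_of_ereal a)) w" and "a \<noteq> -\<infinity>"
  then obtain a' where a: "a = ereal a'" using c(1) by (cases a) auto
  have lim: "(wronskian u w \<longlongrightarrow> 0) (at_right a')" using boundary_wronskian[OF bc] by (simp add: a)
  have ev: "\<forall>\<^sub>F x in at_right a'. wronskian u w x = wronskian u w c"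
    unfolding eventually_at_right_field
  proof (intro exI[of _ c] conjI allI impI)
    fix x assume x: "a' < x" "x < c"
    show "wronskian u w x = wronskian u w c"
      by (rule wronskian_const[OF u(1) w(1)]) (use x c eq in \<open>auto simp: a\<close>)
  qed (use c a in simp)
  have "((\<lambda>_. wronskian u w c) \<longlongrightarrow> 0) (at_right a')" by (rule iffD1[OF tendsto_cong[OF ev] lim])
  then show ?thesis by (simp add: tendsto_const_iff)
next
  assume "limit_point_at_left a b q1"
  then have "\<exists>v. sl_solution a b q1 r v \<and> \<not> (\<exists>c\<in>einterval a b. square_integrable (interval_measure_on a (ereal c)) v)"
    unfolding limit_point_at_left_def sl_solution_def by (rule spec)
  then obtain v where v: "sl_solution a b q1 r v"
    and nv0: "\<not> (\<exists>c\<in>einterval a b. square_integrable (interval_measure_on a (ereal c)) v)" by (elim exE conjE)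
  have nv: "\<not> square_integrable (interval_measure_on a (ereal c)) v"
  proof
    assume "square_integrable (interval_measure_on a (ereal c)) v"
    then have "\<exists>c\<in>einterval a b. square_integrable (interval_measure_on a (ereal c)) v" using c by (intro bexI[of _ c]) simp_all
    with nv0 show False by (rule notE)
  qed
  show ?thesis
  proof (rule ccontr)
    assume ne: "wronskian u w c \<noteq> 0"
    define \<kappa> where "\<kappa> = wronskian u w c"
    \<comment> \<open>Left of \<open>c\<close> the two potentials agree, so all three Wronskians are
      constant there and the three-term identity has constant coefficients.\<close>
    have veq: "v x = (- wronskian w v c / \<kappa>) * u x + (- wronskian v u c / \<kappa>) * w x" if "x \<in> einterval a (ereal c)" for x
    proof -
      have x: "a < ereal x" "x \<le> c" using that by auto
      have "wronskian u w x = \<kappa>" unfolding \<kappa>_def by (rule wronskian_const[OF u(1) w(1) x c(2)]) (use x(1) in \<open>simp add: eq less_trans[of a "ereal x"]\<close>)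
      moreover have "wronskian w v x = wronskian w v c"
        by (rule wronskian_const[OF w(1) v x c(2)]) (use x(1) in \<open>simp add: eq less_trans[of a "ereal x"]\<close>)
      moreover have "wronskian v u x = wronskian v u c"
        by (rule wronskian_const[OF v u(1) x c(2) refl])
      ultimately have "v x * \<kappa> + u x * wronskian w v c + w x * wronskian v u c = 0"
        using three_wronskians[of v x u w] by simp
      with ne[folded \<kappa>_def] show ?thesis by (rule linear_relation_solve)
    qed
    have sub: "einterval a (ereal c) \<subseteq> einterval a b" using c by (auto simp: less_trans[of _ "ereal c" b])
    have "square_integrable (interval_measure_on a (ereal c)) v"
      by (rule iffD2[OF square_integrable_cong_interval[OF veq]
          square_integrable_combine[OF square_integrable_subinterval[OF u(2) sub] square_integrable_subinterval[OF w(2) sub]]])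
    with nv show False by (rule notE)
  qed
qed

lemma right_wronskian_zero:
  assumes u: "sl_solution a b q1 r u" "square_integrable (interval_measure_on a b) u"
    and w: "sl_solution a b q2 r w" "square_integrable (interval_measure_on a b) w"
    and d: "a < ereal d" "ereal d < b" and eq: "\<And>x. d < x \<Longrightarrow> ereal x < b \<Longrightarrow> q1 x = q2 x"
    and cases: "boundary_condition \<beta> (at_left (real_of_ereal b)) u \<and> boundary_condition \<beta> (at_left (real_of_ereal b)) w \<and> b \<noteq> \<infinity> \<or>
      limit_point_at_right a b q1"
  shows "wronskian u w d = 0"
  using cases
proof (elim disjE conjE)
  assume bc: "boundary_condition \<beta> (at_left (real_of_ereal b)) u" "boundary_condition \<beta> (at_left (real_of_ereal b)) w" and "b \<noteq> \<infinity>"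
  then obtain b' where b: "b = ereal b'" using d(2) by (cases b) auto
  have lim: "(wronskian u w \<longlongrightarrow> 0) (at_left b')" using boundary_wronskian[OF bc] by (simp add: b)
  have ev: "\<forall>\<^sub>F x in at_left b'. wronskian u w x = wronskian u w d"
    unfolding eventually_at_left_field
  proof (intro exI[of _ d] conjI allI impI)
    fix x assume x: "d < x" "x < b'"
    show "wronskian u w x = wronskian u w d"
      by (rule wronskian_const[OF u(1) w(1), symmetric]) (use x d eq in \<open>auto simp: b\<close>)
  qed (use d b in simp)
  have "((\<lambda>_. wronskian u w d) \<longlongrightarrow> 0) (at_left b')" by (rule iffD1[OF tendsto_cong[OF ev] lim])
  then show ?thesis by (simp add: tendsto_const_iff)
next
  assume "limit_point_at_right a b q1"
  then have "\<exists>v. sl_solution a b q1 r v \<and> \<not> (\<exists>c\<in>einterval a b. square_integrable (interval_measure_on (ereal c) b) v)"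
    unfolding limit_point_at_right_def sl_solution_def by (rule spec)
  then obtain v where v: "sl_solution a b q1 r v"
    and nv0: "\<not> (\<exists>c\<in>einterval a b. square_integrable (interval_measure_on (ereal c) b) v)" by (elim exE conjE)
  have nv: "\<not> square_integrable (interval_measure_on (ereal d) b) v"
  proof
    assume "square_integrable (interval_measure_on (ereal d) b) v"
    then have "\<exists>c\<in>einterval a b. square_integrable (interval_measure_on (ereal c) b) v" using d by (intro bexI[of _ d]) simp_all
    with nv0 show False by (rule notE)
  qed
  show ?thesis
  proof (rule ccontr)
    assume ne: "wronskian u w d \<noteq> 0"
    define \<kappa> where "\<kappa> = wronskian u w d"
    have veq: "v x = (- wronskian w v d / \<kappa>) * u x + (- wronskian v u d / \<kappa>) * w x" if "x \<in> einterval (ereal d) b" for x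
    proof -
      have x: "d \<le> x" "ereal x < b" using that by auto
      have "wronskian u w d = wronskian u w x" by (rule wronskian_const[OF u(1) w(1) d(1) x]) (use x(2) in \<open>simp add: eq less_trans[of _ "ereal x" b]\<close>)
      moreover have "wronskian w v d = wronskian w v x"
        by (rule wronskian_const[OF w(1) v d(1) x]) (use x(2) in \<open>simp add: eq less_trans[of _ "ereal x" b]\<close>)
      moreover have "wronskian v u d = wronskian v u x"
        by (rule wronskian_const[OF v u(1) d(1) x refl])
      ultimately have "v x * \<kappa> + u x * wronskian w v d + w x * wronskian v u d = 0"
        using three_wronskians[of v x u w] by (simp add: \<kappa>_def)
      with ne[folded \<kappa>_def] show ?thesis by (rule linear_relation_solve)
    qed
    have sub: "einterval (ereal d) b \<subseteq> einterval a b" using d by (auto simp: less_trans[of a "ereal d"])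
    have "square_integrable (interval_measure_on (ereal d) b) v"
      by (rule iffD2[OF square_integrable_cong_interval[OF veq]
          square_integrable_combine[OF square_integrable_subinterval[OF u(2) sub] square_integrable_subinterval[OF w(2) sub]]])
    with nv show False by (rule notE)
  qed
qed

text \<open>The coefficient in u'' = (q - r) u, set to 0 outside (a, b), where nothing is known
  about \<open>q\<close>; this makes it measurable on the whole line.\<close>

definition sl_kernel :: "ereal \<Rightarrow> ereal \<Rightarrow> (real \<Rightarrow> real) \<Rightarrow> real \<Rightarrow> real \<Rightarrow> real" where
  "sl_kernel a b q r x = indicator (einterval a b) x * (q x - r)"

lemma real_diff_const_integrable:
  assumes "q absolutely_integrable_on S" "S \<subseteq> {s..t}" "S \<in> sets lebesgue"
  shows "(\<lambda>x::real. q x - (r::real)) absolutely_integrable_on S"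
  by (rule set_integral_diff(1)[OF assms(1) set_integrable_subset[OF absolutely_integrable_continuous_real[OF continuous_on_const] assms(3,2)]])

lemma ereal_interval_around:
  assumes "a < ereal x" "ereal x < b" "a < ereal y" "ereal y < b"
  shows "\<exists>s t. a < ereal s \<and> s < x \<and> s < y \<and> x < t \<and> y < t \<and> ereal t < b"
proof -
  have "a < ereal (min x y)" "ereal (max x y) < b" using assms by (simp_all add: min_def max_def)
  then show ?thesis
    using ereal_dense2[of a "ereal (min x y)"] ereal_dense2[of "ereal (max x y)" b] by fastforce
qed

section \<open>A fundamental system and its boundary values\<close>

locale sl_equation =
  fixes a b :: ereal and q :: "real \<Rightarrow> real" and r x0 :: real
  assumes x0: "a < ereal x0" "ereal x0 < b" and q: "locally_integrable a b q"
begin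

abbreviation "K \<equiv> sl_kernel a b q r"
abbreviation "U \<equiv> volterra_sol x0 K"
abbreviation "D \<equiv> volterra_der x0 K"

lemma kernel_interior:
  assumes "a < ereal s" "ereal t < b" shows "K absolutely_integrable_on {s..t}"
proof (rule absolutely_integrable_spike[OF _ negligible_empty])
  have "q absolutely_integrable_on {s..t}"
    using q Icc_subset_einterval[OF assms] unfolding locally_integrable_def by (metis compact_Icc)
  then show "(\<lambda>x. q x - r) absolutely_integrable_on {s..t}" by (rule real_diff_const_integrable) auto
  fix x assume "x \<in> {s..t} - {}"
  then show "K x = q x - r" using Icc_subset_einterval[OF assms] by (auto simp: sl_kernel_def indicator_def)
qed

text \<open>Local integrability gives measurability on compact subintervals, and an exhausting
  sequence of these carries it to the limit.\<close>

lemma kernel_measurable: "K \<in> borel_measurable lebesgue"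
proof -
  have ab: "a < b" using x0 by (rule less_trans)
  obtain h l :: "nat \<Rightarrow> real" where hl: "einterval a b = (\<Union>i. {l i .. h i})" "incseq h" "decseq l"
    "\<And>i. l i < h i" "\<And>i. a < l i" "\<And>i. h i < b"
    by (rule einterval_Icc_approximation[OF ab]) (rule that; assumption)
  show ?thesis
  proof (rule borel_measurable_LIMSEQ_real)
    show "(\<lambda>x. indicator {l i..h i} x *\<^sub>R K x) \<in> borel_measurable lebesgue" for i
      using kernel_interior[OF hl(5,6), of i i] unfolding set_integrable_def by (rule borel_measurable_integrable)
    fix x :: real
    show "(\<lambda>i. indicator {l i..h i} x *\<^sub>R K x) \<longlonglongrightarrow> K x"
    proof (cases "x \<in> einterval a b")
      case True
      then obtain N where N: "x \<in> {l N..h N}" unfolding hl(1) by blast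
      have "indicator {l i..h i} x *\<^sub>R K x = K x" if "i \<ge> N" for i
        using N incseqD[OF hl(2) that] decseqD[OF hl(3) that] by (simp add: indicator_def)
      then show ?thesis by (intro tendsto_eventually) (auto simp: eventually_sequentially)
    next
      case False
      then have "K x = 0" by (simp add: sl_kernel_def indicator_def del: einterval_set)
      then show ?thesis by simp
    qed
  qed
qed

text \<open>Regularity makes the coefficient integrable up to the endpoint, so the Volterra
  construction works on a closed interval starting at \<open>a\<close>, and boundary values become
  values of \<open>U\<close> and \<open>D\<close>.\<close>

lemma kernel_left:
  assumes reg: "regular_at_left a b q" and t: "ereal t < b"
  shows "K absolutely_integrable_on {real_of_ereal a..t}" "real_of_ereal a < x0" "a = ereal (real_of_ereal a)"
proof -
  obtain c where c: "a < ereal c" "ereal c < b" "q absolutely_integrable_on einterval a (ereal c)" and "a \<noteq> -\<infinity>"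
    using reg unfolding regular_at_left_def by auto
  then obtain a' where a: "a = ereal a'" by (cases a) auto
  then show "real_of_ereal a < x0" "a = ereal (real_of_ereal a)" using x0 by auto
  have e: "einterval a (ereal c) = {a'<..<c}" by (auto simp: a)
  have "K absolutely_integrable_on {a'<..<c}"
  proof (rule absolutely_integrable_spike[OF _ negligible_empty])
    show "(\<lambda>x. q x - r) absolutely_integrable_on {a'<..<c}"
      using c(3) unfolding e by (rule real_diff_const_integrable[of _ _ a' c]) auto
    fix x assume "x \<in> {a'<..<c} - {}"
    then show "K x = q x - r" using less_trans[of "ereal x" "ereal c" b] c(2) by (simp add: sl_kernel_def indicator_def a)
  qed
  then have "K absolutely_integrable_on ({a'<..<c} \<union> {a'}) \<union> {c..max c t}"
    by (rule absolutely_integrable_Un[OF absolutely_integrable_Un[OF _ absolutely_integrable_negligible] kernel_interior])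
      (use c t in \<open>auto simp: max_def\<close>)
  then show "K absolutely_integrable_on {real_of_ereal a..t}"
    by (rule set_integrable_subset) (auto simp: a)
qed

lemma kernel_right:
  assumes reg: "regular_at_right a b q" and t: "a < ereal t"
  shows "K absolutely_integrable_on {t..real_of_ereal b}" "x0 < real_of_ereal b" "b = ereal (real_of_ereal b)"
proof -
  obtain c where c: "a < ereal c" "ereal c < b" "q absolutely_integrable_on einterval (ereal c) b" and "b \<noteq> \<infinity>"
    using reg unfolding regular_at_right_def by auto
  then obtain b' where b: "b = ereal b'" by (cases b) auto
  then show "x0 < real_of_ereal b" "b = ereal (real_of_ereal b)" using x0 by auto
  have e: "einterval (ereal c) b = {c<..<b'}" by (auto simp: b)
  have "K absolutely_integrable_on {c<..<b'}"
  proof (rule absolutely_integrable_spike[OF _ negligible_empty])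
    show "(\<lambda>x. q x - r) absolutely_integrable_on {c<..<b'}"
      using c(3) unfolding e by (rule real_diff_const_integrable[of _ _ c b']) auto
    fix x assume "x \<in> {c<..<b'} - {}"
    then show "K x = q x - r" using less_trans[of a "ereal c" "ereal x"] c(1) by (simp add: sl_kernel_def indicator_def b)
  qed
  then have "K absolutely_integrable_on ({c<..<b'} \<union> {b'}) \<union> {min c t..c}"
    by (rule absolutely_integrable_Un[OF absolutely_integrable_Un[OF _ absolutely_integrable_negligible] kernel_interior])
      (use c t in \<open>auto simp: min_def\<close>)
  then show "K absolutely_integrable_on {t..real_of_ereal b}"
    by (rule set_integrable_subset) (auto simp: b)
qed

lemma volterra_on: "K absolutely_integrable_on {s..t} \<Longrightarrow> s \<le> x0 \<Longrightarrow> x0 \<le> t \<Longrightarrow> volterra_interval K s t x0"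
  by unfold_locales (auto intro: kernel_measurable)

lemma volterra_interior: "a < ereal s \<Longrightarrow> ereal t < b \<Longrightarrow> s \<le> x0 \<Longrightarrow> x0 \<le> t \<Longrightarrow> volterra_interval K s t x0"
  by (intro volterra_on kernel_interior)

lemma initial_values: "U A B x0 = A" "D A B x0 = B"
proof -
  have v: "volterra_interval K x0 x0 x0" by (rule volterra_interior) (use x0 in auto)
  show "U A B x0 = A" using volterra_interval.u_eq[OF v, of x0 A B] by simp
  show "D A B x0 = B" using volterra_interval.D_eq[OF v, of x0 A B] by simp
qed

lemma U_derivative:
  assumes "x \<in> einterval a b" shows "(U A B has_vector_derivative D A B x) (at x)"
proof -
  obtain s t where st: "a < ereal s" "s < x" "s < x0" "x < t" "x0 < t" "ereal t < b"
    using ereal_interval_around[of a x b x0] assms x0 by auto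
  have v: "volterra_interval K s t x0" by (rule volterra_interior) (use st in auto)
  show ?thesis by (rule volterra_interval.u_derivative[OF v]) (use st in auto)
qed

lemma D_derivative_AE:
  "\<exists>N. negligible N \<and> (\<forall>x\<in>einterval a b - N. (D A B has_vector_derivative K x * U A B x) (at x))"
proof -
  have ab: "a < b" using x0 by (rule less_trans)
  obtain h l :: "nat \<Rightarrow> real" where hl: "einterval a b = (\<Union>i. {l i .. h i})" "incseq h" "decseq l"
    "\<And>i. l i < h i" "\<And>i. a < l i" "\<And>i. h i < b"
    by (rule einterval_Icc_approximation[OF ab]) (rule that; assumption)
  have "\<exists>N. negligible N \<and> (\<forall>x\<in>{min (l n) x0<..<max (h n) x0} - N. (D A B has_vector_derivative K x * U A B x) (at x))" for n
    by (rule volterra_interval.D_derivative[OF volterra_interior])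
      (use hl(5)[of n] hl(6)[of n] x0 in \<open>auto simp: min_def max_def\<close>)
  then have "\<forall>n. \<exists>N. negligible N \<and> (\<forall>x\<in>{min (l n) x0<..<max (h n) x0} - N. (D A B has_vector_derivative K x * U A B x) (at x))" ..
  then obtain N where N: "\<forall>n. negligible (N n) \<and> (\<forall>x\<in>{min (l n) x0<..<max (h n) x0} - N n. (D A B has_vector_derivative K x * U A B x) (at x))"
    by (rule choice[THEN exE])
  \<comment> \<open>Derivatives are known inside open intervals, so the endpoints of the exhausting
    intervals join the exceptional set.\<close>
  define E where "E = (\<Union>n. N n) \<union> range (\<lambda>n. min (l n) x0) \<union> range (\<lambda>n. max (h n) x0)"
  have rng: "negligible (range s)" for s :: "nat \<Rightarrow> real"
    unfolding negligible_iff_null_sets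
    by (rule null_sets_completionI[OF countable_imp_null_set_lborel]) simp
  have "negligible (\<Union>n. N n)" by (rule negligible_countable_Union) (use N in auto)
  then have "negligible E" unfolding E_def
    by (intro negligible_Un rng)
  moreover have "(D A B has_vector_derivative K x * U A B x) (at x)" if x: "x \<in> einterval a b - E" for x
  proof -
    obtain n where n: "x \<in> {l n..h n}" using x unfolding hl(1) by blast
    have "x \<noteq> min (l n) x0" "x \<noteq> max (h n) x0" "x \<notin> N n" using x unfolding E_def by auto
    then have "x \<in> {min (l n) x0<..<max (h n) x0} - N n" using n by (auto simp: min_def max_def split: if_splits)
    then show ?thesis using N by blast
  qed
  ultimately show ?thesis by (intro exI[of _ E] conjI ballI)
qed

lemma D_ac: "a < ereal s \<Longrightarrow> ereal t < b \<Longrightarrow> absolutely_continuous_on s t (\<lambda>x. complex_of_real (D A B x))"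
  and D_continuous_on: "a < ereal s \<Longrightarrow> ereal t < b \<Longrightarrow> continuous_on {s..t} (D A B)"
  and U_continuous_on: "a < ereal s \<Longrightarrow> ereal t < b \<Longrightarrow> continuous_on {s..t} (U A B)"
proof -
  assume st: "a < ereal s" "ereal t < b"
  have v: "volterra_interval K (min s x0) (max t x0) x0"
    by (rule volterra_interior) (use st x0 in \<open>auto simp: min_def max_def\<close>)
  have sub: "{s..t} \<subseteq> {min s x0..max t x0}" by auto
  show "absolutely_continuous_on s t (\<lambda>x. complex_of_real (D A B x))"
    by (rule ac_subinterval[OF volterra_interval.D_ac[OF v]]) auto
  show "continuous_on {s..t} (D A B)" "continuous_on {s..t} (U A B)"
    using volterra_interval.D_continuous[OF v] volterra_interval.u_continuous[OF v] sub
    by (blast intro: continuous_on_subset)+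
qed

text \<open>The derivative \<open>D\<close> is continuous, hence bounded on compact subintervals, so
  the solution is Lipschitz there.\<close>

lemma U_ac:
  assumes st: "a < ereal s" "ereal t < b"
  shows "absolutely_continuous_on s t (\<lambda>x. complex_of_real (U A B x))"
proof -
  obtain C where C: "\<forall>x\<in>D A B ` {s..t}. norm x \<le> C"
    using compact_imp_bounded[OF compact_continuous_image[OF D_continuous_on[OF st] compact_Icc]] unfolding bounded_iff by blast
  show ?thesis
  proof (rule ac_lipschitz[of _ _ _ "max C 0"])
    fix x y assume xy: "s \<le> x" "x \<le> y" "y \<le> t"
    have "norm (U A B y - U A B x) \<le> max C 0 * norm (y - x)"
    proof (rule field_differentiable_bound[of "{s..t}" _ "D A B"])
      fix z assume z: "z \<in> {s..t}"
      then have "z \<in> einterval a b" using Icc_subset_einterval[OF st] by blast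
      then have "(U A B has_real_derivative D A B z) (at z)"
        unfolding has_real_derivative_iff_has_vector_derivative by (rule U_derivative)
      then show "(U A B has_real_derivative D A B z) (at z within {s..t})" by (rule has_field_derivative_at_within)
      show "norm (D A B z) \<le> max C 0" using C z by (meson imageI max.coboundedI1)
    qed (use xy in auto)
    moreover have "cmod (complex_of_real (U A B y) - complex_of_real (U A B x)) = \<bar>U A B y - U A B x\<bar>"
      by (simp flip: of_real_diff)
    ultimately show "cmod (complex_of_real (U A B y) - complex_of_real (U A B x)) \<le> max C 0 * (y - x)" using xy by simp
  qed simp
qed

lemma U_solution: "sl_solution a b q r (\<lambda>x. complex_of_real (U A B x))"
  and U_vderiv: "x \<in> einterval a b \<Longrightarrow> vderiv (\<lambda>x. complex_of_real (U A B x)) x = complex_of_real (D A B x)"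
proof -
  have d: "((\<lambda>x. complex_of_real (U A B x)) has_vector_derivative complex_of_real (D A B x)) (at x)" if "x \<in> einterval a b" for x
    by (rule bounded_linear.has_vector_derivative[OF bounded_linear_of_real U_derivative[OF that]])
  then show "x \<in> einterval a b \<Longrightarrow> vderiv (\<lambda>x. complex_of_real (U A B x)) x = complex_of_real (D A B x)"
    by (rule vector_derivative_at)
  obtain N where N: "negligible N" "\<forall>x\<in>einterval a b - N. (D A B has_vector_derivative K x * U A B x) (at x)"
    using D_derivative_AE[of A B] by (elim exE conjE)
  show "sl_solution a b q r (\<lambda>x. complex_of_real (U A B x))"
    unfolding sl_solution_iff
  proof (intro exI[of _ "\<lambda>x. complex_of_real (D A B x)"] conjI ballI exI[of _ N])
    show "locally_absolutely_continuous a b (\<lambda>x. complex_of_real (U A B x))"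
      "locally_absolutely_continuous a b (\<lambda>x. complex_of_real (D A B x))"
      unfolding locally_absolutely_continuous_def by (auto intro: U_ac D_ac)
    show "((\<lambda>x. complex_of_real (U A B x)) has_vector_derivative complex_of_real (D A B x)) (at x)" if "x \<in> einterval a b" for x
      by (rule d[OF that])
    fix x assume x: "x \<in> einterval a b - N"
    have dK: "((\<lambda>x. complex_of_real (D A B x)) has_vector_derivative complex_of_real (K x * U A B x)) (at x)"
      by (rule bounded_linear.has_vector_derivative[OF bounded_linear_of_real N(2)[rule_format, OF x]])
    have "K x * U A B x = (q x - r) * U A B x" using x by (simp add: sl_kernel_def indicator_def)
    then show "((\<lambda>x. complex_of_real (D A B x)) has_vector_derivative complex_of_real (q x - r) * complex_of_real (U A B x)) (at x)"
      using dK by (simp only: of_real_mult)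
  qed (rule N(1))
qed

abbreviation "\<theta> \<equiv> U 1 0" abbreviation "\<phi> \<equiv> U 0 1"
abbreviation "\<theta>' \<equiv> D 1 0" abbreviation "\<phi>' \<equiv> D 0 1"

lemma combination_solution:
  "sl_solution a b q r (\<lambda>x. A * complex_of_real (\<theta> x) + B * complex_of_real (\<phi> x))"
  and combination_vderiv: "x \<in> einterval a b \<Longrightarrow>
    vderiv (\<lambda>x. A * complex_of_real (\<theta> x) + B * complex_of_real (\<phi> x)) x = A * complex_of_real (\<theta>' x) + B * complex_of_real (\<phi>' x)"
  using sl_solution_combine[OF U_solution[of 1 0] U_solution[of 0 1], where A = A and B = B] U_vderiv by simp_all

text \<open>Uniqueness for the initial value problem: the Wronskians of \<open>w\<close> with
  \<theta> and \<phi> are constant and known at \<open>x0\<close>, and that of \<theta> and \<phi>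
  is 1, so the three-term identity can be solved for \<open>w\<close>.\<close>

lemma solution_representation:
  assumes w: "sl_solution a b q r w" and x: "x \<in> einterval a b"
  shows "w x = w x0 * complex_of_real (\<theta> x) + vderiv w x0 * complex_of_real (\<phi> x)"
proof -
  let ?t = "\<lambda>x. complex_of_real (\<theta> x)" and ?p = "\<lambda>x. complex_of_real (\<phi> x)"
  have c: "wronskian u v x = wronskian u v x0" if u: "sl_solution a b q r u" and v: "sl_solution a b q r v" for u v
    using wronskian_const[OF u v, of x x0] wronskian_const[OF u v, of x0 x] x x0 by (cases "x \<le> x0") auto
  have x0': "x0 \<in> einterval a b" using x0 by simp
  note i = initial_values U_vderiv[OF x0']
  have "wronskian ?t ?p x = 1" "wronskian ?p w x = - w x0" "wronskian w ?t x = - vderiv w x0"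
    unfolding c[OF U_solution U_solution] c[OF U_solution w] c[OF w U_solution] by (simp_all add: wronskian_def i)
  then have "w x + ?t x * (- w x0) + ?p x * (- vderiv w x0) = 0"
    using three_wronskians[of w x ?t ?p] by simp
  then show ?thesis by (simp add: algebra_simps)
qed

lemma left_limits:
  assumes "regular_at_left a b q"
  shows "(U A B \<longlongrightarrow> U A B (real_of_ereal a)) (at_right (real_of_ereal a))"
    "(D A B \<longlongrightarrow> D A B (real_of_ereal a)) (at_right (real_of_ereal a))"
    "\<forall>\<^sub>F x in at_right (real_of_ereal a). x \<in> einterval a b"
proof -
  note k = kernel_left[OF assms x0(2)]
  have v: "volterra_interval K (real_of_ereal a) x0 x0" by (rule volterra_on) (use k in auto)
  show "(U A B \<longlongrightarrow> U A B (real_of_ereal a)) (at_right (real_of_ereal a))"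
    "(D A B \<longlongrightarrow> D A B (real_of_ereal a)) (at_right (real_of_ereal a))"
    using continuous_on_Icc_at_rightD[OF volterra_interval.u_continuous[OF v] k(2)]
      continuous_on_Icc_at_rightD[OF volterra_interval.D_continuous[OF v] k(2)] .
  show "\<forall>\<^sub>F x in at_right (real_of_ereal a). x \<in> einterval a b"
    unfolding eventually_at_right_field
  proof (intro exI[of _ x0] conjI allI impI k(2))
    fix y assume y: "y > real_of_ereal a" "y < x0"
    have "a < ereal y" by (subst k(3)) (use y in simp)
    moreover have "ereal y < b" by (rule less_trans[OF _ x0(2)]) (use y in simp)
    ultimately show "y \<in> einterval a b" by simp
  qed
qed

lemma right_limits:
  assumes "regular_at_right a b q"
  shows "(U A B \<longlongrightarrow> U A B (real_of_ereal b)) (at_left (real_of_ereal b))"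
    "(D A B \<longlongrightarrow> D A B (real_of_ereal b)) (at_left (real_of_ereal b))"
    "\<forall>\<^sub>F x in at_left (real_of_ereal b). x \<in> einterval a b"
proof -
  note k = kernel_right[OF assms x0(1)]
  have v: "volterra_interval K x0 (real_of_ereal b) x0" by (rule volterra_on) (use k in auto)
  show "(U A B \<longlongrightarrow> U A B (real_of_ereal b)) (at_left (real_of_ereal b))"
    "(D A B \<longlongrightarrow> D A B (real_of_ereal b)) (at_left (real_of_ereal b))"
    using continuous_on_Icc_at_leftD[OF volterra_interval.u_continuous[OF v] k(2)]
      continuous_on_Icc_at_leftD[OF volterra_interval.D_continuous[OF v] k(2)] .
  show "\<forall>\<^sub>F x in at_left (real_of_ereal b). x \<in> einterval a b"
    unfolding eventually_at_left_field
  proof (intro exI[of _ x0] conjI allI impI k(2))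
    fix y assume y: "y > x0" "y < real_of_ereal b"
    have "ereal y < b" by (subst k(3)) (use y in simp)
    moreover have "a < ereal y" by (rule less_trans[OF x0(1)]) (use y in simp)
    ultimately show "y \<in> einterval a b" by simp
  qed
qed

text \<open>Limits of the combination and of its derivative are unique, so the condition becomes one
  linear equation in \<open>A\<close> and \<open>B\<close>, with values of the fundamental system at
  the endpoint \<open>e\<close> as coefficients.\<close>

lemma combination_boundary:
  assumes lim: "(\<theta> \<longlongrightarrow> \<theta> e) F" "(\<theta>' \<longlongrightarrow> \<theta>' e) F" "(\<phi> \<longlongrightarrow> \<phi> e) F" "(\<phi>' \<longlongrightarrow> \<phi>' e) F"
    and ev: "\<forall>\<^sub>F x in F. x \<in> einterval a b" and F: "F \<noteq> bot"
  shows "boundary_condition \<gamma> F (\<lambda>x. A * complex_of_real (\<theta> x) + B * complex_of_real (\<phi> x)) \<longleftrightarrow>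
    A * complex_of_real (\<theta> e * cos \<gamma> + \<theta>' e * sin \<gamma>) + B * complex_of_real (\<phi> e * cos \<gamma> + \<phi>' e * sin \<gamma>) = 0"
    (is "boundary_condition \<gamma> F ?u \<longleftrightarrow> ?R = 0")
proof -
  have u: "(?u \<longlongrightarrow> A * complex_of_real (\<theta> e) + B * complex_of_real (\<phi> e)) F"
    by (intro tendsto_intros lim)
  have "((\<lambda>x. A * complex_of_real (\<theta>' x) + B * complex_of_real (\<phi>' x)) \<longlongrightarrow> A * complex_of_real (\<theta>' e) + B * complex_of_real (\<phi>' e)) F"
    by (intro tendsto_intros lim)
  moreover have "\<forall>\<^sub>F x in F. A * complex_of_real (\<theta>' x) + B * complex_of_real (\<phi>' x) = vderiv ?u x"
    using ev by (rule eventually_mono) (rule combination_vderiv[symmetric])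
  ultimately have u': "(vderiv ?u \<longlongrightarrow> A * complex_of_real (\<theta>' e) + B * complex_of_real (\<phi>' e)) F"
    by (rule Lim_transform_eventually)
  have R: "?R = (A * complex_of_real (\<theta> e) + B * complex_of_real (\<phi> e)) * complex_of_real (cos \<gamma>) +
      (A * complex_of_real (\<theta>' e) + B * complex_of_real (\<phi>' e)) * complex_of_real (sin \<gamma>)"
    by (simp add: algebra_simps)
  show ?thesis
  proof
    assume "boundary_condition \<gamma> F ?u"
    then obtain l l' where l: "(?u \<longlongrightarrow> l) F" "(vderiv ?u \<longlongrightarrow> l') F" "l * complex_of_real (cos \<gamma>) + l' * complex_of_real (sin \<gamma>) = 0"
      unfolding boundary_condition_def by (elim exE conjE)
    show "?R = 0" unfolding R using l(3) unfolding tendsto_unique[OF F l(1) u] tendsto_unique[OF F l(2) u'] .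
  next
    assume "?R = 0"
    then show "boundary_condition \<gamma> F ?u" unfolding R boundary_condition_def using u u' by (intro exI conjI)
  qed
qed

end

section \<open>Eigenfunctions as genuine functions\<close>

definition sl_eigenfunction :: "ereal \<Rightarrow> ereal \<Rightarrow> real \<Rightarrow> real \<Rightarrow> (real \<Rightarrow> real) \<Rightarrow> real \<Rightarrow> (real \<Rightarrow> complex) \<Rightarrow> bool" where
  "sl_eigenfunction a b \<alpha> \<beta> q r u \<longleftrightarrow>
     sl_solution a b q r u \<and> square_integrable (interval_measure_on a b) u \<and>
     (regular_at_left a b q \<longrightarrow> boundary_condition \<alpha> (at_right (real_of_ereal a)) u) \<and>
     (regular_at_right a b q \<longrightarrow> boundary_condition \<beta> (at_left (real_of_ereal b)) u) \<and>
     (\<exists>x\<in>einterval a b. u x \<noteq> 0)"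

lemma sl_expression_continuous:
  assumes "sl_expression a b q u w" shows "continuous_on (einterval a b) u"
  using assms differentiable_imp_continuous_within
  by (auto simp: sl_expression_def intro!: continuous_at_imp_continuous_on)

lemma continuous_nonzero_not_negligible:
  fixes u :: "real \<Rightarrow> complex"
  assumes u: "continuous_on (einterval a b) u" and x: "x \<in> einterval a b" "u x \<noteq> 0"
  shows "\<not> (AE x in lebesgue_on (einterval a b). u x = 0)"
proof
  assume "AE x in lebesgue_on (einterval a b). u x = 0"
  then obtain N where N: "negligible N" "\<forall>x\<in>einterval a b - N. u x = 0" unfolding AE_einterval_negligible by (elim exE conjE)
  have "open {x \<in> einterval a b. u x \<in> - {0}}"
    by (rule continuous_open_preimage[OF u open_einterval, of "- {0}", unfolded vimage_def Int_def, simplified mem_Collect_eq]) auto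
  moreover have "{x \<in> einterval a b. u x \<in> - {0}} \<noteq> {}" using x by blast
  ultimately have "\<not> negligible {x \<in> einterval a b. u x \<in> - {0}}" by (rule open_not_negligible)
  moreover have "{x \<in> einterval a b. u x \<in> - {0}} \<subseteq> N" using N(2) by blast
  ultimately show False using N(1) negligible_subset by blast
qed

text \<open>An eigenvector is a class of functions; passing to its regular representative changes
  both sides of the equation on a null set. Nonvanishing transfers because a continuous function
  that is nonzero somewhere is nonzero on an open set.\<close>

lemma point_spectrum_sl_operator:
  "r \<in> point_spectrum (L2_hspace a b) (sl_operator a b \<alpha> \<beta> q) \<longleftrightarrow> (\<exists>u. sl_eigenfunction a b \<alpha> \<beta> q r u)"
proof
  assume "r \<in> point_spectrum (L2_hspace a b) (sl_operator a b \<alpha> \<beta> q)"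
  then obtain w u where w: "square_integrable (interval_measure_on a b) w"
    and ne: "(\<integral>x. w x * cnj (w x) \<partial>interval_measure_on a b) \<noteq> 0"
    and ae: "AE x in interval_measure_on a b. w x = u x" and u: "sl_expression a b q u (\<lambda>x. complex_of_real r * w x)"
    and bc: "regular_at_left a b q \<longrightarrow> boundary_condition \<alpha> (at_right (real_of_ereal a)) u"
      "regular_at_right a b q \<longrightarrow> boundary_condition \<beta> (at_left (real_of_ereal b)) u"
    unfolding point_spectrum_def sl_operator_def L2_hspace_def by auto
  have "AE x in interval_measure_on a b. \<exists>u''. (vderiv u has_vector_derivative u'') (at x) \<and> - u'' + complex_of_real (q x) * u x = complex_of_real r * w x"
    using u unfolding sl_expression_def by blast
  then have "AE x in interval_measure_on a b. \<exists>u''. (vderiv u has_vector_derivative u'') (at x) \<and> - u'' + complex_of_real (q x) * u x = complex_of_real r * u x"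
    using ae by eventually_elim simp
  then have sol: "sl_solution a b q r u" using u unfolding sl_solution_def sl_expression_def by blast
  have m: "u \<in> borel_measurable (interval_measure_on a b)"
    by (rule continuous_imp_measurable_on_sets_lebesgue[OF sl_expression_continuous[OF u]]) simp
  have "integrable (interval_measure_on a b) (\<lambda>x. (cmod (u x))\<^sup>2)"
    by (rule integrable_cong_AE_imp[of _ "\<lambda>x. (cmod (w x))\<^sup>2"]) (use w m ae in \<open>auto simp: square_integrable_def\<close>)
  then have "square_integrable (interval_measure_on a b) u" using m by (simp add: square_integrable_def)
  moreover have "\<exists>x\<in>einterval a b. u x \<noteq> 0"
  proof (rule ccontr)
    assume "\<not> (\<exists>x\<in>einterval a b. u x \<noteq> 0)"
    then have z: "\<forall>x\<in>einterval a b. u x = 0" by blast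
    have "AE x in interval_measure_on a b. w x * cnj (w x) = 0"
      using ae AE_space by eventually_elim (use z in \<open>simp add: space_restrict_space\<close>)
    then have "(\<integral>x. w x * cnj (w x) \<partial>interval_measure_on a b) = 0" by (rule integral_eq_zero_AE)
    with ne show False ..
  qed
  ultimately show "\<exists>u. sl_eigenfunction a b \<alpha> \<beta> q r u" using sol bc unfolding sl_eigenfunction_def by blast
next
  assume "\<exists>u. sl_eigenfunction a b \<alpha> \<beta> q r u"
  then obtain u where u: "sl_eigenfunction a b \<alpha> \<beta> q r u" ..
  then have sq: "square_integrable (interval_measure_on a b) u" and sol: "sl_expression a b q u (\<lambda>x. complex_of_real r * u x)"
    unfolding sl_eigenfunction_def sl_solution_def by blast+
  obtain x where x: "x \<in> einterval a b" "u x \<noteq> 0" using u unfolding sl_eigenfunction_def by blast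
  have sqr: "square_integrable (interval_measure_on a b) (\<lambda>x. complex_of_real r * u x)"
    using square_integrable_combine[OF sq sq, of "complex_of_real r" 0] by simp
  have "(\<integral>x. u x * cnj (u x) \<partial>interval_measure_on a b) = complex_of_real (\<integral>x. (cmod (u x))\<^sup>2 \<partial>interval_measure_on a b)"
    by (simp add: complex_norm_square[symmetric] flip: of_real_power)
  moreover have "(\<integral>x. (cmod (u x))\<^sup>2 \<partial>interval_measure_on a b) \<noteq> 0"
  proof
    assume "(\<integral>x. (cmod (u x))\<^sup>2 \<partial>interval_measure_on a b) = 0"
    then have "AE x in interval_measure_on a b. (cmod (u x))\<^sup>2 = 0"
      using sq by (subst (asm) integral_nonneg_eq_0_iff_AE) (auto simp: square_integrable_def)
    then have "AE x in interval_measure_on a b. u x = 0" by simp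
    then show False using continuous_nonzero_not_negligible[where u = u, OF sl_expression_continuous[OF sol] x] by blast
  qed
  ultimately have "vinner (L2_hspace a b) u u \<noteq> 0" by (simp add: L2_hspace_def)
  moreover have "(u, vscale (L2_hspace a b) (complex_of_real r) u) \<in> sl_operator a b \<alpha> \<beta> q"
    using u sq sqr sol unfolding sl_operator_def L2_hspace_def sl_eigenfunction_def
    by (auto intro!: exI[of _ u])
  ultimately show "r \<in> point_spectrum (L2_hspace a b) (sl_operator a b \<alpha> \<beta> q)"
    unfolding point_spectrum_def by blast
qed

text \<open>Compactness replaces a measurable selection: boundedness at one point of the compact set can be tested
  on a countable dense subset.\<close>

lemma compact_bounded_family:
  fixes Q :: "nat \<Rightarrow> 'e::metric_space \<Rightarrow> real"
  assumes S: "compact S" and E: "E \<subseteq> S" "S \<subseteq> closure E" and cont: "\<And>n. continuous_on S (Q n)"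
    and mono: "\<And>n m e. n \<le> m \<Longrightarrow> Q n e \<le> Q m e"
  shows "(\<exists>e\<in>S. \<exists>m::nat. \<forall>n. Q n e \<le> real m) \<longleftrightarrow> (\<exists>m::nat. \<forall>n. \<exists>e\<in>E. Q n e < real m)"
proof
  assume "\<exists>e\<in>S. \<exists>m::nat. \<forall>n. Q n e \<le> real m"
  then obtain e and m :: nat where e: "e \<in> S" "\<forall>n. Q n e \<le> real m" by blast
  have "\<exists>e'\<in>E. Q n e' < real (Suc m)" for n
  proof -
    obtain d where d: "d > 0" "\<forall>e'\<in>S. dist e' e < d \<longrightarrow> dist (Q n e') (Q n e) < 1"
      using cont[of n] e(1) unfolding continuous_on_iff by (meson zero_less_one)
    obtain e' where e': "e' \<in> E" "dist e' e < d"
      using E(2) e(1) d(1) unfolding closure_approachable by (meson closure_approachable subsetD)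
    then have "dist (Q n e') (Q n e) < 1" using d(2) E(1) by blast
    then have "Q n e' < real (Suc m)" using e(2)[rule_format, of n] by (simp add: dist_real_def)
    then show ?thesis using e'(1) by blast
  qed
  then show "\<exists>m::nat. \<forall>n. \<exists>e\<in>E. Q n e < real m" by blast
next
  assume "\<exists>m::nat. \<forall>n. \<exists>e\<in>E. Q n e < real m"
  then obtain m :: nat where m: "\<forall>n. \<exists>e. e \<in> E \<and> Q n e < real m" by blast
  obtain e where e: "\<forall>n. e n \<in> E \<and> Q n (e n) < real m" using choice[OF m] by blast
  then have "\<forall>n. e n \<in> S" using E(1) by blast
  then obtain l \<sigma> where l: "l \<in> S" "strict_mono (\<sigma> :: nat \<Rightarrow> nat)" "(e \<circ> \<sigma>) \<longlonglongrightarrow> l"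
    using S unfolding compact_def by blast
  have "Q n l \<le> real m" for n
  proof (rule LIMSEQ_le_const2)
    show "(\<lambda>k. Q n ((e \<circ> \<sigma>) k)) \<longlonglongrightarrow> Q n l"
      by (rule continuous_on_tendsto_compose[OF cont l(3,1)]) (use \<open>\<forall>n. e n \<in> S\<close> in auto)
    show "\<exists>N. \<forall>k\<ge>N. Q n ((e \<circ> \<sigma>) k) \<le> real m"
    \<comment> \<open>For \<open>k\<close> at least \<open>n\<close>, monotonicity compares the
      fixed function \<open>Q n\<close> with \<open>Q (\<sigma> k)\<close>, which is below
      \<open>m\<close> at its own point.\<close>
    proof (intro exI[of _ n] allI impI)
      fix k assume "n \<le> k"
      then have "n \<le> \<sigma> k" using seq_suble[OF l(2), of k] by linarith
      then have "Q n (e (\<sigma> k)) \<le> Q (\<sigma> k) (e (\<sigma> k))" by (rule mono)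
      also have "\<dots> < real m" using e by blast
      finally show "Q n ((e \<circ> \<sigma>) k) \<le> real m" by simp
    qed
  qed
  then show "\<exists>e\<in>S. \<exists>m::nat. \<forall>n. Q n e \<le> real m" using l(1) by blast
qed

section \<open>Real coefficients of eigenfunctions\<close>

context sl_equation
begin

lemma U_borel [measurable]: "U A B \<in> borel_measurable borel"
  by (rule volterra_interval.u_meas[OF volterra_interior[of x0 x0]]) (use x0 in auto)

text \<open>The fundamental system and the boundary forms are real, so real and imaginary parts of
  the coefficient pair satisfy the same conditions separately; a nonzero one of them is rescaled to
  the unit circle, a compact parameter set.\<close>

lemma eigenfunction_iff_real:
  "(\<exists>u. sl_eigenfunction a b \<alpha> \<beta> q r u) \<longleftrightarrow>
     (\<exists>A B :: real. A\<^sup>2 + B\<^sup>2 = 1 \<and>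
        square_integrable (interval_measure_on a b) (\<lambda>x. complex_of_real (A * \<theta> x + B * \<phi> x)) \<and>
        (regular_at_left a b q \<longrightarrow> A * (\<theta> (real_of_ereal a) * cos \<alpha> + \<theta>' (real_of_ereal a) * sin \<alpha>) +
           B * (\<phi> (real_of_ereal a) * cos \<alpha> + \<phi>' (real_of_ereal a) * sin \<alpha>) = 0) \<and>
        (regular_at_right a b q \<longrightarrow> A * (\<theta> (real_of_ereal b) * cos \<beta> + \<theta>' (real_of_ereal b) * sin \<beta>) +
           B * (\<phi> (real_of_ereal b) * cos \<beta> + \<phi>' (real_of_ereal b) * sin \<beta>) = 0))"
    (is "?E \<longleftrightarrow> (\<exists>A B. ?P A B \<and> ?sq A B \<and> (?rl \<longrightarrow> A * ?la + B * ?lb = 0) \<and> (?rr \<longrightarrow> A * ?ra + B * ?rb = 0))")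
  and real_eigenfunction: "(\<exists>u. sl_eigenfunction a b \<alpha> \<beta> q r u) \<Longrightarrow>
    \<exists>w::real \<Rightarrow> real. sl_eigenfunction a b \<alpha> \<beta> q r (\<lambda>x. complex_of_real (w x))"
proof -
  let ?u = "\<lambda>A B x. A * complex_of_real (\<theta> x) + B * complex_of_real (\<phi> x)"
  have bl: "boundary_condition \<alpha> (at_right (real_of_ereal a)) (?u A B) \<longleftrightarrow> A * complex_of_real ?la + B * complex_of_real ?lb = 0"
    if ?rl for A B using left_limits[OF that] by (intro combination_boundary) auto
  have br: "boundary_condition \<beta> (at_left (real_of_ereal b)) (?u A B) \<longleftrightarrow> A * complex_of_real ?ra + B * complex_of_real ?rb = 0"
    if ?rr for A B using right_limits[OF that] by (intro combination_boundary) auto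
  have realI: "sl_eigenfunction a b \<alpha> \<beta> q r (\<lambda>x. complex_of_real (A * \<theta> x + B * \<phi> x))"
    if AB: "?P A B" "?sq A B" "?rl \<longrightarrow> A * ?la + B * ?lb = 0" "?rr \<longrightarrow> A * ?ra + B * ?rb = 0" for A B
  proof -
    let ?w = "?u (complex_of_real A) (complex_of_real B)"
    have cx: "complex_of_real A * complex_of_real p + complex_of_real B * complex_of_real r = complex_of_real (A * p + B * r)" for p r
      by simp
    have "\<exists>x\<in>einterval a b. ?w x \<noteq> 0"
    proof (rule ccontr)
      assume "\<not> (\<exists>x\<in>einterval a b. ?w x \<noteq> 0)"
      then have z: "?w x = 0" if "x \<in> einterval a b" for x using that by blast
      have x0': "x0 \<in> einterval a b" using x0 by simp
      have "A = 0" using z[OF x0'] by (simp add: initial_values)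
      have "((\<lambda>x. 0) has_vector_derivative vderiv ?w x0) (at x0)"
        by (rule has_vector_derivative_transform_within_open[OF sl_solution_vderiv[OF combination_solution x0'] open_einterval x0'])
          (rule z)
      then have "vderiv ?w x0 = 0" using vector_derivative_at has_vector_derivative_const by metis
      then have "B = 0" unfolding combination_vderiv[OF x0'] by (simp add: initial_values)
      with \<open>A = 0\<close> AB(1) show False by simp
    qed
    moreover have "square_integrable (interval_measure_on a b) ?w" using AB(2) unfolding cx .
    moreover have "?rl \<longrightarrow> boundary_condition \<alpha> (at_right (real_of_ereal a)) ?w"
    proof
      assume reg: ?rl
      then have z: "A * ?la + B * ?lb = 0" using AB(3) by blast
      show "boundary_condition \<alpha> (at_right (real_of_ereal a)) ?w"
        by (rule iffD2[OF bl[OF reg]]) (unfold cx z, rule of_real_0)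
    qed
    moreover have "?rr \<longrightarrow> boundary_condition \<beta> (at_left (real_of_ereal b)) ?w"
    proof
      assume reg: ?rr
      then have z: "A * ?ra + B * ?rb = 0" using AB(4) by blast
      show "boundary_condition \<beta> (at_left (real_of_ereal b)) ?w"
        by (rule iffD2[OF br[OF reg]]) (unfold cx z, rule of_real_0)
    qed
    ultimately have "sl_eigenfunction a b \<alpha> \<beta> q r ?w" unfolding sl_eigenfunction_def using combination_solution by blast
    then show ?thesis unfolding cx .
  qed
  have forth: "\<exists>A B. ?P A B \<and> ?sq A B \<and> (?rl \<longrightarrow> A * ?la + B * ?lb = 0) \<and> (?rr \<longrightarrow> A * ?ra + B * ?rb = 0)" if ex: ?E
  proof -
    from ex
    obtain u where u: "sl_eigenfunction a b \<alpha> \<beta> q r u" ..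
    define A B where "A = u x0" and "B = vderiv u x0"
    have sol: "sl_solution a b q r u" using u unfolding sl_eigenfunction_def by blast
    have eq: "u x = ?u A B x" if "x \<in> einterval a b" for x
      unfolding A_def B_def by (rule solution_representation[OF sol that])
    have veq: "vderiv u x = vderiv (?u A B) x" if x: "x \<in> einterval a b" for x
    proof -
      have "(?u A B has_vector_derivative vderiv u x) (at x)"
        by (rule has_vector_derivative_transform_within_open[OF sl_solution_vderiv[OF sol x] open_einterval x]) (rule eq)
      then show ?thesis by (rule vector_derivative_at[symmetric])
    qed
    have bceq: "boundary_condition \<gamma> F (?u A B)" if bc: "boundary_condition \<gamma> F u" and ev: "\<forall>\<^sub>F x in F. x \<in> einterval a b" for \<gamma> F
    proof -
      obtain l l' where l: "(u \<longlongrightarrow> l) F" "(vderiv u \<longlongrightarrow> l') F" "l * complex_of_real (cos \<gamma>) + l' * complex_of_real (sin \<gamma>) = 0"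
        using bc unfolding boundary_condition_def by (elim exE conjE)
      have "\<forall>\<^sub>F x in F. u x = ?u A B x" using ev by (rule eventually_mono) (rule eq)
      moreover have "\<forall>\<^sub>F x in F. vderiv u x = vderiv (?u A B) x" using ev by (rule eventually_mono) (rule veq)
      ultimately show ?thesis
        unfolding boundary_condition_def using Lim_transform_eventually[OF l(1)] Lim_transform_eventually[OF l(2)] l(3)
        by (intro exI conjI)
    qed
    have L: "A * complex_of_real ?la + B * complex_of_real ?lb = 0" if ?rl
      by (rule iffD1[OF bl[OF that]]) (rule bceq, use u that left_limits(3)[OF that] in \<open>auto simp: sl_eigenfunction_def\<close>)
    have R: "A * complex_of_real ?ra + B * complex_of_real ?rb = 0" if ?rr
      by (rule iffD1[OF br[OF that]]) (rule bceq, use u that right_limits(3)[OF that] in \<open>auto simp: sl_eigenfunction_def\<close>)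
    have "square_integrable (interval_measure_on a b) u" using u unfolding sl_eigenfunction_def by blast
    moreover have "square_integrable (interval_measure_on a b) u \<longleftrightarrow> square_integrable (interval_measure_on a b) (?u A B)"
      by (rule square_integrable_cong_interval) (rule eq)
    ultimately have sq: "square_integrable (interval_measure_on a b) (?u A B)" by (rule iffD1[rotated])
    obtain x where x: "x \<in> einterval a b" "u x \<noteq> 0" using u unfolding sl_eigenfunction_def by blast
    then have "A \<noteq> 0 \<or> B \<noteq> 0" using eq[OF x(1)] by auto
    then have "(Re A)\<^sup>2 + (Re B)\<^sup>2 \<noteq> 0 \<or> (Im A)\<^sup>2 + (Im B)\<^sup>2 \<noteq> 0"
      by (auto simp: complex_eq_iff add_nonneg_eq_0_iff)
    \<comment> \<open>\<open>h\<close> stands for \<open>Re\<close> or \<open>Im\<close>, whichever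
      gives a nonzero pair; the two cases are treated together.\<close>
    then obtain h where h: "h = Re \<or> h = Im" and nz: "(h A)\<^sup>2 + (h B)\<^sup>2 \<noteq> 0" by blast
    have hc: "h (A * complex_of_real p + B * complex_of_real r) = h A * p + h B * r" for p r using h by auto
    have h0: "h 0 = 0" using h by auto
    have hn: "\<bar>h z\<bar> \<le> cmod z" for z using h abs_Re_le_cmod abs_Im_le_cmod by auto
    define c where "c = sqrt ((h A)\<^sup>2 + (h B)\<^sup>2)"
    have c: "c > 0" "c\<^sup>2 = (h A)\<^sup>2 + (h B)\<^sup>2" using nz unfolding c_def by (simp_all add: less_le)
    have sqh: "square_integrable (interval_measure_on a b) (\<lambda>x. complex_of_real (h (?u A B x)))"
      unfolding square_integrable_def
    proof (intro conjI)
      have m: "?u A B \<in> borel_measurable (interval_measure_on a b)" using sq by (simp add: square_integrable_def)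
      have "h \<in> borel_measurable borel" using h by auto
      then have hm: "(\<lambda>x. h (?u A B x)) \<in> borel_measurable (interval_measure_on a b)" by (rule measurable_compose[OF m])
      then show "(\<lambda>x. complex_of_real (h (?u A B x))) \<in> borel_measurable (interval_measure_on a b)" by measurable
      show "integrable (interval_measure_on a b) (\<lambda>x. (cmod (complex_of_real (h (?u A B x))))\<^sup>2)"
      proof (rule Bochner_Integration.integrable_bound)
        show "integrable (interval_measure_on a b) (\<lambda>x. (cmod (?u A B x))\<^sup>2)" using sq unfolding square_integrable_def by blast
        show "(\<lambda>x. (cmod (complex_of_real (h (?u A B x))))\<^sup>2) \<in> borel_measurable (interval_measure_on a b)"
          using hm by measurable
        show "AE x in interval_measure_on a b. norm ((cmod (complex_of_real (h (?u A B x))))\<^sup>2) \<le> norm ((cmod (?u A B x))\<^sup>2)"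
        proof (rule AE_I2)
          fix x
          have "\<bar>h (?u A B x)\<bar>\<^sup>2 \<le> (cmod (?u A B x))\<^sup>2" using hn by (rule power_mono) simp
          then show "norm ((cmod (complex_of_real (h (?u A B x))))\<^sup>2) \<le> norm ((cmod (?u A B x))\<^sup>2)" by simp
        qed
      qed
    qed
    show "\<exists>A B. ?P A B \<and> ?sq A B \<and> (?rl \<longrightarrow> A * ?la + B * ?lb = 0) \<and> (?rr \<longrightarrow> A * ?ra + B * ?rb = 0)"
    proof (rule exI[of _ "h A / c"], rule exI[of _ "h B / c"], intro conjI impI)
      show "?P (h A / c) (h B / c)"
        unfolding power_divide add_divide_distrib[symmetric] c(2)[symmetric] using c(1) by simp
      have "(\<lambda>x. complex_of_real (h A / c * \<theta> x + h B / c * \<phi> x)) = (\<lambda>x. complex_of_real (1 / c) * complex_of_real (h (?u A B x)) + 0 * complex_of_real (h (?u A B x)))"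
        unfolding hc by (simp add: add_divide_distrib)
      then show "?sq (h A / c) (h B / c)" using square_integrable_combine[OF sqh sqh, of "complex_of_real (1 / c)" 0] by (simp only:)
      show "h A / c * ?la + h B / c * ?lb = 0" if ?rl
        using arg_cong[OF L[OF that], of h] unfolding hc h0 by (simp flip: add_divide_distrib)
      show "h A / c * ?ra + h B / c * ?rb = 0" if ?rr
        using arg_cong[OF R[OF that], of h] unfolding hc h0 by (simp flip: add_divide_distrib)
    qed
  qed
  show "?E \<longleftrightarrow> (\<exists>A B. ?P A B \<and> ?sq A B \<and> (?rl \<longrightarrow> A * ?la + B * ?lb = 0) \<and> (?rr \<longrightarrow> A * ?ra + B * ?rb = 0))"
  proof
    assume "\<exists>A B. ?P A B \<and> ?sq A B \<and> (?rl \<longrightarrow> A * ?la + B * ?lb = 0) \<and> (?rr \<longrightarrow> A * ?ra + B * ?rb = 0)"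
    then obtain A B where "?P A B" "?sq A B" "?rl \<longrightarrow> A * ?la + B * ?lb = 0" "?rr \<longrightarrow> A * ?ra + B * ?rb = 0"
      by (elim exE conjE)
    from realI[OF this] show ?E
      by (rule exI[of _ "\<lambda>x. complex_of_real (A * \<theta> x + B * \<phi> x)"])
  qed (rule forth)
  assume ?E
  from forth[OF this] obtain A B where "?P A B" "?sq A B" "?rl \<longrightarrow> A * ?la + B * ?lb = 0" "?rr \<longrightarrow> A * ?ra + B * ?rb = 0"
    by (elim exE conjE)
  from realI[OF this] show "\<exists>w::real \<Rightarrow> real. sl_eigenfunction a b \<alpha> \<beta> q r (\<lambda>x. complex_of_real (w x))"
    by (intro exI[of _ "\<lambda>x. A * \<theta> x + B * \<phi> x"])
qed

lemma combination_integrable: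
  assumes "a < ereal s" "ereal t < b"
  shows "integrable lborel (\<lambda>x. indicator {s..t} x * (U A B x * U A' B' x))"
  using borel_integrable_atLeastAtMost'[OF continuous_on_mult[OF U_continuous_on[OF assms] U_continuous_on[OF assms]]]
  unfolding set_integrable_def by simp

text \<open>As a quadratic form in the coefficients the integral is continuous in them, and its
  measurability in a parameter is that of three integrals over the fundamental system.\<close>

lemma combination_square:
  assumes "a < ereal s" "ereal t < b"
  shows "integrable lborel (\<lambda>x. indicator {s..t} x * (A * \<theta> x + B * \<phi> x)\<^sup>2)"
    and "(\<integral>x. indicator {s..t} x * (A * \<theta> x + B * \<phi> x)\<^sup>2 \<partial>lborel) =
      A\<^sup>2 * (\<integral>x. indicator {s..t} x * (\<theta> x * \<theta> x) \<partial>lborel) + 2 * A * B * (\<integral>x. indicator {s..t} x * (\<theta> x * \<phi> x) \<partial>lborel) +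
      B\<^sup>2 * (\<integral>x. indicator {s..t} x * (\<phi> x * \<phi> x) \<partial>lborel)"
proof -
  have e: "indicator {s..t} x * (A * \<theta> x + B * \<phi> x)\<^sup>2 = A\<^sup>2 * (indicator {s..t} x * (\<theta> x * \<theta> x)) +
    2 * A * B * (indicator {s..t} x * (\<theta> x * \<phi> x)) + B\<^sup>2 * (indicator {s..t} x * (\<phi> x * \<phi> x))" for x :: real
    by (simp add: power2_eq_square algebra_simps)
  show "integrable lborel (\<lambda>x. indicator {s..t} x * (A * \<theta> x + B * \<phi> x)\<^sup>2)"
    unfolding e by (intro Bochner_Integration.integrable_add integrable_mult_right combination_integrable[OF assms])
  show "(\<integral>x. indicator {s..t} x * (A * \<theta> x + B * \<phi> x)\<^sup>2 \<partial>lborel) =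
      A\<^sup>2 * (\<integral>x. indicator {s..t} x * (\<theta> x * \<theta> x) \<partial>lborel) + 2 * A * B * (\<integral>x. indicator {s..t} x * (\<theta> x * \<phi> x) \<partial>lborel) +
      B\<^sup>2 * (\<integral>x. indicator {s..t} x * (\<phi> x * \<phi> x) \<partial>lborel)"
    unfolding e
    by (simp only: Bochner_Integration.integral_add Bochner_Integration.integrable_add integrable_mult_right
        combination_integrable[OF assms] integral_mult_right_zero)
qed

text \<open>Monotone convergence along the exhausting intervals; a natural number as bound keeps the
  quantifiers countable.\<close>

lemma square_integrable_iff_bounded:
  assumes hl: "einterval a b = (\<Union>i. {l i .. h i})" "incseq h" "decseq l" "\<And>i. a < ereal (l i)" "\<And>i. ereal (h i) < b"
  shows "square_integrable (interval_measure_on a b) (\<lambda>x. complex_of_real (A * \<theta> x + B * \<phi> x)) \<longleftrightarrow>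
    (\<exists>m::nat. \<forall>n::nat. (\<integral>x. indicator {l n..h n} x * (A * \<theta> x + B * \<phi> x)\<^sup>2 \<partial>lborel) \<le> real m)"
proof -
  let ?g = "\<lambda>x. A * \<theta> x + B * \<phi> x"
  have g [measurable]: "?g \<in> borel_measurable borel" by measurable
  have "(\<lambda>x. complex_of_real (?g x)) \<in> borel_measurable lborel" by measurable
  then have "(\<lambda>x. complex_of_real (?g x)) \<in> borel_measurable lebesgue" by (rule measurable_completion)
  then have m: "(\<lambda>x. complex_of_real (?g x)) \<in> borel_measurable (interval_measure_on a b)"
    by (rule measurable_restrict_space1)
  have "square_integrable (interval_measure_on a b) (\<lambda>x. complex_of_real (?g x)) \<longleftrightarrow>
      integrable (interval_measure_on a b) (\<lambda>x. (?g x)\<^sup>2)"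
    unfolding square_integrable_def using m by (simp del: of_real_add of_real_mult)
  also have "\<dots> \<longleftrightarrow> integrable lebesgue (\<lambda>x. indicator (einterval a b) x *\<^sub>R (?g x)\<^sup>2)"
    by (rule integrable_restrict_space) simp
  also have "\<dots> \<longleftrightarrow> integrable lborel (\<lambda>x. indicator (einterval a b) x *\<^sub>R (?g x)\<^sup>2)"
    by (rule integrable_completion) measurable
  also have "\<dots> \<longleftrightarrow> (\<exists>m::nat. \<forall>n::nat. (\<integral>x. indicator {l n..h n} x * (?g x)\<^sup>2 \<partial>lborel) \<le> real m)"
  proof
    assume i: "integrable lborel (\<lambda>x. indicator (einterval a b) x *\<^sub>R (?g x)\<^sup>2)"
    obtain m :: nat where m: "(\<integral>x. indicator (einterval a b) x *\<^sub>R (?g x)\<^sup>2 \<partial>lborel) \<le> real m" using real_arch_simple by blast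
    have "(\<integral>x. indicator {l n..h n} x * (?g x)\<^sup>2 \<partial>lborel) \<le> (\<integral>x. indicator (einterval a b) x *\<^sub>R (?g x)\<^sup>2 \<partial>lborel)" for n
    proof (rule integral_mono[OF combination_square(1)[OF hl(4,5)] i])
      fix x show "indicator {l n..h n} x * (?g x)\<^sup>2 \<le> indicator (einterval a b) x *\<^sub>R (?g x)\<^sup>2"
        unfolding hl(1) by (auto simp: indicator_def)
    qed
    then show "\<exists>m::nat. \<forall>n::nat. (\<integral>x. indicator {l n..h n} x * (?g x)\<^sup>2 \<partial>lborel) \<le> real m" using m by (meson order_trans)
  next
    assume "\<exists>m::nat. \<forall>n::nat. (\<integral>x. indicator {l n..h n} x * (?g x)\<^sup>2 \<partial>lborel) \<le> real m"
    then obtain m :: nat where mb: "\<forall>n. (\<integral>x. indicator {l n..h n} x * (?g x)\<^sup>2 \<partial>lborel) \<le> real m" ..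
    have nn: "(\<integral>\<^sup>+x. ennreal (indicator {l n..h n} x * (?g x)\<^sup>2) \<partial>lborel) \<le> ennreal (real m)" for n
      by (subst nn_integral_eq_integral[OF combination_square(1)[OF hl(4,5)]]) (use mb in \<open>auto intro: ennreal_leI\<close>)
    have step: "indicator {l n..h n} x * (?g x)\<^sup>2 \<le> indicator {l k..h k} x * (?g x)\<^sup>2" if "n \<le> k" for n k x
      using incseqD[OF hl(2) that] decseqD[OF hl(3) that] by (auto simp: indicator_def)
    have "(\<integral>\<^sup>+x. ennreal (norm (indicator (einterval a b) x *\<^sub>R (?g x)\<^sup>2)) \<partial>lborel) = (\<integral>\<^sup>+x. (SUP n. ennreal (indicator {l n..h n} x * (?g x)\<^sup>2)) \<partial>lborel)"
    proof (rule nn_integral_cong)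
      fix x :: real
      show "ennreal (norm (indicator (einterval a b) x *\<^sub>R (?g x)\<^sup>2)) = (SUP n. ennreal (indicator {l n..h n} x * (?g x)\<^sup>2))"
      proof (rule antisym)
        show "(SUP n. ennreal (indicator {l n..h n} x * (?g x)\<^sup>2)) \<le> ennreal (norm (indicator (einterval a b) x *\<^sub>R (?g x)\<^sup>2))"
          unfolding hl(1) by (rule SUP_least, rule ennreal_leI) (auto simp: indicator_def)
        show "ennreal (norm (indicator (einterval a b) x *\<^sub>R (?g x)\<^sup>2)) \<le> (SUP n. ennreal (indicator {l n..h n} x * (?g x)\<^sup>2))"
        proof (cases "x \<in> einterval a b")
          case True
          then obtain n where "x \<in> {l n..h n}" unfolding hl(1) by blast
          then show ?thesis using True by (intro SUP_upper2[of n]) (simp_all add: indicator_def)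
        next
          case False
          then have "norm (indicator (einterval a b) x *\<^sub>R (?g x)\<^sup>2) = 0" by (simp del: einterval_set)
          then show ?thesis by (simp only: ennreal_0 zero_le)
        qed
      qed
    qed
    also have "\<dots> = (SUP n. \<integral>\<^sup>+x. ennreal (indicator {l n..h n} x * (?g x)\<^sup>2) \<partial>lborel)"
      by (rule nn_integral_monotone_convergence_SUP) (auto simp: incseq_def le_fun_def intro!: ennreal_leI step)
    also have "\<dots> \<le> ennreal (real m)" by (rule SUP_least) (rule nn)
    also have "\<dots> < \<infinity>" by simp
    finally show "integrable lborel (\<lambda>x. indicator (einterval a b) x *\<^sub>R (?g x)\<^sup>2)"
      by (intro integrableI_bounded) measurable
  qed
  finally show ?thesis .
qed

end

section \<open>Measurability of the set of pairs of parameter and eigenvalue\<close>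

lemma (in sl_equation) potential_integrable: "a < ereal s \<Longrightarrow> ereal t < b \<Longrightarrow> q absolutely_integrable_on {s..t}"
  using q Icc_subset_einterval[of a s t b] unfolding locally_integrable_def by (metis compact_Icc)

text \<open>Local integrability allows moving the cut point freely. Fixing it at \<open>x0\<close>
  removes the quantifier over \<open>c\<close> from the definition, so that regularity becomes a
  measurable event.\<close>

lemma (in sl_equation) regular_at_left_iff:
  "regular_at_left a b q \<longleftrightarrow> a \<noteq> -\<infinity> \<and> q absolutely_integrable_on einterval a (ereal x0)"
proof
  assume "regular_at_left a b q"
  then obtain c where c: "a < ereal c" "ereal c < b" "q absolutely_integrable_on einterval a (ereal c)" and a: "a \<noteq> -\<infinity>"
    unfolding regular_at_left_def by auto
  have "q absolutely_integrable_on einterval a (ereal c) \<union> {c..x0}"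
    by (rule absolutely_integrable_Un[OF c(3) potential_integrable]) (use c x0 in auto)
  then have "q absolutely_integrable_on einterval a (ereal x0)" by (rule set_integrable_subset) auto
  with a show "a \<noteq> -\<infinity> \<and> q absolutely_integrable_on einterval a (ereal x0)" ..
qed (use x0 in \<open>auto simp: regular_at_left_def\<close>)

lemma (in sl_equation) regular_at_right_iff:
  "regular_at_right a b q \<longleftrightarrow> b \<noteq> \<infinity> \<and> q absolutely_integrable_on einterval (ereal x0) b"
proof
  assume "regular_at_right a b q"
  then obtain c where c: "a < ereal c" "ereal c < b" "q absolutely_integrable_on einterval (ereal c) b" and b: "b \<noteq> \<infinity>"
    unfolding regular_at_right_def by auto
  have "q absolutely_integrable_on einterval (ereal c) b \<union> {x0..c}"
    by (rule absolutely_integrable_Un[OF c(3) potential_integrable]) (use c x0 in auto)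
  then have "q absolutely_integrable_on einterval (ereal x0) b" by (rule set_integrable_subset) auto
  with b show "b \<noteq> \<infinity> \<and> q absolutely_integrable_on einterval (ereal x0) b" ..
qed (use x0 in \<open>auto simp: regular_at_right_def\<close>)

text \<open>Integrability of a measurable function is finiteness of the integral of its norm, and
  this integral is measurable in the parameter.\<close>

lemma pred_absolutely_integrable:
  fixes q :: "'w \<Rightarrow> real \<Rightarrow> real"
  assumes qm: "(\<lambda>(\<omega>, x). indicator (einterval a b) x * q \<omega> x) \<in> borel_measurable (M \<Otimes>\<^sub>M lebesgue)"
    and S: "S \<subseteq> einterval a b" "S \<in> sets lebesgue"
  shows "{\<omega> \<in> space M. q \<omega> absolutely_integrable_on S} \<in> sets M"
proof -
  interpret L: sigma_finite_measure "lebesgue :: real measure" by (rule sigma_finite_lebesgue)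
  let ?w = "\<lambda>\<omega> x. indicator (einterval a b) x * q \<omega> x"
  have ind: "(\<lambda>z. indicator S (snd z) :: real) \<in> borel_measurable (M \<Otimes>\<^sub>M lebesgue)"
    by (rule measurable_compose[OF measurable_snd borel_measurable_indicator[OF S(2)]])
  have e: "indicator S x * ?w \<omega> x = indicator S x *\<^sub>R q \<omega> x" for \<omega> x
    using S(1) by (cases "x \<in> S") (auto simp del: einterval_set)
  have m: "(\<lambda>(\<omega>, x). ennreal (norm (indicator S x *\<^sub>R q \<omega> x))) \<in> borel_measurable (M \<Otimes>\<^sub>M lebesgue)"
  proof -
    have "(\<lambda>z. indicator S (snd z) * (case z of (\<omega>, x) \<Rightarrow> ?w \<omega> x)) = (\<lambda>z. indicator S (snd z) *\<^sub>R q (fst z) (snd z))"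
      by (rule ext) (simp only: case_prod_beta e)
    with borel_measurable_times[OF ind qm]
    have "(\<lambda>z. indicator S (snd z) *\<^sub>R q (fst z) (snd z)) \<in> borel_measurable (M \<Otimes>\<^sub>M lebesgue)" by (simp only:)
    then have "(\<lambda>z. ennreal (norm (indicator S (snd z) *\<^sub>R q (fst z) (snd z)))) \<in> borel_measurable (M \<Otimes>\<^sub>M lebesgue)"
      by measurable
    then show ?thesis by (simp only: case_prod_beta')
  qed
  have "q \<omega> absolutely_integrable_on S \<longleftrightarrow> (\<integral>\<^sup>+x. ennreal (norm (indicator S x *\<^sub>R q \<omega> x)) \<partial>lebesgue) < \<infinity>" if \<omega>: "\<omega> \<in> space M" for \<omega>
  proof -
    have "(\<lambda>x. case (\<omega>, x) of (\<omega>, x) \<Rightarrow> ?w \<omega> x) \<in> borel_measurable lebesgue"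
      by (rule measurable_compose[OF measurable_Pair1'[OF \<omega>] qm])
    then have w: "?w \<omega> \<in> borel_measurable lebesgue" by (simp only: prod.case)
    have "(\<lambda>x. indicator S x * ?w \<omega> x) \<in> borel_measurable lebesgue"
      by (rule borel_measurable_times[OF borel_measurable_indicator[OF S(2)] w])
    then have "(\<lambda>x. indicator S x *\<^sub>R q \<omega> x) \<in> borel_measurable lebesgue" unfolding e .
    then show ?thesis unfolding set_integrable_def by (simp only: integrable_iff_bounded simp_thms)
  qed
  then have "{\<omega> \<in> space M. q \<omega> absolutely_integrable_on S} =
      {\<omega> \<in> space M. (\<integral>\<^sup>+x. ennreal (norm (indicator S x *\<^sub>R q \<omega> x)) \<partial>lebesgue) < \<infinity>}" by blast
  also have "\<dots> \<in> sets M"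
    by (rule borel_measurable_less[OF L.borel_measurable_nn_integral[OF m]]) simp
  finally show ?thesis .
qed

text \<open>Square integrability and boundary conditions are merged into boundedness in
  \<open>n\<close> of a single quantity \<open>Q\<close>, increasing in \<open>n\<close> and
  continuous in the coefficients; \<open>compact_bounded_family\<close> then reduces the existence
  of coefficients on the unit circle to countably many measurable conditions.\<close>

lemma eigenvalue_set_measurable:
  fixes M :: "'w measure" and q :: "'w \<Rightarrow> real \<Rightarrow> real"
  assumes x0: "a < ereal x0" "ereal x0 < b" and q: "\<And>\<omega>. \<omega> \<in> space M \<Longrightarrow> locally_integrable a b (q \<omega>)"
    and qm: "(\<lambda>(\<omega>, x). indicator (einterval a b) x * q \<omega> x) \<in> borel_measurable (M \<Otimes>\<^sub>M lebesgue)"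
  shows "{p \<in> space (M \<Otimes>\<^sub>M borel). \<exists>u. sl_eigenfunction a b \<alpha> \<beta> (q (fst p)) (snd p) u} \<in> sets (M \<Otimes>\<^sub>M borel)"
proof -
  have ab: "a < b" using x0 by (rule less_trans)
  obtain h l :: "nat \<Rightarrow> real" where hl0: "einterval a b = (\<Union>i. {l i .. h i})" "incseq h" "decseq l"
    "\<And>i. l i < h i" "\<And>i. a < l i" "\<And>i. h i < b"
    by (rule einterval_Icc_approximation[OF ab]) (rule that; assumption)
  note hl = hl0(1-3,5,6)
  let ?N = "M \<Otimes>\<^sub>M (borel :: real measure)"
  let ?k = "\<lambda>p. sl_kernel a b (q (fst p)) (snd p)"
  have m1: "(\<lambda>z. (fst (fst z), snd z)) \<in> measurable (?N \<Otimes>\<^sub>M lebesgue) (M \<Otimes>\<^sub>M (lebesgue :: real measure))" by measurable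
  have m3: "(\<lambda>z. indicator (einterval a b) (snd z) :: real) \<in> borel_measurable (?N \<Otimes>\<^sub>M lebesgue)"
    by (rule measurable_compose[OF measurable_snd borel_measurable_indicator]) simp
  have m4: "(\<lambda>z. snd (fst z)) \<in> borel_measurable (?N \<Otimes>\<^sub>M (lebesgue :: real measure))" by measurable
  have km: "(\<lambda>(p, t). ?k p t) \<in> borel_measurable (?N \<Otimes>\<^sub>M lebesgue)"
    using borel_measurable_diff[OF measurable_compose[OF m1 qm] borel_measurable_times[OF m3 m4]]
    by (simp add: sl_kernel_def case_prod_beta' right_diff_distrib)
  have lb: "sets (?N \<Otimes>\<^sub>M lborel) = sets (?N \<Otimes>\<^sub>M (borel :: real measure))" by (rule sets_pair_measure_cong) simp_all
  have sm: "(\<lambda>(p, x). volterra_sol x0 (?k p) A B x) \<in> borel_measurable (?N \<Otimes>\<^sub>M lborel)" for A B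
    using volterra_sol_measurable[OF km] unfolding measurable_cong_sets[OF lb refl] .
  let ?I = "\<lambda>A B A' B' n p. \<integral>x. indicator {l n..h n} x * (volterra_sol x0 (?k p) A B x * volterra_sol x0 (?k p) A' B' x) \<partial>lborel"
  have Im: "?I A B A' B' n \<in> borel_measurable ?N" for A B A' B' and n :: nat
  proof (rule lborel.borel_measurable_lebesgue_integral)
    have "(\<lambda>z. indicator {l n..h n} (snd z) :: real) \<in> borel_measurable (?N \<Otimes>\<^sub>M lborel)" by measurable
    from borel_measurable_times[OF this borel_measurable_times[OF sm[of A B] sm[of A' B']]]
    show "(\<lambda>(p, x). indicator {l n..h n} x * (volterra_sol x0 (?k p) A B x * volterra_sol x0 (?k p) A' B' x)) \<in> borel_measurable (?N \<Otimes>\<^sub>M lborel)"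
      by (simp add: case_prod_beta')
  qed
  let ?b = "\<lambda>\<gamma> e A B p. volterra_sol x0 (?k p) A B e * cos \<gamma> + volterra_der x0 (?k p) A B e * sin \<gamma>"
  have bm: "?b \<gamma> e A B \<in> borel_measurable ?N" for \<gamma> e A B
  proof -
    have "(\<lambda>p. case (p, e) of (p, x) \<Rightarrow> volterra_sol x0 (?k p) A B x) \<in> borel_measurable ?N"
      by (rule measurable_compose[OF _ volterra_sol_measurable[OF km]]) measurable
    then have [measurable]: "(\<lambda>p. volterra_sol x0 (?k p) A B e) \<in> borel_measurable ?N" by simp
    have [measurable]: "(\<lambda>p. volterra_der x0 (?k p) A B e) \<in> borel_measurable ?N" by (rule volterra_der_measurable[OF km])
    show ?thesis by measurable
  qed
  have sl: "sl_equation a b (q \<omega>) x0" if "\<omega> \<in> space M" for \<omega> by (rule sl_equation.intro[OF x0 q[OF that]])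
  have subl: "einterval a (ereal x0) \<subseteq> einterval a b" using x0 by (auto simp: less_trans[of _ "ereal x0" b])
  have subr: "einterval (ereal x0) b \<subseteq> einterval a b" using x0 by (auto simp: less_trans[of a "ereal x0"])
  \<comment> \<open>Whether an endpoint is regular may depend on the parameter; a factor 0 or 1
    switches its boundary condition off or on.\<close>
  let ?RL = "\<lambda>p :: 'w \<times> real. if regular_at_left a b (q (fst p)) then 1 else 0 :: real"
  let ?RR = "\<lambda>p :: 'w \<times> real. if regular_at_right a b (q (fst p)) then 1 else 0 :: real"
  have "{\<omega> \<in> space M. regular_at_left a b (q \<omega>)} = (if a \<noteq> -\<infinity> then {\<omega> \<in> space M. q \<omega> absolutely_integrable_on einterval a (ereal x0)} else {})"
    using sl_equation.regular_at_left_iff[OF sl] by auto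
  also have "\<dots> \<in> sets M"
    using pred_absolutely_integrable[OF qm subl] by simp
  finally have [measurable]: "Measurable.pred M (\<lambda>\<omega>. regular_at_left a b (q \<omega>))" by (simp add: pred_def)
  have "{\<omega> \<in> space M. regular_at_right a b (q \<omega>)} = (if b \<noteq> \<infinity> then {\<omega> \<in> space M. q \<omega> absolutely_integrable_on einterval (ereal x0) b} else {})"
    using sl_equation.regular_at_right_iff[OF sl] by auto
  also have "\<dots> \<in> sets M"
    using pred_absolutely_integrable[OF qm subr] by simp
  finally have [measurable]: "Measurable.pred M (\<lambda>\<omega>. regular_at_right a b (q \<omega>))" by (simp add: pred_def)
  have RLm: "?RL \<in> borel_measurable ?N" and RRm: "?RR \<in> borel_measurable ?N" by measurable
  define la lb ra rb where "la = ?b \<alpha> (real_of_ereal a) 1 0" and "lb = ?b \<alpha> (real_of_ereal a) 0 1"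
    and "ra = ?b \<beta> (real_of_ereal b) 1 0" and "rb = ?b \<beta> (real_of_ereal b) 0 1"
  define I1 I2 I3 where "I1 = ?I 1 0 1 0" and "I2 = ?I 1 0 0 1" and "I3 = ?I 0 1 0 1"
  define RL RR where "RL = ?RL" and "RR = ?RR"
  \<comment> \<open>Sum of the squares of the active boundary forms, zero exactly when all boundary
    conditions hold; in \<open>Q\<close> it is multiplied by \<open>n\<close>, so boundedness forces
    it to vanish.\<close>
  define T where "T p e = RL p * (fst e * la p + snd e * lb p)\<^sup>2 + RR p * (fst e * ra p + snd e * rb p)\<^sup>2" for p :: "'w \<times> real" and e :: "real \<times> real"
  define Q where "Q p n e = (fst e)\<^sup>2 * I1 n p + 2 * fst e * snd e * I2 n p + (snd e)\<^sup>2 * I3 n p + real n * T p e" for p :: "'w \<times> real" and n and e :: "real \<times> real"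
  have [measurable]: "la \<in> borel_measurable ?N" "lb \<in> borel_measurable ?N" "ra \<in> borel_measurable ?N" "rb \<in> borel_measurable ?N"
    unfolding la_def lb_def ra_def rb_def by (rule bm)+
  have [measurable]: "I1 n \<in> borel_measurable ?N" "I2 n \<in> borel_measurable ?N" "I3 n \<in> borel_measurable ?N" for n
    unfolding I1_def I2_def I3_def by (rule Im)+
  have [measurable]: "RL \<in> borel_measurable ?N" "RR \<in> borel_measurable ?N" unfolding RL_def RR_def by (rule RLm RRm)+
  have Qm: "(\<lambda>p. Q p n e) \<in> borel_measurable ?N" for n e unfolding Q_def T_def by measurable
  obtain E :: "(real \<times> real) set" where E: "countable E" "E \<subseteq> sphere 0 1" "sphere 0 1 \<subseteq> closure E"
    by (rule separable)
  have T_nonneg: "T p e \<ge> 0" for p e by (simp add: T_def RL_def RR_def)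
  have char: "(\<exists>u. sl_eigenfunction a b \<alpha> \<beta> (q (fst p)) (snd p) u) \<longleftrightarrow> (\<exists>m::nat. \<forall>n. \<exists>e\<in>E. Q p n e < real m)"
    if p: "p \<in> space ?N" for p
  proof -
    have "fst p \<in> space M" using p by (simp add: space_pair_measure mem_Times_iff)
    then interpret S: sl_equation a b "q (fst p)" "snd p" x0 by (rule sl)
    let ?J = "\<lambda>n e. \<integral>x. indicator {l n..h n} x * (fst e * S.U 1 0 x + snd e * S.U 0 1 x)\<^sup>2 \<partial>lborel"
    have Q_eq: "Q p n e = ?J n e + real n * T p e" for n and e :: "real \<times> real"
      unfolding Q_def I1_def I2_def I3_def S.combination_square(2)[OF hl(4,5)] ..
    have J_mono: "?J n e \<le> ?J m e" if "n \<le> m" for n m and e :: "real \<times> real"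
    proof (rule integral_mono[OF S.combination_square(1)[OF hl(4,5)] S.combination_square(1)[OF hl(4,5)]])
      fix x show "indicator {l n..h n} x * (fst e * S.U 1 0 x + snd e * S.U 0 1 x)\<^sup>2 \<le> indicator {l m..h m} x * (fst e * S.U 1 0 x + snd e * S.U 0 1 x)\<^sup>2"
        using incseqD[OF hl(2) that] decseqD[OF hl(3) that] by (auto simp: indicator_def)
    qed
    have J_nonneg: "?J n e \<ge> 0" for n and e :: "real \<times> real" by (rule Bochner_Integration.integral_nonneg) simp
    have bounded: "(\<exists>m::nat. \<forall>n. Q p n e \<le> real m) \<longleftrightarrow> (\<exists>m::nat. \<forall>n. ?J n e \<le> real m) \<and> T p e = 0" for e
    proof
      assume "\<exists>m::nat. \<forall>n. Q p n e \<le> real m"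
      then obtain m :: nat where m: "\<And>n. ?J n e + real n * T p e \<le> real m" unfolding Q_eq by blast
      have "T p e = 0"
      proof (rule ccontr)
        assume "T p e \<noteq> 0"
        then have "T p e > 0" using T_nonneg[of p e] by simp
        then obtain n :: nat where "real m < real n * T p e" using ex_less_of_nat_mult by blast
        then show False using m[of n] J_nonneg[of n e] by linarith
      qed
      then show "(\<exists>m::nat. \<forall>n. ?J n e \<le> real m) \<and> T p e = 0" using m by auto
    qed (auto simp: Q_eq)
    have T0: "T p e = 0 \<longleftrightarrow> (regular_at_left a b (q (fst p)) \<longrightarrow> fst e * la p + snd e * lb p = 0) \<and>
        (regular_at_right a b (q (fst p)) \<longrightarrow> fst e * ra p + snd e * rb p = 0)" for e
    proof -
      have "T p e = 0 \<longleftrightarrow> RL p * (fst e * la p + snd e * lb p)\<^sup>2 = 0 \<and> RR p * (fst e * ra p + snd e * rb p)\<^sup>2 = 0"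
        unfolding T_def by (rule add_nonneg_eq_0_iff) (simp_all add: RL_def RR_def)
      then show ?thesis by (simp add: RL_def RR_def)
    qed
    have sph: "e \<in> sphere 0 1 \<longleftrightarrow> (fst e)\<^sup>2 + (snd e)\<^sup>2 = 1" for e :: "real \<times> real"
      by (simp add: norm_prod_def)
    have "(\<exists>u. sl_eigenfunction a b \<alpha> \<beta> (q (fst p)) (snd p) u) \<longleftrightarrow>
        (\<exists>A B. (A, B) \<in> sphere 0 1 \<and> (\<exists>m::nat. \<forall>n. Q p n (A, B) \<le> real m))"
      unfolding bounded T0 sph S.eigenfunction_iff_real S.square_integrable_iff_bounded[OF hl] la_def lb_def ra_def rb_def fst_conv snd_conv ..
    also have "\<dots> \<longleftrightarrow> (\<exists>e\<in>sphere 0 1. \<exists>m::nat. \<forall>n. Q p n e \<le> real m)" by (simp only: Bex_def split_paired_Ex)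
    also have "\<dots> \<longleftrightarrow> (\<exists>m::nat. \<forall>n. \<exists>e\<in>E. Q p n e < real m)"
    proof (rule compact_bounded_family[OF compact_sphere E(2,3)])
      show "continuous_on (sphere 0 1) (Q p n)" for n
        unfolding Q_def[abs_def] T_def by (intro continuous_intros)
      show "Q p n e \<le> Q p m e" if "n \<le> m" for n m e
        unfolding Q_eq using J_mono[OF that] T_nonneg that by (intro add_mono mult_right_mono) auto
    qed
    finally show ?thesis .
  qed
  have "{p \<in> space ?N. \<exists>u. sl_eigenfunction a b \<alpha> \<beta> (q (fst p)) (snd p) u} =
      {p \<in> space ?N. \<exists>m::nat. \<forall>n. \<exists>e\<in>E. Q p n e < real m}" using char by blast
  also have "\<dots> \<in> sets ?N"
    by (intro sets.sets_Collect_countable_Ex sets.sets_Collect_countable_All sets.sets_Collect_countable_Ex' E(1)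
        borel_measurable_less Qm borel_measurable_const)
  finally show ?thesis .
qed

section \<open>Orthogonality and countability of the couplings\<close>

text \<open>Bessel's inequality for the semidefinite form \<open>\<integral> G f h\<close>; quotients with vanishing denominator are 0.\<close>

lemma bessel_inequality:
  fixes G \<xi> :: "real \<Rightarrow> real" and w :: "'s \<Rightarrow> real \<Rightarrow> real"
  assumes F: "finite F" and G: "\<And>x. G x \<ge> 0"
    and i\<xi>: "integrable M (\<lambda>x. G x * (\<xi> x * \<xi> x))" and i\<xi>w: "\<And>s. s \<in> F \<Longrightarrow> integrable M (\<lambda>x. G x * (\<xi> x * w s x))"
    and iw: "\<And>s t. s \<in> F \<Longrightarrow> t \<in> F \<Longrightarrow> integrable M (\<lambda>x. G x * (w s x * w t x))"
    and orth: "\<And>s t. s \<in> F \<Longrightarrow> t \<in> F \<Longrightarrow> s \<noteq> t \<Longrightarrow> (\<integral>x. G x * (w s x * w t x) \<partial>M) = 0"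
  shows "(\<Sum>s\<in>F. (\<integral>x. G x * (\<xi> x * w s x) \<partial>M)\<^sup>2 / (\<integral>x. G x * (w s x * w s x) \<partial>M)) \<le> (\<integral>x. G x * (\<xi> x * \<xi> x) \<partial>M)"
proof -
  define b where "b s = (\<integral>x. G x * (\<xi> x * w s x) \<partial>M)" for s
  define n where "n s = (\<integral>x. G x * (w s x * w s x) \<partial>M)" for s
  define a where "a s = b s / n s" for s
  have "0 \<le> (\<integral>x. G x * (\<xi> x - (\<Sum>s\<in>F. a s * w s x))\<^sup>2 \<partial>M)"
    by (rule Bochner_Integration.integral_nonneg) (use G in simp)
  also have "(\<lambda>x. G x * (\<xi> x - (\<Sum>s\<in>F. a s * w s x))\<^sup>2) = (\<lambda>x. G x * (\<xi> x * \<xi> x) - 2 * (\<Sum>s\<in>F. a s * (G x * (\<xi> x * w s x))) +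
      (\<Sum>s\<in>F. \<Sum>t\<in>F. a s * a t * (G x * (w s x * w t x))))"
  proof
    fix x
    have "(\<Sum>s\<in>F. a s * w s x) * (\<Sum>t\<in>F. a t * w t x) = (\<Sum>s\<in>F. \<Sum>t\<in>F. (a s * w s x) * (a t * w t x))"
      by (rule sum_product)
    then have "G x * ((\<Sum>s\<in>F. a s * w s x) * (\<Sum>t\<in>F. a t * w t x)) = (\<Sum>s\<in>F. \<Sum>t\<in>F. a s * a t * (G x * (w s x * w t x)))"
      by (simp add: sum_distrib_left mult.assoc mult.left_commute)
    moreover have "G x * \<xi> x * (\<Sum>s\<in>F. a s * w s x) = (\<Sum>s\<in>F. a s * (G x * (\<xi> x * w s x)))"
      by (simp add: sum_distrib_left mult.assoc mult.left_commute)
    moreover have "G x * (p - S)\<^sup>2 = G x * (p * p) - 2 * (G x * p * S) + G x * (S * S)" for p S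
      by (simp add: power2_eq_square algebra_simps)
    ultimately show "G x * (\<xi> x - (\<Sum>s\<in>F. a s * w s x))\<^sup>2 = G x * (\<xi> x * \<xi> x) - 2 * (\<Sum>s\<in>F. a s * (G x * (\<xi> x * w s x))) +
      (\<Sum>s\<in>F. \<Sum>t\<in>F. a s * a t * (G x * (w s x * w t x)))" by simp
  qed
  also have "(\<integral>x. G x * (\<xi> x * \<xi> x) - 2 * (\<Sum>s\<in>F. a s * (G x * (\<xi> x * w s x))) +
      (\<Sum>s\<in>F. \<Sum>t\<in>F. a s * a t * (G x * (w s x * w t x))) \<partial>M) =
      (\<integral>x. G x * (\<xi> x * \<xi> x) \<partial>M) - 2 * (\<Sum>s\<in>F. a s * b s) + (\<Sum>s\<in>F. \<Sum>t\<in>F. a s * a t * (\<integral>x. G x * (w s x * w t x) \<partial>M))"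
    using i\<xi> i\<xi>w iw by (simp add: b_def)
  also have "(\<Sum>s\<in>F. \<Sum>t\<in>F. a s * a t * (\<integral>x. G x * (w s x * w t x) \<partial>M)) = (\<Sum>s\<in>F. a s * b s)"
  proof (rule sum.cong[OF refl])
    fix s assume s: "s \<in> F"
    have "(\<Sum>t\<in>F. a s * a t * (\<integral>x. G x * (w s x * w t x) \<partial>M)) = (\<Sum>t\<in>F. if t = s then a s * a s * n s else 0)"
      by (rule sum.cong[OF refl]) (use orth s in \<open>auto simp: n_def\<close>)
    also have "\<dots> = a s * a s * n s" using F s by simp
    also have "\<dots> = a s * b s" by (simp add: a_def)
    finally show "(\<Sum>t\<in>F. a s * a t * (\<integral>x. G x * (w s x * w t x) \<partial>M)) = a s * b s" .
  qed
  finally have "(\<Sum>s\<in>F. a s * b s) \<le> (\<integral>x. G x * (\<xi> x * \<xi> x) \<partial>M)" by linarith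
  then show ?thesis by (simp add: a_def b_def n_def power2_eq_square)
qed

text \<open>For a fixed rational interval, Bessel's inequality makes the coefficients of its
  indicator summable, so countably many \<open>s\<close> have a nonzero one. Every
  \<open>w s\<close> is continuous and nonzero at a point, so it has constant sign on some rational
  interval and a nonzero coefficient there.\<close>

lemma countable_orthogonal_continuous:
  fixes g :: "real \<Rightarrow> real" and w :: "'s \<Rightarrow> real \<Rightarrow> real"
  assumes g: "g absolutely_integrable_on {c..d}" and pos: "AE x in lebesgue. x \<in> {c<..<d} \<longrightarrow> g x > 0"
    and w: "\<And>s. s \<in> T \<Longrightarrow> continuous_on {c..d} (w s)"
    and nz: "\<And>s. s \<in> T \<Longrightarrow> \<exists>x\<in>{c<..<d}. w s x \<noteq> 0"
    and orth: "\<And>s t. s \<in> T \<Longrightarrow> t \<in> T \<Longrightarrow> s \<noteq> t \<Longrightarrow> ((\<lambda>x. g x * (w s x * w t x)) has_integral 0) {c..d}"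
  shows "countable T"
proof -
  \<comment> \<open>The absolute value makes the weight nonnegative everywhere, as Bessel's
    inequality requires; almost everywhere on (c, d) it agrees with \<open>g\<close>.\<close>
  define G where "G x = indicator {c<..<d} x * \<bar>g x\<bar>" for x
  have G0: "G x \<ge> 0" for x by (simp add: G_def)
  have "(\<lambda>x. \<bar>g x\<bar>) absolutely_integrable_on {c<..<d}"
    by (rule set_integrable_abs, rule set_integrable_subset[OF g]) auto
  then have Gi: "integrable lebesgue G" unfolding set_integrable_def G_def[abs_def] by simp
  have id: "(\<lambda>x::real. x) \<in> borel_measurable lebesgue" by (rule measurable_completion) simp
  define \<xi> where "\<xi> i x = (indicator {fst i<..<snd i} x :: real)" for i :: "real \<times> real" and x
  have \<xi>m: "\<xi> i \<in> borel_measurable lebesgue" for i unfolding \<xi>_def[abs_def] by (rule borel_measurable_indicator) simp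
  have prod_int: "integrable lebesgue (\<lambda>x. G x * f x)"
    if m: "(\<lambda>x. indicator {c..d} x * f x) \<in> borel_measurable lebesgue" and B: "\<And>x. x \<in> {c..d} \<Longrightarrow> \<bar>f x\<bar> \<le> B" for f B
  proof -
    have e: "G x * f x = G x * (indicator {c..d} x * f x)" for x by (auto simp: G_def indicator_def)
    show ?thesis
    proof (rule Bochner_Integration.integrable_bound)
      show "integrable lebesgue (\<lambda>x. \<bar>B\<bar> * G x)" using Gi by (rule integrable_mult_right)
      show "(\<lambda>x. G x * f x) \<in> borel_measurable lebesgue"
        unfolding e by (rule borel_measurable_times[OF borel_measurable_integrable[OF Gi] m])
      show "AE x in lebesgue. norm (G x * f x) \<le> norm (\<bar>B\<bar> * G x)"
      proof (rule AE_I2)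
        fix x
        show "norm (G x * f x) \<le> norm (\<bar>B\<bar> * G x)"
        proof (cases "x \<in> {c<..<d}")
          case True
          then have "\<bar>f x\<bar> \<le> \<bar>B\<bar>" using B[of x] by auto
          then show ?thesis using G0[of x] by (simp add: abs_mult mult.commute mult_left_mono)
        qed (simp add: G_def)
      qed
    qed
  qed
  have wm: "(\<lambda>x. indicator {c..d} x * w s x) \<in> borel_measurable lebesgue" if "s \<in> T" for s
    using absolutely_integrable_continuous_real[OF w[OF that]] unfolding set_integrable_def by (auto dest: borel_measurable_integrable)
  have wB: "\<exists>B. \<forall>x\<in>{c..d}. \<bar>w s x\<bar> \<le> B" if "s \<in> T" for s
    using compact_imp_bounded[OF compact_continuous_image[OF w[OF that] compact_Icc]] unfolding bounded_iff by auto
  have iww: "integrable lebesgue (\<lambda>x. G x * (w s x * w t x))" if st: "s \<in> T" "t \<in> T" for s t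
  proof -
    obtain B B' where B: "\<forall>x\<in>{c..d}. \<bar>w s x\<bar> \<le> B" "\<forall>x\<in>{c..d}. \<bar>w t x\<bar> \<le> B'" using wB[OF st(1)] wB[OF st(2)] by blast
    show ?thesis
    proof (rule prod_int[where B = "B * B'"])
      have "(\<lambda>x. (indicator {c..d} x * w s x) * (indicator {c..d} x * w t x)) \<in> borel_measurable lebesgue"
        by (rule borel_measurable_times[OF wm[OF st(1)] wm[OF st(2)]])
      moreover have "(indicator {c..d} x * w s x) * (indicator {c..d} x * w t x) = indicator {c..d} x * (w s x * w t x)" for x
        by (simp add: indicator_def)
      ultimately show "(\<lambda>x. indicator {c..d} x * (w s x * w t x)) \<in> borel_measurable lebesgue" by simp
      show "\<bar>w s x * w t x\<bar> \<le> B * B'" if "x \<in> {c..d}" for x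
        unfolding abs_mult using B that by (intro mult_mono) (auto intro: order_trans[OF abs_ge_zero])
    qed
  qed
  have i\<xi>w: "integrable lebesgue (\<lambda>x. G x * (\<xi> i x * w s x))" if s: "s \<in> T" for s i
  proof -
    obtain B where B: "\<forall>x\<in>{c..d}. \<bar>w s x\<bar> \<le> B" using wB[OF s] by blast
    show ?thesis
    proof (rule prod_int[where B = "B"])
      show "(\<lambda>x. indicator {c..d} x * (\<xi> i x * w s x)) \<in> borel_measurable lebesgue"
        using borel_measurable_times[OF \<xi>m[of i] wm[OF s]] by (simp only: mult.left_commute)
      show "\<bar>\<xi> i x * w s x\<bar> \<le> B" if "x \<in> {c..d}" for x
        using B that abs_ge_zero[of "w s x"] by (cases "x \<in> {fst i<..<snd i}") (auto simp: \<xi>_def simp del: abs_ge_zero intro: order_trans)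
    qed
  qed
  have i\<xi>: "integrable lebesgue (\<lambda>x. G x * (\<xi> i x * \<xi> i x))" for i
    by (rule prod_int[where B = 1], intro borel_measurable_times \<xi>m borel_measurable_indicator) (auto simp: \<xi>_def indicator_def)
  have gpos: "AE x in lebesgue. G x = indicator {c<..<d} x * g x"
    using pos by eventually_elim (auto simp: G_def indicator_def)
  have orthG: "(\<integral>x. G x * (w s x * w t x) \<partial>lebesgue) = 0" if st: "s \<in> T" "t \<in> T" "s \<noteq> t" for s t
  proof -
    have "((\<lambda>x. G x * (w s x * w t x)) has_integral (\<integral>x. G x * (w s x * w t x) \<partial>lebesgue)) UNIV"
      by (rule has_integral_integral_lebesgue[OF iww[OF st(1,2)]])
    moreover have "((\<lambda>x. G x * (w s x * w t x)) has_integral 0) UNIV"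
    proof -
      have "\<exists>N. negligible N \<and> {x. G x \<noteq> indicator {c<..<d} x * g x} \<subseteq> N"
        using gpos unfolding eventually_ae_filter negligible_iff_null_sets by (simp add: Bex_def)
      then obtain N where N: "negligible N" "{x. G x \<noteq> indicator {c<..<d} x * g x} \<subseteq> N" by (elim exE conjE)
      have N2: "G x = indicator {c<..<d} x * g x" if "x \<notin> N" for x using N(2) that by blast
      have neg: "negligible (N \<union> {c, d})" by (rule negligible_Un[OF N(1) negligible_finite]) simp
      have sp: "((\<lambda>x. if x \<in> {c..d} then g x * (w s x * w t x) else 0) has_integral 0) UNIV"
        unfolding has_integral_restrict_UNIV by (rule orth[OF st])
      show ?thesis
        by (rule has_integral_spike[OF neg _ sp]) (auto simp: N2)
    qed
    ultimately show ?thesis by (rule has_integral_unique)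
  qed
  define C where "C i s = (\<integral>x. G x * (\<xi> i x * w s x) \<partial>lebesgue)\<^sup>2 / (\<integral>x. G x * (w s x * w s x) \<partial>lebesgue)" for i s
  have cnt: "countable {s \<in> T. C i s \<noteq> 0}" for i
  proof (rule summable_countable_real, rule nonneg_bdd_above_summable_on)
    show "C i s \<ge> 0" for s unfolding C_def
      by (intro divide_nonneg_nonneg Bochner_Integration.integral_nonneg) (simp_all add: G0)
    have "sum (C i) F \<le> (\<integral>x. G x * (\<xi> i x * \<xi> i x) \<partial>lebesgue)" if F: "F \<subseteq> T" "finite F" for F
      unfolding C_def
      by (rule bessel_inequality[OF F(2) G0 i\<xi>]) (use F(1) i\<xi>w iww orthG in blast)+
    then show "bdd_above (sum (C i) ` {F. F \<subseteq> T \<and> finite F})" by (auto intro!: bdd_aboveI)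
  qed
  \<comment> \<open>Positivity of \<open>g\<close> almost everywhere prevents the weight from
    vanishing on an interval; this rules out both a zero coefficient and a zero norm below.\<close>
  have no_null: False
    if uv: "c \<le> u" "u < v" "v \<le> d" and ae: "AE x in lebesgue. x \<in> {u<..<v} \<longrightarrow> G x = 0" for u v
  proof -
    have "AE x in lebesgue. x \<notin> {u<..<v}"
      using ae pos by eventually_elim (use uv in \<open>auto simp: G_def indicator_def\<close>)
    then obtain N where N: "negligible N" "{x. \<not> x \<notin> {u<..<v}} \<subseteq> N"
      unfolding eventually_ae_filter negligible_iff_null_sets by auto
    have "negligible {u<..<v}" by (rule negligible_subset[OF N(1)]) (use N(2) in auto)
    moreover have "{u<..<v} \<noteq> {}" using uv(2) dense[of u v] by auto
    ultimately show False using open_not_negligible[OF open_greaterThanLessThan] by blast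
  qed
  have "\<exists>i\<in>\<rat> \<times> \<rat>. C i s \<noteq> 0" if s: "s \<in> T" for s
  proof -
    obtain x1 where x1: "x1 \<in> {c<..<d}" "w s x1 \<noteq> 0" using nz[OF s] by blast
    have "\<exists>\<delta>>0. \<forall>x\<in>{c..d}. dist x x1 < \<delta> \<longrightarrow> dist (w s x) (w s x1) < \<bar>w s x1\<bar>"
      using w[OF s, unfolded continuous_on_iff, rule_format, of x1 "\<bar>w s x1\<bar>"] x1 by simp
    then obtain \<delta> where \<delta>: "\<delta> > 0" "\<forall>x\<in>{c..d}. dist x x1 < \<delta> \<longrightarrow> dist (w s x) (w s x1) < \<bar>w s x1\<bar>" by (elim exE conjE)
    obtain u where u: "u \<in> \<rat>" "max c (x1 - \<delta>) < u" "u < x1" using Rats_dense_in_real[of "max c (x1 - \<delta>)" x1] x1 \<delta>(1) by auto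
    obtain v where v: "v \<in> \<rat>" "x1 < v" "v < min d (x1 + \<delta>)" using Rats_dense_in_real[of x1 "min d (x1 + \<delta>)"] x1 \<delta>(1) by auto
    have sgn: "w s x1 * w s x > 0" if "x \<in> {u<..<v}" for x
    proof -
      have "x \<in> {c..d}" "dist x x1 < \<delta>" using that u v by (auto simp: dist_real_def)
      then have "\<bar>w s x - w s x1\<bar> < \<bar>w s x1\<bar>" using \<delta>(2) by (simp add: dist_real_def)
      then have "w s x1 > 0 \<and> w s x > 0 \<or> w s x1 < 0 \<and> w s x < 0" by linarith
      then show ?thesis by (auto simp: zero_less_mult_iff)
    qed
    have uv: "c \<le> u" "u < v" "v \<le> d" using u v by auto
    have "(\<integral>x. G x * (\<xi> (u, v) x * w s x) \<partial>lebesgue) \<noteq> 0"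
    proof
      assume z: "(\<integral>x. G x * (\<xi> (u, v) x * w s x) \<partial>lebesgue) = 0"
      have "(\<integral>x. w s x1 * (G x * (\<xi> (u, v) x * w s x)) \<partial>lebesgue) = 0" using z by simp
      moreover have "integrable lebesgue (\<lambda>x. w s x1 * (G x * (\<xi> (u, v) x * w s x)))" by (rule integrable_mult_right[OF i\<xi>w[OF s]])
      moreover have nn: "w s x1 * (G x * (\<xi> (u, v) x * w s x)) \<ge> 0" for x
      proof (cases "x \<in> {u<..<v}")
        case True
        have "G x * (w s x1 * w s x) \<ge> 0" using G0[of x] sgn[OF True] by simp
        then show ?thesis using True by (simp add: \<xi>_def mult.left_commute)
      qed (simp add: \<xi>_def)
      ultimately have "AE x in lebesgue. w s x1 * (G x * (\<xi> (u, v) x * w s x)) = 0"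
        by (subst (asm) integral_nonneg_eq_0_iff_AE) auto
      then have "AE x in lebesgue. x \<in> {u<..<v} \<longrightarrow> G x = 0"
      proof eventually_elim
        case (elim x)
        then show ?case using sgn[of x] by (auto simp: \<xi>_def)
      qed
      then show False by (rule no_null[OF uv])
    qed
    moreover have "(\<integral>x. G x * (w s x * w s x) \<partial>lebesgue) \<noteq> 0"
    proof
      assume "(\<integral>x. G x * (w s x * w s x) \<partial>lebesgue) = 0"
      then have "AE x in lebesgue. G x * (w s x * w s x) = 0"
        using G0 iww[OF s s] by (subst (asm) integral_nonneg_eq_0_iff_AE) auto
      then have "AE x in lebesgue. x \<in> {u<..<v} \<longrightarrow> G x = 0"
      proof eventually_elim
        case (elim x)
        then show ?case using sgn[of x] by auto
      qed
      then show False by (rule no_null[OF uv])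
    qed
    ultimately show ?thesis using u(1) v(1) by (intro bexI[of _ "(u, v)"]) (auto simp: C_def)
  qed
  then have "T \<subseteq> (\<Union>i\<in>\<rat> \<times> \<rat>. {s \<in> T. C i s \<noteq> 0})" by blast
  moreover have "countable (\<Union>i\<in>\<rat> \<times> \<rat>. {s \<in> T. C i s \<noteq> 0})"
    by (intro countable_UN cnt countable_SIGMA countable_rat)
  ultimately show ?thesis by (rule countable_subset)
qed

text \<open>Regularity depends on the potential near the endpoint, where the two coincide.\<close>

lemma regular_at_left_transfer:
  assumes q: "locally_integrable a b q" "locally_integrable a b q'" and c: "a < ereal c" "ereal c < b"
    and eq: "\<And>x. a < ereal x \<Longrightarrow> x < c \<Longrightarrow> q x = q' x" and reg: "regular_at_left a b q"
  shows "regular_at_left a b q'"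
proof -
  obtain e where e: "a < ereal e" "ereal e < b" "q absolutely_integrable_on einterval a (ereal e)" and a: "a \<noteq> -\<infinity>"
    using reg unfolding regular_at_left_def by auto
  define m where "m = min c e"
  have "q absolutely_integrable_on einterval a (ereal m)"
    by (rule set_integrable_subset[OF e(3)]) (auto simp: m_def)
  then have "q' absolutely_integrable_on einterval a (ereal m)"
    by (rule absolutely_integrable_spike[OF _ negligible_empty]) (auto simp: m_def eq)
  then show ?thesis unfolding regular_at_left_def using a c e by (intro conjI bexI[of _ m]) (auto simp: m_def min_def)
qed

lemma regular_at_right_transfer:
  assumes q: "locally_integrable a b q" "locally_integrable a b q'" and c: "a < ereal c" "ereal c < b"
    and eq: "\<And>x. c < x \<Longrightarrow> ereal x < b \<Longrightarrow> q x = q' x" and reg: "regular_at_right a b q"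
  shows "regular_at_right a b q'"
proof -
  obtain e where e: "a < ereal e" "ereal e < b" "q absolutely_integrable_on einterval (ereal e) b" and b: "b \<noteq> \<infinity>"
    using reg unfolding regular_at_right_def by auto
  define m where "m = max c e"
  have "q absolutely_integrable_on einterval (ereal m) b"
    by (rule set_integrable_subset[OF e(3)]) (auto simp: m_def)
  then have "q' absolutely_integrable_on einterval (ereal m) b"
    by (rule absolutely_integrable_spike[OF _ negligible_empty]) (auto simp: m_def eq)
  then show ?thesis unfolding regular_at_right_def using b c e by (intro conjI bexI[of _ m]) (auto simp: m_def max_def)
qed

text \<open>Eigenfunctions for different couplings \<open>s\<close> and the same eigenvalue are orthogonal with weight \<open>g\<close>:
  their Wronskian vanishes at both ends of the support of \<open>g\<close>.\<close>

lemma countable_couplings: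
  fixes q :: "real \<Rightarrow> real \<Rightarrow> real"
  assumes cd: "a < ereal c" "c < d" "ereal d < b"
    and q: "\<And>s. s \<in> A \<Longrightarrow> locally_integrable a b (q s)"
    and left: "\<And>s. s \<in> A \<Longrightarrow> regular_at_left a b (q s) \<or> limit_point_at_left a b (q s)"
    and right: "\<And>s. s \<in> A \<Longrightarrow> regular_at_right a b (q s) \<or> limit_point_at_right a b (q s)"
    and diff: "\<And>s t x. s \<in> A \<Longrightarrow> t \<in> A \<Longrightarrow> x \<in> einterval a b \<Longrightarrow> q t x - q s x = (t - s) * g x"
    and g: "g absolutely_integrable_on {c..d}" and pos: "AE x in lebesgue. x \<in> {c<..<d} \<longrightarrow> g x > 0"
    and zero: "\<And>x. x \<in> einterval a b \<Longrightarrow> x \<notin> {c<..<d} \<Longrightarrow> g x = 0"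
  shows "countable {s \<in> A. \<exists>u. sl_eigenfunction a b \<alpha> \<beta> (q s) r u}" (is "countable ?T")
proof -
  have cb: "ereal c < b" using less_trans[of "ereal c" "ereal d" b] cd by simp
  have ad: "a < ereal d" using less_trans[of a "ereal c" "ereal d"] cd by simp
  have sl: "sl_equation a b (q s) x" if "s \<in> A" "a < ereal x" "ereal x < b" for s x
    by (rule sl_equation.intro[OF that(2,3) q[OF that(1)]])
  have "\<exists>w::real \<Rightarrow> real. sl_eigenfunction a b \<alpha> \<beta> (q s) r (\<lambda>x. complex_of_real (w x))" if "s \<in> ?T" for s
    using sl_equation.real_eigenfunction[OF sl[of s c]] that cd(1) cb by blast
  then have "\<forall>s\<in>?T. \<exists>w::real \<Rightarrow> real. sl_eigenfunction a b \<alpha> \<beta> (q s) r (\<lambda>x. complex_of_real (w x))" by blast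
  then obtain w :: "real \<Rightarrow> real \<Rightarrow> real" where
    w: "\<forall>s\<in>?T. sl_eigenfunction a b \<alpha> \<beta> (q s) r (\<lambda>x. complex_of_real (w s x))" by (rule bchoice[THEN exE])
  have sol: "sl_solution a b (q s) r (\<lambda>x. complex_of_real (w s x))" if "s \<in> ?T" for s
    using w that unfolding sl_eigenfunction_def by blast
  show ?thesis
  proof (rule countable_orthogonal_continuous[OF g pos])
    fix s assume s: "s \<in> ?T"
    have "continuous_on {c..d} (\<lambda>x. complex_of_real (w s x))"
      by (rule ac_continuous_on[OF sl_solution_ac(1)[OF sol[OF s] cd(1) _ cd(3)]]) (use cd(2) in simp)
    then show "continuous_on {c..d} (w s)" using continuous_on_Re by fastforce
    \<comment> \<open>A solution vanishing on (c, d) has zero initial data at the midpoint and would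
      vanish identically.\<close>
    show "\<exists>x\<in>{c<..<d}. w s x \<noteq> 0"
    proof (rule ccontr)
      assume "\<not> (\<exists>x\<in>{c<..<d}. w s x \<noteq> 0)"
      then have z: "w s x = 0" if "x \<in> {c<..<d}" for x using that by blast
      define x1 where "x1 = (c + d) / 2"
      have x1: "x1 \<in> {c<..<d}" using cd(2) by (simp add: x1_def)
      have x1ab: "a < ereal x1" "ereal x1 < b"
        using x1 less_trans[OF cd(1), of "ereal x1"] less_trans[OF _ cd(3), of "ereal x1"] by simp_all
      interpret E: sl_equation a b "q s" r x1 using sl[of s x1] s x1ab by blast
      have "((\<lambda>x. 0::complex) has_vector_derivative vderiv (\<lambda>x. complex_of_real (w s x)) x1) (at x1)"
        by (rule has_vector_derivative_transform_within_open[OF sl_solution_vderiv[OF sol[OF s]] open_greaterThanLessThan x1])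
          (use x1ab z in auto)
      then have d0: "vderiv (\<lambda>x. complex_of_real (w s x)) x1 = 0" using vector_derivative_at has_vector_derivative_const by metis
      have "complex_of_real (w s x) = 0" if "x \<in> einterval a b" for x
        using E.solution_representation[OF sol[OF s] that] unfolding d0 z[OF x1] by simp
      moreover obtain x where "x \<in> einterval a b" "complex_of_real (w s x) \<noteq> 0"
        using w s unfolding sl_eigenfunction_def by blast
      ultimately show False by blast
    qed
  next
    fix s t assume st: "s \<in> ?T" "t \<in> ?T" "s \<noteq> t"
    then have A: "s \<in> A" "t \<in> A" by auto
    let ?u = "\<lambda>x. complex_of_real (w s x)" and ?v = "\<lambda>x. complex_of_real (w t x)"
    have u: "sl_eigenfunction a b \<alpha> \<beta> (q s) r ?u" and v: "sl_eigenfunction a b \<alpha> \<beta> (q t) r ?v" using w st by blast+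
    have equal: "q s x = q t x" if "x \<in> einterval a b" "x \<notin> {c<..<d}" for x
      using diff[OF A that(1)] zero[OF that] by simp
    have eql: "q s x = q t x" if "a < ereal x" "x < c" for x
      using equal[of x] that less_trans[of "ereal x" "ereal c" b] cb by simp
    have eqr: "q s x = q t x" if "d < x" "ereal x < b" for x
      using equal[of x] that less_trans[of a "ereal d" "ereal x"] ad by simp
    have sq: "square_integrable (interval_measure_on a b) ?u" "square_integrable (interval_measure_on a b) ?v"
      using u v unfolding sl_eigenfunction_def by blast+
    have "wronskian ?u ?v c = 0"
    proof (rule left_wronskian_zero[OF sol[OF st(1)] sq(1) sol[OF st(2)] sq(2) cd(1) cb eql])
      show "boundary_condition \<alpha> (at_right (real_of_ereal a)) ?u \<and> boundary_condition \<alpha> (at_right (real_of_ereal a)) ?v \<and> a \<noteq> -\<infinity> \<or>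
        limit_point_at_left a b (q s)"
        using left[OF A(1)]
      proof
        assume r: "regular_at_left a b (q s)"
        \<comment> \<open>The coupling does not affect the potential near \<open>a\<close>, so both
          eigenfunctions obey the boundary condition once one potential is regular there.\<close>
        have "regular_at_left a b (q t)" by (rule regular_at_left_transfer[OF q[OF A(1)] q[OF A(2)] cd(1) cb _ r]) (rule eql)
        then show ?thesis using r u v unfolding sl_eigenfunction_def regular_at_left_def by blast
      qed (rule disjI2)
    qed
    moreover have "wronskian ?u ?v d = 0"
    proof (rule right_wronskian_zero[OF sol[OF st(1)] sq(1) sol[OF st(2)] sq(2) ad cd(3) eqr])
      show "boundary_condition \<beta> (at_left (real_of_ereal b)) ?u \<and> boundary_condition \<beta> (at_left (real_of_ereal b)) ?v \<and> b \<noteq> \<infinity> \<or>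
        limit_point_at_right a b (q s)"
        using right[OF A(1)]
      proof
        assume r: "regular_at_right a b (q s)"
        have "regular_at_right a b (q t)" by (rule regular_at_right_transfer[OF q[OF A(1)] q[OF A(2)] ad cd(3) _ r]) (rule eqr)
        then show ?thesis using r u v unfolding sl_eigenfunction_def regular_at_right_def by blast
      qed (rule disjI2)
    qed
    \<comment> \<open>The integrand contains the difference of the potentials, (t - s) g; dividing
      by t - s leaves the weight \<open>g\<close>.\<close>
    ultimately have "((\<lambda>x. complex_of_real (q t x - q s x) * (?u x * ?v x)) has_integral 0) {c..d}"
      using wronskian_integral[OF sol[OF st(1)] sol[OF st(2)] cd(1) _ cd(3)] cd(2) by simp
    then have "((\<lambda>x. (1 / (t - s)) * Re (complex_of_real (q t x - q s x) * (?u x * ?v x))) has_integral (1 / (t - s)) * Re 0) {c..d}"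
      by (intro has_integral_mult_right has_integral_Re)
    then have "((\<lambda>x. (1 / (t - s)) * Re (complex_of_real (q t x - q s x) * (?u x * ?v x))) has_integral 0) {c..d}" by simp
    then show "((\<lambda>x. g x * (w s x * w t x)) has_integral 0) {c..d}"
    proof (rule has_integral_eq[rotated])
      fix x assume "x \<in> {c..d}"
      then have x: "x \<in> einterval a b" using Icc_subset_einterval[OF cd(1,3)] by blast
      have "complex_of_real (q t x - q s x) * (?u x * ?v x) = complex_of_real ((t - s) * g x * (w s x * w t x))"
        unfolding diff[OF A x] by (simp only: of_real_mult)
      then show "1 / (t - s) * Re (complex_of_real (q t x - q s x) * (?u x * ?v x)) = g x * (w s x * w t x)"
        using st(3) by (simp only: Re_complex_of_real) simp
    qed
  qed
qed

section \<open>Fubini's theorem in the coordinate \<open>n0\<close>\<close>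

theorem theorem2:
  fixes a b :: ereal and n1 n2 :: "int extended" and I :: "int set"
    and p :: "int \<Rightarrow> real measure" and P :: "(int \<Rightarrow> real) measure"
    and v :: "real \<Rightarrow> real" and f :: "int \<Rightarrow> real \<Rightarrow> real"
    and q :: "(int \<Rightarrow> real) \<Rightarrow> real \<Rightarrow> real"
    and \<alpha> \<beta> :: real
    and H :: "(int \<Rightarrow> real) \<Rightarrow> (real \<Rightarrow> complex) operator"
    and J :: "(int \<Rightarrow> real) \<Rightarrow> 'h::complex_hilbert_space operator"
    and c d :: real and n0 :: int
  assumes ab: "a < b"
    and n12: "n1 < n2" and I_def: "I = {n. n1 < Fin n \<and> Fin n < n2}"
    and p: "\<And>n. n \<in> I \<Longrightarrow> prob_space (p n)" "\<And>n. n \<in> I \<Longrightarrow> sets (p n) = sets borel"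
    and P_def: "P = (\<Pi>\<^sub>M n\<in>I. p n)"
    and v: "locally_integrable a b v"
    and f: "\<And>n. n \<in> I \<Longrightarrow> locally_integrable a b (f n)"
    and q_def: "q = random_potential I v f"
    and q_well_defined: "\<And>\<omega> x. \<omega> \<in> space P \<Longrightarrow> x \<in> einterval a b \<Longrightarrow>
          (\<lambda>n. \<omega> n * f n x) summable_on I"
    and q_loc: "\<And>\<omega>. \<omega> \<in> space P \<Longrightarrow> locally_integrable a b (q \<omega>)"
    and left: "\<And>\<omega>. \<omega> \<in> space P \<Longrightarrow>
          regular_at_left a b (q \<omega>) \<or> limit_point_at_left a b (q \<omega>)"
    and right: "\<And>\<omega>. \<omega> \<in> space P \<Longrightarrow>
          regular_at_right a b (q \<omega>) \<or> limit_point_at_right a b (q \<omega>)"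
    and H_def: "H = (\<lambda>\<omega>. sl_operator a b \<alpha> \<beta> (q \<omega>))"
    and H_selfadjoint: "\<And>\<omega>. \<omega> \<in> space P \<Longrightarrow> selfadjoint (L2_hspace a b) (H \<omega>)"
    and cd: "a < ereal c" "c < d" "ereal d < b"
    and n0: "n0 \<in> I"
    and f_pos: "AE x in lebesgue. x \<in> {c<..<d} \<longrightarrow> f n0 x > 0"
    and f_zero: "\<And>x. x \<in> einterval a b \<Longrightarrow> x \<notin> {c<..<d} \<Longrightarrow> f n0 x = 0"
    and p_continuous: "\<And>r. measure (p n0) {r} = 0"
    and separable: "\<exists>S::'h set. countable S \<and> closure S = UNIV"
    and J: "measurable_family P J"
    and J_indep: "\<And>\<omega> \<omega>'. \<omega> \<in> space P \<Longrightarrow> \<omega>' \<in> space P \<Longrightarrow>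
          (\<And>n. n \<in> I - {n0} \<Longrightarrow> \<omega> n = \<omega>' n) \<Longrightarrow>
          point_spectrum type_hspace (J \<omega>) = point_spectrum type_hspace (J \<omega>')"
  shows "{\<omega> \<in> space P. point_spectrum type_hspace (J \<omega>) \<inter> point_spectrum (L2_hspace a b) (H \<omega>) \<noteq> {}}
           \<in> null_sets P"
proof -
  have cb: "ereal c < b" using less_trans[of "ereal c" "ereal d" b] cd by simp
  have kernel: "(\<lambda>x. indicator (einterval a b) x * g x) \<in> borel_measurable lebesgue" if "locally_integrable a b g" for g
    using sl_equation.kernel_measurable[OF sl_equation.intro[OF cd(1) cb that], of 0] by (simp add: sl_kernel_def[abs_def])
  \<comment> \<open>Joint measurability is obtained from partial sums of the series; the indicator
    restricts attention to (a, b), where summability is assumed.\<close>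
  have qm: "(\<lambda>(\<omega>, x). indicator (einterval a b) x * q \<omega> x) \<in> borel_measurable (P \<Otimes>\<^sub>M lebesgue)"
  proof (rule borel_measurable_LIMSEQ_real)
    let ?F = "\<lambda>N::nat. I \<inter> {- int N..int N}"
    show "(\<lambda>z. indicator (einterval a b) (snd z) * v (snd z) + (\<Sum>n\<in>?F N. fst z n * (indicator (einterval a b) (snd z) * f n (snd z))))
        \<in> borel_measurable (P \<Otimes>\<^sub>M lebesgue)" for N
    proof (intro borel_measurable_add borel_measurable_sum borel_measurable_times[of "\<lambda>z. fst z _"])
      show "(\<lambda>z. indicator (einterval a b) (snd z) * v (snd z)) \<in> borel_measurable (P \<Otimes>\<^sub>M lebesgue)"
        by (rule measurable_compose[OF measurable_snd kernel[OF v]])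
      fix n assume "n \<in> ?F N"
      then have n: "n \<in> I" by blast
      show "(\<lambda>z. indicator (einterval a b) (snd z) * f n (snd z)) \<in> borel_measurable (P \<Otimes>\<^sub>M lebesgue)"
        by (rule measurable_compose[OF measurable_snd kernel[OF f[OF n]]])
      have "(\<lambda>\<omega>. \<omega> n) \<in> measurable P (p n)" unfolding P_def by (rule measurable_component_singleton[OF n])
      then have "(\<lambda>\<omega>. \<omega> n) \<in> borel_measurable P" by (simp only: measurable_cong_sets[OF refl p(2)[OF n]])
      then show "(\<lambda>z. fst z n) \<in> borel_measurable (P \<Otimes>\<^sub>M lebesgue)" by (rule measurable_compose[OF measurable_fst])
    qed
    fix z assume z: "z \<in> space (P \<Otimes>\<^sub>M (lebesgue :: real measure))"
    then have \<omega>: "fst z \<in> space P" by (simp add: space_pair_measure mem_Times_iff)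
    show "(\<lambda>N. indicator (einterval a b) (snd z) * v (snd z) + (\<Sum>n\<in>?F N. fst z n * (indicator (einterval a b) (snd z) * f n (snd z))))
        \<longlonglongrightarrow> (case z of (\<omega>, x) \<Rightarrow> indicator (einterval a b) x * q \<omega> x)"
    proof (cases "snd z \<in> einterval a b")
      case True
      \<comment> \<open>\<open>infsum\<close> is a limit along the finite subsets of
        \<open>I\<close>; the symmetric windows are cofinal among them, so a sequence suffices and
        measurability survives.\<close>
      have F: "filterlim ?F (finite_subsets_at_top I) sequentially"
        unfolding filterlim_finite_subsets_at_top
      proof (intro allI impI)
        fix X assume X: "finite X \<and> X \<subseteq> I"
        have bnd: "\<bar>x\<bar> \<le> (\<Sum>y\<in>X. \<bar>y\<bar>)" if "x \<in> X" for x using X that by (intro member_le_sum) auto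
        show "\<forall>\<^sub>F N in sequentially. finite (?F N) \<and> X \<subseteq> ?F N \<and> ?F N \<subseteq> I"
          unfolding eventually_sequentially
        proof (intro exI[of _ "nat (\<Sum>y\<in>X. \<bar>y\<bar>)"] allI impI conjI)
          fix N assume N: "nat (\<Sum>y\<in>X. \<bar>y\<bar>) \<le> N"
          show "X \<subseteq> ?F N"
          proof
            fix x assume x: "x \<in> X"
            then have "\<bar>x\<bar> \<le> int N" using bnd[OF x] N by linarith
            then show "x \<in> ?F N" using x X by auto
          qed
        qed auto
      qed
      have "(\<lambda>N. \<Sum>n\<in>?F N. fst z n * f n (snd z)) \<longlonglongrightarrow> (\<Sum>\<^sub>\<infinity>n\<in>I. fst z n * f n (snd z))"
        by (rule filterlim_compose[OF infsum_tendsto[OF q_well_defined[OF \<omega> True]] F])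
      then have "(\<lambda>N. v (snd z) + (\<Sum>n\<in>?F N. fst z n * f n (snd z))) \<longlonglongrightarrow> q (fst z) (snd z)"
        unfolding q_def random_potential_def by (intro tendsto_add tendsto_const)
      then show ?thesis using True by (simp add: case_prod_beta' del: einterval_set)
    next
      case False
      then show ?thesis by (simp add: case_prod_beta' del: einterval_set)
    qed
  qed
  define T where "T = {z \<in> space (P \<Otimes>\<^sub>M borel). \<exists>u. sl_eigenfunction a b \<alpha> \<beta> (q (fst z)) (snd z) u}"
  have T: "T \<in> sets (P \<Otimes>\<^sub>M borel)" unfolding T_def by (rule eigenvalue_set_measurable[OF cd(1) cb q_loc qm])
  define S where "S = {\<omega> \<in> space P. point_spectrum type_hspace (J \<omega>) \<inter> point_spectrum (L2_hspace a b) (H \<omega>) \<noteq> {}}"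
  have ev_iff: "r \<in> point_spectrum (L2_hspace a b) (H \<omega>) \<longleftrightarrow> (\<exists>u. sl_eigenfunction a b \<alpha> \<beta> (q \<omega>) r u)" for r \<omega>
    unfolding H_def by (rule point_spectrum_sl_operator)
  have T_iff: "(\<omega>, r) \<in> T \<longleftrightarrow> \<omega> \<in> space P \<and> r \<in> point_spectrum (L2_hspace a b) (H \<omega>)" for \<omega> r
    unfolding ev_iff T_def by (simp add: space_pair_measure)
  have "S = {\<omega> \<in> space P. \<exists>r\<in>point_spectrum type_hspace (J \<omega>). (\<omega>, r) \<in> T}"
    unfolding S_def T_iff by blast
  then have S: "S \<in> sets P" using measurable_point_spectrum_meets[OF J separable T] by simp
  \<comment> \<open>\<open>P\<close> is the image of the product of \<open>p n0\<close> with the law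
    of the remaining coordinates, under insertion of the value at \<open>n0\<close>.\<close>
  let ?P' = "\<Pi>\<^sub>M n\<in>I - {n0}. p n"
  let ?g = "\<lambda>(x, X). X(n0 := x)"
  have I: "insert n0 (I - {n0}) = I" using n0 by auto
  interpret p0: prob_space "p n0" by (rule p(1)[OF n0])
  interpret P': prob_space ?P' by (rule prob_space_PiM) (use p(1) in auto)
  interpret pair: pair_sigma_finite "p n0" ?P' ..
  have sp: "space (p n0) = UNIV" using sets_eq_imp_space_eq[OF p(2)[OF n0]] by simp
  have gm: "?g \<in> measurable (p n0 \<Otimes>\<^sub>M ?P') P"
    using measurable_compose[OF measurable_pair_swap' measurable_add_dim[of n0 "I - {n0}" p]]
    unfolding I P_def[symmetric] by (simp add: case_prod_beta')
  have in_P: "X(n0 := x) \<in> space P" if X: "X \<in> space ?P'" for X x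
    using measurable_space[OF gm, of "(x, X)"] X by (simp add: space_pair_measure sp)
  have fibre: "emeasure (p n0) ((\<lambda>x. (x, X)) -` (?g -` S \<inter> space (p n0 \<Otimes>\<^sub>M ?P'))) = 0" if X: "X \<in> space ?P'" for X
  proof -
    \<comment> \<open>0 is an arbitrary reference value: by \<open>J_indep\<close> the point
      spectrum is the same for every value of the coordinate \<open>n0\<close>.\<close>
    let ?R = "point_spectrum type_hspace (J (X(n0 := 0)))"
    \<comment> \<open>All couplings at which some eigenvalue of \<open>J\<close> is hit: a countable
      union of countable sets, hence null for a distribution without atoms.\<close>
    let ?C = "\<Union>r\<in>?R. {s \<in> UNIV. \<exists>u. sl_eigenfunction a b \<alpha> \<beta> (q (X(n0 := s))) r u}"
    have "countable {s \<in> UNIV. \<exists>u. sl_eigenfunction a b \<alpha> \<beta> (q (X(n0 := s))) r u}" for r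
    proof (rule countable_couplings[OF cd, where g = "f n0"])
      fix s t x assume x: "x \<in> einterval a b"
      \<comment> \<open>Splitting off the term of \<open>n0\<close> shows that the potential is
        affine in the coupling, with slope \<open>f n0 x\<close>.\<close>
      have e: "q (X(n0 := s)) x = v x + (s * f n0 x + (\<Sum>\<^sub>\<infinity>n\<in>I - {n0}. X n * f n x))" for s
      proof -
        have "(\<lambda>n. (X(n0 := s)) n * f n x) summable_on I - {n0}"
          by (rule summable_on_subset_banach[OF q_well_defined[OF in_P[OF X] x]]) auto
        then have "(\<Sum>\<^sub>\<infinity>n\<in>insert n0 (I - {n0}). (X(n0 := s)) n * f n x) = (X(n0 := s)) n0 * f n0 x + (\<Sum>\<^sub>\<infinity>n\<in>I - {n0}. (X(n0 := s)) n * f n x)"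
          by (rule infsum_insert) simp
        moreover have "(\<Sum>\<^sub>\<infinity>n\<in>I - {n0}. (X(n0 := s)) n * f n x) = (\<Sum>\<^sub>\<infinity>n\<in>I - {n0}. X n * f n x)"
          by (rule infsum_cong) simp
        ultimately show ?thesis unfolding q_def random_potential_def I by simp
      qed
      show "q (X(n0 := t)) x - q (X(n0 := s)) x = (t - s) * f n0 x" unfolding e by (simp add: left_diff_distrib)
    next
      show "f n0 absolutely_integrable_on {c..d}"
        using f[OF n0] Icc_subset_einterval[OF cd(1,3)] unfolding locally_integrable_def by (metis compact_Icc)
      show "AE x in lebesgue. x \<in> {c<..<d} \<longrightarrow> 0 < f n0 x" by (rule f_pos)
    next
      fix s
      show "locally_integrable a b (q (X(n0 := s)))" by (rule q_loc[OF in_P[OF X]])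
      show "regular_at_left a b (q (X(n0 := s))) \<or> limit_point_at_left a b (q (X(n0 := s)))" by (rule left[OF in_P[OF X]])
      show "regular_at_right a b (q (X(n0 := s))) \<or> limit_point_at_right a b (q (X(n0 := s)))" by (rule right[OF in_P[OF X]])
    next
      fix x assume "x \<in> einterval a b" "x \<notin> {c<..<d}"
      then show "f n0 x = 0" by (rule f_zero)
    qed
    then have "countable ?C" using countable_point_spectrum[OF J separable in_P[OF X]] by (intro countable_UN) auto
    then have nul: "(\<Union>s\<in>?C. {s}) \<in> null_sets (p n0)"
    proof (rule null_sets_UN')
      fix s
      show "{s} \<in> null_sets (p n0)"
        using p_continuous[of s] p(2)[OF n0] by (intro null_setsI) (simp_all add: p0.emeasure_eq_measure)
    qed
    have sub: "(\<lambda>x. (x, X)) -` (?g -` S \<inter> space (p n0 \<Otimes>\<^sub>M ?P')) \<subseteq> (\<Union>s\<in>?C. {s})"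
    proof
      fix s assume "s \<in> (\<lambda>x. (x, X)) -` (?g -` S \<inter> space (p n0 \<Otimes>\<^sub>M ?P'))"
      then have "X(n0 := s) \<in> S" by simp
      then obtain r where r1: "r \<in> point_spectrum type_hspace (J (X(n0 := s)))"
        and r2: "r \<in> point_spectrum (L2_hspace a b) (H (X(n0 := s)))"
        unfolding S_def by blast
      have "point_spectrum type_hspace (J (X(n0 := s))) = ?R"
        by (rule J_indep[OF in_P[OF X] in_P[OF X]]) simp
      then show "s \<in> (\<Union>s\<in>?C. {s})" using r1 r2[unfolded ev_iff] by blast
    qed
    have "emeasure (p n0) ((\<lambda>x. (x, X)) -` (?g -` S \<inter> space (p n0 \<Otimes>\<^sub>M ?P'))) \<le> emeasure (p n0) (\<Union>s\<in>?C. {s})"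
      by (rule emeasure_mono[OF sub null_setsD2[OF nul]])
    also have "\<dots> = 0" using nul by (rule null_setsD1)
    finally show ?thesis by simp
  qed
  have "emeasure P S = emeasure (distr (p n0 \<Otimes>\<^sub>M ?P') P ?g) S"
    using distr_pair_PiM_eq_PiM[of "I - {n0}" p n0] p(1) n0 unfolding I P_def[symmetric] by simp
  also have "\<dots> = emeasure (p n0 \<Otimes>\<^sub>M ?P') (?g -` S \<inter> space (p n0 \<Otimes>\<^sub>M ?P'))" by (rule emeasure_distr[OF gm S])
  also have "\<dots> = (\<integral>\<^sup>+X. emeasure (p n0) ((\<lambda>x. (x, X)) -` (?g -` S \<inter> space (p n0 \<Otimes>\<^sub>M ?P'))) \<partial>?P')"
    by (rule pair.emeasure_pair_measure_alt2[OF measurable_sets[OF gm S]])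
  also have "\<dots> = (\<integral>\<^sup>+X. 0 \<partial>?P')" by (rule nn_integral_cong) (rule fibre)
  finally have "emeasure P S = 0" by simp
  then have "S \<in> null_sets P" using S by (rule null_setsI)
  then show ?thesis unfolding S_def .
qed

end
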